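(* Let $h\in C_c(0,1)$, $a\in\mathbb{R}$ and $F\in\mathrm{Lip}_e(L)$. Then the limit $$\lim_{\epsilon\to 0}\ \mathbb{E}\left[F(B)\int_0^1 h_\theta\, :\!\dot B_{\epsilon,\theta}^2\!:\, dL^a_\theta\right]$$ exists.
   Context: $(B_\theta)_{\theta\in[0,1]}$ is a standard real Brownian motion started at $0$, regarded as a random element of $C:=\{k:[0,1]\to\mathbb{R}\text{ continuous},\ k_0=0\}$. $L:=L^2(0,1)$ with its usual scalar product $\langle\cdot,\cdot\rangle$ and norm $\|\cdot\|$; $C\subset L$. $\mathrm{Lip}_e(L)$ is the set of functions $F:L\to\mathbb{R}$ for which there exists $c>0$ with $|F(h)-F(k)|\le e^{c\|h\|}\,\|h-k\|$ for all $h,k\in L$. Mollifiers: $\rho\in C_c^\infty(-1,1)$, $\rho\ge 0$, $\rho(x)=\rho(-x)$, $\int_{\mathbb{R}}\rho\,dx=1$, and $\rho_\epsilon:=\frac1\epsilon\rho(\cdot/\epsilon)$ for $\epsilon>0$. For $\ell\in C$ and $\theta\in[0,1]$, $\ell_{\epsilon,\theta}:=\int_0^1\rho_\epsilon(\sigma-\theta)\,\ell_\sigma\,d\sigma$ and $\dot\ell_{\epsilon,\theta}=\ell'_{\epsilon,\theta}:=\frac{d}{d\theta}\ell_{\epsilon,\theta}$. Set $:\!\dot B_{\epsilon,\theta}^2\!:\ :=(\dot B_{\epsilon,\theta})^2-\mathbb{E}[(\dot B_{\epsilon,\theta})^2]$. $(L^a_\theta)_{\theta\in[0,1]}$ is the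 local time of $B$ at $a\in\mathbb{R}$ (jointly continuous version), normalized by the occupation times formula $\int_0^\theta\psi(s,B_s)\,ds=\int_{\mathbb{R}}\int_0^\theta\psi(s,a)\,dL^a_s\,da$ for all bounded Borel $\psi:[0,\infty)\times\mathbb{R}\to\mathbb{R}$. $C_c(0,1)$ is the space of continuous functions with compact support in $(0,1)$. *)

theory Defs
  imports "HOL-Probability.Probability"
begin

definition standard_BM :: "'w measure \<Rightarrow> (real \<Rightarrow> 'w \<Rightarrow> real) \<Rightarrow> bool" where
  "standard_BM M B \<longleftrightarrow>
     prob_space M \<and>
     (\<forall>t\<in>{0..1}. B t \<in> borel_measurable M) \<and>
     (\<forall>\<omega>\<in>space M. B 0 \<omega> = 0 \<and> continuous_on {0..1} (\<lambda>t. B t \<omega>)) \<and>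
     (\<forall>s t. 0 \<le> s \<and> s < t \<and> t \<le> 1 \<longrightarrow>
        distributed M lborel (\<lambda>\<omega>. B t \<omega> - B s \<omega>) (normal_density 0 (sqrt (t - s)))) \<and>
     (\<forall>(n::nat) t. (\<forall>i\<le>n. t i \<in> {0..1}) \<and> (\<forall>i<n. t i \<le> t (Suc i)) \<longrightarrow>
        prob_space.indep_vars M (\<lambda>_. borel) (\<lambda>i \<omega>. B (t (Suc i)) \<omega> - B (t i) \<omega>) {..<n})"

text \<open>Elements of \<open>L\<^sup>2(0,1)\<close> are given by representatives: measurable functions on the reals,
  of which only the restriction to \<open>(0,1)\<close> matters. No separate hypothesis
  says that a functional depends only on the almost-everywhere class; membership in
  \<open>Lip_e\<close> implies it (lemma \<open>Lip_e_AE_cong\<close>).\<close>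

definition L2_01 :: "(real \<Rightarrow> real) set" where
  "L2_01 = {k. k \<in> borel_measurable (lebesgue_on {0<..<1}) \<and>
               integrable (lebesgue_on {0<..<1}) (\<lambda>x. (k x)\<^sup>2)}"

definition L2_01_norm :: "(real \<Rightarrow> real) \<Rightarrow> real" where
  "L2_01_norm k = sqrt (\<integral>x. (k x)\<^sup>2 \<partial>lebesgue_on {0<..<1})"

definition Lip_e :: "((real \<Rightarrow> real) \<Rightarrow> real) set" where
  "Lip_e = {F. \<exists>c>0. \<forall>h\<in>L2_01. \<forall>k\<in>L2_01.
     \<bar>F h - F k\<bar> \<le> exp (c * L2_01_norm h) * L2_01_norm (\<lambda>x. h x - k x)}"

lemma Lip_e_AE_cong:
  assumes "F \<in> Lip_e" "h \<in> L2_01" "k \<in> L2_01"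
    and "AE x in lebesgue_on {0<..<1}. h x = k x"
  shows "F h = F k"
proof -
  have "(\<integral>x. (h x - k x)\<^sup>2 \<partial>lebesgue_on {0<..<1}) = 0"
    using assms(4) by (intro integral_eq_zero_AE) auto
  then have "L2_01_norm (\<lambda>x. h x - k x) = 0"
    by (simp add: L2_01_norm_def)
  then show ?thesis
    using assms(1-3) unfolding Lip_e_def by fastforce
qed

definition Cc_01 :: "(real \<Rightarrow> real) set" where
  "Cc_01 = {h. continuous_on UNIV h \<and> compact (closure {x. h x \<noteq> 0}) \<and>
               closure {x. h x \<noteq> 0} \<subseteq> {0<..<1}}"

definition mollifier :: "(real \<Rightarrow> real) \<Rightarrow> bool" where
  "mollifier \<rho> \<longleftrightarrow>
     (\<forall>n x. (deriv ^^ n) \<rho> differentiable (at x)) \<and>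
     compact (closure {x. \<rho> x \<noteq> 0}) \<and> closure {x. \<rho> x \<noteq> 0} \<subseteq> {-1<..<1} \<and>
     (\<forall>x. \<rho> x \<ge> 0) \<and> (\<forall>x. \<rho> (-x) = \<rho> x) \<and>
     (\<integral>x. \<rho> x \<partial>lborel) = 1"

definition mollify :: "(real \<Rightarrow> real) \<Rightarrow> real \<Rightarrow> (real \<Rightarrow> real) \<Rightarrow> real \<Rightarrow> real" where
  "mollify \<rho> \<epsilon> l \<theta> = (LINT \<sigma>:{0..1}|lborel. (1 / \<epsilon>) * \<rho> ((\<sigma> - \<theta>) / \<epsilon>) * l \<sigma>)"

definition mollify_deriv :: "(real \<Rightarrow> real) \<Rightarrow> real \<Rightarrow> (real \<Rightarrow> real) \<Rightarrow> real \<Rightarrow> real" where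
  "mollify_deriv \<rho> \<epsilon> l \<theta> = deriv (mollify \<rho> \<epsilon> l) \<theta>"

definition wick_square ::
    "'w measure \<Rightarrow> (real \<Rightarrow> 'w \<Rightarrow> real) \<Rightarrow> (real \<Rightarrow> real) \<Rightarrow> real \<Rightarrow> real \<Rightarrow> 'w \<Rightarrow> real" where
  "wick_square M B \<rho> \<epsilon> \<theta> \<omega> =
     (mollify_deriv \<rho> \<epsilon> (\<lambda>s. B s \<omega>) \<theta>)\<^sup>2
     - (\<integral>\<omega>'. (mollify_deriv \<rho> \<epsilon> (\<lambda>s. B s \<omega>') \<theta>)\<^sup>2 \<partial>M)"

text \<open>The measure \<open>dg\<close> of a continuous nondecreasing \<open>g\<close> on \<open>[0,1]\<close>, as a measure on the reals;
  \<open>g\<close> is extended by constants outside \<open>[0,1]\<close>.\<close>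

definition stieltjes_01 :: "(real \<Rightarrow> real) \<Rightarrow> real measure" where
  "stieltjes_01 g = interval_measure (\<lambda>s. g (max 0 (min 1 s)))"

text \<open>\<open>loct a \<theta> \<omega>\<close> is the local time at level \<open>a\<close> and time \<open>\<theta>\<close>. Path regularity is
  required for every \<open>\<omega>\<close> and not merely almost surely, since the probability space is
  not assumed complete and path functionals of \<open>loct\<close> have to be measurable. The occupation times
  formula holds almost surely, with an exceptional set that may depend on \<open>\<psi>\<close> and \<open>\<theta>\<close>.\<close>

definition is_local_time ::
    "'w measure \<Rightarrow> (real \<Rightarrow> 'w \<Rightarrow> real) \<Rightarrow> (real \<Rightarrow> real \<Rightarrow> 'w \<Rightarrow> real) \<Rightarrow> bool" where
  "is_local_time M B loct \<longleftrightarrow>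
     (\<forall>a. \<forall>\<theta>\<in>{0..1}. loct a \<theta> \<in> borel_measurable M) \<and>
     (\<forall>\<omega>\<in>space M. continuous_on (UNIV \<times> {0..1}) (\<lambda>(a, \<theta>). loct a \<theta> \<omega>) \<and>
        (\<forall>a. loct a 0 \<omega> = 0 \<and> mono_on {0..1} (\<lambda>\<theta>. loct a \<theta> \<omega>))) \<and>
     (\<forall>\<psi> :: real \<times> real \<Rightarrow> real. \<psi> \<in> borel_measurable borel \<and> bounded (range \<psi>) \<longrightarrow>
        (\<forall>\<theta>\<in>{0..1}. AE \<omega> in M.
           (LINT s:{0..\<theta>}|lborel. \<psi> (s, B s \<omega>)) =
           (\<integral>a. (LINT s:{0..\<theta>}|stieltjes_01 (\<lambda>s. loct a s \<omega>). \<psi> (s, a)) \<partial>lborel)))"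

definition renormalized_functional ::
    "'w measure \<Rightarrow> (real \<Rightarrow> 'w \<Rightarrow> real) \<Rightarrow> (real \<Rightarrow> real \<Rightarrow> 'w \<Rightarrow> real) \<Rightarrow> (real \<Rightarrow> real) \<Rightarrow>
     (real \<Rightarrow> real) \<Rightarrow> real \<Rightarrow> real \<Rightarrow> 'w \<Rightarrow> real" where
  "renormalized_functional M B loct \<rho> h a \<epsilon> \<omega> =
     (LINT \<theta>:{0..1}|stieltjes_01 (\<lambda>s. loct a s \<omega>). h \<theta> * wick_square M B \<rho> \<epsilon> \<theta> \<omega>)"

end

theory Submission
  imports Defs
begin

text \<open>
  The local time measure \<open>dL\<^sup>a\<close> is the weak limit of \<open>\<phi>(B\<^sub>\<theta>) d\<theta>\<close> for nonnegative \<open>\<phi>\<close> of mass one shrinking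
  to \<open>a\<close>, so it suffices to bound, uniformly in \<open>\<phi>\<close>, the difference of the functionals
  \<open>E[F(B) \<integral> h\<^sub>\<theta> :N\<^sub>\<epsilon>\<^sup>2: \<phi>(B\<^sub>\<theta>) d\<theta>]\<close> at two scales \<open>\<epsilon>' \<le> \<epsilon> \<le> 2\<epsilon>'\<close>, where \<open>N\<^sub>\<epsilon>\<close> is the derivative of the
  mollified path. Write \<open>N\<^sub>\<epsilon>\<^sup>2 - N\<^sub>\<epsilon>\<^sub>'\<^sup>2 = (N\<^sub>\<epsilon> - N\<^sub>\<epsilon>\<^sub>') (N\<^sub>\<epsilon> + N\<^sub>\<epsilon>\<^sub>')\<close> and integrate the first factor by parts.
  The term in which \<open>N\<^sub>\<epsilon> + N\<^sub>\<epsilon>\<^sub>'\<close> is differentiated cancels the Wick subtraction. The term with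
  \<open>\<phi>'(B\<^sub>\<theta>)\<close> vanishes because \<open>N\<^sub>\<epsilon> - N\<^sub>\<epsilon>\<^sub>'\<close> is uncorrelated with \<open>B\<^sub>\<theta>\<close>: the covariance of \<open>N\<^sub>\<epsilon>\<close> with \<open>B\<^sub>\<theta>\<close> does
  not depend on \<open>\<epsilon>\<close>. What remains is the derivative of \<open>F\<close> in directions localised within distance \<open>\<epsilon>\<close>
  of \<open>\<theta>\<close>, and it is of order \<open>\<epsilon>\<^sup>1\<^sup>/\<^sup>8\<close> because \<open>B\<close> rarely visits the support of \<open>\<phi>\<close> during a time interval
  of length \<open>2\<epsilon>\<close>. Summing over \<open>\<epsilon>, \<epsilon>/2, \<epsilon>/4, \<dots>\<close> gives the Cauchy property.
\<close>

section \<open>Cylinder functionals of Brownian motion\<close>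

text \<open>\<open>F\<close> is only Lipschitz, so the integration by parts is done for smooth
  cylinder functionals: \<open>F\<close> is read on step functions through \<open>n\<close> grid
  values and averaged over a Gaussian noise of width \<open>1/n\<close>. What survives is a gradient
  bound in the discrete L2 norm with constants free of \<open>n\<close>. The leftover term is this
  gradient along the random direction t -> \<open>Z\<close> at t, so only the second moment of
  \<open>Z\<close> at each single t is required, averaged over the grid. For fixed scales and fixed
  \<phi> the limit in \<open>n\<close> is taken first, then \<phi> shrinks, and only then do the
  scales vary. The exponent: \<open>Z\<close> is of order e^(-2) times oscillation times occupation,
  the oscillation is of order e^(3/2), and the occupation of a visited window is of order e^(1/2).
  These powers cancel exactly, so all decay comes from the probability e^(1/2) of a visit, which
  enters through an L4 norm and leaves e^(1/8). The probabilistic input is the redrawing of one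
  Gaussian increment: it yields the density bound behind the occupation moments and the
  Cameron-Martin formula, whose derivative at 0 is the integration by parts.\<close>

definition cyl :: "real set \<Rightarrow> ((real \<Rightarrow> real) \<Rightarrow> 'b::topological_space) \<Rightarrow> bool" where
  "cyl S \<Psi> \<longleftrightarrow> (\<forall>k k'. (\<forall>s\<in>S. k s = k' s) \<longrightarrow> \<Psi> k = \<Psi> k') \<and> \<Psi> \<in> borel_measurable (PiM S (\<lambda>_. borel))"

lemma cyl_cong: "cyl S \<Psi> \<Longrightarrow> (\<And>s. s \<in> S \<Longrightarrow> k s = k' s) \<Longrightarrow> \<Psi> k = \<Psi> k'"
  unfolding cyl_def by blast

text \<open>The two halves of \<open>cyl\<close> meet here: the product sigma-algebra concerns
  functions restricted to \<open>S\<close>, while a path is a function on all reals. Restricting the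
  path first is measurable, and by the first half the functional does not notice the
  restriction.\<close>

lemma cyl_measurable_compose:
  assumes "cyl S \<Psi>" "\<And>s. s \<in> S \<Longrightarrow> (\<lambda>x. X x s) \<in> borel_measurable N"
  shows "(\<lambda>x. \<Psi> (X x)) \<in> borel_measurable N"
proof -
  have "(\<lambda>x. \<Psi> (restrict (X x) S)) \<in> borel_measurable N"
    by (rule measurable_compose[OF measurable_restrict]) (use assms in \<open>auto simp: cyl_def\<close>)
  moreover have "\<Psi> (restrict (X x) S) = \<Psi> (X x)" for x
    by (rule cyl_cong[OF assms(1)]) auto
  ultimately show ?thesis by simp
qed

lemma cylI:
  assumes "\<And>k k'. (\<And>s. s \<in> S \<Longrightarrow> k s = k' s) \<Longrightarrow> \<Psi> k = \<Psi> k'"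
    and "\<Psi> \<in> borel_measurable (PiM S (\<lambda>_. borel))"
  shows "cyl S \<Psi>"
  using assms unfolding cyl_def by blast

lemma cyl_mono:
  assumes "cyl S \<Psi>" "S \<subseteq> T"
  shows "cyl T \<Psi>"
proof (rule cylI)
  show "\<Psi> k = \<Psi> k'" if "\<And>s. s \<in> T \<Longrightarrow> k s = k' s" for k k'
    using that assms by (intro cyl_cong[OF assms(1)]) auto
  show "\<Psi> \<in> borel_measurable (PiM T (\<lambda>_. borel))"
    by (rule cyl_measurable_compose[OF assms(1)]) (use assms in \<open>auto intro!: measurable_component_singleton\<close>)
qed

lemma cyl_coord [intro]: "s \<in> S \<Longrightarrow> cyl S (\<lambda>k. k s)"
  by (rule cylI) (auto intro!: measurable_component_singleton)

lemma cyl_const [intro]: "cyl S (\<lambda>k. c)"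
  by (rule cylI) auto

lemma cyl_compose:
  assumes "g \<in> borel_measurable borel" "cyl S \<Psi>"
  shows "cyl S (\<lambda>k. g (\<Psi> k))"
  using assms unfolding cyl_def by (auto intro: measurable_compose) metis

lemma cyl_compose2:
  assumes "(\<lambda>(x, y). g x y) \<in> borel_measurable (borel \<Otimes>\<^sub>M borel)" "cyl S \<Psi>" "cyl S \<Phi>"
  shows "cyl S (\<lambda>k. g (\<Psi> k) (\<Phi> k))"
proof (rule cylI)
  show "g (\<Psi> k) (\<Phi> k) = g (\<Psi> k') (\<Phi> k')" if "\<And>s. s \<in> S \<Longrightarrow> k s = k' s" for k k'
    using cyl_cong[OF assms(2) that] cyl_cong[OF assms(3) that] by simp
  have "(\<lambda>k. (\<Psi> k, \<Phi> k)) \<in> PiM S (\<lambda>_. borel) \<rightarrow>\<^sub>M borel \<Otimes>\<^sub>M borel"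
    using assms(2,3) unfolding cyl_def by (intro measurable_Pair) auto
  from measurable_compose[OF this assms(1)]
  show "(\<lambda>k. g (\<Psi> k) (\<Phi> k)) \<in> borel_measurable (PiM S (\<lambda>_. borel))"
    by simp
qed

lemma cyl_times_ennreal: "cyl S \<Psi> \<Longrightarrow> cyl S \<Phi> \<Longrightarrow> cyl S (\<lambda>k. \<Psi> k * \<Phi> k :: ennreal)"
  by (rule cyl_compose2) auto

lemma cyl_shift:
  assumes "cyl S \<Psi>"
  shows "cyl S (\<lambda>k. \<Psi> (\<lambda>r. k r + u r))"
proof (rule cylI)
  show "\<Psi> (\<lambda>r. k r + u r) = \<Psi> (\<lambda>r. k' r + u r)" if "\<And>s. s \<in> S \<Longrightarrow> k s = k' s" for k k'
    using that by (intro cyl_cong[OF assms]) auto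
  show "(\<lambda>k. \<Psi> (\<lambda>r. k r + u r)) \<in> borel_measurable (PiM S (\<lambda>_. borel))"
    by (rule cyl_measurable_compose[OF assms])
       (auto intro!: borel_measurable_add measurable_component_singleton)
qed

locale brownian =
  fixes M :: "'w measure" and B :: "real \<Rightarrow> 'w \<Rightarrow> real"
  assumes bm: "standard_BM M B"
begin

sublocale prob_space M
  using bm by (simp add: standard_BM_def)

lemma B_measurable: "t \<in> {0..1} \<Longrightarrow> B t \<in> borel_measurable M"
  using bm by (simp add: standard_BM_def)

lemma B_0: "\<omega> \<in> space M \<Longrightarrow> B 0 \<omega> = 0"
  using bm by (simp add: standard_BM_def)

lemma B_cont: "\<omega> \<in> space M \<Longrightarrow> continuous_on {0..1} (\<lambda>t. B t \<omega>)"
  using bm by (simp add: standard_BM_def)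

lemma B_incr: "0 \<le> s \<Longrightarrow> s < t \<Longrightarrow> t \<le> 1 \<Longrightarrow>
    distributed M lborel (\<lambda>\<omega>. B t \<omega> - B s \<omega>) (normal_density 0 (sqrt (t - s)))"
  using bm by (simp add: standard_BM_def)

lemma B_indep: "(\<And>i. i \<le> n \<Longrightarrow> t i \<in> {0..1}) \<Longrightarrow> (\<And>i. i < n \<Longrightarrow> t i \<le> t (Suc i)) \<Longrightarrow>
    indep_vars (\<lambda>_. borel) (\<lambda>i \<omega>. B (t (Suc i)) \<omega> - B (t i) \<omega>) {..<n}"
  using bm by (simp add: standard_BM_def)

lemma cyl_B_measurable:
  assumes "cyl S \<Psi>" "S \<subseteq> {0..1}"
  shows "(\<lambda>\<omega>. \<Psi> (\<lambda>s. B s \<omega>)) \<in> borel_measurable M"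
  by (rule cyl_measurable_compose[OF assms(1)]) (use assms(2) B_measurable in auto)

end

text \<open>Sorting brings an arbitrary finite set of times into the form of consecutive grid points
  to which independence of increments applies.\<close>

lemma finite_set_grid:
  assumes "finite S" "S \<subseteq> {0..1::real}" "0 \<in> S"
  obtains t :: "nat \<Rightarrow> real" and N where "strict_mono_on {..N} t" "t ` {..N} = S" "t 0 = 0"
proof -
  define l where "l = sorted_list_of_set S"
  have l: "sorted_wrt (<) l" "set l = S" "l \<noteq> []"
    using assms by (auto simp: l_def)
  define N where "N = length l - 1"
  have N: "length l = Suc N" using l by (cases l) (auto simp: N_def)
  have im: "(\<lambda>i. l ! i) ` {..N} = S"
    using l(2) N unfolding set_conv_nth by (auto simp: less_Suc_eq_le)
  have sm: "strict_mono_on {..N} (\<lambda>i. l ! i)"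
    using l(1) N by (auto simp: strict_mono_on_def sorted_wrt_iff_nth_less)
  have "l ! 0 = 0"
  proof -
    have "0 \<in> (\<lambda>i. l ! i) ` {..N}" unfolding im by (rule assms(3))
    then obtain j where j: "j \<le> N" "l ! j = 0" by auto
    have "l ! 0 \<in> S" unfolding im[symmetric] by blast
    then have "0 \<le> l ! 0" using assms(2) by auto
    moreover have "l ! 0 \<le> l ! j" using strict_mono_on_leD[OF sm, of 0 j] j by simp
    ultimately show ?thesis using j by auto
  qed
  with that sm im show thesis by blast
qed

text \<open>The inner integral no longer depends on the coordinate \<open>p\<close>, so integrating
  that coordinate out contributes only total mass 1. Outside \<open>I\<close> the standard deviation
  is set to 1, which makes every member of the family a probability measure.\<close>

lemma PiM_normal_resample:
  fixes sd :: "nat \<Rightarrow> real" and H :: "(nat \<Rightarrow> real) \<Rightarrow> ennreal"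
  assumes "finite I" "p \<in> I" "\<And>i. i \<in> I \<Longrightarrow> 0 < sd i"
    and H: "H \<in> borel_measurable (PiM I (\<lambda>_. borel))"
  defines "N \<equiv> \<lambda>i. density lborel (normal_density 0 (if i \<in> I then sd i else 1))"
  shows "(\<integral>\<^sup>+x. H x \<partial>PiM I N) = (\<integral>\<^sup>+x. (\<integral>\<^sup>+y. H (x(p := y)) \<partial>N p) \<partial>PiM I N)"
proof -
  have pr: "prob_space (N i)" for i
    unfolding N_def by (rule prob_space_normal_density) (use assms in auto)
  interpret product_sigma_finite N
    unfolding product_sigma_finite_def using pr prob_space_imp_sigma_finite by blast
  interpret Np: prob_space "N p" by (rule pr)
  have sets[measurable_cong]: "sets (N i) = sets borel" for i by (simp add: N_def)
  have sP: "sets (PiM I N) = sets (PiM I (\<lambda>_. borel))" for I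
    by (intro sets_PiM_cong) (auto simp: sets)
  define J where "J = I - {p}"
  have J: "finite J" "p \<notin> J" "insert p J = I" using assms by (auto simp: J_def)
  have Hm[measurable]: "H \<in> borel_measurable (PiM (insert p J) N)"
    using H unfolding J by (simp add: measurable_cong_sets[OF sP refl])
  have G: "(\<lambda>x. \<integral>\<^sup>+y. H (x(p := y)) \<partial>N p) \<in> borel_measurable (PiM (insert p J) N)"
  proof -
    have "(\<lambda>(x, y). H (x(p := y))) \<in> borel_measurable (PiM (insert p J) N \<Otimes>\<^sub>M N p)"
    proof -
      have "(\<lambda>z. (fst z)(p := snd z)) \<in> PiM (insert p J) N \<Otimes>\<^sub>M N p \<rightarrow>\<^sub>M PiM (insert p J) N"
        by (rule measurable_fun_upd[where J = "insert p J"]) auto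
      from measurable_compose[OF this Hm] show ?thesis by (simp add: case_prod_beta')
    qed
    then show ?thesis
      by (rule sigma_finite_measure.borel_measurable_nn_integral[OF prob_space_imp_sigma_finite[OF pr]])
  qed
  have "(\<integral>\<^sup>+x. (\<integral>\<^sup>+y. H (x(p := y)) \<partial>N p) \<partial>PiM (insert p J) N)
      = (\<integral>\<^sup>+x. (\<integral>\<^sup>+z. (\<integral>\<^sup>+y. H ((x(p := z))(p := y)) \<partial>N p) \<partial>N p) \<partial>PiM J N)"
    by (rule product_nn_integral_insert[OF J(1,2) G])
  also have "\<dots> = (\<integral>\<^sup>+x. (\<integral>\<^sup>+y. H (x(p := y)) \<partial>N p) \<partial>PiM J N)"
    by (simp add: Np.emeasure_space_1)
  also have "\<dots> = (\<integral>\<^sup>+x. H x \<partial>PiM (insert p J) N)"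
    by (rule product_nn_integral_insert[OF J(1,2) Hm, symmetric])
  finally show ?thesis unfolding J ..
qed

context brownian
begin

text \<open>No time of \<open>S\<close> lies strictly between \<open>s\<close> and
  \<open>s'\<close>, so the functional sees the increment over this interval as one independent
  Gaussian variable, and that variable may be redrawn. Replacing the increment by \<open>x\<close>
  translates all values from time \<open>s'\<close> on, which is what the conditional term records.
  Both \<open>one_step\<close> and the Cameron-Martin formula are consequences.\<close>

lemma resample:
  fixes \<Psi> :: "(real \<Rightarrow> real) \<Rightarrow> ennreal"
  assumes S: "finite S" "S \<subseteq> {0..1}" and s: "0 \<le> s" "s < s'" "s' \<le> 1"
    and gap: "S \<inter> {s<..<s'} = {}" and \<Psi>: "cyl S \<Psi>"
  shows "(\<integral>\<^sup>+\<omega>. \<Psi> (\<lambda>r. B r \<omega>) \<partial>M) =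
    (\<integral>\<^sup>+\<omega>. (\<integral>\<^sup>+x. ennreal (normal_density 0 (sqrt (s' - s)) x) *
        \<Psi> (\<lambda>r. B r \<omega> + (if s' \<le> r then x - (B s' \<omega> - B s \<omega>) else 0)) \<partial>lborel) \<partial>M)"
proof -
  define U where "U = insert 0 (insert s (insert s' S))"
  have U: "finite U" "U \<subseteq> {0..1}" "0 \<in> U" using S s by (auto simp: U_def)
  obtain t :: "nat \<Rightarrow> real" and N where t: "strict_mono_on {..N} t" "t ` {..N} = U" "t 0 = 0"
    by (rule finite_set_grid[OF U])
  have t01: "t i \<in> {0..1}" if "i \<le> N" for i using t(2) U(2) that by blast
  have tless: "t i < t j \<longleftrightarrow> i < j" "t i \<le> t j \<longleftrightarrow> i \<le> j" if "i \<le> N" "j \<le> N" for i j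
    using that t(1) by (simp_all add: strict_mono_on_less strict_mono_on_less_eq)
  have "s \<in> t ` {..N}" "s' \<in> t ` {..N}" unfolding t(2) by (auto simp: U_def)
  then obtain p q where p: "p \<le> N" "t p = s" and q: "q \<le> N" "t q = s'" by blast
  have pq: "p < q" using tless(1)[OF p(1) q(1)] p q s by simp
  \<comment> \<open>The gap hypothesis enters only through this adjacency: the increment from
    \<open>s\<close> to \<open>s'\<close> is then a single coordinate of the product
    measure.\<close>
  have qp: "q = Suc p"
  proof (rule ccontr)
    assume "q \<noteq> Suc p"
    then have *: "p < Suc p" "Suc p < q" using pq by auto
    then have "Suc p \<le> N" using q by simp
    then have "s < t (Suc p)" "t (Suc p) < s'" using tless(1) * p q by (metis)+
    moreover have "t (Suc p) \<in> U" using t(2) \<open>Suc p \<le> N\<close> by blast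
    ultimately show False using gap s by (auto simp: U_def)
  qed
  have pN: "p < N" using qp q by simp
  define X where "X = (\<lambda>i \<omega>. B (t (Suc i)) \<omega> - B (t i) \<omega>)"
  define sd where "sd = (\<lambda>i. sqrt (t (Suc i) - t i))"
  define D where "D = (\<lambda>i. density lborel (normal_density 0 (if i \<in> {..<N} then sd i else 1)))"
  have Xm: "X i \<in> borel_measurable M" if "i < N" for i
    unfolding X_def using that t01 by (intro borel_measurable_diff B_measurable) auto
  have Xd: "distr M borel (X i) = D i" if "i < N" for i
  proof -
    have "distributed M lborel (X i) (normal_density 0 (sd i))"
      unfolding X_def sd_def using that t01[of i] t01[of "Suc i"] tless(1)[of i "Suc i"]
      by (intro B_incr) auto
    then have "distr M lborel (X i) = density lborel (normal_density 0 (sd i))"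
      by (rule distributed_distr_eq_density)
    moreover have "distr M lborel (X i) = distr M borel (X i)" by (intro distr_cong) auto
    ultimately show ?thesis using that by (simp add: D_def)
  qed
  have "distr M (PiM {..<N} (\<lambda>_. borel)) (\<lambda>\<omega>. \<lambda>i\<in>{..<N}. X i \<omega>) = PiM {..<N} (\<lambda>i. distr M borel (X i))"
  proof (rule indep_vars_iff_distr_eq_PiM'[THEN iffD1])
    show "{..<N} \<noteq> {}" using pN by auto
    show "indep_vars (\<lambda>_. borel) X {..<N}"
      unfolding X_def by (rule B_indep) (use t01 tless in auto)
  qed (use Xm in auto)
  also have "\<dots> = PiM {..<N} D" by (intro PiM_cong) (auto simp: Xd)
  finally have dist: "distr M (PiM {..<N} (\<lambda>_. borel)) (\<lambda>\<omega>. \<lambda>i\<in>{..<N}. X i \<omega>) = PiM {..<N} D" .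
  \<comment> \<open>Rebuilds the value at time \<open>r\<close> from the increments. At grid times
    it is the path itself, because the grid starts at 0 and \<open>B 0\<close> is 0.\<close>
  define P where "P = (\<lambda>(x::nat \<Rightarrow> real) r. \<Sum>i<N. if t (Suc i) \<le> r then x i else 0)"
  have PX: "P (\<lambda>i\<in>{..<N}. X i \<omega>) r = B r \<omega>" if "r \<in> U" "\<omega> \<in> space M" for r \<omega>
  proof -
    have "r \<in> t ` {..N}" unfolding t(2) by (rule that(1))
    then obtain j where j: "j \<le> N" "t j = r" by blast
    have "P (\<lambda>i\<in>{..<N}. X i \<omega>) r = (\<Sum>i<N. if i \<in> {..<j} then X i \<omega> else 0)"
      unfolding P_def
    proof (rule sum.cong)
      fix i assume "i \<in> {..<N}"
      then have "t (Suc i) \<le> r \<longleftrightarrow> i < j" using tless(2)[of "Suc i" j] j by (simp add: Suc_le_eq)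
      then show "(if t (Suc i) \<le> r then (\<lambda>i\<in>{..<N}. X i \<omega>) i else 0) = (if i \<in> {..<j} then X i \<omega> else 0)"
        using \<open>i \<in> {..<N}\<close> by simp
    qed simp
    also have "\<dots> = (\<Sum>i\<in>{..<N} \<inter> {..<j}. X i \<omega>)" by (rule sum.inter_restrict[symmetric]) simp
    also have "{..<N} \<inter> {..<j} = {..<j}" using j by auto
    also have "(\<Sum>i<j. X i \<omega>) = B (t j) \<omega> - B (t 0) \<omega>"
      unfolding X_def by (rule sum_lessThan_telescope)
    finally show ?thesis unfolding j(2) t(3) B_0[OF that(2)] diff_zero .
  qed
  define H where "H = (\<lambda>x. \<Psi> (P x))"
  have SU: "S \<subseteq> U" by (auto simp: U_def)
  have Hm: "H \<in> borel_measurable (PiM {..<N} (\<lambda>_. borel))"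
    unfolding H_def
  proof (rule cyl_measurable_compose[OF \<Psi>])
    fix r show "(\<lambda>x. P x r) \<in> borel_measurable (PiM {..<N} (\<lambda>_. borel))"
      unfolding P_def
    proof (rule borel_measurable_sum)
      fix i assume "i \<in> {..<N}"
      then show "(\<lambda>x. if t (Suc i) \<le> r then x i else 0) \<in> borel_measurable (PiM {..<N} (\<lambda>_. borel))"
        by (cases "t (Suc i) \<le> r") (simp_all add: measurable_component_singleton)
    qed
  qed
  have HX: "H (\<lambda>i\<in>{..<N}. X i \<omega>) = \<Psi> (\<lambda>r. B r \<omega>)" if "\<omega> \<in> space M" for \<omega>
    unfolding H_def by (rule cyl_cong[OF \<Psi>]) (use PX[OF _ that] SU in blast)
  have upd: "P (x(p := y)) r = P x r + (if s' \<le> r then y - x p else 0)" for x y r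
  proof -
    have tp: "t (Suc p) = s'" using q qp by simp
    have "P (x(p := y)) r = (\<Sum>i<N. (if t (Suc i) \<le> r then x i else 0) + (if p = i then (if s' \<le> r then y - x p else 0) else 0))"
      unfolding P_def by (rule sum.cong) (use tp in auto)
    also have "\<dots> = P x r + (if s' \<le> r then y - x p else 0)"
      unfolding P_def sum.distrib by (simp add: sum.delta pN)
    finally show ?thesis .
  qed
  have HXy: "H ((\<lambda>i\<in>{..<N}. X i \<omega>)(p := y)) = \<Psi> (\<lambda>r. B r \<omega> + (if s' \<le> r then y - (B s' \<omega> - B s \<omega>) else 0))"
    if "\<omega> \<in> space M" for \<omega> y
    unfolding H_def
  proof (rule cyl_cong[OF \<Psi>])
    fix r assume "r \<in> S"
    then have "P (\<lambda>i\<in>{..<N}. X i \<omega>) r = B r \<omega>" using PX[OF _ that] SU by blast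
    then show "P ((\<lambda>i\<in>{..<N}. X i \<omega>)(p := y)) r = B r \<omega> + (if s' \<le> r then y - (B s' \<omega> - B s \<omega>) else 0)"
      using pN p q qp by (simp only: upd) (simp add: X_def)
  qed
  have Dp: "D p = density lborel (normal_density 0 (sqrt (s' - s)))"
    using pN p q qp by (simp add: D_def sd_def)
  have XX: "(\<lambda>\<omega>. \<lambda>i\<in>{..<N}. X i \<omega>) \<in> M \<rightarrow>\<^sub>M PiM {..<N} (\<lambda>_. borel)"
    by (rule measurable_restrict) (use Xm in auto)
  have "(\<integral>\<^sup>+\<omega>. \<Psi> (\<lambda>r. B r \<omega>) \<partial>M) = (\<integral>\<^sup>+\<omega>. H (\<lambda>i\<in>{..<N}. X i \<omega>) \<partial>M)"
    by (intro nn_integral_cong) (simp add: HX)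
  also have "\<dots> = (\<integral>\<^sup>+x. H x \<partial>PiM {..<N} D)"
    unfolding dist[symmetric] by (subst nn_integral_distr[OF XX]) (use Hm in auto)
  also have "\<dots> = (\<integral>\<^sup>+x. (\<integral>\<^sup>+y. H (x(p := y)) \<partial>D p) \<partial>PiM {..<N} D)"
    unfolding D_def
  proof (rule PiM_normal_resample)
    show "0 < sd i" if "i \<in> {..<N}" for i
      using that tless(1)[of i "Suc i"] by (simp add: sd_def)
  qed (use pN Hm in auto)
  also have "\<dots> = (\<integral>\<^sup>+\<omega>. (\<integral>\<^sup>+y. H ((\<lambda>i\<in>{..<N}. X i \<omega>)(p := y)) \<partial>D p) \<partial>M)"
    unfolding dist[symmetric]
  proof (rule nn_integral_distr[OF XX])
    have sDp[measurable_cong]: "sets (D p) = sets borel" by (simp add: D_def)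
    interpret Dp: prob_space "D p"
      unfolding Dp by (rule prob_space_normal_density) (use s in auto)
    have "(\<lambda>z. (fst z)(p := snd z)) \<in> PiM {..<N} (\<lambda>_. borel) \<Otimes>\<^sub>M D p \<rightarrow>\<^sub>M PiM {..<N} (\<lambda>_. borel::real measure)"
      by (rule measurable_fun_upd[where J = "{..<N}"]) (use pN in auto)
    from measurable_compose[OF this Hm]
    have "(\<lambda>(x, y). H (x(p := y))) \<in> borel_measurable (PiM {..<N} (\<lambda>_. borel) \<Otimes>\<^sub>M D p)"
      by (simp add: case_prod_beta')
    then have "(\<lambda>x. \<integral>\<^sup>+y. H (x(p := y)) \<partial>D p) \<in> borel_measurable (PiM {..<N} (\<lambda>_. borel))"
      by (rule sigma_finite_measure.borel_measurable_nn_integral[OF Dp.sigma_finite_measure_axioms])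
    then show "(\<lambda>x. \<integral>\<^sup>+y. H (x(p := y)) \<partial>D p) \<in> borel_measurable (distr M (PiM {..<N} (\<lambda>_. borel)) (\<lambda>\<omega>. \<lambda>i\<in>{..<N}. X i \<omega>))"
      by simp
  qed
  also have "\<dots> = (\<integral>\<^sup>+\<omega>. (\<integral>\<^sup>+y. ennreal (normal_density 0 (sqrt (s' - s)) y) *
        \<Psi> (\<lambda>r. B r \<omega> + (if s' \<le> r then y - (B s' \<omega> - B s \<omega>) else 0)) \<partial>lborel) \<partial>M)"
  proof (intro nn_integral_cong)
    fix \<omega> assume \<omega>: "\<omega> \<in> space M"
    have "(\<lambda>y. H ((\<lambda>i\<in>{..<N}. X i \<omega>)(p := y))) \<in> borel_measurable borel"
      unfolding HXy[OF \<omega>] by (rule cyl_measurable_compose[OF \<Psi>]) simp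
    then show "(\<integral>\<^sup>+y. H ((\<lambda>i\<in>{..<N}. X i \<omega>)(p := y)) \<partial>D p) = (\<integral>\<^sup>+y. ennreal (normal_density 0 (sqrt (s' - s)) y) *
        \<Psi> (\<lambda>r. B r \<omega> + (if s' \<le> r then y - (B s' \<omega> - B s \<omega>) else 0)) \<partial>lborel)"
      unfolding Dp by (subst nn_integral_density) (auto simp: HXy[OF \<omega>])
  qed
  finally show ?thesis .
qed

end

section \<open>The Cameron-Martin formula on a grid\<close>

text \<open>Completing the square: the one-dimensional Cameron-Martin formula at the level of
  densities.\<close>

lemma normal_density_shift:
  assumes "0 < \<tau>"
  shows "normal_density 0 (sqrt \<tau>) (a + x) * exp (a / \<tau> * (a + x) - a\<^sup>2 / (2 * \<tau>)) = normal_density 0 (sqrt \<tau>) x"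
proof -
  have "- (a + x)\<^sup>2 / (2 * \<tau>) + (a / \<tau> * (a + x) - a\<^sup>2 / (2 * \<tau>)) = - x\<^sup>2 / (2 * \<tau>)"
    using assms by (simp add: field_simps power2_eq_square)
  then show ?thesis
    using assms unfolding normal_density_def by (simp add: exp_add[symmetric])
qed

context brownian
begin

text \<open>Given the path up to \<open>s\<close>, the variable \<open>B s'\<close> is Gaussian with
  variance \<open>s' - s\<close>, so its conditional density is at most 1 / sqrt (2 pi (s' - s)).
  Integrating \<phi> against it costs only the mass of \<phi>; the shape and the height of \<phi> do
  not enter, which is the source of all uniformity in \<phi>.\<close>

lemma one_step:
  fixes G :: "(real \<Rightarrow> real) \<Rightarrow> ennreal" and \<phi> :: "real \<Rightarrow> ennreal"
  assumes T: "finite T" "T \<subseteq> {0..s}" and s: "0 \<le> s" "s < s'" "s' \<le> 1"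
    and G: "cyl T G" and \<phi>: "\<phi> \<in> borel_measurable borel" "(\<integral>\<^sup>+x. \<phi> x \<partial>lborel) \<le> 1"
  shows "(\<integral>\<^sup>+\<omega>. G (\<lambda>r. B r \<omega>) * \<phi> (B s' \<omega>) \<partial>M) \<le>
    ennreal (1 / sqrt (2 * pi * (s' - s))) * (\<integral>\<^sup>+\<omega>. G (\<lambda>r. B r \<omega>) \<partial>M)"
proof -
  let ?c = "1 / sqrt (2 * pi * (s' - s))"
  let ?S = "insert s' T"
  have "cyl ?S (\<lambda>k. G k * \<phi> (k s'))"
    by (intro cyl_times_ennreal cyl_mono[OF G] cyl_compose[OF \<phi>(1)] cyl_coord) auto
  then have "(\<integral>\<^sup>+\<omega>. G (\<lambda>r. B r \<omega>) * \<phi> (B s' \<omega>) \<partial>M) =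
    (\<integral>\<^sup>+\<omega>. (\<integral>\<^sup>+x. ennreal (normal_density 0 (sqrt (s' - s)) x) *
        (G (\<lambda>r. B r \<omega> + (if s' \<le> r then x - (B s' \<omega> - B s \<omega>) else 0)) *
         \<phi> (B s' \<omega> + (if s' \<le> s' then x - (B s' \<omega> - B s \<omega>) else 0))) \<partial>lborel) \<partial>M)"
    using T s by (intro resample) auto
  also have "\<dots> \<le> (\<integral>\<^sup>+\<omega>. ennreal ?c * G (\<lambda>r. B r \<omega>) \<partial>M)"
  proof (rule nn_integral_mono)
    fix \<omega> assume "\<omega> \<in> space M"
    have nd: "normal_density 0 (sqrt (s' - s)) x \<le> ?c" for x
    proof -
      have "normal_density 0 (sqrt (s' - s)) x = ?c * exp (- x\<^sup>2 / (2 * (s' - s)))"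
        using s by (simp add: normal_density_def)
      also have "\<dots> \<le> ?c * 1"
        using s by (intro mult_left_mono) auto
      finally show ?thesis by simp
    qed
    have "(\<integral>\<^sup>+x. ennreal (normal_density 0 (sqrt (s' - s)) x) *
        (G (\<lambda>r. B r \<omega> + (if s' \<le> r then x - (B s' \<omega> - B s \<omega>) else 0)) *
         \<phi> (B s' \<omega> + (if s' \<le> s' then x - (B s' \<omega> - B s \<omega>) else 0))) \<partial>lborel)
      \<le> (\<integral>\<^sup>+x. (ennreal ?c * G (\<lambda>r. B r \<omega>)) * \<phi> (B s \<omega> + 1 * x) \<partial>lborel)"
    proof (rule nn_integral_mono)
      fix x :: real
      have "G (\<lambda>r. B r \<omega> + (if s' \<le> r then x - (B s' \<omega> - B s \<omega>) else 0)) = G (\<lambda>r. B r \<omega>)"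
        by (rule cyl_cong[OF G]) (use T s in force)
      then show "ennreal (normal_density 0 (sqrt (s' - s)) x) *
        (G (\<lambda>r. B r \<omega> + (if s' \<le> r then x - (B s' \<omega> - B s \<omega>) else 0)) *
         \<phi> (B s' \<omega> + (if s' \<le> s' then x - (B s' \<omega> - B s \<omega>) else 0)))
        \<le> (ennreal ?c * G (\<lambda>r. B r \<omega>)) * \<phi> (B s \<omega> + 1 * x)"
        unfolding mult.assoc using nd[of x]
        by (intro mult_mono ennreal_leI) (auto simp: add.commute mult.assoc)
    qed
    also have "\<dots> = (ennreal ?c * G (\<lambda>r. B r \<omega>)) * (\<integral>\<^sup>+x. \<phi> (B s \<omega> + 1 * x) \<partial>lborel)"
      by (intro nn_integral_cmult measurable_compose[OF _ \<phi>(1)]) simp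
    also have "(\<integral>\<^sup>+x. \<phi> (B s \<omega> + 1 * x) \<partial>lborel) = (\<integral>\<^sup>+x. \<phi> x \<partial>lborel)"
      using nn_integral_real_affine[OF \<phi>(1), of 1 "B s \<omega>"] by simp
    also have "(ennreal ?c * G (\<lambda>r. B r \<omega>)) * (\<integral>\<^sup>+x. \<phi> x \<partial>lborel) \<le> (ennreal ?c * G (\<lambda>r. B r \<omega>)) * 1"
      by (intro mult_left_mono \<phi>(2)) simp
    finally show "(\<integral>\<^sup>+x. ennreal (normal_density 0 (sqrt (s' - s)) x) *
        (G (\<lambda>r. B r \<omega> + (if s' \<le> r then x - (B s' \<omega> - B s \<omega>) else 0)) *
         \<phi> (B s' \<omega> + (if s' \<le> s' then x - (B s' \<omega> - B s \<omega>) else 0))) \<partial>lborel)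
       \<le> ennreal ?c * G (\<lambda>r. B r \<omega>)" by simp
  qed
  also have "\<dots> = ennreal ?c * (\<integral>\<^sup>+\<omega>. G (\<lambda>r. B r \<omega>) \<partial>M)"
    by (intro nn_integral_cmult cyl_B_measurable[OF G]) (use T s in force)
  finally show ?thesis .
qed

text \<open>A jump by \<open>a\<close> at \<open>s'\<close> translates exactly one Gaussian
  increment. As \<open>S\<close> has no time inside the gap, the jump cannot be told on
  \<open>S\<close> from a shift growing linearly over the interval from \<open>s\<close> to
  \<open>s'\<close>, and the weight is the Cameron-Martin density of that shift.\<close>

lemma cameron_martin_jump:
  fixes \<Psi> :: "(real \<Rightarrow> real) \<Rightarrow> ennreal"
  assumes S: "finite S" "S \<subseteq> {0..1}" and s: "0 \<le> s" "s < s'" "s' \<le> 1"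
    and gap: "S \<inter> {s<..<s'} = {}" and \<Psi>: "cyl S \<Psi>"
  shows "(\<integral>\<^sup>+\<omega>. \<Psi> (\<lambda>r. B r \<omega> + (if s' \<le> r then a else 0)) \<partial>M) =
    (\<integral>\<^sup>+\<omega>. \<Psi> (\<lambda>r. B r \<omega>) * ennreal (exp (a / (s' - s) * (B s' \<omega> - B s \<omega>) - a\<^sup>2 / (2 * (s' - s)))) \<partial>M)"
proof -
  let ?p = "normal_density 0 (sqrt (s' - s))"
  let ?J = "\<lambda>\<omega> x r. B r \<omega> + (if s' \<le> r then x - (B s' \<omega> - B s \<omega>) else 0)"
  let ?e = "\<lambda>x. exp (a / (s' - s) * x - a\<^sup>2 / (2 * (s' - s)))"
  let ?U = "insert s (insert s' S)"
  have "cyl ?U (\<lambda>k. \<Psi> k * ennreal (?e (k s' - k s)))"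
  proof (intro cyl_times_ennreal cyl_mono[OF \<Psi>])
    show "cyl ?U (\<lambda>k. ennreal (?e (k s' - k s)))"
      by (rule cyl_compose2[where g = "\<lambda>x y. ennreal (?e (x - y))"]) auto
  qed auto
  then have R: "(\<integral>\<^sup>+\<omega>. \<Psi> (\<lambda>r. B r \<omega>) * ennreal (?e (B s' \<omega> - B s \<omega>)) \<partial>M) =
     (\<integral>\<^sup>+\<omega>. (\<integral>\<^sup>+x. ennreal (?p x) * (\<Psi> (?J \<omega> x) * ennreal (?e (?J \<omega> x s' - ?J \<omega> x s))) \<partial>lborel) \<partial>M)"
    using S s gap by (intro resample[where S = ?U]) auto
  have L: "(\<integral>\<^sup>+\<omega>. \<Psi> (\<lambda>r. B r \<omega> + (if s' \<le> r then a else 0)) \<partial>M) =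
     (\<integral>\<^sup>+\<omega>. (\<integral>\<^sup>+x. ennreal (?p x) * \<Psi> (\<lambda>r. ?J \<omega> x r + (if s' \<le> r then a else 0)) \<partial>lborel) \<partial>M)"
    by (intro resample[OF S s gap] cyl_shift[OF \<Psi>])
  show ?thesis
    unfolding L R
  proof (rule nn_integral_cong)
    fix \<omega> assume "\<omega> \<in> space M"
    have m: "(\<lambda>x. \<Psi> (?J \<omega> x)) \<in> borel_measurable borel"
      by (rule cyl_measurable_compose[OF \<Psi>]) simp
    have "(\<integral>\<^sup>+x. ennreal (?p x) * (\<Psi> (?J \<omega> x) * ennreal (?e (?J \<omega> x s' - ?J \<omega> x s))) \<partial>lborel)
       = (\<integral>\<^sup>+x. ennreal (?p x * ?e x) * \<Psi> (?J \<omega> x) \<partial>lborel)"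
      using s by (intro nn_integral_cong) (simp add: ennreal_mult mult_ac)
    \<comment> \<open>Translating the redrawn increment by \<open>a\<close> turns the density times
      the weight back into the plain Gaussian density.\<close>
    also have "\<dots> = ennreal \<bar>1\<bar> * (\<integral>\<^sup>+x. ennreal (?p (a + 1 * x) * ?e (a + 1 * x)) * \<Psi> (?J \<omega> (a + 1 * x)) \<partial>lborel)"
      by (rule nn_integral_real_affine) (use m in auto)
    also have "\<dots> = (\<integral>\<^sup>+x. ennreal (?p x) * \<Psi> (?J \<omega> (a + x)) \<partial>lborel)"
    proof -
      have "?p (a + 1 * x) * ?e (a + 1 * x) = ?p x" for x
        using normal_density_shift[of "s' - s" a x] s by (simp only: mult_1 diff_gt_0_iff_gt)
      then show ?thesis by (simp only: mult_1 abs_one ennreal_1)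
    qed
    also have "\<dots> = (\<integral>\<^sup>+x. ennreal (?p x) * \<Psi> (\<lambda>r. ?J \<omega> x r + (if s' \<le> r then a else 0)) \<partial>lborel)"
    proof (intro nn_integral_cong arg_cong2[where f = "(*)"] refl arg_cong[where f = \<Psi>] ext)
      fix x r show "?J \<omega> (a + x) r = ?J \<omega> x r + (if s' \<le> r then a else 0)" by simp
    qed
    finally show "(\<integral>\<^sup>+x. ennreal (?p x) * \<Psi> (\<lambda>r. ?J \<omega> x r + (if s' \<le> r then a else 0)) \<partial>lborel) =
      (\<integral>\<^sup>+x. ennreal (?p x) * (\<Psi> (?J \<omega> x) * ennreal (?e (?J \<omega> x s' - ?J \<omega> x s))) \<partial>lborel)" ..
  qed
qed

text \<open>Induction on the number of shifted increments. The induction hypothesis is used for the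
  functional that already contains the last jump; the weight it produces involves only increments
  that end before that jump, so it is unchanged when the jump is finally traded for its own
  weight.\<close>

lemma cameron_martin_grid_nn:
  fixes \<Psi> :: "(real \<Rightarrow> real) \<Rightarrow> ennreal"
  assumes t: "strict_mono_on {..N} t" "t ` {..N} \<subseteq> {0..1}" and p: "p \<le> N" and \<Psi>: "cyl (t ` {..N}) \<Psi>"
  shows "(\<integral>\<^sup>+\<omega>. \<Psi> (\<lambda>r. B r \<omega> + (\<Sum>i<p. if t (Suc i) \<le> r then a i else 0)) \<partial>M) =
    (\<integral>\<^sup>+\<omega>. \<Psi> (\<lambda>r. B r \<omega>) * ennreal (exp (\<Sum>i<p. a i / (t (Suc i) - t i) * (B (t (Suc i)) \<omega> - B (t i) \<omega>)
        - (a i)\<^sup>2 / (2 * (t (Suc i) - t i)))) \<partial>M)"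
  using p \<Psi>
proof (induction p arbitrary: \<Psi>)
  case 0
  then show ?case by simp
next
  case (Suc p)
  let ?S = "t ` {..N}"
  let ?e = "\<lambda>i k. a i / (t (Suc i) - t i) * (k (t (Suc i)) - k (t i)) - (a i)\<^sup>2 / (2 * (t (Suc i) - t i))"
  let ?E = "\<lambda>p k. ennreal (exp (\<Sum>i<p. ?e i k))"
  have tless: "t i < t j" if "i < j" "j \<le> N" for i j
    using t(1) that by (simp add: strict_mono_on_def)
  have tle: "t i \<le> t j" if "i \<le> j" "j \<le> N" for i j
    using tless[of i j] that by (cases "i = j") auto
  define \<Psi>' where "\<Psi>' = (\<lambda>k. \<Psi> (\<lambda>r. k r + (if t (Suc p) \<le> r then a p else 0)))"
  have c': "cyl ?S \<Psi>'" unfolding \<Psi>'_def by (rule cyl_shift[OF Suc.prems(2)])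
  have cE: "cyl ?S (?E p)"
  proof (rule cylI)
    show "?E p k = ?E p k'" if "\<And>s. s \<in> ?S \<Longrightarrow> k s = k' s" for k k'
      using that Suc.prems(1) by (intro arg_cong[where f = "\<lambda>x. ennreal (exp x)"] sum.cong) auto
    show "?E p \<in> borel_measurable (PiM ?S (\<lambda>_. borel))"
    proof (intro measurable_compose[OF _ measurable_ennreal] borel_measurable_exp measurable_compose[OF _ borel_measurable_exp]
        borel_measurable_sum borel_measurable_diff borel_measurable_times borel_measurable_const)
      fix i assume "i \<in> {..<p}"
      then show "(\<lambda>k. k (t (Suc i))) \<in> borel_measurable (PiM ?S (\<lambda>_. borel))"
        "(\<lambda>k. k (t i)) \<in> borel_measurable (PiM ?S (\<lambda>_. borel))"
        using Suc.prems(1) by (auto intro!: measurable_component_singleton)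
    qed
  qed
  have "(\<integral>\<^sup>+\<omega>. \<Psi> (\<lambda>r. B r \<omega> + (\<Sum>i<Suc p. if t (Suc i) \<le> r then a i else 0)) \<partial>M)
      = (\<integral>\<^sup>+\<omega>. \<Psi>' (\<lambda>r. B r \<omega> + (\<Sum>i<p. if t (Suc i) \<le> r then a i else 0)) \<partial>M)"
    unfolding \<Psi>'_def by (simp add: add.assoc)
  also have "\<dots> = (\<integral>\<^sup>+\<omega>. \<Psi>' (\<lambda>r. B r \<omega>) * ?E p (\<lambda>r. B r \<omega>) \<partial>M)"
    using Suc.prems by (intro Suc.IH c') auto
  also have "\<dots> = (\<integral>\<^sup>+\<omega>. (\<lambda>k. \<Psi> k * ?E p k) (\<lambda>r. B r \<omega> + (if t (Suc p) \<le> r then a p else 0)) \<partial>M)"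
  proof (intro nn_integral_cong)
    fix \<omega> assume "\<omega> \<in> space M"
    have "?E p (\<lambda>r. B r \<omega> + (if t (Suc p) \<le> r then a p else 0)) = ?E p (\<lambda>r. B r \<omega>)"
    proof (intro arg_cong[where f = "\<lambda>x. ennreal (exp x)"] sum.cong refl)
      fix i assume "i \<in> {..<p}"
      then have "t i < t (Suc p)" "t (Suc i) < t (Suc p)" using Suc.prems(1) by (auto intro!: tless)
      then show "?e i (\<lambda>r. B r \<omega> + (if t (Suc p) \<le> r then a p else 0)) = ?e i (\<lambda>r. B r \<omega>)"
        by (simp only: not_le[symmetric] if_False add_0_right simp_thms)
    qed
    then show "\<Psi>' (\<lambda>r. B r \<omega>) * ?E p (\<lambda>r. B r \<omega>) =
       (\<lambda>k. \<Psi> k * ?E p k) (\<lambda>r. B r \<omega> + (if t (Suc p) \<le> r then a p else 0))"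
      unfolding \<Psi>'_def by simp
  qed
  also have "\<dots> = (\<integral>\<^sup>+\<omega>. (\<lambda>k. \<Psi> k * ?E p k) (\<lambda>r. B r \<omega>) * ennreal (exp (a p / (t (Suc p) - t p) * (B (t (Suc p)) \<omega> - B (t p) \<omega>) - (a p)\<^sup>2 / (2 * (t (Suc p) - t p)))) \<partial>M)"
  proof (rule cameron_martin_jump[where S = ?S])
    have "t p \<in> {0..1}" "t (Suc p) \<in> {0..1}" using t(2) Suc.prems(1) by (auto simp: image_subset_iff)
    then show "0 \<le> t p" "t (Suc p) \<le> 1" by auto
    show "t p < t (Suc p)" using Suc.prems(1) by (intro tless) auto
    show "?S \<inter> {t p<..<t (Suc p)} = {}"
    proof (rule ccontr)
      assume "?S \<inter> {t p<..<t (Suc p)} \<noteq> {}"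
      then obtain j where j: "j \<le> N" "t p < t j" "t j < t (Suc p)" by auto
      have "p < j" using tle[of j p] Suc.prems(1) j by (cases "p < j") auto
      then have "t (Suc p) \<le> t j" using j by (intro tle) auto
      with j show False by simp
    qed
    show "cyl ?S (\<lambda>k. \<Psi> k * ?E p k)" by (rule cyl_times_ennreal[OF Suc.prems(2) cE])
  qed (use t(2) in auto)
  also have "\<dots> = (\<integral>\<^sup>+\<omega>. \<Psi> (\<lambda>r. B r \<omega>) * ?E (Suc p) (\<lambda>r. B r \<omega>) \<partial>M)"
    by (intro nn_integral_cong) (simp add: mult.assoc ennreal_mult[symmetric] exp_add[symmetric])
  finally show ?case .
qed

text \<open>The nonnegative version, applied to indicators, is an equality of laws: the shifted path
  under \<open>M\<close> and the path under the weighted measure \<open>Q\<close> have the same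
  distribution on the grid. Integrals against equal measures agree, so the formula holds for every
  real \<psi>, integrable or not.\<close>

lemma cameron_martin_grid:
  fixes \<psi> :: "(real \<Rightarrow> real) \<Rightarrow> real"
  assumes t: "strict_mono_on {..N} t" "t ` {..N} \<subseteq> {0..1}" and p: "p \<le> N" and \<psi>: "cyl (t ` {..N}) \<psi>"
  shows "(\<integral>\<omega>. \<psi> (\<lambda>r. B r \<omega> + (\<Sum>i<p. if t (Suc i) \<le> r then a i else 0)) \<partial>M) =
    (\<integral>\<omega>. exp (\<Sum>i<p. a i / (t (Suc i) - t i) * (B (t (Suc i)) \<omega> - B (t i) \<omega>)
        - (a i)\<^sup>2 / (2 * (t (Suc i) - t i))) * \<psi> (\<lambda>r. B r \<omega>) \<partial>M)"
proof -
  let ?S = "t ` {..N}"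
  let ?u = "\<lambda>r. \<Sum>i<p. if t (Suc i) \<le> r then a i else 0"
  let ?X = "\<lambda>\<omega>. restrict (\<lambda>r. B r \<omega>) ?S"
  let ?Y = "\<lambda>\<omega>. restrict (\<lambda>r. B r \<omega> + ?u r) ?S"
  let ?e = "\<lambda>\<omega>. exp (\<Sum>i<p. a i / (t (Suc i) - t i) * (B (t (Suc i)) \<omega> - B (t i) \<omega>)
        - (a i)\<^sup>2 / (2 * (t (Suc i) - t i)))"
  let ?P = "PiM ?S (\<lambda>_. borel :: real measure)"
  have BS: "B r \<in> borel_measurable M" if "r \<in> ?S" for r
    using that t(2) by (intro B_measurable) auto
  have X: "?X \<in> M \<rightarrow>\<^sub>M ?P" and Y: "?Y \<in> M \<rightarrow>\<^sub>M ?P"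
    by (intro measurable_restrict borel_measurable_add BS borel_measurable_const; assumption)+
  have em: "?e \<in> borel_measurable M"
  proof (intro measurable_compose[OF _ borel_measurable_exp]
        borel_measurable_sum borel_measurable_diff borel_measurable_times borel_measurable_const)
    fix i assume "i \<in> {..<p}"
    then show "B (t (Suc i)) \<in> borel_measurable M" "B (t i) \<in> borel_measurable M"
      using p by (auto intro!: BS)
  qed
  define Q where "Q = density M (\<lambda>\<omega>. ennreal (?e \<omega>))"
  have XQ: "?X \<in> Q \<rightarrow>\<^sub>M ?P" using X by (simp add: Q_def)
  have "distr M ?P ?Y = distr Q ?P ?X"
  proof (rule measure_eqI)
    fix A assume "A \<in> sets (distr M ?P ?Y)"
    then have A: "A \<in> sets ?P" by simp
    let ?\<Psi> = "\<lambda>k. indicator A (restrict k ?S) :: ennreal"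
    have cyl: "cyl ?S ?\<Psi>"
    proof (rule cylI)
      show "?\<Psi> k = ?\<Psi> k'" if "\<And>s. s \<in> ?S \<Longrightarrow> k s = k' s" for k k'
        using that by (intro arg_cong[where f = "indicator A"] restrict_ext)
      have "(\<lambda>k. restrict k ?S) \<in> ?P \<rightarrow>\<^sub>M ?P"
        by (intro measurable_restrict measurable_component_singleton)
      from measurable_compose[OF this, of "indicator A :: _ \<Rightarrow> ennreal"] A
      show "?\<Psi> \<in> borel_measurable ?P" by simp
    qed
    have "emeasure (distr M ?P ?Y) A = (\<integral>\<^sup>+\<omega>. ?\<Psi> (\<lambda>r. B r \<omega> + ?u r) \<partial>M)"
    proof -
      have "emeasure (distr M ?P ?Y) A = (\<integral>\<^sup>+x. indicator A x \<partial>distr M ?P ?Y)" using A by simp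
      also have "\<dots> = (\<integral>\<^sup>+\<omega>. indicator A (?Y \<omega>) \<partial>M)" by (rule nn_integral_distr[OF Y]) (use A in simp)
      finally show ?thesis .
    qed
    also have "\<dots> = (\<integral>\<^sup>+\<omega>. ?\<Psi> (\<lambda>r. B r \<omega>) * ennreal (?e \<omega>) \<partial>M)"
      by (rule cameron_martin_grid_nn[OF t p cyl])
    also have "\<dots> = (\<integral>\<^sup>+\<omega>. indicator A (?X \<omega>) \<partial>Q)"
    proof -
      have "(\<lambda>\<omega>. indicator A (?X \<omega>) :: ennreal) \<in> borel_measurable M"
        using measurable_compose[OF X, of "indicator A :: _ \<Rightarrow> ennreal"] A by simp
      then show ?thesis unfolding Q_def using em by (subst nn_integral_density) (auto simp: mult.commute)
    qed
    also have "\<dots> = emeasure (distr Q ?P ?X) A"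
    proof -
      have "emeasure (distr Q ?P ?X) A = (\<integral>\<^sup>+x. indicator A x \<partial>distr Q ?P ?X)" using A by simp
      also have "\<dots> = (\<integral>\<^sup>+\<omega>. indicator A (?X \<omega>) \<partial>Q)" by (rule nn_integral_distr[OF XQ]) (use A in simp)
      finally show ?thesis ..
    qed
    finally show "emeasure (distr M ?P ?Y) A = emeasure (distr Q ?P ?X) A" .
  qed simp
  then have "(\<integral>x. \<psi> x \<partial>distr M ?P ?Y) = (\<integral>x. \<psi> x \<partial>distr Q ?P ?X)" by simp
  moreover have \<psi>m: "\<psi> \<in> borel_measurable ?P" using \<psi> by (simp add: cyl_def)
  ultimately have "(\<integral>\<omega>. \<psi> (?Y \<omega>) \<partial>M) = (\<integral>\<omega>. \<psi> (?X \<omega>) \<partial>Q)"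
    by (simp add: integral_distr[OF X] integral_distr[OF Y] integral_distr[OF XQ])
  also have "\<dots> = (\<integral>\<omega>. ?e \<omega> * \<psi> (?X \<omega>) \<partial>M)"
    unfolding Q_def using em measurable_compose[OF X \<psi>m] by (subst integral_density) auto
  finally have "(\<integral>\<omega>. \<psi> (?Y \<omega>) \<partial>M) = (\<integral>\<omega>. ?e \<omega> * \<psi> (?X \<omega>) \<partial>M)" .
  moreover have "\<psi> (?Y \<omega>) = \<psi> (\<lambda>r. B r \<omega> + ?u r)" "\<psi> (?X \<omega>) = \<psi> (\<lambda>r. B r \<omega>)" for \<omega>
    by (rule cyl_cong[OF \<psi>]; simp)+
  ultimately show ?thesis by simp
qed

end

section \<open>Exponential moments\<close>

text \<open>The sum is at most the number of terms times its maximum. This reduces exponential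
  moments of several path values to moments at single times; the summand 1 covers the empty
  set.\<close>

lemma exp_sum_le:
  fixes x :: "'a \<Rightarrow> real"
  assumes "finite S"
  shows "exp (\<Sum>s\<in>S. x s) \<le> 1 + (\<Sum>s\<in>S. exp (card S * x s))"
proof (cases "S = {}")
  case False
  let ?m = "Max (x ` S)"
  have "?m \<in> x ` S" using assms False by (intro Max_in) auto
  then obtain s where s: "s \<in> S" "x s = ?m" by auto
  have "(\<Sum>s\<in>S. x s) \<le> (\<Sum>s\<in>S. ?m)"
    using assms by (intro sum_mono Max_ge) auto
  then have "exp (\<Sum>s\<in>S. x s) \<le> exp (card S * x s)" using s by simp
  also have "\<dots> \<le> (\<Sum>s\<in>S. exp (card S * x s))"
    by (rule member_le_sum[OF s(1)]) (use assms in auto)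
  finally show ?thesis by simp
qed simp

lemma abs_exp_minus_1_le: "\<bar>exp x - 1\<bar> \<le> \<bar>x\<bar> * exp \<bar>x::real\<bar>"
proof (cases "x \<ge> 0")
  case True
  have "1 - x \<le> exp (- x)" using exp_ge_add_one_self[of "- x"] by simp
  then have "(1 - x) * exp x \<le> exp (- x) * exp x" by (intro mult_right_mono) auto
  then show ?thesis using True by (simp add: exp_minus algebra_simps)
next
  case False
  have "1 + x \<le> exp x" by (rule exp_ge_add_one_self)
  moreover have "exp x < 1" using False by simp
  ultimately have "\<bar>exp x - 1\<bar> \<le> \<bar>x\<bar> * 1" using False by linarith
  also have "\<dots> \<le> \<bar>x\<bar> * exp \<bar>x\<bar>" by (intro mult_left_mono) auto
  finally show ?thesis .
qed

text \<open>This l1 norm serves qualitative purposes, that is measurability, integrability and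
  domination, with constants that may depend on \<open>S\<close>. Estimates that must be uniform in
  the grid use \<open>grid_norm\<close>.\<close>

definition coord_norm :: "real set \<Rightarrow> (real \<Rightarrow> real) \<Rightarrow> real" where
  "coord_norm S k = (\<Sum>s\<in>S. \<bar>k s\<bar>)"

lemma coord_norm_nonneg [simp]: "0 \<le> coord_norm S k"
  by (simp add: coord_norm_def sum_nonneg)

lemma coord_norm_triangle: "coord_norm S (\<lambda>s. k s + l s) \<le> coord_norm S k + coord_norm S l"
  unfolding coord_norm_def sum.distrib[symmetric] by (intro sum_mono) auto

lemma coord_norm_scale: "coord_norm S (\<lambda>s. c * k s) = \<bar>c\<bar> * coord_norm S k"
  unfolding coord_norm_def sum_distrib_left by (simp add: abs_mult)

lemma coord_norm_mono: "finite T \<Longrightarrow> S \<subseteq> T \<Longrightarrow> coord_norm S k \<le> coord_norm T k"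
  unfolding coord_norm_def by (intro sum_mono2) auto

lemma coord_norm_member: "finite S \<Longrightarrow> s \<in> S \<Longrightarrow> \<bar>k s\<bar> \<le> coord_norm S k"
  unfolding coord_norm_def by (rule member_le_sum) auto

text \<open>A class adapted to differentiation under the expectation: it contains coordinates and
  Lipschitz functions of a coordinate, it is closed under products, and its difference quotients
  along the path are dominated by an integrable exponential.\<close>

definition exp_lip :: "real set \<Rightarrow> ((real \<Rightarrow> real) \<Rightarrow> real) \<Rightarrow> bool" where
  "exp_lip S f \<longleftrightarrow> (\<exists>C\<ge>0. \<forall>k k'. \<bar>f k - f k'\<bar> \<le> C * exp (C * (coord_norm S k + coord_norm S k')) * coord_norm S (\<lambda>s. k s - k' s))"

lemma exp_lip_growth:
  assumes "exp_lip S f"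
  shows "\<exists>C\<ge>0. \<forall>k. \<bar>f k\<bar> \<le> C * exp (C * coord_norm S k)"
proof -
  obtain C where C: "C \<ge> 0" "\<And>k k'. \<bar>f k - f k'\<bar> \<le> C * exp (C * (coord_norm S k + coord_norm S k')) * coord_norm S (\<lambda>s. k s - k' s)"
    using assms by (auto simp: exp_lip_def)
  let ?D = "C + 1 + \<bar>f (\<lambda>_. 0)\<bar>"
  show ?thesis
  proof (intro exI[of _ ?D] conjI allI)
    show "?D \<ge> 0" using C by simp
    fix k
    have z: "coord_norm S (\<lambda>_. 0) = 0" by (simp add: coord_norm_def)
    have "\<bar>f k\<bar> \<le> \<bar>f (\<lambda>_. 0)\<bar> + C * exp (C * coord_norm S k) * coord_norm S k"
      using C(2)[of k "\<lambda>_. 0"] by (simp add: z)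
    also have "C * exp (C * coord_norm S k) * coord_norm S k \<le> C * exp (C * coord_norm S k) * exp (coord_norm S k)"
      using C exp_ge_add_one_self[of "coord_norm S k"] by (intro mult_left_mono) (auto simp del: exp_ge_add_one_self)
    also have "\<dots> = C * exp ((C + 1) * coord_norm S k)" by (simp add: exp_add[symmetric] algebra_simps)
    also have "\<dots> \<le> C * exp (?D * coord_norm S k)"
      using C by (intro mult_left_mono) (auto intro!: mult_right_mono)
    finally have 1: "\<bar>f k\<bar> \<le> \<bar>f (\<lambda>_. 0)\<bar> + C * exp (?D * coord_norm S k)" by simp
    have "\<bar>f (\<lambda>_. 0)\<bar> * 1 \<le> \<bar>f (\<lambda>_. 0)\<bar> * exp (?D * coord_norm S k)"
      using C by (intro mult_left_mono) auto
    with 1 have "\<bar>f k\<bar> \<le> \<bar>f (\<lambda>_. 0)\<bar> * exp (?D * coord_norm S k) + C * exp (?D * coord_norm S k)" by simp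
    also have "\<dots> \<le> ?D * exp (?D * coord_norm S k)" by (simp add: algebra_simps)
    finally show "\<bar>f k\<bar> \<le> ?D * exp (?D * coord_norm S k)" .
  qed
qed

lemma exp_lipI:
  assumes "C \<ge> 0" "\<And>k k'. \<bar>f k - f k'\<bar> \<le> C * exp (C * (coord_norm S k + coord_norm S k')) * coord_norm S (\<lambda>s. k s - k' s)"
  shows "exp_lip S f"
  using assms unfolding exp_lip_def by blast

lemma exp_lip_mono:
  assumes "exp_lip S f" "finite T" "S \<subseteq> T"
  shows "exp_lip T f"
proof -
  obtain C where C: "C \<ge> 0" "\<And>k k'. \<bar>f k - f k'\<bar> \<le> C * exp (C * (coord_norm S k + coord_norm S k')) * coord_norm S (\<lambda>s. k s - k' s)"
    using assms by (auto simp: exp_lip_def)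
  show ?thesis
  proof (rule exp_lipI[OF C(1)])
    fix k k'
    note C(2)[of k k']
    also have "C * exp (C * (coord_norm S k + coord_norm S k')) * coord_norm S (\<lambda>s. k s - k' s)
       \<le> C * exp (C * (coord_norm T k + coord_norm T k')) * coord_norm T (\<lambda>s. k s - k' s)"
      using C(1) by (intro mult_mono coord_norm_mono[OF assms(2,3)] mult_left_mono)
        (auto intro!: mult_left_mono add_mono coord_norm_mono[OF assms(2,3)] mult_nonneg_nonneg)
    finally show "\<bar>f k - f k'\<bar> \<le> C * exp (C * (coord_norm T k + coord_norm T k')) * coord_norm T (\<lambda>s. k s - k' s)" .
  qed
qed

lemma exp_lip_mult:
  assumes "exp_lip S f" "exp_lip S g"
  shows "exp_lip S (\<lambda>k. f k * g k)"
proof -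
  obtain C where C: "C \<ge> 0" "\<And>k k'. \<bar>f k - f k'\<bar> \<le> C * exp (C * (coord_norm S k + coord_norm S k')) * coord_norm S (\<lambda>s. k s - k' s)"
    using assms by (auto simp: exp_lip_def)
  obtain D where D: "D \<ge> 0" "\<And>k k'. \<bar>g k - g k'\<bar> \<le> D * exp (D * (coord_norm S k + coord_norm S k')) * coord_norm S (\<lambda>s. k s - k' s)"
    using assms by (auto simp: exp_lip_def)
  obtain C' where C': "C' \<ge> 0" "\<And>k. \<bar>f k\<bar> \<le> C' * exp (C' * coord_norm S k)" using exp_lip_growth[OF assms(1)] by blast
  obtain D' where D': "D' \<ge> 0" "\<And>k. \<bar>g k\<bar> \<le> D' * exp (D' * coord_norm S k)" using exp_lip_growth[OF assms(2)] by blast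
  \<comment> \<open>Majorises at once the two exponential rates \<open>C + D'\<close> and
    \<open>D + C'\<close> and the prefactor \<open>C * D' + D * C'\<close>.\<close>
  let ?E = "(C + D + C' + D') + C * D' + D * C'"
  have E: "C + D' \<le> ?E" "D + C' \<le> ?E" "0 \<le> ?E" using C D C' D' by (auto simp: add_increasing add_increasing2)
  show ?thesis
  proof (rule exp_lipI[OF E(3)])
    fix k k'
    let ?s = "coord_norm S k + coord_norm S k'" and ?d = "coord_norm S (\<lambda>s. k s - k' s)"
    have s: "coord_norm S k \<le> ?s" "coord_norm S k' \<le> ?s" "0 \<le> ?s" by auto
    have "\<bar>f k * g k - f k' * g k'\<bar> = \<bar>(f k - f k') * g k + f k' * (g k - g k')\<bar>"
      by (simp add: algebra_simps)
    also have "\<dots> \<le> \<bar>f k - f k'\<bar> * \<bar>g k\<bar> + \<bar>f k'\<bar> * \<bar>g k - g k'\<bar>"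
      by (metis abs_mult abs_triangle_ineq)
    also have "\<dots> \<le> (C * exp (C * ?s) * ?d) * (D' * exp (D' * ?s)) + (C' * exp (C' * ?s)) * (D * exp (D * ?s) * ?d)"
    proof (intro add_mono mult_mono)
      have "D' * exp (D' * coord_norm S k) \<le> D' * exp (D' * ?s)"
        using D' s by (intro mult_left_mono) (auto intro!: mult_left_mono)
      then show "\<bar>g k\<bar> \<le> D' * exp (D' * ?s)" using D'(2)[of k] by linarith
      have "C' * exp (C' * coord_norm S k') \<le> C' * exp (C' * ?s)"
        using C' s by (intro mult_left_mono) (auto intro!: mult_left_mono)
      then show "\<bar>f k'\<bar> \<le> C' * exp (C' * ?s)" using C'(2)[of k'] by linarith
    qed (use C D C' D' in \<open>auto intro!: mult_nonneg_nonneg\<close>)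
    also have "\<dots> = (C * D') * exp ((C + D') * ?s) * ?d + (D * C') * exp ((D + C') * ?s) * ?d"
      by (simp add: exp_add algebra_simps)
    also have "\<dots> \<le> (C * D') * exp (?E * ?s) * ?d + (D * C') * exp (?E * ?s) * ?d"
      using C D C' D' E s(3) by (intro add_mono mult_right_mono mult_left_mono) (auto intro!: mult_right_mono)
    also have "\<dots> = (C * D' + D * C') * exp (?E * ?s) * ?d" by (simp add: algebra_simps)
    also have "\<dots> \<le> ?E * exp (?E * ?s) * ?d"
      using C D C' D' by (intro mult_right_mono) auto
    finally show "\<bar>f k * g k - f k' * g k'\<bar> \<le> ?E * exp (?E * ?s) * ?d" .
  qed
qed

lemma exp_lip_lipschitz:
  assumes "finite S" "s \<in> S" "L \<ge> 0" "\<And>x y. \<bar>\<phi> x - \<phi> y\<bar> \<le> L * \<bar>x - y\<bar>"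
  shows "exp_lip S (\<lambda>k. \<phi> (k s))"
proof (rule exp_lipI[OF assms(3)])
  fix k k' :: "real \<Rightarrow> real"
  have "\<bar>\<phi> (k s) - \<phi> (k' s)\<bar> \<le> L * \<bar>k s - k' s\<bar>" by (rule assms(4))
  also have "\<dots> \<le> L * coord_norm S (\<lambda>s. k s - k' s)"
    using coord_norm_member[OF assms(1,2), of "\<lambda>s. k s - k' s"] assms(3) by (intro mult_left_mono) auto
  also have "\<dots> = L * coord_norm S (\<lambda>s. k s - k' s) * 1" by simp
  also have "\<dots> \<le> L * coord_norm S (\<lambda>s. k s - k' s) * exp (L * (coord_norm S k + coord_norm S k'))"
    using assms(3) by (intro mult_left_mono) auto
  finally show "\<bar>\<phi> (k s) - \<phi> (k' s)\<bar> \<le> L * exp (L * (coord_norm S k + coord_norm S k')) * coord_norm S (\<lambda>s. k s - k' s)"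
    by (simp add: mult_ac)
qed

lemma exp_lip_coord: "finite S \<Longrightarrow> s \<in> S \<Longrightarrow> exp_lip S (\<lambda>k. k s)"
  using exp_lip_lipschitz[of S s 1 "\<lambda>x. x"] by simp

text \<open>The Lipschitz bound makes the functional continuous in its finitely many coordinates,
  hence measurable.\<close>

lemma exp_lip_cyl:
  assumes "finite S" "exp_lip S f"
  shows "cyl S f"
proof -
  obtain C where C: "C \<ge> 0" "\<And>k k'. \<bar>f k - f k'\<bar> \<le> C * exp (C * (coord_norm S k + coord_norm S k')) * coord_norm S (\<lambda>s. k s - k' s)"
    using assms by (auto simp: exp_lip_def)
  have dep: "f k = f k'" if "\<And>s. s \<in> S \<Longrightarrow> k s = k' s" for k k'
  proof -
    have "coord_norm S (\<lambda>s. k s - k' s) = 0" unfolding coord_norm_def using that by (intro sum.neutral) auto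
    then show ?thesis using C(2)[of k k'] by simp
  qed
  \<comment> \<open>Numbering \<open>S\<close> transports \<open>f\<close> to functions on the
    naturals. Over a countable index set a map that is measurable in each coordinate is Borel
    measurable for the product topology, so the continuity of \<open>g\<close> can be used.\<close>
  obtain e :: "nat \<Rightarrow> real" and n where e: "S = e ` {i. i < n}" "inj_on e {i. i < n}"
    using finite_imp_nat_seg_image_inj_on[OF assms(1)] by blast
  define ix where "ix = inv_into {i. i < n} e"
  have ix: "ix s < n" "e (ix s) = s" if "s \<in> S" for s
    using that inv_into_into[of s e "{i. i < n}"] f_inv_into_f[of s e "{i. i < n}"] unfolding ix_def e(1) by auto
  let ?p = "\<lambda>(y::nat \<Rightarrow> real) s. y (ix s)"
  define g where "g = (\<lambda>y. f (?p y))"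
  have co: "((\<lambda>y::nat \<Rightarrow> real. y j) \<longlongrightarrow> y0 j) (at y0)" for j y0
  proof -
    have "continuous_on UNIV (\<lambda>y::nat \<Rightarrow> real. y j)" by (rule continuous_on_product_coordinates)
    then show ?thesis by (simp add: continuous_on_def)
  qed
  have "continuous_on UNIV g"
    unfolding continuous_on_def
  proof
    fix y0 :: "nat \<Rightarrow> real"
    have "((\<lambda>y. g y - g y0) \<longlongrightarrow> 0) (at y0)"
    proof (rule Lim_null_comparison)
      show "\<forall>\<^sub>F y in at y0. norm (g y - g y0) \<le> C * exp (C * (coord_norm S (?p y) + coord_norm S (?p y0))) * coord_norm S (\<lambda>s. ?p y s - ?p y0 s)"
        unfolding g_def real_norm_def by (intro always_eventually allI C(2))
      have "((\<lambda>y. C * exp (C * (coord_norm S (?p y) + coord_norm S (?p y0))) * coord_norm S (\<lambda>s. ?p y s - ?p y0 s))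
         \<longlongrightarrow> C * exp (C * (coord_norm S (?p y0) + coord_norm S (?p y0))) * coord_norm S (\<lambda>s. ?p y0 s - ?p y0 s)) (at y0)"
        unfolding coord_norm_def by (intro tendsto_intros co)
      then show "((\<lambda>y. C * exp (C * (coord_norm S (?p y) + coord_norm S (?p y0))) * coord_norm S (\<lambda>s. ?p y s - ?p y0 s)) \<longlongrightarrow> 0) (at y0)"
        by (simp add: coord_norm_def)
    qed
    then show "(g \<longlongrightarrow> g y0) (at y0 within UNIV)" by (simp add: LIM_zero_iff)
  qed
  then have g: "g \<in> borel_measurable borel" by (rule borel_measurable_continuous_onI)
  let ?q = "\<lambda>x i. if i < n then x (e i) else 0"
  have q: "?q \<in> PiM S (\<lambda>_. borel) \<rightarrow>\<^sub>M (borel :: (nat \<Rightarrow> real) measure)"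
  proof (rule measurable_coordinatewise_then_product)
    fix i show "(\<lambda>x. ?q x i) \<in> borel_measurable (PiM S (\<lambda>_. borel))"
      by (cases "i < n") (auto simp: e(1) intro!: measurable_component_singleton)
  qed
  have "f x = g (?q x)" for x
    unfolding g_def by (rule dep) (use ix in simp)
  then have eq: "f = (\<lambda>x. g (?q x))" by (rule ext)
  have "(\<lambda>x. g (?q x)) \<in> borel_measurable (PiM S (\<lambda>_. borel))"
    by (rule measurable_compose[OF q g])
  then have fm: "f \<in> borel_measurable (PiM S (\<lambda>_. borel))" by (simp only: eq[symmetric])
  show ?thesis by (rule cylI[OF dep fm])
qed

context brownian
begin

text \<open>For t \<le> 1 the factor exp (x^2 / 4) leaves a Gaussian integrand, with variance 2t /
  (2 - t), and the normalising constants differ by a factor of at most 2. That the bound does not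
  depend on t is what permits averaging over times later.\<close>

lemma nn_exp_square_B:
  assumes t: "t \<in> {0..1}"
  shows "(\<integral>\<^sup>+\<omega>. ennreal (exp ((B t \<omega>)\<^sup>2 / 4)) \<partial>M) \<le> 2"
proof (cases "t = 0")
  case True
  then have "(\<integral>\<^sup>+\<omega>. ennreal (exp ((B t \<omega>)\<^sup>2 / 4)) \<partial>M) = (\<integral>\<^sup>+\<omega>. 1 \<partial>M)"
    by (intro nn_integral_cong) (simp add: B_0)
  then show ?thesis by (simp add: emeasure_space_1)
next
  case False
  with t have t: "0 < t" "t \<le> 1" by auto
  let ?\<sigma> = "sqrt (2 * t / (2 - t))"
  have "(\<integral>\<^sup>+\<omega>. ennreal (exp ((B t \<omega>)\<^sup>2 / 4)) \<partial>M) = (\<integral>\<^sup>+\<omega>. ennreal (exp ((B t \<omega> - B 0 \<omega>)\<^sup>2 / 4)) \<partial>M)"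
    by (intro nn_integral_cong) (simp add: B_0)
  also have "\<dots> = (\<integral>\<^sup>+x. ennreal (normal_density 0 (sqrt (t - 0)) x) * ennreal (exp (x\<^sup>2 / 4)) \<partial>lborel)"
    using t by (intro distributed_nn_integral[symmetric] B_incr) auto
  also have "\<dots> \<le> (\<integral>\<^sup>+x. 2 * ennreal (normal_density 0 ?\<sigma> x) \<partial>lborel)"
  proof (rule nn_integral_mono)
    fix x :: real
    have e: "- x\<^sup>2 / (2 * t) + x\<^sup>2 / 4 = - x\<^sup>2 / (2 * (2 * t / (2 - t)))"
      using t by (simp add: field_simps)
    have "normal_density 0 (sqrt (t - 0)) x * exp (x\<^sup>2 / 4) = 1 / sqrt (2 * pi * t) * exp (- x\<^sup>2 / (2 * t) + x\<^sup>2 / 4)"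
      using t by (simp add: normal_density_def flip: exp_add)
    also have "\<dots> \<le> (2 / sqrt (2 * pi * (2 * t / (2 - t)))) * exp (- x\<^sup>2 / (2 * t) + x\<^sup>2 / 4)"
    proof (rule mult_right_mono)
      have "2 * t / (2 - t) \<le> 4 * t" using t by (simp add: field_simps)
      then have "sqrt (2 * pi * (2 * t / (2 - t))) \<le> sqrt (2 * pi * (4 * t))"
        by (intro real_sqrt_le_mono mult_left_mono) auto
      also have "\<dots> = 2 * sqrt (2 * pi * t)"
        using real_sqrt_mult[of 4 "2 * pi * t"] by (simp add: mult_ac)
      finally show "1 / sqrt (2 * pi * t) \<le> 2 / sqrt (2 * pi * (2 * t / (2 - t)))"
        using t by (simp add: divide_simps)
    qed simp
    also have "\<dots> = 2 * normal_density 0 ?\<sigma> x"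
      unfolding e using t by (simp add: normal_density_def)
    finally have "normal_density 0 (sqrt (t - 0)) x * exp (x\<^sup>2 / 4) \<le> 2 * normal_density 0 ?\<sigma> x" .
    then have "ennreal (normal_density 0 (sqrt (t - 0)) x * exp (x\<^sup>2 / 4)) \<le> ennreal (2 * normal_density 0 ?\<sigma> x)"
      by (rule ennreal_leI)
    then show "ennreal (normal_density 0 (sqrt (t - 0)) x) * ennreal (exp (x\<^sup>2 / 4)) \<le> 2 * ennreal (normal_density 0 ?\<sigma> x)"
      by (simp add: ennreal_mult)
  qed
  also have "\<dots> = 2 * (\<integral>\<^sup>+x. ennreal (normal_density 0 ?\<sigma> x) \<partial>lborel)"
    by (intro nn_integral_cmult) simp
  also have "(\<integral>\<^sup>+x. ennreal (normal_density 0 ?\<sigma> x) \<partial>lborel) = 1"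
    using t by (subst nn_integral_eq_integral) auto
  finally show ?thesis by simp
qed

lemma integrable_exp_square_B:
  assumes t: "t \<in> {0..1}"
  shows "integrable M (\<lambda>\<omega>. exp ((B t \<omega>)\<^sup>2 / 4))"
proof (rule integrableI_nonneg)
  show "(\<integral>\<^sup>+\<omega>. ennreal (exp ((B t \<omega>)\<^sup>2 / 4)) \<partial>M) < \<infinity>"
    using nn_exp_square_B[OF t] by (rule order.strict_trans1) simp
qed (use B_measurable[OF t] in auto)

lemma integral_exp_square_B: "t \<in> {0..1} \<Longrightarrow> (\<integral>\<omega>. exp ((B t \<omega>)\<^sup>2 / 4) \<partial>M) \<le> 2"
  using nn_exp_square_B[of t] nn_integral_eq_integral[OF integrable_exp_square_B, of t]
  by (simp add: ennreal_le_iff flip: ennreal_numeral)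

lemma integrable_exp_abs_B:
  assumes t: "t \<in> {0..1}"
  shows "integrable M (\<lambda>\<omega>. exp (c * \<bar>B t \<omega>\<bar>))"
proof (rule Bochner_Integration.integrable_bound)
  show "integrable M (\<lambda>\<omega>. exp (c\<^sup>2) * exp ((B t \<omega>)\<^sup>2 / 4))"
    by (intro integrable_mult_right integrable_exp_square_B t)
  show "AE \<omega> in M. norm (exp (c * \<bar>B t \<omega>\<bar>)) \<le> norm (exp (c\<^sup>2) * exp ((B t \<omega>)\<^sup>2 / 4))"
  proof (rule AE_I2)
    fix \<omega>
    have "c * \<bar>B t \<omega>\<bar> \<le> c\<^sup>2 + (B t \<omega>)\<^sup>2 / 4"
      using zero_le_power2[of "c - \<bar>B t \<omega>\<bar> / 2"] by (simp add: power2_eq_square algebra_simps)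
    then show "norm (exp (c * \<bar>B t \<omega>\<bar>)) \<le> norm (exp (c\<^sup>2) * exp ((B t \<omega>)\<^sup>2 / 4))"
      by (simp flip: exp_add)
  qed
qed (use B_measurable[OF t] in auto)

lemma coord_norm_B_measurable: "S \<subseteq> {0..1} \<Longrightarrow> (\<lambda>\<omega>. coord_norm S (\<lambda>s. B s \<omega>)) \<in> borel_measurable M"
  unfolding coord_norm_def by (intro borel_measurable_sum borel_measurable_abs B_measurable) auto

lemma integrable_exp_coord_norm:
  assumes "finite S" "S \<subseteq> {0..1}"
  shows "integrable M (\<lambda>\<omega>. exp (c * coord_norm S (\<lambda>s. B s \<omega>)))"
proof (rule Bochner_Integration.integrable_bound)
  show "integrable M (\<lambda>\<omega>. 1 + (\<Sum>s\<in>S. exp (card S * c * \<bar>B s \<omega>\<bar>)))"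
    using assms by (intro Bochner_Integration.integrable_add Bochner_Integration.integrable_sum integrable_exp_abs_B) auto
  show "(\<lambda>\<omega>. exp (c * coord_norm S (\<lambda>s. B s \<omega>))) \<in> borel_measurable M"
    using coord_norm_B_measurable[OF assms(2)] by auto
  show "AE \<omega> in M. norm (exp (c * coord_norm S (\<lambda>s. B s \<omega>))) \<le> norm (1 + (\<Sum>s\<in>S. exp (card S * c * \<bar>B s \<omega>\<bar>)))"
  proof (rule AE_I2)
    fix \<omega>
    have "exp (c * coord_norm S (\<lambda>s. B s \<omega>)) \<le> 1 + (\<Sum>s\<in>S. exp (card S * (c * \<bar>B s \<omega>\<bar>)))"
      unfolding coord_norm_def sum_distrib_left by (rule exp_sum_le[OF assms(1)])
    then show "norm (exp (c * coord_norm S (\<lambda>s. B s \<omega>))) \<le> norm (1 + (\<Sum>s\<in>S. exp (card S * c * \<bar>B s \<omega>\<bar>)))"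
      by (simp add: mult.assoc)
  qed
qed

lemma integrable_exp_growth:
  assumes S: "finite S" "S \<subseteq> {0..1}" and X: "X \<in> borel_measurable M"
    and b: "\<And>\<omega>. \<omega> \<in> space M \<Longrightarrow> \<bar>X \<omega>\<bar> \<le> C * exp (c * coord_norm S (\<lambda>s. B s \<omega>))"
  shows "integrable M X"
proof (rule Bochner_Integration.integrable_bound)
  show "integrable M (\<lambda>\<omega>. C * exp (c * coord_norm S (\<lambda>s. B s \<omega>)))"
    by (intro integrable_mult_right integrable_exp_coord_norm S)
  show "AE \<omega> in M. norm (X \<omega>) \<le> norm (C * exp (c * coord_norm S (\<lambda>s. B s \<omega>)))"
    using b by (intro AE_I2) (fastforce intro: order_trans)
qed (rule X)

text \<open>Differentiates a Cameron-Martin weight under the expectation; the quadratic term does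
  not contribute at first order. The constant \<open>q\<close> is left free because the weight of a
  single value and that of a combination of increments are both needed, in
  \<open>gaussian_ibp\<close> and in \<open>smoothing\<close>.\<close>

lemma exp_tilt_derivative:
  assumes S: "finite S" "S \<subseteq> {0..1}" and G: "G \<in> borel_measurable M" and l: "l \<in> borel_measurable M"
    and Gb: "\<And>\<omega>. \<omega> \<in> space M \<Longrightarrow> \<bar>G \<omega>\<bar> \<le> C * exp (C * coord_norm S (\<lambda>s. B s \<omega>))"
    and lb: "\<And>\<omega>. \<omega> \<in> space M \<Longrightarrow> \<bar>l \<omega>\<bar> \<le> c * coord_norm S (\<lambda>s. B s \<omega>)"
    and C: "0 \<le> C"
  shows "((\<lambda>x. \<integral>\<omega>. exp (x * l \<omega> - x\<^sup>2 * q) * G \<omega> \<partial>M) has_real_derivative (\<integral>\<omega>. l \<omega> * G \<omega> \<partial>M)) (at 0)"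
    and "integrable M (\<lambda>\<omega>. l \<omega> * G \<omega>)"
proof -
  let ?n = "\<lambda>\<omega>. coord_norm S (\<lambda>s. B s \<omega>)"
  \<comment> \<open>Dominates all difference quotients with 0 < |x| \<le> 1. It arises from |exp y -
    1| \<le> |y| exp |y| together with z \<le> exp z, and these two exponentials are the reason for
    the factor 2.\<close>
  define W where "W = (\<lambda>\<omega>. exp (2 * (\<bar>l \<omega>\<bar> + \<bar>q\<bar>)) * \<bar>G \<omega>\<bar>)"
  have Wm: "W \<in> borel_measurable M" unfolding W_def using G l by auto
  have Wi: "integrable M W"
  proof (rule integrable_exp_growth[OF S Wm])
    fix \<omega> assume \<omega>: "\<omega> \<in> space M"
    have "W \<omega> \<le> exp (2 * (c * ?n \<omega> + \<bar>q\<bar>)) * (C * exp (C * ?n \<omega>))"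
      unfolding W_def using lb[OF \<omega>] Gb[OF \<omega>] by (intro mult_mono) auto
    also have "\<dots> = (C * exp (2 * \<bar>q\<bar>)) * exp ((2 * c + C) * ?n \<omega>)"
      by (simp add: exp_add[symmetric] algebra_simps)
    finally show "\<bar>W \<omega>\<bar> \<le> (C * exp (2 * \<bar>q\<bar>)) * exp ((2 * c + C) * ?n \<omega>)" by (simp add: W_def)
  qed
  have ex: "y \<le> exp y" for y :: real using exp_ge_add_one_self[of y] by linarith
  have bnd: "\<bar>(exp (x * l \<omega> - x\<^sup>2 * q) - 1) / x * G \<omega>\<bar> \<le> W \<omega>" if x: "x \<noteq> 0" "\<bar>x\<bar> \<le> 1" for x \<omega>
  proof -
    let ?z = "\<bar>l \<omega>\<bar> + \<bar>q\<bar>"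
    have "\<bar>x * l \<omega> - x\<^sup>2 * q\<bar> \<le> \<bar>x\<bar> * \<bar>l \<omega>\<bar> + \<bar>x\<bar> * (\<bar>x\<bar> * \<bar>q\<bar>)"
      using abs_triangle_ineq4[of "x * l \<omega>" "x\<^sup>2 * q"] by (simp add: abs_mult power2_eq_square mult.assoc[symmetric])
    also have "\<dots> \<le> \<bar>x\<bar> * \<bar>l \<omega>\<bar> + \<bar>x\<bar> * (1 * \<bar>q\<bar>)"
      using x by (intro add_left_mono mult_left_mono mult_right_mono) auto
    finally have a: "\<bar>x * l \<omega> - x\<^sup>2 * q\<bar> \<le> \<bar>x\<bar> * ?z" by (simp add: algebra_simps)
    also have "\<dots> \<le> 1 * ?z" using x by (intro mult_right_mono) auto
    finally have b: "\<bar>x * l \<omega> - x\<^sup>2 * q\<bar> \<le> ?z" by simp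
    have "\<bar>exp (x * l \<omega> - x\<^sup>2 * q) - 1\<bar> \<le> \<bar>x * l \<omega> - x\<^sup>2 * q\<bar> * exp \<bar>x * l \<omega> - x\<^sup>2 * q\<bar>"
      by (rule abs_exp_minus_1_le)
    also have "\<dots> \<le> (\<bar>x\<bar> * ?z) * exp ?z" using a b by (intro mult_mono) auto
    also have "\<dots> \<le> (\<bar>x\<bar> * exp ?z) * exp ?z" using ex[of ?z] by (intro mult_right_mono mult_left_mono) auto
    also have "\<dots> = \<bar>x\<bar> * exp (2 * ?z)" by (simp add: exp_add[symmetric] mult.assoc)
    finally have "\<bar>exp (x * l \<omega> - x\<^sup>2 * q) - 1\<bar> / \<bar>x\<bar> \<le> exp (2 * ?z)"
      using x by (simp add: field_simps)
    then have "\<bar>exp (x * l \<omega> - x\<^sup>2 * q) - 1\<bar> / \<bar>x\<bar> * \<bar>G \<omega>\<bar> \<le> W \<omega>"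
      unfolding W_def by (intro mult_right_mono) auto
    then show ?thesis by (simp add: abs_mult abs_divide)
  qed
  show lG: "integrable M (\<lambda>\<omega>. l \<omega> * G \<omega>)"
  proof (rule Bochner_Integration.integrable_bound[OF Wi])
    show "AE \<omega> in M. norm (l \<omega> * G \<omega>) \<le> norm (W \<omega>)"
    proof (rule AE_I2)
      fix \<omega>
      have "\<bar>l \<omega>\<bar> \<le> exp (2 * (\<bar>l \<omega>\<bar> + \<bar>q\<bar>))" by (rule order_trans[OF _ ex]) simp
      then show "norm (l \<omega> * G \<omega>) \<le> norm (W \<omega>)"
        unfolding W_def by (simp add: abs_mult mult_right_mono)
    qed
  qed (use G l in auto)
  let ?I = "\<lambda>x. \<integral>\<omega>. exp (x * l \<omega> - x\<^sup>2 * q) * G \<omega> \<partial>M"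
  have Gi: "integrable M G"
    by (rule integrable_exp_growth[OF S G Gb])
  have int: "integrable M (\<lambda>\<omega>. exp (x * l \<omega> - x\<^sup>2 * q) * G \<omega>)" for x
  proof (rule integrable_exp_growth[OF S])
    fix \<omega> assume \<omega>: "\<omega> \<in> space M"
    have "x * l \<omega> - x\<^sup>2 * q \<le> \<bar>x\<bar> * (c * ?n \<omega>) + \<bar>x\<^sup>2 * q\<bar>"
    proof -
      have "x * l \<omega> \<le> \<bar>x\<bar> * \<bar>l \<omega>\<bar>" by (metis abs_ge_self abs_mult)
      also have "\<dots> \<le> \<bar>x\<bar> * (c * ?n \<omega>)" by (intro mult_left_mono lb[OF \<omega>]) auto
      finally show ?thesis by linarith
    qed
    then have "\<bar>exp (x * l \<omega> - x\<^sup>2 * q) * G \<omega>\<bar> \<le> exp (\<bar>x\<bar> * (c * ?n \<omega>) + \<bar>x\<^sup>2 * q\<bar>) * (C * exp (C * ?n \<omega>))"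
      unfolding abs_mult using Gb[OF \<omega>] by (intro mult_mono) auto
    also have "\<dots> = (C * exp \<bar>x\<^sup>2 * q\<bar>) * exp ((\<bar>x\<bar> * c + C) * ?n \<omega>)"
      by (simp add: exp_add[symmetric] algebra_simps)
    finally show "\<bar>exp (x * l \<omega> - x\<^sup>2 * q) * G \<omega>\<bar> \<le> (C * exp \<bar>x\<^sup>2 * q\<bar>) * exp ((\<bar>x\<bar> * c + C) * ?n \<omega>)" .
  qed (use G l in auto)
  have "((\<lambda>x. (?I (0 + x) - ?I 0) / x) \<longlongrightarrow> (\<integral>\<omega>. l \<omega> * G \<omega> \<partial>M)) (at 0)"
  proof (rule LIMSEQ_SEQ_conv[THEN iffD1], intro allI impI, elim conjE)
    fix X :: "nat \<Rightarrow> real" assume X: "\<forall>n. X n \<noteq> 0" "X \<longlonglongrightarrow> 0"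
    have "eventually (\<lambda>n. \<bar>X n\<bar> < 1) sequentially"
      using tendstoD[OF X(2), of 1] by (simp add: dist_real_def)
    then obtain n0 where n0: "\<And>n. n \<ge> n0 \<Longrightarrow> \<bar>X n\<bar> < 1" by (auto simp: eventually_sequentially)
    \<comment> \<open>Dropping finitely many terms puts the sequence into the range |x| \<le> 1 in
      which \<open>W\<close> dominates.\<close>
    define Y where "Y = (\<lambda>n. X (n + n0))"
    have Y: "Y n \<noteq> 0" "\<bar>Y n\<bar> \<le> 1" for n using X(1) n0[of "n + n0"] by (auto simp: Y_def)
    have Y0: "Y \<longlonglongrightarrow> 0" unfolding Y_def using X(2) by (rule LIMSEQ_ignore_initial_segment)
    have "(\<lambda>n. \<integral>\<omega>. (exp (Y n * l \<omega> - (Y n)\<^sup>2 * q) - 1) / Y n * G \<omega> \<partial>M) \<longlonglongrightarrow> (\<integral>\<omega>. l \<omega> * G \<omega> \<partial>M)"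
    proof (rule integral_dominated_convergence[where w = W])
      show "AE \<omega> in M. (\<lambda>n. (exp (Y n * l \<omega> - (Y n)\<^sup>2 * q) - 1) / Y n * G \<omega>) \<longlonglongrightarrow> l \<omega> * G \<omega>"
      proof (rule AE_I2)
        fix \<omega>
        have "((\<lambda>x. exp (x * l \<omega> - x\<^sup>2 * q)) has_real_derivative l \<omega>) (at 0)"
          by (auto intro!: derivative_eq_intros)
        then have "((\<lambda>x. (exp (x * l \<omega> - x\<^sup>2 * q) - 1) / x) \<longlongrightarrow> l \<omega>) (at 0)"
          by (simp add: DERIV_def)
        then have "(\<lambda>n. (exp (Y n * l \<omega> - (Y n)\<^sup>2 * q) - 1) / Y n) \<longlonglongrightarrow> l \<omega>"
          using Y(1) Y0 by (subst (asm) LIMSEQ_SEQ_conv[symmetric]) blast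
        then show "(\<lambda>n. (exp (Y n * l \<omega> - (Y n)\<^sup>2 * q) - 1) / Y n * G \<omega>) \<longlonglongrightarrow> l \<omega> * G \<omega>"
          by (intro tendsto_mult tendsto_const)
      qed
      show "AE \<omega> in M. norm ((exp (Y n * l \<omega> - (Y n)\<^sup>2 * q) - 1) / Y n * G \<omega>) \<le> W \<omega>" for n
        using bnd[OF Y] by simp
    qed (use G l Wi in auto)
    moreover have "(?I (Y n) - ?I 0) / Y n = (\<integral>\<omega>. (exp (Y n * l \<omega> - (Y n)\<^sup>2 * q) - 1) / Y n * G \<omega> \<partial>M)" for n
    proof -
      have "?I (Y n) - ?I 0 = (\<integral>\<omega>. exp (Y n * l \<omega> - (Y n)\<^sup>2 * q) * G \<omega> - G \<omega> \<partial>M)"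
        using Bochner_Integration.integral_diff[OF int[of "Y n"] Gi] by simp
      also have "\<dots> / Y n = (\<integral>\<omega>. (exp (Y n * l \<omega> - (Y n)\<^sup>2 * q) * G \<omega> - G \<omega>) / Y n \<partial>M)"
        by simp
      also have "\<dots> = (\<integral>\<omega>. (exp (Y n * l \<omega> - (Y n)\<^sup>2 * q) - 1) / Y n * G \<omega> \<partial>M)"
        by (intro Bochner_Integration.integral_cong) (auto simp: field_simps)
      finally show ?thesis .
    qed
    ultimately have "(\<lambda>n. (?I (Y n) - ?I 0) / Y n) \<longlonglongrightarrow> (\<integral>\<omega>. l \<omega> * G \<omega> \<partial>M)" by (simp only:)
    then have "(\<lambda>n. (?I (X (n + n0)) - ?I 0) / X (n + n0)) \<longlonglongrightarrow> (\<integral>\<omega>. l \<omega> * G \<omega> \<partial>M)"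
      by (simp only: Y_def)
    from LIMSEQ_offset[OF this]
    show "(\<lambda>n. (?I (0 + X n) - ?I 0) / X n) \<longlonglongrightarrow> (\<integral>\<omega>. l \<omega> * G \<omega> \<partial>M)" by simp
  qed
  then show "(?I has_real_derivative (\<integral>\<omega>. l \<omega> * G \<omega> \<partial>M)) (at 0)"
    unfolding DERIV_def .
qed

end

section \<open>Gaussian integration by parts\<close>

lemma tendsto_at_0_seq:
  assumes "(f \<longlongrightarrow> l) (at (0::real))"
  shows "(\<lambda>n. f (1 / real (Suc n))) \<longlonglongrightarrow> l"
proof -
  have "(\<lambda>n. 1 / real (Suc n)) \<longlonglongrightarrow> 0" by (rule LIMSEQ_Suc[OF lim_1_over_n])
  then have "(\<forall>n. 1 / real (Suc n) \<noteq> 0) \<and> (\<lambda>n. 1 / real (Suc n)) \<longlonglongrightarrow> 0" by simp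
  with LIMSEQ_SEQ_conv[of 0 f l, THEN iffD2, OF assms, THEN spec, of "\<lambda>n. 1 / real (Suc n)"]
  show ?thesis by (rule mp)
qed

context brownian
begin

text \<open>The direction r -> min s r is the covariance function of \<open>B s\<close>, a path of
  slope 1 up to time s that is constant afterwards. It is the direction whose Cameron-Martin weight
  depends on the path through \<open>B s\<close> alone.\<close>

lemma cameron_martin_min:
  fixes \<psi> :: "(real \<Rightarrow> real) \<Rightarrow> real"
  assumes S: "finite S" "S \<subseteq> {0..1}" and s: "s \<in> {0..1}" and \<psi>: "cyl S \<psi>"
  shows "(\<integral>\<omega>. \<psi> (\<lambda>r. B r \<omega> + x * min s r) \<partial>M) = (\<integral>\<omega>. exp (x * B s \<omega> - x\<^sup>2 * (s / 2)) * \<psi> (\<lambda>r. B r \<omega>) \<partial>M)"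
proof -
  define U where "U = insert 0 (insert s S)"
  have U: "finite U" "U \<subseteq> {0..1}" "0 \<in> U" using S s by (auto simp: U_def)
  obtain t :: "nat \<Rightarrow> real" and N where t: "strict_mono_on {..N} t" "t ` {..N} = U" "t 0 = 0"
    by (rule finite_set_grid[OF U])
  have tle: "t i \<le> t j \<longleftrightarrow> i \<le> j" if "i \<le> N" "j \<le> N" for i j
    using that t(1) by (simp add: strict_mono_on_less_eq)
  have tless: "t i < t (Suc i)" if "i < N" for i
    using that t(1) by (simp add: strict_mono_on_def)
  have "s \<in> t ` {..N}" unfolding t(2) by (simp add: U_def)
  then obtain q where q: "q \<le> N" "t q = s" by blast
  \<comment> \<open>Jumps proportional to the time steps reproduce x min (s, r) on the grid, and
    with them both sums in the weight telescope, to \<open>x * B s\<close> and to x^2 s / 2.\<close>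
  let ?a = "\<lambda>i. x * (t (Suc i) - t i)"
  have cyl: "cyl (t ` {..N}) \<psi>" unfolding t(2) by (rule cyl_mono[OF \<psi>]) (auto simp: U_def)
  have shift: "(\<Sum>i<q. if t (Suc i) \<le> r then ?a i else 0) = x * min s r" if "r \<in> S" for r
  proof -
    have "r \<in> t ` {..N}" unfolding t(2) using that by (simp add: U_def)
    then obtain j where j: "j \<le> N" "t j = r" by blast
    have "(\<Sum>i<q. if t (Suc i) \<le> r then ?a i else 0) = (\<Sum>i<q. if i \<in> {..<j} then ?a i else 0)"
    proof (rule sum.cong)
      fix i assume "i \<in> {..<q}"
      then have "t (Suc i) \<le> r \<longleftrightarrow> i < j" using tle[of "Suc i" j] j q by (simp add: Suc_le_eq)
      then show "(if t (Suc i) \<le> r then ?a i else 0) = (if i \<in> {..<j} then ?a i else 0)" by simp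
    qed simp
    also have "\<dots> = (\<Sum>i\<in>{..<q} \<inter> {..<j}. ?a i)" by (rule sum.inter_restrict[symmetric]) simp
    also have "{..<q} \<inter> {..<j} = {..<min q j}" by auto
    also have "(\<Sum>i<min q j. ?a i) = x * (\<Sum>i<min q j. t (Suc i) - t i)"
      by (rule sum_distrib_left[symmetric])
    also have "(\<Sum>i<min q j. t (Suc i) - t i) = t (min q j) - t 0"
      by (rule sum_lessThan_telescope)
    also have "t (min q j) = min s r"
      using tle[of q j] tle[of j q] q j by (auto simp: min_def)
    finally show ?thesis by (simp add: t(3))
  qed
  have ex: "(\<Sum>i<q. ?a i / (t (Suc i) - t i) * (B (t (Suc i)) \<omega> - B (t i) \<omega>) - (?a i)\<^sup>2 / (2 * (t (Suc i) - t i)))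
      = x * B s \<omega> - x\<^sup>2 * (s / 2)" if "\<omega> \<in> space M" for \<omega>
  proof -
    have algebra: "x * d / d * b - (x * d)\<^sup>2 / (2 * d) = x * b - x\<^sup>2 / 2 * d" if "d \<noteq> 0" for b d :: real
      using that by (simp add: power2_eq_square field_simps)
    have "(\<Sum>i<q. ?a i / (t (Suc i) - t i) * (B (t (Suc i)) \<omega> - B (t i) \<omega>) - (?a i)\<^sup>2 / (2 * (t (Suc i) - t i)))
      = (\<Sum>i<q. x * (B (t (Suc i)) \<omega> - B (t i) \<omega>) - x\<^sup>2 / 2 * (t (Suc i) - t i))"
    proof (rule sum.cong)
      fix i assume "i \<in> {..<q}"
      then have "t (Suc i) - t i \<noteq> 0" using tless[of i] q by simp
      then show "?a i / (t (Suc i) - t i) * (B (t (Suc i)) \<omega> - B (t i) \<omega>) - (?a i)\<^sup>2 / (2 * (t (Suc i) - t i))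
        = x * (B (t (Suc i)) \<omega> - B (t i) \<omega>) - x\<^sup>2 / 2 * (t (Suc i) - t i)"
        by (rule algebra)
    qed simp
    also have "\<dots> = x * (\<Sum>i<q. B (t (Suc i)) \<omega> - B (t i) \<omega>) - x\<^sup>2 / 2 * (\<Sum>i<q. t (Suc i) - t i)"
      unfolding sum_distrib_left by (rule sum_subtractf)
    also have "(\<Sum>i<q. B (t (Suc i)) \<omega> - B (t i) \<omega>) = B (t q) \<omega> - B (t 0) \<omega>"
      by (rule sum_lessThan_telescope)
    also have "(\<Sum>i<q. t (Suc i) - t i) = t q - t 0"
      by (rule sum_lessThan_telescope)
    finally show ?thesis by (simp add: q t(3) B_0[OF that])
  qed
  have "(\<integral>\<omega>. \<psi> (\<lambda>r. B r \<omega> + x * min s r) \<partial>M)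
     = (\<integral>\<omega>. \<psi> (\<lambda>r. B r \<omega> + (\<Sum>i<q. if t (Suc i) \<le> r then ?a i else 0)) \<partial>M)"
    by (intro Bochner_Integration.integral_cong refl cyl_cong[OF \<psi>]) (simp add: shift)
  also have "\<dots> = (\<integral>\<omega>. exp (\<Sum>i<q. ?a i / (t (Suc i) - t i) * (B (t (Suc i)) \<omega> - B (t i) \<omega>)
        - (?a i)\<^sup>2 / (2 * (t (Suc i) - t i))) * \<psi> (\<lambda>r. B r \<omega>) \<partial>M)"
    by (rule cameron_martin_grid[OF t(1) _ q(1) cyl]) (use t(2) U(2) in simp)
  also have "\<dots> = (\<integral>\<omega>. exp (x * B s \<omega> - x\<^sup>2 * (s / 2)) * \<psi> (\<lambda>r. B r \<omega>) \<partial>M)"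
    by (intro Bochner_Integration.integral_cong refl arg_cong2[where f = "(*)"] arg_cong[where f = exp] ex)
  finally show ?thesis .
qed

text \<open>The first-order term of \<open>cameron_martin_min\<close> at x = 0: on the weighted side
  the derivative produces the factor \<open>B s\<close>, on the shifted side it produces the
  derivative of \<psi> along the covariance function of \<open>B s\<close>.\<close>

lemma gaussian_ibp:
  fixes \<psi> :: "(real \<Rightarrow> real) \<Rightarrow> real"
  assumes S: "finite S" "S \<subseteq> {0..1}" and s: "s \<in> {0..1}" and \<psi>: "exp_lip S \<psi>"
    and D: "\<And>k. ((\<lambda>x. \<psi> (\<lambda>r. k r + x * min s r)) has_real_derivative D k) (at 0)"
  shows "integrable M (\<lambda>\<omega>. B s \<omega> * \<psi> (\<lambda>r. B r \<omega>))"
    and "integrable M (\<lambda>\<omega>. D (\<lambda>r. B r \<omega>))"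
    and "(\<integral>\<omega>. B s \<omega> * \<psi> (\<lambda>r. B r \<omega>) \<partial>M) = (\<integral>\<omega>. D (\<lambda>r. B r \<omega>) \<partial>M)"
proof -
  let ?U = "insert s S"
  let ?m = "min s"
  have U: "finite ?U" "?U \<subseteq> {0..1}" using S s by auto
  obtain C where C: "C \<ge> 0" "\<And>k k'. \<bar>\<psi> k - \<psi> k'\<bar> \<le> C * exp (C * (coord_norm S k + coord_norm S k')) * coord_norm S (\<lambda>s. k s - k' s)"
    using \<psi> by (auto simp: exp_lip_def)
  obtain C' where C': "C' \<ge> 0" "\<And>k. \<bar>\<psi> k\<bar> \<le> C' * exp (C' * coord_norm S k)" using exp_lip_growth[OF \<psi>] by blast
  have cyl: "cyl S \<psi>" by (rule exp_lip_cyl[OF S(1) \<psi>])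
  have \<psi>m: "(\<lambda>\<omega>. \<psi> (\<lambda>r. B r \<omega>)) \<in> borel_measurable M" by (rule cyl_B_measurable[OF cyl S(2)])
  have g: "\<bar>\<psi> (\<lambda>r. B r \<omega>)\<bar> \<le> C' * exp (C' * coord_norm ?U (\<lambda>r. B r \<omega>))" for \<omega>
  proof -
    have "coord_norm S (\<lambda>r. B r \<omega>) \<le> coord_norm ?U (\<lambda>r. B r \<omega>)" by (rule coord_norm_mono[OF U(1)]) auto
    then have "C' * exp (C' * coord_norm S (\<lambda>r. B r \<omega>)) \<le> C' * exp (C' * coord_norm ?U (\<lambda>r. B r \<omega>))"
      using C'(1) by (intro mult_left_mono) (auto intro: mult_left_mono)
    with C'(2)[of "\<lambda>r. B r \<omega>"] show ?thesis by linarith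
  qed
  have l: "\<bar>B s \<omega>\<bar> \<le> 1 * coord_norm ?U (\<lambda>r. B r \<omega>)" for \<omega>
    using coord_norm_member[OF U(1), of s "\<lambda>r. B r \<omega>"] by simp
  note tilt = exp_tilt_derivative(1)[OF U \<psi>m B_measurable[OF s] g l C'(1), where q = "s / 2"]
    exp_tilt_derivative(2)[OF U \<psi>m B_measurable[OF s] g l C'(1)]
  show "integrable M (\<lambda>\<omega>. B s \<omega> * \<psi> (\<lambda>r. B r \<omega>))" by (rule tilt(2))
  let ?J = "\<lambda>x. \<integral>\<omega>. \<psi> (\<lambda>r. B r \<omega> + x * ?m r) \<partial>M"
  have "(?J has_real_derivative (\<integral>\<omega>. B s \<omega> * \<psi> (\<lambda>r. B r \<omega>) \<partial>M)) (at 0)"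
    using tilt(1) by (simp only: cameron_martin_min[OF S s cyl])
  then have "(\<lambda>n. (?J (0 + 1 / real (Suc n)) - ?J 0) / (1 / real (Suc n))) \<longlonglongrightarrow> (\<integral>\<omega>. B s \<omega> * \<psi> (\<lambda>r. B r \<omega>) \<partial>M)"
    unfolding DERIV_def
    by (rule tendsto_at_0_seq)
  then have l0: "(\<lambda>n. (?J (0 + 1 / real (Suc n)) - ?J 0) / (1 / real (Suc n))) \<longlonglongrightarrow> (\<integral>\<omega>. B s \<omega> * \<psi> (\<lambda>r. B r \<omega>) \<partial>M)" .
  have sm: "(\<lambda>\<omega>. \<psi> (\<lambda>r. B r \<omega> + x * ?m r)) \<in> borel_measurable M" for x
    by (rule cyl_B_measurable[OF cyl_shift[OF cyl] S(2)])
  have si: "integrable M (\<lambda>\<omega>. \<psi> (\<lambda>r. B r \<omega> + x * ?m r))" for x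
  proof (rule integrable_exp_growth[OF S sm])
    fix \<omega>
    have "C' * exp (C' * coord_norm S (\<lambda>r. B r \<omega> + x * ?m r)) \<le> C' * exp (C' * (coord_norm S (\<lambda>r. B r \<omega>) + coord_norm S (\<lambda>r. x * ?m r)))"
      using C'(1) coord_norm_triangle[of S "\<lambda>r. B r \<omega>" "\<lambda>r. x * ?m r"] by (intro mult_left_mono) (auto intro: mult_left_mono)
    also have "\<dots> = (C' * exp (C' * coord_norm S (\<lambda>r. x * ?m r))) * exp (C' * coord_norm S (\<lambda>r. B r \<omega>))"
      by (simp add: exp_add[symmetric] algebra_simps)
    finally show "\<bar>\<psi> (\<lambda>r. B r \<omega> + x * ?m r)\<bar> \<le> (C' * exp (C' * coord_norm S (\<lambda>r. x * ?m r))) * exp (C' * coord_norm S (\<lambda>r. B r \<omega>))"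
      using C'(2)[of "\<lambda>r. B r \<omega> + x * ?m r"] by linarith
  qed
  let ?q = "\<lambda>n \<omega>. (\<psi> (\<lambda>r. B r \<omega> + (1 / real (Suc n)) * ?m r) - \<psi> (\<lambda>r. B r \<omega>)) / (1 / real (Suc n))"
  have l1: "(?J (0 + 1 / real (Suc n)) - ?J 0) / (1 / real (Suc n)) = (\<integral>\<omega>. ?q n \<omega> \<partial>M)" for n
    using Bochner_Integration.integral_diff[OF si[of "1 / real (Suc n)"] si[of 0]] by simp
  have lim1: "(\<lambda>n. \<integral>\<omega>. ?q n \<omega> \<partial>M) \<longlonglongrightarrow> (\<integral>\<omega>. B s \<omega> * \<psi> (\<lambda>r. B r \<omega>) \<partial>M)"
    using l0 by (simp only: l1)
  have lim: "(\<lambda>n. ?q n \<omega>) \<longlonglongrightarrow> D (\<lambda>r. B r \<omega>)" for \<omega>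
  proof -
    have "((\<lambda>x. (\<psi> (\<lambda>r. B r \<omega> + (0 + x) * ?m r) - \<psi> (\<lambda>r. B r \<omega> + 0 * ?m r)) / x) \<longlongrightarrow> D (\<lambda>r. B r \<omega>)) (at 0)"
      using D[of "\<lambda>r. B r \<omega>"] unfolding DERIV_def .
    then have "(\<lambda>n. (\<psi> (\<lambda>r. B r \<omega> + (0 + 1 / real (Suc n)) * ?m r) - \<psi> (\<lambda>r. B r \<omega> + 0 * ?m r)) / (1 / real (Suc n))) \<longlonglongrightarrow> D (\<lambda>r. B r \<omega>)"
      by (rule tendsto_at_0_seq)
    then show ?thesis by simp
  qed
  have qm: "?q n \<in> borel_measurable M" for n using sm[of "1 / real (Suc n)"] \<psi>m by auto
  \<comment> \<open>\<open>D\<close> is given only pointwise; along the path it is measurable as the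
    limit of the difference quotients.\<close>
  have Dm: "(\<lambda>\<omega>. D (\<lambda>r. B r \<omega>)) \<in> borel_measurable M"
    by (rule borel_measurable_LIMSEQ_real[OF lim qm])
  define w where "w = (\<lambda>\<omega>. (C * exp (C * coord_norm S ?m) * coord_norm S ?m) * exp ((2 * C) * coord_norm S (\<lambda>r. B r \<omega>)))"
  have wi: "integrable M w" unfolding w_def by (intro integrable_mult_right integrable_exp_coord_norm S)
  have dom: "\<bar>?q n \<omega>\<bar> \<le> w \<omega>" for n \<omega>
  proof -
    let ?x = "1 / real (Suc n)"
    have x: "0 < ?x" "?x \<le> 1" by auto
    have sc: "coord_norm S (\<lambda>r. ?x * ?m r) = ?x * coord_norm S ?m" using coord_norm_scale[of S ?x ?m] by simp
    have "\<bar>\<psi> (\<lambda>r. B r \<omega> + ?x * ?m r) - \<psi> (\<lambda>r. B r \<omega>)\<bar>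
       \<le> C * exp (C * (coord_norm S (\<lambda>r. B r \<omega> + ?x * ?m r) + coord_norm S (\<lambda>r. B r \<omega>))) * coord_norm S (\<lambda>r. ?x * ?m r)"
      using C(2)[of "\<lambda>r. B r \<omega> + ?x * ?m r" "\<lambda>r. B r \<omega>"] by simp
    also have "\<dots> \<le> C * exp (C * (coord_norm S ?m + 2 * coord_norm S (\<lambda>r. B r \<omega>))) * coord_norm S (\<lambda>r. ?x * ?m r)"
    proof (intro mult_right_mono mult_left_mono iffD2[OF exp_le_cancel_iff])
      have "?x * coord_norm S ?m \<le> 1 * coord_norm S ?m" using x by (intro mult_right_mono) auto
      then show "coord_norm S (\<lambda>r. B r \<omega> + ?x * ?m r) + coord_norm S (\<lambda>r. B r \<omega>) \<le> coord_norm S ?m + 2 * coord_norm S (\<lambda>r. B r \<omega>)"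
        using coord_norm_triangle[of S "\<lambda>r. B r \<omega>" "\<lambda>r. ?x * ?m r"] unfolding sc by linarith
    qed (use C in auto)
    also have "\<dots> = ?x * w \<omega>"
      unfolding sc w_def by (simp add: exp_add[symmetric] algebra_simps)
    finally have d: "\<bar>\<psi> (\<lambda>r. B r \<omega> + ?x * ?m r) - \<psi> (\<lambda>r. B r \<omega>)\<bar> \<le> ?x * w \<omega>" .
    have "\<bar>a / y\<bar> \<le> b" if "\<bar>a\<bar> \<le> y * b" "0 < y" for a b y :: real
      using that by (simp add: abs_divide field_simps)
    from this[OF d x(1)] show ?thesis .
  qed
  note dc = integrable_dominated_convergence[where f = "\<lambda>\<omega>. D (\<lambda>r. B r \<omega>)" and s = ?q and w = w and M = M]
    integral_dominated_convergence[where f = "\<lambda>\<omega>. D (\<lambda>r. B r \<omega>)" and s = ?q and w = w and M = M]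
  show "integrable M (\<lambda>\<omega>. D (\<lambda>r. B r \<omega>))"
    by (rule dc(1)[OF Dm qm wi]) (use lim dom in auto)
  have lim2: "(\<lambda>n. \<integral>\<omega>. ?q n \<omega> \<partial>M) \<longlonglongrightarrow> (\<integral>\<omega>. D (\<lambda>r. B r \<omega>) \<partial>M)"
    by (rule dc(2)[OF Dm qm wi]) (use lim dom in auto)
  show "(\<integral>\<omega>. B s \<omega> * \<psi> (\<lambda>r. B r \<omega>) \<partial>M) = (\<integral>\<omega>. D (\<lambda>r. B r \<omega>) \<partial>M)"
    by (rule LIMSEQ_unique[OF lim1 lim2])
qed

end

section \<open>Smoothing of cylinder functionals\<close>

text \<open>Normalised to be the L2(0,1) norm of the step function with these values, see
  \<open>step_L2\<close>. Time 0 is left out because each cell carries the value at its right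
  end.\<close>

definition grid_norm :: "nat \<Rightarrow> (real \<Rightarrow> real) \<Rightarrow> real" where
  "grid_norm n k = L2_set (\<lambda>i. k (real i / real n)) {1..n} / sqrt (real n)"

definition grid_set :: "nat \<Rightarrow> real set" where
  "grid_set n = (\<lambda>i. real i / real n) ` {1..n}"

lemma grid_set: "finite (grid_set n)" "grid_set n \<subseteq> {0..1}"
  by (auto simp: grid_set_def divide_simps)

lemma grid_norm_nonneg [simp]: "0 \<le> grid_norm n k"
  by (simp add: grid_norm_def)

lemma grid_norm_triangle: "grid_norm n (\<lambda>s. k s + l s) \<le> grid_norm n k + grid_norm n l"
  unfolding grid_norm_def add_divide_distrib[symmetric]
  by (intro divide_right_mono L2_set_triangle_ineq) simp

lemma grid_norm_scale: "grid_norm n (\<lambda>s. c * k s) = \<bar>c\<bar> * grid_norm n k"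
  unfolding grid_norm_def L2_set_def power_mult_distrib sum_distrib_left[symmetric]
  by (simp add: real_sqrt_mult)

lemma grid_norm_square: "(grid_norm n k)\<^sup>2 = (\<Sum>i=1..n. (k (real i / real n))\<^sup>2) / real n"
  by (simp add: grid_norm_def L2_set_def power_divide sum_nonneg)

lemma grid_norm_le_coord_norm:
  assumes "n \<ge> 1"
  shows "grid_norm n k \<le> coord_norm (grid_set n) k"
proof -
  have inj: "inj_on (\<lambda>i. real i / real n) {1..n}" using assms by (auto simp: inj_on_def)
  have "grid_norm n k \<le> L2_set (\<lambda>i. k (real i / real n)) {1..n} / 1"
    unfolding grid_norm_def using assms by (intro divide_left_mono) auto
  also have "\<dots> \<le> (\<Sum>i\<in>{1..n}. \<bar>k (real i / real n)\<bar>)" using L2_set_le_sum_abs by simp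
  also have "\<dots> = coord_norm (grid_set n) k"
    unfolding coord_norm_def grid_set_def by (subst sum.reindex[OF inj]) (simp add: o_def)
  finally show ?thesis .
qed

section \<open>Exponential moments of the discrete norm, uniformly in the grid\<close>

lemma exp_mean_le:
  fixes x :: "nat \<Rightarrow> real"
  assumes "n \<ge> 1"
  shows "exp ((\<Sum>i=1..n. x i) / real n) \<le> (\<Sum>i=1..n. exp (x i)) / real n"
proof -
  let ?m = "(\<Sum>i=1..n. x i) / real n"
  \<comment> \<open>Jensen's inequality: exp lies above its tangent at the mean, and the linear
    terms average out.\<close>
  have "(\<Sum>i=1..n. exp ?m * (1 + (x i - ?m))) \<le> (\<Sum>i=1..n. exp (x i))"
  proof (rule sum_mono)
    fix i
    have "exp ?m * (1 + (x i - ?m)) \<le> exp ?m * exp (x i - ?m)" by (intro mult_left_mono) auto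
    then show "exp ?m * (1 + (x i - ?m)) \<le> exp (x i)" by (simp add: exp_add[symmetric])
  qed
  moreover have "(\<Sum>i=1..n. exp ?m * (1 + (x i - ?m))) = exp ?m * (real n + ((\<Sum>i=1..n. x i) - real n * ?m))"
    by (simp add: sum_distrib_left[symmetric] sum.distrib sum_subtractf)
  ultimately show ?thesis using assms by (simp add: field_simps)
qed

lemma le_square_bound: "c * y \<le> c\<^sup>2 + y\<^sup>2 / (4::real)"
  using zero_le_power2[of "c - y / 2"] by (simp add: power2_eq_square algebra_simps)

lemma exp_grid_norm_le:
  assumes "n \<ge> 1"
  shows "exp (c * grid_norm n k) \<le> exp (c\<^sup>2) * ((\<Sum>i=1..n. exp ((k (real i / real n))\<^sup>2 / 4)) / real n)"
proof -
  have "exp (c * grid_norm n k) \<le> exp (c\<^sup>2 + (grid_norm n k)\<^sup>2 / 4)" using le_square_bound by simp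
  also have "\<dots> = exp (c\<^sup>2) * exp ((\<Sum>i=1..n. (k (real i / real n))\<^sup>2 / 4) / real n)"
    unfolding grid_norm_square exp_add by (simp add: sum_divide_distrib[symmetric])
  also have "\<dots> \<le> exp (c\<^sup>2) * ((\<Sum>i=1..n. exp ((k (real i / real n))\<^sup>2 / 4)) / real n)"
    by (intro mult_left_mono exp_mean_le assms) simp
  finally show ?thesis .
qed

context brownian
begin

lemma grid_norm_B_measurable: "(\<lambda>\<omega>. grid_norm n (\<lambda>r. B r \<omega>)) \<in> borel_measurable M"
  unfolding grid_norm_def L2_set_def
  by (intro borel_measurable_divide borel_measurable_sqrt measurable_compose[OF _ borel_measurable_sqrt]
      borel_measurable_sum borel_measurable_power borel_measurable_const B_measurable) (auto simp: divide_simps)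

text \<open>The term c y is traded for c^2 + y^2 / 4, and Jensen moves the exponential of the
  averaged square inside the average over the grid. Only moments at single times remain, and these
  are bounded by 2; hence the bound is free of \<open>n\<close>.\<close>

lemma exp_grid_norm_B:
  assumes "n \<ge> 1"
  shows "integrable M (\<lambda>\<omega>. exp (c * grid_norm n (\<lambda>r. B r \<omega>)))"
    and "(\<integral>\<omega>. exp (c * grid_norm n (\<lambda>r. B r \<omega>)) \<partial>M) \<le> 2 * exp (c\<^sup>2)"
proof -
  let ?b = "\<lambda>\<omega>. exp (c\<^sup>2) * ((\<Sum>i=1..n. exp ((B (real i / real n) \<omega>)\<^sup>2 / 4)) / real n)"
  have r: "real i / real n \<in> {0..1}" if "i \<in> {1..n}" for i using that by (auto simp: divide_simps)
  have bi: "integrable M ?b"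
    by (intro integrable_mult_right integrable_divide_zero integrable_divide Bochner_Integration.integrable_sum integrable_exp_square_B r)
  have le: "exp (c * grid_norm n (\<lambda>r. B r \<omega>)) \<le> ?b \<omega>" for \<omega>
    using exp_grid_norm_le[OF assms, of c "\<lambda>r. B r \<omega>"] .
  show i: "integrable M (\<lambda>\<omega>. exp (c * grid_norm n (\<lambda>r. B r \<omega>)))"
  proof (rule Bochner_Integration.integrable_bound[OF bi])
    show "AE \<omega> in M. norm (exp (c * grid_norm n (\<lambda>r. B r \<omega>))) \<le> norm (?b \<omega>)"
      using le by (intro AE_I2) (smt (verit) exp_gt_zero real_norm_def)
  qed (use grid_norm_B_measurable in auto)
  have "(\<integral>\<omega>. exp (c * grid_norm n (\<lambda>r. B r \<omega>)) \<partial>M) \<le> (\<integral>\<omega>. ?b \<omega> \<partial>M)"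
    by (intro integral_mono i bi le)
  also have "\<dots> = exp (c\<^sup>2) * ((\<Sum>i=1..n. \<integral>\<omega>. exp ((B (real i / real n) \<omega>)\<^sup>2 / 4) \<partial>M) / real n)"
    using r by (simp add: Bochner_Integration.integral_sum integrable_exp_square_B)
  also have "\<dots> \<le> exp (c\<^sup>2) * ((\<Sum>i=1..n. 2) / real n)"
    by (intro mult_left_mono divide_right_mono sum_mono integral_exp_square_B r) auto
  also have "\<dots> = 2 * exp (c\<^sup>2)" using assms by simp
  finally show "(\<integral>\<omega>. exp (c * grid_norm n (\<lambda>r. B r \<omega>)) \<partial>M) \<le> 2 * exp (c\<^sup>2)" .
qed

lemma integral_grid_norm_B_le:
  assumes "n \<ge> 1"
  shows "integrable M (\<lambda>\<omega>. grid_norm n (\<lambda>r. B r \<omega>))" "(\<integral>\<omega>. grid_norm n (\<lambda>r. B r \<omega>) \<partial>M) \<le> 2 * exp 1"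
proof -
  have ex: "grid_norm n k \<le> exp (1 * grid_norm n k)" for k
    unfolding mult_1 using exp_ge_add_one_self[of "grid_norm n k"] by linarith
  show i: "integrable M (\<lambda>\<omega>. grid_norm n (\<lambda>r. B r \<omega>))"
    by (rule Bochner_Integration.integrable_bound[OF exp_grid_norm_B(1)[OF assms, of 1] grid_norm_B_measurable])
      (use ex in auto)
  have "(\<integral>\<omega>. grid_norm n (\<lambda>r. B r \<omega>) \<partial>M) \<le> (\<integral>\<omega>. exp (1 * grid_norm n (\<lambda>r. B r \<omega>)) \<partial>M)"
    by (intro integral_mono i exp_grid_norm_B(1) assms ex)
  also have "\<dots> \<le> 2 * exp (1\<^sup>2)" by (rule exp_grid_norm_B(2)[OF assms])
  finally show "(\<integral>\<omega>. grid_norm n (\<lambda>r. B r \<omega>) \<partial>M) \<le> 2 * exp 1" by simp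
qed

end

context brownian
begin

text \<open>\<open>g\<close> averages \<open>f\<close> over a noise of width \<kappa> with the law
  of the Brownian path itself. A translation of the argument can be moved onto the noise by
  Cameron-Martin, so \<open>g\<close> is differentiable although \<open>f\<close> is only Lipschitz.
  The factor 1/\<kappa> appears in the formula for the partial derivatives but not in the Lipschitz
  bound, which \<open>g\<close> inherits from \<open>f\<close>.\<close>

lemma smoothing:
  fixes f :: "(real \<Rightarrow> real) \<Rightarrow> real"
  assumes n: "n \<ge> 1" and c: "c \<ge> 0" and \<kappa>: "\<kappa> > 0"
    and f: "\<And>k k'. \<bar>f k - f k'\<bar> \<le> exp (c * grid_norm n k) * grid_norm n (\<lambda>r. k r - k' r)"
  defines "g \<equiv> \<lambda>k. \<integral>\<omega>. f (\<lambda>r. k r + \<kappa> * B r \<omega>) \<partial>M"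
  shows "\<bar>g k - f k\<bar> \<le> exp (c * grid_norm n k) * (\<kappa> * (2 * exp 1))"
    and "\<bar>g k - g k'\<bar> \<le> 2 * exp ((c * \<kappa>)\<^sup>2) * exp (c * grid_norm n k) * grid_norm n (\<lambda>r. k r - k' r)"
    and "\<exists>D. \<forall>k u. ((\<lambda>x. g (\<lambda>r. k r + x * u r)) has_real_derivative (\<Sum>i=1..n. u (real i / real n) * D i k)) (at 0)"
proof -
  have ef: "exp_lip (grid_set n) f"
  proof (rule exp_lipI[of "c + 1"])
    fix k k' :: "real \<Rightarrow> real"
    have le: "grid_norm n k \<le> coord_norm (grid_set n) k + coord_norm (grid_set n) k'"
      using grid_norm_le_coord_norm[OF n, of k] coord_norm_nonneg[of "grid_set n" k'] by linarith
    note f[of k k']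
    also have "exp (c * grid_norm n k) * grid_norm n (\<lambda>r. k r - k' r)
        \<le> exp ((c + 1) * (coord_norm (grid_set n) k + coord_norm (grid_set n) k')) * coord_norm (grid_set n) (\<lambda>r. k r - k' r)"
      using c le by (intro mult_mono grid_norm_le_coord_norm n iffD2[OF exp_le_cancel_iff]) auto
    also have "\<dots> \<le> (c + 1) * (exp ((c + 1) * (coord_norm (grid_set n) k + coord_norm (grid_set n) k')) * coord_norm (grid_set n) (\<lambda>r. k r - k' r))"
      using mult_right_mono[of 1 "c + 1" "exp ((c + 1) * (coord_norm (grid_set n) k + coord_norm (grid_set n) k')) * coord_norm (grid_set n) (\<lambda>r. k r - k' r)"] c
      by simp
    finally show "\<bar>f k - f k'\<bar> \<le> (c + 1) * exp ((c + 1) * (coord_norm (grid_set n) k + coord_norm (grid_set n) k')) * coord_norm (grid_set n) (\<lambda>r. k r - k' r)"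
      by (simp only: mult.assoc)
  qed (use c in simp)
  have cf: "cyl (grid_set n) f" by (rule exp_lip_cyl[OF grid_set(1) ef])
  obtain C where C: "C \<ge> 0" "\<And>k. \<bar>f k\<bar> \<le> C * exp (C * coord_norm (grid_set n) k)" using exp_lip_growth[OF ef] by blast
  have ck: "cyl (grid_set n) (\<lambda>l. f (\<lambda>r. k r + \<kappa> * l r))" for k
  proof (rule cylI)
    show "f (\<lambda>r. k r + \<kappa> * l r) = f (\<lambda>r. k r + \<kappa> * l' r)" if "\<And>s. s \<in> grid_set n \<Longrightarrow> l s = l' s" for l l'
      using that by (intro cyl_cong[OF cf]) auto
    show "(\<lambda>l. f (\<lambda>r. k r + \<kappa> * l r)) \<in> borel_measurable (PiM (grid_set n) (\<lambda>_. borel))"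
      by (rule cyl_measurable_compose[OF cf])
        (auto intro!: borel_measurable_add borel_measurable_times measurable_component_singleton)
  qed
  have fm: "(\<lambda>\<omega>. f (\<lambda>r. k r + \<kappa> * B r \<omega>)) \<in> borel_measurable M" for k
    by (rule cyl_B_measurable[OF ck grid_set(2)])
  have fb: "\<bar>f (\<lambda>r. k r + \<kappa> * l r)\<bar> \<le> (C * exp (C * coord_norm (grid_set n) k)) * exp ((C * \<kappa>) * coord_norm (grid_set n) l)" for k l
  proof -
    have "coord_norm (grid_set n) (\<lambda>r. k r + \<kappa> * l r) \<le> coord_norm (grid_set n) k + \<kappa> * coord_norm (grid_set n) l"
      using coord_norm_triangle[of "grid_set n" k "\<lambda>r. \<kappa> * l r"] \<kappa> by (simp add: coord_norm_scale)
    then have "C * exp (C * coord_norm (grid_set n) (\<lambda>r. k r + \<kappa> * l r)) \<le> C * exp (C * (coord_norm (grid_set n) k + \<kappa> * coord_norm (grid_set n) l))"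
      using C(1) by (intro mult_left_mono iffD2[OF exp_le_cancel_iff]) auto
    also have "\<dots> = (C * exp (C * coord_norm (grid_set n) k)) * exp ((C * \<kappa>) * coord_norm (grid_set n) l)"
      by (simp add: exp_add[symmetric] algebra_simps)
    finally show ?thesis using C(2)[of "\<lambda>r. k r + \<kappa> * l r"] by linarith
  qed
  have fi: "integrable M (\<lambda>\<omega>. f (\<lambda>r. k r + \<kappa> * B r \<omega>))" for k
    by (rule integrable_exp_growth[OF grid_set fm fb])
  show "\<bar>g k - f k\<bar> \<le> exp (c * grid_norm n k) * (\<kappa> * (2 * exp 1))"
  proof -
    have "g k - f k = (\<integral>\<omega>. f (\<lambda>r. k r + \<kappa> * B r \<omega>) - f k \<partial>M)"
      unfolding g_def by (subst Bochner_Integration.integral_diff[OF fi]) (auto simp: prob_space)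
    also have "\<bar>\<dots>\<bar> \<le> (\<integral>\<omega>. \<bar>f (\<lambda>r. k r + \<kappa> * B r \<omega>) - f k\<bar> \<partial>M)"
      using integral_norm_bound[of M "\<lambda>\<omega>. f (\<lambda>r. k r + \<kappa> * B r \<omega>) - f k"] by simp
    also have "\<dots> \<le> (\<integral>\<omega>. exp (c * grid_norm n k) * (\<kappa> * grid_norm n (\<lambda>r. B r \<omega>)) \<partial>M)"
    proof (rule integral_mono)
      show "integrable M (\<lambda>\<omega>. \<bar>f (\<lambda>r. k r + \<kappa> * B r \<omega>) - f k\<bar>)"
        using fi by (intro integrable_abs Bochner_Integration.integrable_diff) auto
      show "integrable M (\<lambda>\<omega>. exp (c * grid_norm n k) * (\<kappa> * grid_norm n (\<lambda>r. B r \<omega>)))"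
        by (intro integrable_mult_right integral_grid_norm_B_le n)
      fix \<omega>
      have "grid_norm n (\<lambda>r. k r - (k r + \<kappa> * B r \<omega>)) = \<kappa> * grid_norm n (\<lambda>r. B r \<omega>)"
        using grid_norm_scale[of n "- \<kappa>" "\<lambda>r. B r \<omega>"] \<kappa> by simp
      then show "\<bar>f (\<lambda>r. k r + \<kappa> * B r \<omega>) - f k\<bar> \<le> exp (c * grid_norm n k) * (\<kappa> * grid_norm n (\<lambda>r. B r \<omega>))"
        using f[of k "\<lambda>r. k r + \<kappa> * B r \<omega>"] by (simp add: abs_minus_commute)
    qed
    also have "\<dots> = exp (c * grid_norm n k) * (\<kappa> * (\<integral>\<omega>. grid_norm n (\<lambda>r. B r \<omega>) \<partial>M))" by simp
    also have "\<dots> \<le> exp (c * grid_norm n k) * (\<kappa> * (2 * exp 1))"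
      using \<kappa> by (intro mult_left_mono integral_grid_norm_B_le n) auto
    finally show ?thesis .
  qed
  show "\<bar>g k - g k'\<bar> \<le> 2 * exp ((c * \<kappa>)\<^sup>2) * exp (c * grid_norm n k) * grid_norm n (\<lambda>r. k r - k' r)"
  proof -
    let ?d = "grid_norm n (\<lambda>r. k r - k' r)"
    have "g k - g k' = (\<integral>\<omega>. f (\<lambda>r. k r + \<kappa> * B r \<omega>) - f (\<lambda>r. k' r + \<kappa> * B r \<omega>) \<partial>M)"
      unfolding g_def by (subst Bochner_Integration.integral_diff[OF fi fi]) auto
    also have "\<bar>\<dots>\<bar> \<le> (\<integral>\<omega>. \<bar>f (\<lambda>r. k r + \<kappa> * B r \<omega>) - f (\<lambda>r. k' r + \<kappa> * B r \<omega>)\<bar> \<partial>M)"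
      using integral_norm_bound[of M "\<lambda>\<omega>. f (\<lambda>r. k r + \<kappa> * B r \<omega>) - f (\<lambda>r. k' r + \<kappa> * B r \<omega>)"] by simp
    also have "\<dots> \<le> (\<integral>\<omega>. exp (c * grid_norm n k) * ?d * exp ((c * \<kappa>) * grid_norm n (\<lambda>r. B r \<omega>)) \<partial>M)"
    proof (rule integral_mono)
      show "integrable M (\<lambda>\<omega>. \<bar>f (\<lambda>r. k r + \<kappa> * B r \<omega>) - f (\<lambda>r. k' r + \<kappa> * B r \<omega>)\<bar>)"
        by (intro integrable_abs Bochner_Integration.integrable_diff fi)
      show "integrable M (\<lambda>\<omega>. exp (c * grid_norm n k) * ?d * exp ((c * \<kappa>) * grid_norm n (\<lambda>r. B r \<omega>)))"
        by (intro integrable_mult_right exp_grid_norm_B n)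
      fix \<omega>
      have "grid_norm n (\<lambda>r. k r + \<kappa> * B r \<omega>) \<le> grid_norm n k + \<kappa> * grid_norm n (\<lambda>r. B r \<omega>)"
        using grid_norm_triangle[of n k "\<lambda>r. \<kappa> * B r \<omega>"] \<kappa> by (simp add: grid_norm_scale)
      then have "c * grid_norm n (\<lambda>r. k r + \<kappa> * B r \<omega>) \<le> c * grid_norm n k + (c * \<kappa>) * grid_norm n (\<lambda>r. B r \<omega>)"
        using mult_left_mono[OF _ c] by (fastforce simp: algebra_simps)
      then have "exp (c * grid_norm n (\<lambda>r. k r + \<kappa> * B r \<omega>)) * ?d \<le> exp (c * grid_norm n k + (c * \<kappa>) * grid_norm n (\<lambda>r. B r \<omega>)) * ?d"
        by (intro mult_right_mono) auto
      then show "\<bar>f (\<lambda>r. k r + \<kappa> * B r \<omega>) - f (\<lambda>r. k' r + \<kappa> * B r \<omega>)\<bar> \<le> exp (c * grid_norm n k) * ?d * exp ((c * \<kappa>) * grid_norm n (\<lambda>r. B r \<omega>))"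
        using f[of "\<lambda>r. k r + \<kappa> * B r \<omega>" "\<lambda>r. k' r + \<kappa> * B r \<omega>"] by (simp add: exp_add mult_ac)
    qed
    also have "\<dots> = exp (c * grid_norm n k) * ?d * (\<integral>\<omega>. exp ((c * \<kappa>) * grid_norm n (\<lambda>r. B r \<omega>)) \<partial>M)" by simp
    also have "\<dots> \<le> exp (c * grid_norm n k) * ?d * (2 * exp ((c * \<kappa>)\<^sup>2))"
      by (intro mult_left_mono exp_grid_norm_B n) auto
    finally show ?thesis by (simp add: mult_ac)
  qed
  define t where "t = (\<lambda>i. real i / real n)"
  have tU: "t ` {..n} \<subseteq> {0..1}" using n by (auto simp: t_def divide_simps)
  have tfin: "finite (t ` {..n})" by simp
  have smt: "strict_mono_on {..n} t" using n by (auto simp: t_def strict_mono_on_def divide_strict_right_mono)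
  have St: "grid_set n \<subseteq> t ` {..n}" by (auto simp: grid_set_def t_def)
  have tau: "t (Suc i) - t i = 1 / real n" for i using n by (simp add: t_def field_simps)
  define b where "b = (\<lambda>i k. \<integral>\<omega>. (B (t (Suc i)) \<omega> - B (t i) \<omega>) * f (\<lambda>r. k r + \<kappa> * B r \<omega>) \<partial>M)"
  \<comment> \<open>Summation by parts: \<open>b i\<close> multiplies the difference of two
    neighbouring values of the direction, so the value at time i/n collects \<open>b (i - 1)\<close>
    and minus \<open>b i\<close>. At the last grid point the second contribution is absent.\<close>
  define D where "D = (\<lambda>i k. (real n / \<kappa>) * (b (i - 1) k - (if i < n then b i k else 0)))"
  show "\<exists>D. \<forall>k u. ((\<lambda>x. g (\<lambda>r. k r + x * u r)) has_real_derivative (\<Sum>i=1..n. u (real i / real n) * D i k)) (at 0)"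
  proof (intro exI[of _ D] allI)
    fix k u :: "real \<Rightarrow> real"
    \<comment> \<open>A shift of the noise has to start from 0. Setting the direction to 0 at time 0
      is harmless because \<open>f\<close> does not see that time.\<close>
    define v where "v = (\<lambda>i. if i = 0 then 0 else u (t i))"
    define w where "w = (\<lambda>i. (v (Suc i) - v i) / \<kappa>)"
    define l where "l = (\<lambda>\<omega>. \<Sum>i<n. real n * w i * (B (t (Suc i)) \<omega> - B (t i) \<omega>))"
    define q where "q = (\<Sum>i<n. real n * (w i)\<^sup>2 / 2)"
    let ?\<psi> = "\<lambda>l. f (\<lambda>r. k r + \<kappa> * l r)"
    have Bt: "B (t i) \<in> borel_measurable M" if "i \<le> n" for i
      using tU that by (intro B_measurable) auto
    have lm: "l \<in> borel_measurable M"
      unfolding l_def by (intro borel_measurable_sum borel_measurable_times borel_measurable_diff borel_measurable_const Bt) auto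
    have dB: "\<bar>B (t (Suc i)) \<omega> - B (t i) \<omega>\<bar> \<le> 2 * coord_norm (t ` {..n}) (\<lambda>r. B r \<omega>)" if "i < n" for i \<omega>
    proof -
      have "\<bar>B (t (Suc i)) \<omega>\<bar> \<le> coord_norm (t ` {..n}) (\<lambda>r. B r \<omega>)" "\<bar>B (t i) \<omega>\<bar> \<le> coord_norm (t ` {..n}) (\<lambda>r. B r \<omega>)"
        using that by (auto intro!: coord_norm_member[OF tfin, of _ "\<lambda>r. B r \<omega>"])
      then show ?thesis by linarith
    qed
    have lb: "\<bar>l \<omega>\<bar> \<le> (\<Sum>i<n. real n * \<bar>w i\<bar> * 2) * coord_norm (t ` {..n}) (\<lambda>r. B r \<omega>)" for \<omega>
    proof -
      have "\<bar>l \<omega>\<bar> \<le> (\<Sum>i<n. \<bar>real n * w i * (B (t (Suc i)) \<omega> - B (t i) \<omega>)\<bar>)"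
        unfolding l_def by (rule sum_abs)
      also have "\<dots> \<le> (\<Sum>i<n. real n * \<bar>w i\<bar> * (2 * coord_norm (t ` {..n}) (\<lambda>r. B r \<omega>)))"
        unfolding abs_mult by (intro sum_mono mult_mono dB) auto
      also have "\<dots> = (\<Sum>i<n. real n * \<bar>w i\<bar> * 2) * coord_norm (t ` {..n}) (\<lambda>r. B r \<omega>)"
        unfolding sum_distrib_right by (simp add: mult_ac)
      finally show ?thesis .
    qed
    let ?C = "max (C * exp (C * coord_norm (grid_set n) k)) (C * \<kappa>)"
    have Gb: "\<bar>f (\<lambda>r. k r + \<kappa> * B r \<omega>)\<bar> \<le> ?C * exp (?C * coord_norm (t ` {..n}) (\<lambda>r. B r \<omega>))" for \<omega>
    proof -
      have "(C * exp (C * coord_norm (grid_set n) k)) * exp ((C * \<kappa>) * coord_norm (grid_set n) (\<lambda>r. B r \<omega>)) \<le> ?C * exp (?C * coord_norm (t ` {..n}) (\<lambda>r. B r \<omega>))"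
        using C(1) \<kappa> by (intro mult_mono iffD2[OF exp_le_cancel_iff] coord_norm_mono tfin St) (auto simp: le_max_iff_disj)
      then show ?thesis using fb[of k "\<lambda>r. B r \<omega>"] by linarith
    qed
    have C0: "0 \<le> ?C" using C(1) by (simp add: le_max_iff_disj)
    note tilt = exp_tilt_derivative(1)[OF tfin tU fm lm Gb lb C0, where q = q]
    \<comment> \<open>At the grid times a shift of the argument by x u is a shift of the noise by x
      u / \<kappa>, whose jumps over the cells are x times \<open>w\<close>.\<close>
    have eq: "g (\<lambda>r. k r + x * u r) = (\<integral>\<omega>. exp (x * l \<omega> - x\<^sup>2 * q) * f (\<lambda>r. k r + \<kappa> * B r \<omega>) \<partial>M)" for x
    proof -
      have "(\<Sum>i<n. if t (Suc i) \<le> r then x * w i else 0) = x / \<kappa> * u r" if rS: "r \<in> grid_set n" for r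
      proof -
        obtain j where j: "1 \<le> j" "j \<le> n" "r = t j" using rS unfolding grid_set_def t_def by auto
        have "(\<Sum>i<n. if t (Suc i) \<le> r then x * w i else 0) = (\<Sum>i<n. if i \<in> {..<j} then x * w i else 0)"
          using n unfolding j(3) t_def by (intro sum.cong) (auto simp: divide_le_cancel)
        also have "\<dots> = (\<Sum>i\<in>{..<n} \<inter> {..<j}. x * w i)" by (rule sum.inter_restrict[symmetric]) simp
        also have "{..<n} \<inter> {..<j} = {..<j}" using j by auto
        also have "(\<Sum>i<j. x * w i) = x / \<kappa> * (\<Sum>i<j. v (Suc i) - v i)"
          unfolding w_def sum_distrib_left by (intro sum.cong) auto
        also have "(\<Sum>i<j. v (Suc i) - v i) = v j - v 0" by (rule sum_lessThan_telescope)
        finally show ?thesis using j by (simp add: v_def)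
      qed
      then have "g (\<lambda>r. k r + x * u r) = (\<integral>\<omega>. ?\<psi> (\<lambda>r. B r \<omega> + (\<Sum>i<n. if t (Suc i) \<le> r then x * w i else 0)) \<partial>M)"
        unfolding g_def using \<kappa> by (intro Bochner_Integration.integral_cong refl cyl_cong[OF cf]) (simp add: algebra_simps)
      also have "\<dots> = (\<integral>\<omega>. exp (\<Sum>i<n. x * w i / (t (Suc i) - t i) * (B (t (Suc i)) \<omega> - B (t i) \<omega>)
        - (x * w i)\<^sup>2 / (2 * (t (Suc i) - t i))) * ?\<psi> (\<lambda>r. B r \<omega>) \<partial>M)"
        by (rule cameron_martin_grid[OF smt tU order_refl cyl_mono[OF ck St]])
      also have "\<dots> = (\<integral>\<omega>. exp (x * l \<omega> - x\<^sup>2 * q) * f (\<lambda>r. k r + \<kappa> * B r \<omega>) \<partial>M)"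
      proof (intro Bochner_Integration.integral_cong refl arg_cong2[where f = "(*)"] arg_cong[where f = exp])
        fix \<omega>
        have "x * l \<omega> - x\<^sup>2 * q = (\<Sum>i<n. x * (real n * w i * (B (t (Suc i)) \<omega> - B (t i) \<omega>)) - x\<^sup>2 * (real n * (w i)\<^sup>2 / 2))"
          unfolding l_def q_def sum_subtractf sum_distrib_left ..
        also have "\<dots> = (\<Sum>i<n. x * w i / (t (Suc i) - t i) * (B (t (Suc i)) \<omega> - B (t i) \<omega>)
          - (x * w i)\<^sup>2 / (2 * (t (Suc i) - t i)))"
          unfolding tau using n by (intro sum.cong refl) (simp add: power2_eq_square)
        finally show "(\<Sum>i<n. x * w i / (t (Suc i) - t i) * (B (t (Suc i)) \<omega> - B (t i) \<omega>)
          - (x * w i)\<^sup>2 / (2 * (t (Suc i) - t i))) = x * l \<omega> - x\<^sup>2 * q" ..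
      qed
      finally show ?thesis .
    qed
    have bi: "integrable M (\<lambda>\<omega>. (B (t (Suc i)) \<omega> - B (t i) \<omega>) * f (\<lambda>r. k r + \<kappa> * B r \<omega>))" if "i < n" for i
    proof (rule exp_tilt_derivative(2)[OF tfin tU fm _ Gb dB[OF that] C0])
      show "(\<lambda>\<omega>. B (t (Suc i)) \<omega> - B (t i) \<omega>) \<in> borel_measurable M"
        using that by (intro borel_measurable_diff Bt) auto
    qed
    have "(\<integral>\<omega>. l \<omega> * f (\<lambda>r. k r + \<kappa> * B r \<omega>) \<partial>M)
       = (\<integral>\<omega>. (\<Sum>i<n. (real n * w i) * ((B (t (Suc i)) \<omega> - B (t i) \<omega>) * f (\<lambda>r. k r + \<kappa> * B r \<omega>))) \<partial>M)"
      unfolding l_def sum_distrib_right by (simp only: mult.assoc)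
    also have "\<dots> = (\<Sum>i<n. (real n * w i) * b i k)"
      unfolding b_def using bi by (subst Bochner_Integration.integral_sum) auto
    also have "\<dots> = (real n / \<kappa>) * ((\<Sum>i<n. v (Suc i) * b i k) - (\<Sum>i<n. v i * b i k))"
      unfolding w_def sum_subtractf[symmetric] sum_distrib_left by (intro sum.cong) (auto simp: field_simps)
    also have "(\<Sum>i<n. v (Suc i) * b i k) = (\<Sum>i=1..n. v i * b (i - 1) k)"
      by (rule sum.reindex_bij_witness[where i = "\<lambda>i. i - 1" and j = Suc]) auto
    also have "(\<Sum>i<n. v i * b i k) = (\<Sum>i=1..n. v i * (if i < n then b i k else 0))"
    proof -
      have "(\<Sum>i=1..n. v i * (if i < n then b i k else 0)) = (\<Sum>i\<in>{1..<n}. v i * b i k)"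
        by (rule sum.mono_neutral_cong_right) auto
      moreover have "(\<Sum>i<n. v i * b i k) = (\<Sum>i\<in>{1..<n}. v i * b i k)"
        by (rule sum.mono_neutral_cong_right) (auto simp: v_def)
      ultimately show ?thesis by simp
    qed
    also have "(real n / \<kappa>) * ((\<Sum>i=1..n. v i * b (i - 1) k) - (\<Sum>i=1..n. v i * (if i < n then b i k else 0)))
       = (\<Sum>i=1..n. u (real i / real n) * D i k)"
      unfolding D_def sum_subtractf[symmetric] sum_distrib_left
      by (intro sum.cong refl) (auto simp: v_def t_def algebra_simps)
    finally show "((\<lambda>x. g (\<lambda>r. k r + x * u r)) has_real_derivative (\<Sum>i=1..n. u (real i / real n) * D i k)) (at 0)"
      using tilt unfolding eq by simp
  qed
qed

end

section \<open>Occupation integrals\<close>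

text \<open>Rounding the time down to a multiple of 1/(n+1) leaves countably many times, hence joint
  measurability, and continuity in time makes these approximations converge.\<close>

lemma caratheodory_measurable:
  fixes X :: "real \<Rightarrow> 'w \<Rightarrow> real"
  assumes m: "\<And>r. X r \<in> borel_measurable M"
    and c: "\<And>\<omega>. \<omega> \<in> space M \<Longrightarrow> continuous_on UNIV (\<lambda>r. X r \<omega>)"
  shows "(\<lambda>(r, \<omega>). X r \<omega>) \<in> borel_measurable (borel \<Otimes>\<^sub>M M)"
proof (rule borel_measurable_LIMSEQ_real)
  let ?X = "\<lambda>n (r, \<omega>). X (of_int \<lfloor>r * real (Suc n)\<rfloor> / real (Suc n)) \<omega>"
  show "?X n \<in> borel_measurable (borel \<Otimes>\<^sub>M M)" for n
  proof -
    have "(\<lambda>z. X (of_int \<lfloor>fst z * real (Suc n)\<rfloor> / real (Suc n)) (snd z)) \<in> borel_measurable (borel \<Otimes>\<^sub>M M)"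
    proof (rule measurable_compose_countable'[where g = "\<lambda>z. \<lfloor>fst z * real (Suc n)\<rfloor>" and I = UNIV
          and f = "\<lambda>i z. X (of_int i / real (Suc n)) (snd z)"])
      show "(\<lambda>z. X (of_int i / real (Suc n)) (snd z)) \<in> borel_measurable (borel \<Otimes>\<^sub>M M)" for i
        by (rule measurable_compose[OF measurable_snd m])
      show "(\<lambda>z. \<lfloor>fst z * real (Suc n)\<rfloor>) \<in> (borel \<Otimes>\<^sub>M M) \<rightarrow>\<^sub>M count_space UNIV"
        by measurable
    qed auto
    then show ?thesis by (simp add: case_prod_beta')
  qed
  show "(\<lambda>n. ?X n z) \<longlonglongrightarrow> (case z of (r, \<omega>) \<Rightarrow> X r \<omega>)" if z: "z \<in> space (borel \<Otimes>\<^sub>M M)" for z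
  proof -
    obtain r \<omega> where [simp]: "z = (r, \<omega>)" by (cases z)
    have \<omega>: "\<omega> \<in> space M" using z by (simp add: space_pair_measure)
    have "(\<lambda>n. of_int \<lfloor>r * real (Suc n)\<rfloor> / real (Suc n)) \<longlonglongrightarrow> r"
    proof (rule tendsto_sandwich)
      show "\<forall>\<^sub>F n in sequentially. r - 1 / real (Suc n) \<le> of_int \<lfloor>r * real (Suc n)\<rfloor> / real (Suc n)"
      proof (intro always_eventually allI)
        fix n
        have "r * real (Suc n) - 1 \<le> of_int \<lfloor>r * real (Suc n)\<rfloor>" by linarith
        then have "(r * real (Suc n) - 1) / real (Suc n) \<le> of_int \<lfloor>r * real (Suc n)\<rfloor> / real (Suc n)"
          by (rule divide_right_mono) simp
        then show "r - 1 / real (Suc n) \<le> of_int \<lfloor>r * real (Suc n)\<rfloor> / real (Suc n)"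
          by (simp only: diff_divide_distrib nonzero_mult_div_cancel_right of_nat_eq_0_iff Suc_not_Zero nat.simps simp_thms)
      qed
      show "\<forall>\<^sub>F n in sequentially. of_int \<lfloor>r * real (Suc n)\<rfloor> / real (Suc n) \<le> r"
      proof (intro always_eventually allI)
        fix n
        have "of_int \<lfloor>r * real (Suc n)\<rfloor> \<le> r * real (Suc n)" by linarith
        then show "of_int \<lfloor>r * real (Suc n)\<rfloor> / real (Suc n) \<le> r"
          by (simp add: pos_divide_le_eq)
      qed
      have "(\<lambda>n. r - 1 / real (Suc n)) \<longlonglongrightarrow> r - 0"
        by (intro tendsto_diff tendsto_const LIMSEQ_Suc[OF lim_1_over_n])
      then show "(\<lambda>n. r - 1 / real (Suc n)) \<longlonglongrightarrow> r" by simp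
    qed simp
    moreover have "isCont (\<lambda>r. X r \<omega>) r" using c[OF \<omega>] by (simp add: continuous_on_eq_continuous_at)
    ultimately have "(\<lambda>n. X (of_int \<lfloor>r * real (Suc n)\<rfloor> / real (Suc n)) \<omega>) \<longlonglongrightarrow> X r \<omega>"
      by (rule isCont_tendsto_compose[rotated])
    then show ?thesis by (simp only: \<open>z = (r, \<omega>)\<close> prod.case)
  qed
qed

text \<open>Minus the power of the tail integral is an antiderivative. In terms of multiple
  integrals, the k+1 times are put in order and r is the earliest of them, which leaves a k-fold
  integral over the times after r.\<close>

lemma power_integral_identity:
  fixes g :: "real \<Rightarrow> real"
  assumes g: "continuous_on UNIV g" "\<And>r. 0 \<le> g r" and ab: "\<alpha> \<le> \<beta>"
  shows "(\<integral>\<^sup>+r. ennreal (real (Suc k) * g r * (LINT s:{r..\<beta>}|lborel. g s) ^ k) * indicator {\<alpha>..\<beta>} r \<partial>lborel)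
    = ennreal ((LINT s:{\<alpha>..\<beta>}|lborel. g s) ^ Suc k)"
proof -
  let ?J = "\<lambda>r. integral {r..\<beta>} g"
  have J: "(LINT s:{r..\<beta>}|lborel. g s) = ?J r" for r
    by (intro set_borel_integral_eq_integral borel_integrable_atLeastAtMost' continuous_on_subset[OF g(1)]) auto
  have J0: "0 \<le> ?J r" for r
    by (intro Henstock_Kurzweil_Integration.integral_nonneg integrable_continuous_real continuous_on_subset[OF g(1)] g) auto
  have "((\<lambda>r. real (Suc k) * g r * ?J r ^ k) has_integral (- (?J \<beta> ^ Suc k)) - (- (?J \<alpha> ^ Suc k))) {\<alpha>..\<beta>}"
  proof (rule fundamental_theorem_of_calculus[OF ab])
    fix r assume r: "r \<in> {\<alpha>..\<beta>}"
    have "(?J has_real_derivative - g r) (at r within {\<alpha>..\<beta>})"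
      by (rule integral_has_real_derivative'[OF _ r]) (rule continuous_on_subset[OF g(1)], auto)
    from DERIV_minus[OF DERIV_power[OF this, of "Suc k"]]
    have "((\<lambda>r. - (?J r ^ Suc k)) has_real_derivative - (real (Suc k) * (- g r * ?J r ^ k))) (at r within {\<alpha>..\<beta>})"
      by (simp only: diff_Suc_Suc diff_zero)
    then show "((\<lambda>r. - (?J r ^ Suc k)) has_vector_derivative real (Suc k) * g r * ?J r ^ k) (at r within {\<alpha>..\<beta>})"
      by (simp add: has_real_derivative_iff_has_vector_derivative mult_ac)
  qed
  then have "((\<lambda>r. real (Suc k) * g r * ?J r ^ k) has_integral ?J \<alpha> ^ Suc k) {\<alpha>..\<beta>}" by simp
  then show ?thesis
    unfolding J by (intro nn_integral_has_integral_lebesgue') (use J0 g in auto)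
qed

text \<open>The exact value carries the constant 2 / sqrt (2 pi), which is below 1.\<close>

lemma nn_integral_inverse_sqrt_le:
  assumes "\<alpha> \<le> \<beta>"
  shows "(\<integral>\<^sup>+r. ennreal (1 / sqrt (2 * pi * (r - \<alpha>))) * indicator {\<alpha>..\<beta>} r \<partial>lborel) \<le> ennreal (sqrt (\<beta> - \<alpha>))"
proof -
  let ?c = "\<beta> - \<alpha>"
  let ?f = "\<lambda>x::real. (1 / sqrt (2 * pi)) * x powr (- 1 / 2)"
  have "((\<lambda>x. x powr (- 1 / 2)) has_integral (?c powr (- 1 / 2 + 1) / (- 1 / 2 + 1))) {0..?c}"
    by (rule has_integral_powr_from_0) (use assms in auto)
  then have "(?f has_integral (1 / sqrt (2 * pi)) * (?c powr (- 1 / 2 + 1) / (- 1 / 2 + 1))) {0..?c}"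
    by (rule has_integral_mult_right)
  then have hi: "(?f has_integral (2 / sqrt (2 * pi)) * sqrt ?c) {0..?c}"
    using assms by (simp add: powr_half_sqrt mult.commute)
  have "(\<integral>\<^sup>+r. ennreal (1 / sqrt (2 * pi * (r - \<alpha>))) * indicator {\<alpha>..\<beta>} r \<partial>lborel)
     = ennreal \<bar>1\<bar> * (\<integral>\<^sup>+x. ennreal (1 / sqrt (2 * pi * ((\<alpha> + 1 * x) - \<alpha>))) * indicator {\<alpha>..\<beta>} (\<alpha> + 1 * x) \<partial>lborel)"
    by (rule nn_integral_real_affine) auto
  also have "\<dots> = (\<integral>\<^sup>+x. ennreal (?f x) * indicator {0..?c} x \<partial>lborel)"
    unfolding abs_one ennreal_1 mult_1
  proof (rule nn_integral_cong)
    fix x :: real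
    have "1 / sqrt (2 * pi * ((\<alpha> + x) - \<alpha>)) = ?f x" if "x \<ge> 0"
      using that by (simp add: real_sqrt_mult powr_minus powr_half_sqrt divide_simps)
    then show "ennreal (1 / sqrt (2 * pi * ((\<alpha> + x) - \<alpha>))) * indicator {\<alpha>..\<beta>} (\<alpha> + x) = ennreal (?f x) * indicator {0..?c} x"
      by (auto simp: indicator_def)
  qed
  also have "\<dots> = ennreal ((2 / sqrt (2 * pi)) * sqrt ?c)"
    by (rule nn_integral_has_integral_lebesgue'[OF _ hi]) auto
  also have "\<dots> \<le> ennreal (1 * sqrt ?c)"
  proof (intro ennreal_leI mult_right_mono)
    have "sqrt 4 \<le> sqrt (2 * pi)" using pi_gt3 by (intro real_sqrt_le_mono) auto
    then show "2 / sqrt (2 * pi) \<le> 1" by (simp add: divide_simps)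
  qed (use assms in auto)
  finally show ?thesis by simp
qed

lemma power_le_exp:
  assumes "0 \<le> (y::real)"
  shows "y ^ k \<le> real k ^ k * exp y"
proof (cases "k = 0")
  case True then show ?thesis using assms by simp
next
  case False
  have "y / real k \<le> exp (y / real k)" using exp_ge_add_one_self[of "y / real k"] by linarith
  then have "(y / real k) ^ k \<le> exp (y / real k) ^ k" using assms by (intro power_mono) auto
  also have "\<dots> = exp y" using False by (simp add: exp_of_nat_mult[symmetric])
  finally show ?thesis using False by (simp add: power_divide field_simps)
qed

context brownian
begin

text \<open>The path frozen outside the unit interval. \<open>B\<close> is unspecified there,
  whereas \<open>W\<close> is continuous on the whole line and jointly measurable, so time windows
  can be handled without boundary cases.\<close>

definition W :: "real \<Rightarrow> 'w \<Rightarrow> real" where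
  "W r \<omega> = B (max 0 (min 1 r)) \<omega>"

lemma W_eq: "r \<in> {0..1} \<Longrightarrow> W r \<omega> = B r \<omega>"
  by (simp add: W_def)

lemma W_cont: "\<omega> \<in> space M \<Longrightarrow> continuous_on UNIV (\<lambda>r. W r \<omega>)"
  unfolding W_def by (intro continuous_on_compose2[OF B_cont] continuous_intros) auto

lemma W_measurable: "W r \<in> borel_measurable M"
  unfolding W_def[abs_def] by (intro B_measurable) auto

lemma W_joint: "(\<lambda>(r, \<omega>). W r \<omega>) \<in> borel_measurable (borel \<Otimes>\<^sub>M M)"
  by (intro caratheodory_measurable W_measurable W_cont)

lemma pair_sigma_lborel: "pair_sigma_finite lborel M"
  by (intro pair_sigma_finite.intro sigma_finite_lborel sigma_finite_measure_axioms)

lemma fubini_time: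
  fixes X :: "real \<Rightarrow> 'w \<Rightarrow> real"
  assumes X: "(\<lambda>(r, \<omega>). X r \<omega>) \<in> borel_measurable (borel \<Otimes>\<^sub>M M)"
    and A: "A \<in> sets borel" "A \<subseteq> {0..1}" and C: "C \<ge> 0"
    and b: "\<And>r. r \<in> A \<Longrightarrow> integrable M (X r)" "\<And>r. r \<in> A \<Longrightarrow> (\<integral>\<omega>. \<bar>X r \<omega>\<bar> \<partial>M) \<le> C"
  shows "integrable M (\<lambda>\<omega>. LINT r:A|lborel. X r \<omega>)"
    and "(\<integral>\<omega>. (LINT r:A|lborel. X r \<omega>) \<partial>M) = (LINT r:A|lborel. (\<integral>\<omega>. X r \<omega> \<partial>M))"
    and "set_integrable lborel A (\<lambda>r. \<integral>\<omega>. X r \<omega> \<partial>M)"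
proof -
  interpret LM: pair_sigma_finite lborel M by (rule pair_sigma_lborel)
  let ?Y = "\<lambda>r \<omega>. indicator A r *\<^sub>R X r \<omega>"
  have X'[measurable]: "(\<lambda>z. X (fst z) (snd z)) \<in> borel_measurable (lborel \<Otimes>\<^sub>M M)"
    using X by (simp add: case_prod_beta' measurable_cong_sets[OF sets_pair_measure_cong[OF sets_lborel refl] refl])
  have [measurable]: "A \<in> sets lborel" using A by simp
  have Ym: "(\<lambda>(r, \<omega>). ?Y r \<omega>) \<in> borel_measurable (lborel \<Otimes>\<^sub>M M)"
    unfolding case_prod_beta' by measurable
  have Yi: "integrable (lborel \<Otimes>\<^sub>M M) (\<lambda>(r, \<omega>). ?Y r \<omega>)"
  proof (rule integrableI_bounded[OF Ym])
    have "(\<integral>\<^sup>+z. ennreal (norm (case z of (r, \<omega>) \<Rightarrow> ?Y r \<omega>)) \<partial>(lborel \<Otimes>\<^sub>M M))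
       = (\<integral>\<^sup>+r. (\<integral>\<^sup>+\<omega>. ennreal (norm (?Y r \<omega>)) \<partial>M) \<partial>lborel)"
      using Ym by (subst nn_integral_fst[symmetric]) (auto simp: case_prod_beta')
    also have "\<dots> \<le> (\<integral>\<^sup>+r. ennreal C * indicator {0..1::real} r \<partial>lborel)"
    proof (rule nn_integral_mono)
      fix r :: real
      show "(\<integral>\<^sup>+\<omega>. ennreal (norm (?Y r \<omega>)) \<partial>M) \<le> ennreal C * indicator {0..1} r"
      proof (cases "r \<in> A")
        case True
        have "(\<integral>\<^sup>+\<omega>. ennreal (norm (?Y r \<omega>)) \<partial>M) = (\<integral>\<^sup>+\<omega>. ennreal \<bar>X r \<omega>\<bar> \<partial>M)"
          using True by simp
        also have "\<dots> = ennreal (\<integral>\<omega>. \<bar>X r \<omega>\<bar> \<partial>M)"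
          using b(1)[OF True] by (intro nn_integral_eq_integral integrable_abs) auto
        also have "\<dots> \<le> ennreal C" using b(2)[OF True] by (rule ennreal_leI)
        finally show ?thesis using True A by auto
      qed simp
    qed
    also have "\<dots> = ennreal C" by (subst nn_integral_cmult) auto
    finally show "(\<integral>\<^sup>+z. ennreal (norm (case z of (r, \<omega>) \<Rightarrow> ?Y r \<omega>)) \<partial>(lborel \<Otimes>\<^sub>M M)) < \<infinity>"
      by (rule order.strict_trans1) simp
  qed
  show "integrable M (\<lambda>\<omega>. LINT r:A|lborel. X r \<omega>)"
    unfolding set_lebesgue_integral_def by (rule LM.integrable_snd[OF Yi])
  have eq: "(\<integral>\<omega>. indicator A r *\<^sub>R X r \<omega> \<partial>M) = indicator A r *\<^sub>R (\<integral>\<omega>. X r \<omega> \<partial>M)" for r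
    by simp
  show "(\<integral>\<omega>. (LINT r:A|lborel. X r \<omega>) \<partial>M) = (LINT r:A|lborel. (\<integral>\<omega>. X r \<omega> \<partial>M))"
    unfolding set_lebesgue_integral_def using LM.Fubini_integral[OF Yi] by (simp only: eq)
  show "set_integrable lborel A (\<lambda>r. \<integral>\<omega>. X r \<omega> \<partial>M)"
    unfolding set_integrable_def using LM.integrable_fst[OF Yi] by (simp only: eq)
qed

text \<open>For \<phi> concentrated near a level this approximates the local time accumulated at
  that level between the times \<alpha> and \<beta>.\<close>

definition occ :: "(real \<Rightarrow> real) \<Rightarrow> real \<Rightarrow> real \<Rightarrow> 'w \<Rightarrow> real" where
  "occ \<phi> \<alpha> \<beta> \<omega> = (LINT r:{\<alpha>..\<beta>}|lborel. \<phi> (W r \<omega>))"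

lemma occ_joint:
  assumes "continuous_on UNIV \<phi>"
  shows "(\<lambda>(r, \<omega>). occ \<phi> r \<beta> \<omega>) \<in> borel_measurable (borel \<Otimes>\<^sub>M M)"
proof -
  have [measurable]: "\<phi> \<in> borel_measurable borel" by (rule borel_measurable_continuous_onI[OF assms])
  have W': "(\<lambda>z. W (fst z) (snd z)) \<in> borel_measurable (borel \<Otimes>\<^sub>M M)"
    using W_joint by (simp add: case_prod_beta')
  have Wz[measurable]: "(\<lambda>z. W (snd z) (snd (fst z))) \<in> borel_measurable ((borel \<Otimes>\<^sub>M M) \<Otimes>\<^sub>M lborel)"
    using measurable_compose[OF _ W', of "\<lambda>z. (snd z, snd (fst z))" "(borel \<Otimes>\<^sub>M M) \<Otimes>\<^sub>M lborel"] by simp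
  have "(\<lambda>z. \<integral>s. (if fst z \<le> s \<and> s \<le> \<beta> then \<phi> (W s (snd z)) else 0) \<partial>lborel) \<in> borel_measurable (borel \<Otimes>\<^sub>M M)"
  proof (rule lborel.borel_measurable_lebesgue_integral)
    show "(\<lambda>(z, s). if fst z \<le> s \<and> s \<le> \<beta> then \<phi> (W s (snd z)) else 0) \<in> borel_measurable ((borel \<Otimes>\<^sub>M M) \<Otimes>\<^sub>M lborel)"
      unfolding case_prod_beta' by measurable
  qed
  moreover have "occ \<phi> r \<beta> \<omega> = (\<integral>s. (if r \<le> s \<and> s \<le> \<beta> then \<phi> (W s \<omega>) else 0) \<partial>lborel)" for r \<omega>
    unfolding occ_def set_lebesgue_integral_def by (intro Bochner_Integration.integral_cong) (auto simp: indicator_def)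
  ultimately show ?thesis by (simp add: case_prod_beta')
qed

lemma occ_measurable:
  assumes "continuous_on UNIV \<phi>"
  shows "occ \<phi> r \<beta> \<in> borel_measurable M"
  using measurable_compose[OF measurable_Pair1' occ_joint[OF assms, of \<beta>], of r] by simp

lemma occ_nonneg: "(\<And>x. 0 \<le> \<phi> x) \<Longrightarrow> 0 \<le> occ \<phi> r \<beta> \<omega>"
  unfolding occ_def set_lebesgue_integral_def by (intro Bochner_Integration.integral_nonneg) auto

lemma occ_power:
  assumes \<phi>: "continuous_on UNIV \<phi>" "\<And>x. 0 \<le> \<phi> x" and "\<alpha> \<le> \<beta>" "\<omega> \<in> space M"
  shows "ennreal (occ \<phi> \<alpha> \<beta> \<omega> ^ Suc k) =
    (\<integral>\<^sup>+r. ennreal (real (Suc k) * \<phi> (W r \<omega>) * occ \<phi> r \<beta> \<omega> ^ k) * indicator {\<alpha>..\<beta>} r \<partial>lborel)"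
  unfolding occ_def
  by (rule power_integral_identity[symmetric])
    (use assms in \<open>auto intro!: continuous_on_compose2[OF \<phi>(1)] W_cont\<close>)

text \<open>Isolates the earliest of the k+1 times, so that the density bound can be spent on it
  while the k later times stay together in a power of the occupation integral.\<close>

lemma nn_fubini_occ_power:
  assumes \<phi>: "continuous_on UNIV \<phi>" "\<And>x. 0 \<le> \<phi> x" and ab: "\<alpha> \<le> \<beta>" and G: "G \<in> borel_measurable M"
  shows "(\<integral>\<^sup>+\<omega>. G \<omega> * ennreal (occ \<phi> \<alpha> \<beta> \<omega> ^ Suc k) \<partial>M) =
    (\<integral>\<^sup>+r. (\<integral>\<^sup>+\<omega>. G \<omega> * ennreal (\<phi> (W r \<omega>)) * ennreal (occ \<phi> r \<beta> \<omega> ^ k) \<partial>M) * (ennreal (real (Suc k)) * indicator {\<alpha>..\<beta>} r) \<partial>lborel)"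
proof -
  interpret LM: pair_sigma_finite lborel M by (rule pair_sigma_lborel)
  have [measurable]: "\<phi> \<in> borel_measurable borel" by (rule borel_measurable_continuous_onI[OF \<phi>(1)])
  have [measurable]: "(\<lambda>z. W (fst z) (snd z)) \<in> borel_measurable (lborel \<Otimes>\<^sub>M M)"
    "(\<lambda>z. occ \<phi> (fst z) \<beta> (snd z)) \<in> borel_measurable (lborel \<Otimes>\<^sub>M M)"
    using W_joint occ_joint[OF \<phi>(1), of \<beta>]
    by (simp_all add: case_prod_beta' measurable_cong_sets[OF sets_pair_measure_cong[OF sets_lborel refl] refl])
  note [measurable] = G W_measurable occ_measurable[OF \<phi>(1)]
  let ?h = "\<lambda>r \<omega>. G \<omega> * ennreal (\<phi> (W r \<omega>)) * ennreal (occ \<phi> r \<beta> \<omega> ^ k) * (ennreal (real (Suc k)) * indicator {\<alpha>..\<beta>} r)"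
  have Wr: "(\<lambda>r. W r \<omega>) \<in> borel_measurable borel" if "\<omega> \<in> space M" for \<omega>
    by (rule borel_measurable_continuous_onI[OF W_cont[OF that]])
  have or: "(\<lambda>r. occ \<phi> r \<beta> \<omega>) \<in> borel_measurable borel" if "\<omega> \<in> space M" for \<omega>
    using measurable_compose[OF measurable_Pair2'[OF that] occ_joint[OF \<phi>(1), of \<beta>]] by simp
  have "(\<integral>\<^sup>+\<omega>. G \<omega> * ennreal (occ \<phi> \<alpha> \<beta> \<omega> ^ Suc k) \<partial>M) = (\<integral>\<^sup>+\<omega>. (\<integral>\<^sup>+r. ?h r \<omega> \<partial>lborel) \<partial>M)"
  proof (rule nn_integral_cong)
    fix \<omega> assume \<omega>: "\<omega> \<in> space M"
    note [measurable] = Wr[OF \<omega>] or[OF \<omega>]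
    have "G \<omega> * ennreal (occ \<phi> \<alpha> \<beta> \<omega> ^ Suc k)
      = (\<integral>\<^sup>+r. G \<omega> * (ennreal (real (Suc k) * \<phi> (W r \<omega>) * occ \<phi> r \<beta> \<omega> ^ k) * indicator {\<alpha>..\<beta>} r) \<partial>lborel)"
      unfolding occ_power[OF \<phi> ab \<omega>] by (rule nn_integral_cmult[symmetric]) measurable
    also have "\<dots> = (\<integral>\<^sup>+r. ?h r \<omega> \<partial>lborel)"
      by (intro nn_integral_cong) (simp add: ennreal_mult \<phi>(2) occ_nonneg mult_ac del: of_nat_Suc)
    finally show "G \<omega> * ennreal (occ \<phi> \<alpha> \<beta> \<omega> ^ Suc k) = (\<integral>\<^sup>+r. ?h r \<omega> \<partial>lborel)" .
  qed
  also have "\<dots> = (\<integral>\<^sup>+r. (\<integral>\<^sup>+\<omega>. ?h r \<omega> \<partial>M) \<partial>lborel)"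
    by (rule LM.Fubini') measurable
  also have "\<dots> = (\<integral>\<^sup>+r. (\<integral>\<^sup>+\<omega>. G \<omega> * ennreal (\<phi> (W r \<omega>)) * ennreal (occ \<phi> r \<beta> \<omega> ^ k) \<partial>M) * (ennreal (real (Suc k)) * indicator {\<alpha>..\<beta>} r) \<partial>lborel)"
    by (intro nn_integral_cong nn_integral_multc) measurable
  finally show ?thesis .
qed

text \<open>Induction over all starting times and all functionals of the past. With r the earliest
  time, \<open>G\<close> times \<phi>(\<open>B r\<close>) is a functional of the past of r, so the
  hypothesis treats the times after r; then \<open>one_step\<close> pays 1 / sqrt (2 pi (r -
  \<alpha>)), whose integral is at most sqrt (\<beta> - \<alpha>). Each step contributes one such
  root and one factor of the factorial.\<close>

lemma occ_moment:
  fixes G :: "(real \<Rightarrow> real) \<Rightarrow> ennreal"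
  assumes \<phi>: "continuous_on UNIV \<phi>" "\<And>x. 0 \<le> \<phi> x" "(\<integral>\<^sup>+x. ennreal (\<phi> x) \<partial>lborel) \<le> 1"
    and "0 \<le> \<alpha>" "\<alpha> \<le> \<beta>" "\<beta> \<le> 1" "finite T" "T \<subseteq> {0..\<alpha>}" "cyl T G"
  shows "(\<integral>\<^sup>+\<omega>. G (\<lambda>r. B r \<omega>) * ennreal (occ \<phi> \<alpha> \<beta> \<omega> ^ k) \<partial>M)
    \<le> ennreal (fact k * sqrt (\<beta> - \<alpha>) ^ k) * (\<integral>\<^sup>+\<omega>. G (\<lambda>r. B r \<omega>) \<partial>M)"
  using assms(4-)
proof (induction k arbitrary: \<alpha> T G)
  case 0
  then show ?case by simp
next
  case (Suc k)
  let ?I = "\<integral>\<^sup>+\<omega>. G (\<lambda>r. B r \<omega>) \<partial>M"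
  let ?C = "ennreal (fact k * sqrt (\<beta> - \<alpha>) ^ k)"
  have \<phi>m: "(\<lambda>x. ennreal (\<phi> x)) \<in> borel_measurable borel"
    using borel_measurable_continuous_onI[OF \<phi>(1)] by measurable
  have T1: "T \<subseteq> {0..1}" using Suc.prems by auto
  have "(\<integral>\<^sup>+\<omega>. G (\<lambda>r. B r \<omega>) * ennreal (occ \<phi> \<alpha> \<beta> \<omega> ^ Suc k) \<partial>M) =
    (\<integral>\<^sup>+r. (\<integral>\<^sup>+\<omega>. G (\<lambda>r. B r \<omega>) * ennreal (\<phi> (W r \<omega>)) * ennreal (occ \<phi> r \<beta> \<omega> ^ k) \<partial>M) * (ennreal (real (Suc k)) * indicator {\<alpha>..\<beta>} r) \<partial>lborel)"
    by (rule nn_fubini_occ_power[OF \<phi>(1,2) Suc.prems(2) cyl_B_measurable[OF Suc.prems(6) T1]])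
  also have "\<dots> \<le> (\<integral>\<^sup>+r. (?C * ennreal (real (Suc k)) * ?I) * (ennreal (1 / sqrt (2 * pi * (r - \<alpha>))) * indicator {\<alpha>..\<beta>} r) \<partial>lborel)"
  proof (rule nn_integral_mono_AE)
    \<comment> \<open>At r = \<alpha> the right-hand side is 0, since 1 / sqrt 0 is 0 by convention;
      the density bound holds for r > \<alpha> only.\<close>
    have "AE r in lborel. r \<noteq> \<alpha>" by (rule AE_lborel_singleton)
    then show "AE r in lborel. (\<integral>\<^sup>+\<omega>. G (\<lambda>r. B r \<omega>) * ennreal (\<phi> (W r \<omega>)) * ennreal (occ \<phi> r \<beta> \<omega> ^ k) \<partial>M) * (ennreal (real (Suc k)) * indicator {\<alpha>..\<beta>} r)
       \<le> (?C * ennreal (real (Suc k)) * ?I) * (ennreal (1 / sqrt (2 * pi * (r - \<alpha>))) * indicator {\<alpha>..\<beta>} r)"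
    proof eventually_elim
      case (elim r)
      show ?case
      proof (cases "r \<in> {\<alpha>..\<beta>}")
        case True
        then have r: "\<alpha> < r" "r \<le> \<beta>" "r \<le> 1" "0 \<le> r" using elim Suc.prems by auto
        let ?T = "insert r T"
        have cG: "cyl ?T (\<lambda>k. G k * ennreal (\<phi> (k r)))"
          by (intro cyl_times_ennreal cyl_mono[OF Suc.prems(6)] cyl_compose[OF \<phi>m] cyl_coord) auto
        have "(\<integral>\<^sup>+\<omega>. G (\<lambda>r. B r \<omega>) * ennreal (\<phi> (W r \<omega>)) * ennreal (occ \<phi> r \<beta> \<omega> ^ k) \<partial>M)
          = (\<integral>\<^sup>+\<omega>. (G (\<lambda>r. B r \<omega>) * ennreal (\<phi> (B r \<omega>))) * ennreal (occ \<phi> r \<beta> \<omega> ^ k) \<partial>M)"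
          using r by (simp add: W_eq)
        also have "\<dots> \<le> ennreal (fact k * sqrt (\<beta> - r) ^ k) * (\<integral>\<^sup>+\<omega>. G (\<lambda>r. B r \<omega>) * ennreal (\<phi> (B r \<omega>)) \<partial>M)"
          using r Suc.prems by (intro Suc.IH[OF _ _ _ _ _ cG]) auto
        also have "\<dots> \<le> ?C * (ennreal (1 / sqrt (2 * pi * (r - \<alpha>))) * ?I)"
        proof (intro mult_mono)
          show "ennreal (fact k * sqrt (\<beta> - r) ^ k) \<le> ?C"
            using r by (intro ennreal_leI mult_left_mono power_mono) auto
          show "(\<integral>\<^sup>+\<omega>. G (\<lambda>r. B r \<omega>) * ennreal (\<phi> (B r \<omega>)) \<partial>M) \<le> ennreal (1 / sqrt (2 * pi * (r - \<alpha>))) * ?I"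
            using r Suc.prems by (intro one_step[OF _ _ _ _ _ _ \<phi>m \<phi>(3)]) auto
        qed auto
        finally have "(\<integral>\<^sup>+\<omega>. G (\<lambda>r. B r \<omega>) * ennreal (\<phi> (W r \<omega>)) * ennreal (occ \<phi> r \<beta> \<omega> ^ k) \<partial>M)
          \<le> ?C * (ennreal (1 / sqrt (2 * pi * (r - \<alpha>))) * ?I)" .
        then have "(\<integral>\<^sup>+\<omega>. G (\<lambda>r. B r \<omega>) * ennreal (\<phi> (W r \<omega>)) * ennreal (occ \<phi> r \<beta> \<omega> ^ k) \<partial>M) * (ennreal (real (Suc k)) * indicator {\<alpha>..\<beta>} r)
          \<le> ?C * (ennreal (1 / sqrt (2 * pi * (r - \<alpha>))) * ?I) * (ennreal (real (Suc k)) * indicator {\<alpha>..\<beta>} r)"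
          by (intro mult_right_mono) auto
        then show ?thesis by (simp only: mult_ac)
      qed simp
    qed
  qed
  also have "\<dots> = (?C * ennreal (real (Suc k)) * ?I) * (\<integral>\<^sup>+r. ennreal (1 / sqrt (2 * pi * (r - \<alpha>))) * indicator {\<alpha>..\<beta>} r \<partial>lborel)"
    by (rule nn_integral_cmult) measurable
  also have "\<dots> \<le> (?C * ennreal (real (Suc k)) * ?I) * ennreal (sqrt (\<beta> - \<alpha>))"
    by (intro mult_left_mono nn_integral_inverse_sqrt_le Suc.prems) auto
  also have "\<dots> = (?C * ennreal (real (Suc k)) * ennreal (sqrt (\<beta> - \<alpha>))) * ?I" by (simp only: mult_ac)
  also have "?C * ennreal (real (Suc k)) * ennreal (sqrt (\<beta> - \<alpha>)) = ennreal (fact (Suc k) * sqrt (\<beta> - \<alpha>) ^ Suc k)"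
    using Suc.prems by (subst ennreal_mult[symmetric], simp, simp)+ (simp add: mult_ac)
  finally show ?case .
qed

end

section \<open>Random variables with all moments\<close>

lemma set_integrable_cont: "continuous_on UNIV g \<Longrightarrow> set_integrable lborel {a..b} (g :: real \<Rightarrow> real)"
  by (rule borel_integrable_atLeastAtMost'[OF continuous_on_subset[OF _ subset_UNIV]])

lemma set_integral_const_01: "(LINT s:{0..1::real}|lborel. c) = (c :: real)"
  by (simp add: set_lebesgue_integral_def)

text \<open>Jensen's inequality on the unit interval, again from the tangent of exp at the
  mean.\<close>

lemma exp_integral_le:
  fixes g :: "real \<Rightarrow> real"
  assumes g: "continuous_on UNIV g"
  shows "exp (LINT s:{0..1}|lborel. g s) \<le> (LINT s:{0..1}|lborel. exp (g s))"
proof -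
  let ?m = "LINT s:{0..1}|lborel. g s"
  have i: "set_integrable lborel {0..1} (\<lambda>s. exp ?m * (1 + (g s - ?m)))"
    "set_integrable lborel {0..1} (\<lambda>s. exp (g s))"
    by (intro set_integrable_cont continuous_intros g)+
  have "(LINT s:{0..1}|lborel. exp ?m * (1 + (g s - ?m))) \<le> (LINT s:{0..1}|lborel. exp (g s))"
  proof (rule set_integral_mono[OF i])
    fix s
    have "exp ?m * (1 + (g s - ?m)) \<le> exp ?m * exp (g s - ?m)" by (intro mult_left_mono) auto
    then show "exp ?m * (1 + (g s - ?m)) \<le> exp (g s)" by (simp add: exp_add[symmetric])
  qed
  moreover have "(LINT s:{0..1}|lborel. exp ?m * (1 + (g s - ?m))) = exp ?m"
  proof -
    have "(LINT s:{0..1}|lborel. exp ?m * (1 + (g s - ?m))) = exp ?m * (LINT s:{0..1}|lborel. (1 - ?m) + g s)"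
      by (subst set_integral_mult_right[symmetric]) (simp add: algebra_simps)
    also have "(LINT s:{0..1}|lborel. (1 - ?m) + g s) = (1 - ?m) + ?m"
      by (subst set_integral_add) (auto intro!: set_integrable_cont g simp: set_integral_const_01)
    finally show ?thesis by simp
  qed
  ultimately show ?thesis by simp
qed

context brownian
begin

text \<open>All moments instead of a fixed one: the class is closed under products, so integrability
  of the many products below follows from closure rules alone.\<close>

definition Lp :: "('w \<Rightarrow> real) \<Rightarrow> bool" where
  "Lp X \<longleftrightarrow> X \<in> borel_measurable M \<and> (\<forall>p::nat. integrable M (\<lambda>\<omega>. \<bar>X \<omega>\<bar> ^ p))"

lemma Lp_measurable: "Lp X \<Longrightarrow> X \<in> borel_measurable M"
  by (simp add: Lp_def)

lemma Lp_power_integrable: "Lp X \<Longrightarrow> integrable M (\<lambda>\<omega>. \<bar>X \<omega>\<bar> ^ p)"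
  by (simp add: Lp_def)

lemma Lp_square_integrable: "Lp X \<Longrightarrow> integrable M (\<lambda>\<omega>. (X \<omega>)\<^sup>2)"
  using Lp_power_integrable[of X 2] by simp

lemma Lp_integrable: "Lp X \<Longrightarrow> integrable M X"
  by (rule integrable_abs_cancel) (use Lp_power_integrable[of X 1] Lp_measurable[of X] in simp_all)

lemma LpI_dominated:
  assumes Y: "Lp Y" and X: "X \<in> borel_measurable M" and le: "\<And>\<omega>. \<omega> \<in> space M \<Longrightarrow> \<bar>X \<omega>\<bar> \<le> Y \<omega>"
  shows "Lp X"
  unfolding Lp_def
proof (intro conjI allI X)
  fix p
  show "integrable M (\<lambda>\<omega>. \<bar>X \<omega>\<bar> ^ p)"
  proof (rule Bochner_Integration.integrable_bound[OF Lp_power_integrable[OF Y, of p]])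
    show "AE \<omega> in M. norm (\<bar>X \<omega>\<bar> ^ p) \<le> norm (\<bar>Y \<omega>\<bar> ^ p)"
    proof (rule AE_I2)
      fix \<omega> assume "\<omega> \<in> space M"
      then have "\<bar>X \<omega>\<bar> \<le> \<bar>Y \<omega>\<bar>" using le[of \<omega>] by linarith
      then show "norm (\<bar>X \<omega>\<bar> ^ p) \<le> norm (\<bar>Y \<omega>\<bar> ^ p)" by (simp add: power_mono)
    qed
  qed (use X in auto)
qed

lemma Lp_const: "Lp (\<lambda>_. c)"
  unfolding Lp_def by simp

lemma Lp_add:
  assumes X: "Lp X" and Y: "Lp Y"
  shows "Lp (\<lambda>\<omega>. X \<omega> + Y \<omega>)"
  unfolding Lp_def
proof (intro conjI allI)
  fix p :: nat
  show "integrable M (\<lambda>\<omega>. \<bar>X \<omega> + Y \<omega>\<bar> ^ p)"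
  proof (rule Bochner_Integration.integrable_bound)
    show "integrable M (\<lambda>\<omega>. 2 ^ p * (\<bar>X \<omega>\<bar> ^ p + \<bar>Y \<omega>\<bar> ^ p))"
      by (intro integrable_mult_right Bochner_Integration.integrable_add Lp_power_integrable X Y)
    show "AE \<omega> in M. norm (\<bar>X \<omega> + Y \<omega>\<bar> ^ p) \<le> norm (2 ^ p * (\<bar>X \<omega>\<bar> ^ p + \<bar>Y \<omega>\<bar> ^ p))"
    proof (rule AE_I2)
      fix \<omega>
      let ?m = "max \<bar>X \<omega>\<bar> \<bar>Y \<omega>\<bar>"
      have "\<bar>X \<omega> + Y \<omega>\<bar> ^ p \<le> (2 * ?m) ^ p" by (intro power_mono) auto
      also have "\<dots> = 2 ^ p * ?m ^ p" by (rule power_mult_distrib)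
      also have "\<dots> \<le> 2 ^ p * (\<bar>X \<omega>\<bar> ^ p + \<bar>Y \<omega>\<bar> ^ p)"
        by (intro mult_left_mono) (auto simp: max_def)
      finally show "norm (\<bar>X \<omega> + Y \<omega>\<bar> ^ p) \<le> norm (2 ^ p * (\<bar>X \<omega>\<bar> ^ p + \<bar>Y \<omega>\<bar> ^ p))" by simp
    qed
  qed (use Lp_measurable[OF X] Lp_measurable[OF Y] in auto)
qed (use Lp_measurable[OF X] Lp_measurable[OF Y] in auto)

lemma Lp_mult:
  assumes X: "Lp X" and Y: "Lp Y"
  shows "Lp (\<lambda>\<omega>. X \<omega> * Y \<omega>)"
  unfolding Lp_def
proof (intro conjI allI)
  fix p :: nat
  show "integrable M (\<lambda>\<omega>. \<bar>X \<omega> * Y \<omega>\<bar> ^ p)"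
  proof (rule Bochner_Integration.integrable_bound)
    show "integrable M (\<lambda>\<omega>. \<bar>X \<omega>\<bar> ^ (p * 2) + \<bar>Y \<omega>\<bar> ^ (p * 2))"
      by (intro Bochner_Integration.integrable_add Lp_power_integrable X Y)
    show "AE \<omega> in M. norm (\<bar>X \<omega> * Y \<omega>\<bar> ^ p) \<le> norm (\<bar>X \<omega>\<bar> ^ (p * 2) + \<bar>Y \<omega>\<bar> ^ (p * 2))"
    proof (rule AE_I2)
      fix \<omega>
      have "a * b \<le> a\<^sup>2 + b\<^sup>2" if "0 \<le> a" "0 \<le> b" for a b :: real
        using zero_le_power2[of "a - b"] mult_nonneg_nonneg[OF that] unfolding power2_diff by linarith
      from this[of "\<bar>X \<omega>\<bar> ^ p" "\<bar>Y \<omega>\<bar> ^ p"]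
      show "norm (\<bar>X \<omega> * Y \<omega>\<bar> ^ p) \<le> norm (\<bar>X \<omega>\<bar> ^ (p * 2) + \<bar>Y \<omega>\<bar> ^ (p * 2))"
        by (simp add: power_mult_distrib abs_mult power_mult[symmetric])
    qed
  qed (use Lp_measurable[OF X] Lp_measurable[OF Y] in auto)
qed (use Lp_measurable[OF X] Lp_measurable[OF Y] in auto)

lemma Lp_sum: "(\<And>i. i \<in> I \<Longrightarrow> Lp (X i)) \<Longrightarrow> Lp (\<lambda>\<omega>. \<Sum>i\<in>I. X i \<omega>)"
  by (induction I rule: infinite_finite_induct) (auto intro: Lp_const Lp_add)

lemma Lp_power: "Lp X \<Longrightarrow> Lp (\<lambda>\<omega>. X \<omega> ^ n)"
  by (induction n) (auto intro: Lp_const Lp_mult)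

lemma Lp_minus: "Lp X \<Longrightarrow> Lp Y \<Longrightarrow> Lp (\<lambda>\<omega>. X \<omega> - Y \<omega>)"
  using Lp_add[of X "\<lambda>\<omega>. (- 1) * Y \<omega>"] Lp_mult[OF Lp_const[of "- 1"], of Y] by simp

lemma Lp_exp_growth:
  assumes S: "finite S" "S \<subseteq> {0..1}" and X: "X \<in> borel_measurable M"
    and b: "\<And>\<omega>. \<omega> \<in> space M \<Longrightarrow> \<bar>X \<omega>\<bar> \<le> C * exp (c * coord_norm S (\<lambda>s. B s \<omega>))"
  shows "Lp X"
proof (rule LpI_dominated[OF _ X b])
  have m: "(\<lambda>\<omega>. exp (c * coord_norm S (\<lambda>s. B s \<omega>))) \<in> borel_measurable M"
    using coord_norm_B_measurable[OF S(2)] by auto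
  have "Lp (\<lambda>\<omega>. exp (c * coord_norm S (\<lambda>s. B s \<omega>)))"
    unfolding Lp_def
  proof (intro conjI allI m)
    fix p
    show "integrable M (\<lambda>\<omega>. \<bar>exp (c * coord_norm S (\<lambda>s. B s \<omega>))\<bar> ^ p)"
      using integrable_exp_coord_norm[OF S, of "real p * c"] by (simp add: exp_of_nat_mult[symmetric] mult.assoc)
  qed
  then show "Lp (\<lambda>\<omega>. C * exp (c * coord_norm S (\<lambda>s. B s \<omega>)))" by (intro Lp_mult Lp_const)
qed

lemma Lp_exp_lip:
  assumes S: "finite S" "S \<subseteq> {0..1}" and f: "exp_lip S f"
  shows "Lp (\<lambda>\<omega>. f (\<lambda>s. B s \<omega>))"
proof -
  obtain C where C: "C \<ge> 0" "\<And>k. \<bar>f k\<bar> \<le> C * exp (C * coord_norm S k)" using exp_lip_growth[OF f] by blast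
  show ?thesis
    by (rule Lp_exp_growth[OF S cyl_B_measurable[OF exp_lip_cyl[OF S(1) f] S(2)] C(2)])
qed

lemma Lp_W: "Lp (W r)"
proof -
  let ?r = "max 0 (min 1 r)"
  have "Lp (\<lambda>\<omega>. B ?r \<omega>)"
    by (rule Lp_exp_lip[where S = "{?r}"]) (auto intro: exp_lip_coord)
  then show ?thesis by (simp add: W_def[abs_def])
qed

lemma Lp_bounded: "X \<in> borel_measurable M \<Longrightarrow> (\<And>\<omega>. \<bar>X \<omega>\<bar> \<le> c) \<Longrightarrow> Lp X"
  by (rule LpI_dominated[OF Lp_const[of c]])

text \<open>The squared L2(0,1) norm of the path. A multiple of \<open>1 + Q\<close> dominates every
  time integral of the path against a bounded weight, whatever the position of that weight, and so
  supplies majorants uniform in \<theta>.\<close>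

definition Q :: "'w \<Rightarrow> real" where
  "Q \<omega> = (LINT s:{0..1}|lborel. (W s \<omega>)\<^sup>2)"

lemma W_mult_joint:
  assumes k: "k \<in> borel_measurable borel" and G: "G \<in> borel_measurable M"
  shows "(\<lambda>(s, \<omega>). k s * W s \<omega> * G \<omega>) \<in> borel_measurable (borel \<Otimes>\<^sub>M M)"
proof -
  have [measurable]: "(\<lambda>z. W (fst z) (snd z)) \<in> borel_measurable (borel \<Otimes>\<^sub>M M)"
    using W_joint by (simp add: case_prod_beta')
  note [measurable] = k G
  show ?thesis unfolding case_prod_beta' by measurable
qed

lemma W_compose_joint:
  assumes [measurable]: "\<phi> \<in> borel_measurable borel"
  shows "(\<lambda>(s, \<omega>). \<phi> (W s \<omega>)) \<in> borel_measurable (borel \<Otimes>\<^sub>M M)"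
proof -
  have [measurable]: "(\<lambda>z. W (fst z) (snd z)) \<in> borel_measurable (borel \<Otimes>\<^sub>M M)"
    using W_joint by (simp add: case_prod_beta')
  show ?thesis unfolding case_prod_beta' by measurable
qed

lemma time_integral_measurable:
  assumes X: "(\<lambda>(r, \<omega>). X r \<omega>) \<in> borel_measurable (borel \<Otimes>\<^sub>M M)" and A: "A \<in> sets borel"
  shows "(\<lambda>\<omega>. LINT r:A|lborel. (X r \<omega> :: real)) \<in> borel_measurable M"
  unfolding set_lebesgue_integral_def
proof (rule lborel.borel_measurable_lebesgue_integral)
  have [measurable]: "(\<lambda>z. X (fst z) (snd z)) \<in> borel_measurable (borel \<Otimes>\<^sub>M M)"
    using X by (simp add: case_prod_beta')
  have "(\<lambda>z. X (snd z) (fst z)) \<in> borel_measurable (M \<Otimes>\<^sub>M lborel)"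
    using measurable_compose[OF _ \<open>(\<lambda>z. X (fst z) (snd z)) \<in> borel_measurable (borel \<Otimes>\<^sub>M M)\<close>, of "\<lambda>z. (snd z, fst z)" "M \<Otimes>\<^sub>M lborel"] by simp
  then show "(\<lambda>(\<omega>, r). indicat_real A r *\<^sub>R X r \<omega>) \<in> borel_measurable (M \<Otimes>\<^sub>M lborel)"
    unfolding case_prod_beta' using A by measurable
qed

lemma Q_measurable: "Q \<in> borel_measurable M"
  unfolding Q_def[abs_def] by (intro time_integral_measurable W_compose_joint) auto

lemma Q_nonneg: "0 \<le> Q \<omega>"
  unfolding Q_def set_lebesgue_integral_def by (intro Bochner_Integration.integral_nonneg) auto

lemma Q_exp: "integrable M (\<lambda>\<omega>. exp (Q \<omega> / 4))"
proof (rule Bochner_Integration.integrable_bound)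
  show "integrable M (\<lambda>\<omega>. LINT s:{0..1}|lborel. exp ((W s \<omega>)\<^sup>2 / 4))"
  proof (rule fubini_time(1)[where C = 2])
    show "(\<lambda>(s, \<omega>). exp ((W s \<omega>)\<^sup>2 / 4)) \<in> borel_measurable (borel \<Otimes>\<^sub>M M)"
      by (rule W_compose_joint) auto
    fix r :: real assume "r \<in> {0..1}"
    then show "integrable M (\<lambda>\<omega>. exp ((W r \<omega>)\<^sup>2 / 4))" "(\<integral>\<omega>. \<bar>exp ((W r \<omega>)\<^sup>2 / 4)\<bar> \<partial>M) \<le> 2"
      using integrable_exp_square_B[of r] integral_exp_square_B[of r] by (auto simp: W_eq)
  qed auto
  show "AE \<omega> in M. norm (exp (Q \<omega> / 4)) \<le> norm (LINT s:{0..1}|lborel. exp ((W s \<omega>)\<^sup>2 / 4))"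
  proof (rule AE_I2)
    fix \<omega> assume \<omega>: "\<omega> \<in> space M"
    have "Q \<omega> / 4 = (LINT s:{0..1}|lborel. (W s \<omega>)\<^sup>2 / 4)" by (simp add: Q_def)
    then have "exp (Q \<omega> / 4) \<le> (LINT s:{0..1}|lborel. exp ((W s \<omega>)\<^sup>2 / 4))"
      by (simp only:) (intro exp_integral_le continuous_intros W_cont \<omega>, simp)
    then show "norm (exp (Q \<omega> / 4)) \<le> norm (LINT s:{0..1}|lborel. exp ((W s \<omega>)\<^sup>2 / 4))" by simp
  qed
qed (use Q_measurable in auto)

lemma Lp_Q: "Lp Q"
  unfolding Lp_def
proof (intro conjI allI Q_measurable)
  fix p
  show "integrable M (\<lambda>\<omega>. \<bar>Q \<omega>\<bar> ^ p)"
  proof (rule Bochner_Integration.integrable_bound)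
    show "integrable M (\<lambda>\<omega>. 4 ^ p * real p ^ p * exp (Q \<omega> / 4))"
      by (intro integrable_mult_right Q_exp)
    show "AE \<omega> in M. norm (\<bar>Q \<omega>\<bar> ^ p) \<le> norm (4 ^ p * real p ^ p * exp (Q \<omega> / 4))"
    proof (rule AE_I2)
      fix \<omega>
      have "(Q \<omega> / 4) ^ p \<le> real p ^ p * exp (Q \<omega> / 4)" by (rule power_le_exp) (simp add: Q_nonneg)
      then have "Q \<omega> ^ p \<le> 4 ^ p * (real p ^ p * exp (Q \<omega> / 4))" by (simp add: power_divide field_simps)
      then show "norm (\<bar>Q \<omega>\<bar> ^ p) \<le> norm (4 ^ p * real p ^ p * exp (Q \<omega> / 4))"
        by (simp add: Q_nonneg abs_mult mult.assoc)
    qed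
  qed (use Q_measurable in auto)
qed

lemma integral_abs_W_le: "\<omega> \<in> space M \<Longrightarrow> (LINT s:{0..1}|lborel. \<bar>W s \<omega>\<bar>) \<le> 1 + Q \<omega>"
proof -
  assume \<omega>: "\<omega> \<in> space M"
  have "(LINT s:{0..1}|lborel. \<bar>W s \<omega>\<bar>) \<le> (LINT s:{0..1}|lborel. 1 + (W s \<omega>)\<^sup>2)"
  proof (rule set_integral_mono)
    fix s
    show "\<bar>W s \<omega>\<bar> \<le> 1 + (W s \<omega>)\<^sup>2"
      using zero_le_power2[of "\<bar>W s \<omega>\<bar> - 1"] unfolding power2_diff by simp
  qed (intro set_integrable_cont continuous_intros W_cont \<omega>)+
  also have "\<dots> = 1 + Q \<omega>"
    unfolding Q_def by (subst set_integral_add)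
      (auto intro!: set_integrable_cont continuous_intros W_cont \<omega> simp: set_integral_const_01)
  finally show ?thesis .
qed

text \<open>Integration by parts is available for the path at single times. Exchanging expectation
  and time integral transfers it to weighted time averages such as the derivative of the mollified
  path.\<close>

lemma integral_W_mult:
  assumes k: "k \<in> borel_measurable borel" "\<And>s. \<bar>k s\<bar> \<le> c" and G: "Lp G"
  shows "(\<integral>\<omega>. (LINT s:{0..1}|lborel. k s * W s \<omega>) * G \<omega> \<partial>M)
      = (LINT s:{0..1}|lborel. k s * (\<integral>\<omega>. W s \<omega> * G \<omega> \<partial>M))"
    and "set_integrable lborel {0..1} (\<lambda>s. k s * (\<integral>\<omega>. W s \<omega> * G \<omega> \<partial>M))"
proof -
  let ?X = "\<lambda>s \<omega>. k s * W s \<omega> * G \<omega>"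
  \<comment> \<open>The 4 is twice the bound 2 on the exponential moment of the squared path
    value.\<close>
  let ?C = "c * (4 + (\<integral>\<omega>. (G \<omega>)\<^sup>2 \<partial>M))"
  have c: "0 \<le> c" using k(2)[of 0] by linarith
  have C: "0 \<le> ?C" using c by (intro mult_nonneg_nonneg add_nonneg_nonneg Bochner_Integration.integral_nonneg) auto
  have j: "(\<lambda>(s, \<omega>). ?X s \<omega>) \<in> borel_measurable (borel \<Otimes>\<^sub>M M)"
    by (rule W_mult_joint[OF k(1) Lp_measurable[OF G]])
  have i: "integrable M (?X s)" for s by (intro Lp_integrable Lp_mult Lp_const Lp_W G)
  have b: "(\<integral>\<omega>. \<bar>?X s \<omega>\<bar> \<partial>M) \<le> ?C" if s: "s \<in> {0..1}" for s
  proof -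
    have "(\<integral>\<omega>. \<bar>?X s \<omega>\<bar> \<partial>M) \<le> (\<integral>\<omega>. c * (2 * exp ((B s \<omega>)\<^sup>2 / 4) + (G \<omega>)\<^sup>2) \<partial>M)"
    proof (rule integral_mono)
      show "integrable M (\<lambda>\<omega>. \<bar>?X s \<omega>\<bar>)" by (intro integrable_abs i)
      show "integrable M (\<lambda>\<omega>. c * (2 * exp ((B s \<omega>)\<^sup>2 / 4) + (G \<omega>)\<^sup>2))"
        by (intro integrable_mult_right Bochner_Integration.integrable_add integrable_exp_square_B s Lp_square_integrable G)
      fix \<omega>
      have "(B s \<omega>)\<^sup>2 / 4 \<le> exp ((B s \<omega>)\<^sup>2 / 4)" using exp_ge_add_one_self[of "(B s \<omega>)\<^sup>2 / 4"] by linarith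
      then have e: "(B s \<omega>)\<^sup>2 / 2 \<le> 2 * exp ((B s \<omega>)\<^sup>2 / 4)" by simp
      have "\<bar>W s \<omega> * G \<omega>\<bar> \<le> (B s \<omega>)\<^sup>2 / 2 + (G \<omega>)\<^sup>2 / 2"
        using zero_le_power2[of "\<bar>B s \<omega>\<bar> - \<bar>G \<omega>\<bar>"] unfolding power2_diff by (simp add: W_eq[OF s] abs_mult)
      also have "\<dots> \<le> 2 * exp ((B s \<omega>)\<^sup>2 / 4) + (G \<omega>)\<^sup>2" using e by (simp add: add_mono)
      finally have "\<bar>k s\<bar> * \<bar>W s \<omega> * G \<omega>\<bar> \<le> c * (2 * exp ((B s \<omega>)\<^sup>2 / 4) + (G \<omega>)\<^sup>2)"
        using k(2)[of s] c by (intro mult_mono) auto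
      then show "\<bar>?X s \<omega>\<bar> \<le> c * (2 * exp ((B s \<omega>)\<^sup>2 / 4) + (G \<omega>)\<^sup>2)" by (simp add: abs_mult mult.assoc)
    qed
    also have "\<dots> = c * (2 * (\<integral>\<omega>. exp ((B s \<omega>)\<^sup>2 / 4) \<partial>M) + (\<integral>\<omega>. (G \<omega>)\<^sup>2 \<partial>M))"
      using integrable_exp_square_B[OF s] Lp_square_integrable[OF G] by simp
    also have "\<dots> \<le> c * (2 * 2 + (\<integral>\<omega>. (G \<omega>)\<^sup>2 \<partial>M))"
      using c by (intro mult_left_mono add_mono integral_exp_square_B s) auto
    finally show ?thesis by simp
  qed
  have eq: "(\<integral>\<omega>. ?X s \<omega> \<partial>M) = k s * (\<integral>\<omega>. W s \<omega> * G \<omega> \<partial>M)" for s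
    by (simp add: mult.assoc)
  note F = fubini_time[OF j _ _ C i b]
  have "(\<integral>\<omega>. (LINT s:{0..1}|lborel. ?X s \<omega>) \<partial>M) = (LINT s:{0..1}|lborel. (\<integral>\<omega>. ?X s \<omega> \<partial>M))"
    by (rule F(2)) auto
  then show "(\<integral>\<omega>. (LINT s:{0..1}|lborel. k s * W s \<omega>) * G \<omega> \<partial>M)
      = (LINT s:{0..1}|lborel. k s * (\<integral>\<omega>. W s \<omega> * G \<omega> \<partial>M))"
    unfolding eq by simp
  have "set_integrable lborel {0..1} (\<lambda>s. \<integral>\<omega>. ?X s \<omega> \<partial>M)"
    by (rule F(3)) auto
  then show "set_integrable lborel {0..1} (\<lambda>s. k s * (\<integral>\<omega>. W s \<omega> * G \<omega> \<partial>M))"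
    unfolding eq .
qed

lemma Lp_time_integral:
  assumes k: "continuous_on UNIV k" "\<And>s. \<bar>k s\<bar> \<le> c"
  shows "Lp (\<lambda>\<omega>. LINT s:{0..1}|lborel. k s * W s \<omega>)"
    and "\<And>\<omega>. \<omega> \<in> space M \<Longrightarrow> \<bar>LINT s:{0..1}|lborel. k s * W s \<omega>\<bar> \<le> c * (1 + Q \<omega>)"
proof -
  have km: "k \<in> borel_measurable borel" by (rule borel_measurable_continuous_onI[OF k(1)])
  have c: "0 \<le> c" using k(2)[of 0] by linarith
  have b: "\<bar>LINT s:{0..1}|lborel. k s * W s \<omega>\<bar> \<le> c * (1 + Q \<omega>)" if \<omega>: "\<omega> \<in> space M" for \<omega>
  proof -
    have i: "set_integrable lborel {0..1} (\<lambda>s. k s * W s \<omega>)"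
      by (intro set_integrable_cont continuous_intros k W_cont \<omega>)
    have "\<bar>LINT s:{0..1}|lborel. k s * W s \<omega>\<bar> \<le> (LINT s:{0..1}|lborel. \<bar>k s * W s \<omega>\<bar>)"
      using set_integral_norm_bound[OF i] by simp
    also have "\<dots> \<le> (LINT s:{0..1}|lborel. c * \<bar>W s \<omega>\<bar>)"
      by (intro set_integral_mono set_integrable_cont continuous_intros k W_cont \<omega>)
        (simp add: abs_mult mult_right_mono k)
    also have "\<dots> = c * (LINT s:{0..1}|lborel. \<bar>W s \<omega>\<bar>)" by simp
    also have "\<dots> \<le> c * (1 + Q \<omega>)" by (intro mult_left_mono integral_abs_W_le \<omega> c)
    finally show ?thesis .
  qed
  show "\<And>\<omega>. \<omega> \<in> space M \<Longrightarrow> \<bar>LINT s:{0..1}|lborel. k s * W s \<omega>\<bar> \<le> c * (1 + Q \<omega>)" by (rule b)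
  show "Lp (\<lambda>\<omega>. LINT s:{0..1}|lborel. k s * W s \<omega>)"
  proof (rule LpI_dominated[OF _ _ b])
    show "Lp (\<lambda>\<omega>. c * (1 + Q \<omega>))" by (intro Lp_mult Lp_add Lp_const Lp_Q)
    show "(\<lambda>\<omega>. LINT s:{0..1}|lborel. k s * W s \<omega>) \<in> borel_measurable M"
      using W_mult_joint[OF km, of "\<lambda>_. 1"] by (intro time_integral_measurable) auto
  qed
qed

lemma covariance_B:
  assumes "s \<in> {0..1}" "r \<in> {0..1}"
  shows "(\<integral>\<omega>. W s \<omega> * W r \<omega> \<partial>M) = min s r"
proof -
  have "(\<integral>\<omega>. B s \<omega> * B r \<omega> \<partial>M) = (\<integral>\<omega>. min s r \<partial>M)"
  proof (rule gaussian_ibp(3)[where S = "{r}" and \<psi> = "\<lambda>k. k r"])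
    show "((\<lambda>x. k r + x * min s r) has_real_derivative min s r) (at 0)" for k
      by (auto intro!: derivative_eq_intros)
  qed (use assms in \<open>auto intro: exp_lip_coord\<close>)
  then show ?thesis using assms by (simp add: W_eq prob_space)
qed

end

section \<open>Differentiable cylinder functionals\<close>

lemma set_integral_sum':
  fixes f :: "'i \<Rightarrow> 'a \<Rightarrow> real"
  assumes "\<And>i. i \<in> I \<Longrightarrow> set_integrable M A (f i)"
  shows "set_integrable M A (\<lambda>x. \<Sum>i\<in>I. f i x)"
    and "(LINT x:A|M. (\<Sum>i\<in>I. f i x)) = (\<Sum>i\<in>I. LINT x:A|M. f i x)"
proof -
  have "set_integrable M A (\<lambda>x. \<Sum>i\<in>I. f i x) \<and> (LINT x:A|M. (\<Sum>i\<in>I. f i x)) = (\<Sum>i\<in>I. LINT x:A|M. f i x)"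
    using assms
  proof (induction I rule: infinite_finite_induct)
    case (insert i I)
    then show ?case by (simp add: set_integral_add)
  qed (simp_all add: set_integrable_def set_lebesgue_integral_def)
  then show "set_integrable M A (\<lambda>x. \<Sum>i\<in>I. f i x)"
    and "(LINT x:A|M. (\<Sum>i\<in>I. f i x)) = (\<Sum>i\<in>I. LINT x:A|M. f i x)" by auto
qed

lemma deriv_bound_of_lipschitz:
  assumes "(g has_real_derivative d) (at 0)" and "\<And>x. \<bar>g x - g 0\<bar> \<le> C * \<bar>x\<bar>"
  shows "\<bar>d\<bar> \<le> C"
proof -
  have "((\<lambda>x. \<bar>(g (0 + x) - g 0) / x\<bar>) \<longlongrightarrow> \<bar>d\<bar>) (at 0)"
    using assms(1) unfolding DERIV_def by (rule tendsto_rabs)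
  then show ?thesis
  proof (rule tendsto_upperbound)
    show "\<forall>\<^sub>F x in at 0. \<bar>(g (0 + x) - g 0) / x\<bar> \<le> C"
      unfolding eventually_at_filter
    proof (intro always_eventually allI impI)
      fix x :: real assume "x \<noteq> 0"
      then show "\<bar>(g (0 + x) - g 0) / x\<bar> \<le> C"
        using assms(2)[of x] by (simp add: abs_divide pos_divide_le_eq)
    qed
  qed simp
qed

text \<open>\<open>D i k\<close> is the partial derivative of \<open>f\<close> at \<open>k\<close> with respect to the value at time \<open>i/n\<close>.\<close>

definition smooth_cyl :: "nat \<Rightarrow> real \<Rightarrow> real \<Rightarrow> ((real \<Rightarrow> real) \<Rightarrow> real) \<Rightarrow> (nat \<Rightarrow> (real \<Rightarrow> real) \<Rightarrow> real) \<Rightarrow> bool" where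
  "smooth_cyl n A c f D \<longleftrightarrow> n \<ge> 1 \<and> exp_lip (grid_set n) f \<and>
     (\<forall>k u. ((\<lambda>x. f (\<lambda>r. k r + x * u r)) has_real_derivative (\<Sum>i=1..n. u (real i / real n) * D i k)) (at 0)) \<and>
     (\<forall>k u. \<bar>\<Sum>i=1..n. u (real i / real n) * D i k\<bar> \<le> A * exp (c * grid_norm n k) * grid_norm n u)"

text \<open>Directions are arbitrary functions, so the indicator of a single grid time is
  admissible, and along it only one partial derivative is left.\<close>

lemma smooth_cyl_coord:
  assumes "smooth_cyl n A c f D" "i \<in> {1..n}"
  defines "e \<equiv> \<lambda>r. if r = real i / real n then 1 else 0"
  shows "((\<lambda>x. f (\<lambda>r. k r + x * e r)) has_real_derivative D i k) (at 0)"
    and "\<bar>D i k\<bar> \<le> A * grid_norm n e * exp (c * grid_norm n k)"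
proof -
  have n: "n \<ge> 1" using assms(2) by auto
  have s: "(\<Sum>j=1..n. e (real j / real n) * D j k) = D i k"
  proof -
    have "(\<Sum>j=1..n. e (real j / real n) * D j k) = (\<Sum>j=1..n. if i = j then D j k else 0)"
    proof (rule sum.cong)
      fix j
      have "real j / real n = real i / real n \<longleftrightarrow> i = j" using n by auto
      then show "e (real j / real n) * D j k = (if i = j then D j k else 0)" by (simp add: e_def)
    qed simp
    also have "\<dots> = D i k" using assms(2) by (simp only: sum.delta' sum.delta finite_atLeastAtMost if_True)
    finally show ?thesis .
  qed
  have d: "((\<lambda>x. f (\<lambda>r. k r + x * e r)) has_real_derivative (\<Sum>j=1..n. e (real j / real n) * D j k)) (at 0)"
    and b: "\<bar>\<Sum>j=1..n. e (real j / real n) * D j k\<bar> \<le> A * exp (c * grid_norm n k) * grid_norm n e"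
    using assms(1) unfolding smooth_cyl_def by simp_all
  show "((\<lambda>x. f (\<lambda>r. k r + x * e r)) has_real_derivative D i k) (at 0)"
    using d unfolding s .
  show "\<bar>D i k\<bar> \<le> A * grid_norm n e * exp (c * grid_norm n k)"
    using b unfolding s by (simp only: mult_ac)
qed

context brownian
begin

lemma Lp_grid_norm_exp:
  assumes "n \<ge> 1"
  shows "Lp (\<lambda>\<omega>. exp (c * grid_norm n (\<lambda>r. B r \<omega>)))"
  unfolding Lp_def
proof (intro conjI allI)
  show "(\<lambda>\<omega>. exp (c * grid_norm n (\<lambda>r. B r \<omega>))) \<in> borel_measurable M"
    using grid_norm_B_measurable by auto
  fix p
  show "integrable M (\<lambda>\<omega>. \<bar>exp (c * grid_norm n (\<lambda>s. B s \<omega>))\<bar> ^ p)"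
    using exp_grid_norm_B(1)[OF assms, of "real p * c"] by (simp add: exp_of_nat_mult[symmetric] mult.assoc)
qed

lemma Lp_smooth_D:
  assumes f: "smooth_cyl n A c f D" and i: "i \<in> {1..n}"
  shows "Lp (\<lambda>\<omega>. D i (\<lambda>r. B r \<omega>))"
proof -
  let ?e = "\<lambda>r. if r = real i / real n then 1 else 0 :: real"
  have n: "n \<ge> 1" using i by auto
  have cf: "cyl (grid_set n) f" using f by (auto simp: smooth_cyl_def intro: exp_lip_cyl grid_set)
  note d = smooth_cyl_coord[OF f i]
  show ?thesis
  proof (rule LpI_dominated[OF _ _ d(2)])
    show "Lp (\<lambda>\<omega>. A * grid_norm n ?e * exp (c * grid_norm n (\<lambda>r. B r \<omega>)))"
      by (intro Lp_mult Lp_const Lp_grid_norm_exp n)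
    show "(\<lambda>\<omega>. D i (\<lambda>r. B r \<omega>)) \<in> borel_measurable M"
    proof (rule borel_measurable_LIMSEQ_real)
      let ?q = "\<lambda>m \<omega>. (f (\<lambda>r. B r \<omega> + (1 / real (Suc m)) * ?e r) - f (\<lambda>r. B r \<omega>)) / (1 / real (Suc m))"
      show "(\<lambda>m. ?q m \<omega>) \<longlonglongrightarrow> D i (\<lambda>r. B r \<omega>)" for \<omega>
        using tendsto_at_0_seq[OF d(1)[of "\<lambda>r. B r \<omega>", unfolded DERIV_def]] by simp
      show "?q m \<in> borel_measurable M" for m
        by (intro borel_measurable_divide borel_measurable_diff borel_measurable_const
            cyl_B_measurable[OF cf grid_set(2)] cyl_B_measurable[OF cyl_shift[OF cf] grid_set(2)])
    qed
  qed
qed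

lemma Lp_smooth:
  assumes f: "smooth_cyl n A c f D"
  shows "Lp (\<lambda>\<omega>. f (\<lambda>r. B r \<omega>))"
  by (rule Lp_exp_lip[OF grid_set[of n]]) (use f in \<open>simp add: smooth_cyl_def\<close>)

text \<open>Integration by parts in \<open>W s\<close> against a product of three factors.
  Differentiating \<open>W r\<close> yields its covariance with \<open>W s\<close>, differentiating
  \<open>f\<close> yields the gradient along the covariance function of \<open>W s\<close>, and
  differentiating \<phi> yields \<phi>' with the covariance of \<open>W s\<close> and
  \<open>W \<theta>\<close>.\<close>

lemma ibp_triple:
  assumes f: "smooth_cyl n A c f D"
    and \<phi>: "L \<ge> 0" "\<And>x y. \<bar>\<phi> x - \<phi> y\<bar> \<le> L * \<bar>x - y\<bar>" "\<And>x. \<bar>\<phi> x\<bar> \<le> L"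
    "\<And>x. (\<phi> has_real_derivative \<phi>' x) (at x)" "\<And>x. \<bar>\<phi>' x\<bar> \<le> L" "\<phi>' \<in> borel_measurable borel"
    and s: "s \<in> {0..1}" and r: "r \<in> {0..1}" and \<theta>: "\<theta> \<in> {0..1}"
  shows "(\<integral>\<omega>. W r \<omega> * (W s \<omega> * f (\<lambda>r. B r \<omega>) * \<phi> (W \<theta> \<omega>)) \<partial>M) =
    min s r * (\<integral>\<omega>. f (\<lambda>r. B r \<omega>) * \<phi> (W \<theta> \<omega>) \<partial>M) +
    (\<integral>\<omega>. W r \<omega> * ((\<Sum>i=1..n. min s (real i / real n) * D i (\<lambda>r. B r \<omega>)) * \<phi> (W \<theta> \<omega>)
       + min s \<theta> * (f (\<lambda>r. B r \<omega>) * \<phi>' (W \<theta> \<omega>))) \<partial>M)"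
proof -
  let ?S = "insert r (insert \<theta> (grid_set n))"
  have S: "finite ?S" "?S \<subseteq> {0..1}" using grid_set[of n] r \<theta> by auto
  have ef: "exp_lip (grid_set n) f" using f by (simp add: smooth_cyl_def)
  let ?\<psi> = "\<lambda>k. f k * k r * \<phi> (k \<theta>)"
  let ?D = "\<lambda>k. min s r * (f k * \<phi> (k \<theta>)) + k r * ((\<Sum>i=1..n. min s (real i / real n) * D i k) * \<phi> (k \<theta>) + min s \<theta> * (f k * \<phi>' (k \<theta>)))"
  have e: "exp_lip ?S ?\<psi>"
    by (intro exp_lip_mult exp_lip_mono[OF ef] exp_lip_coord exp_lip_lipschitz[OF _ _ \<phi>(1,2)] S) auto
  have d: "((\<lambda>x. ?\<psi> (\<lambda>r. k r + x * min s r)) has_real_derivative ?D k) (at 0)" for k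
  proof -
    have 1: "((\<lambda>x. f (\<lambda>r. k r + x * min s r)) has_real_derivative (\<Sum>i=1..n. min s (real i / real n) * D i k)) (at 0)"
      using f by (simp add: smooth_cyl_def)
    have 2: "((\<lambda>x. k r + x * min s r) has_real_derivative min s r) (at 0)"
      by (auto intro!: derivative_eq_intros)
    have "((\<lambda>x. k \<theta> + x * min s \<theta>) has_real_derivative min s \<theta>) (at 0)"
      by (auto intro!: derivative_eq_intros)
    from DERIV_chain2[OF _ this, of \<phi> "\<phi>' (k \<theta>)"] \<phi>(4)[of "k \<theta>"]
    have 3: "((\<lambda>x. \<phi> (k \<theta> + x * min s \<theta>)) has_real_derivative \<phi>' (k \<theta>) * min s \<theta>) (at 0)" by simp
    from DERIV_mult[OF DERIV_mult[OF 1 2] 3]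
    show ?thesis by (rule DERIV_cong) (simp add: algebra_simps)
  qed
  have "(\<integral>\<omega>. B s \<omega> * ?\<psi> (\<lambda>r. B r \<omega>) \<partial>M) = (\<integral>\<omega>. ?D (\<lambda>r. B r \<omega>) \<partial>M)"
    by (rule gaussian_ibp(3)[OF S s e d])
  also have "\<dots> = min s r * (\<integral>\<omega>. f (\<lambda>r. B r \<omega>) * \<phi> (B \<theta> \<omega>) \<partial>M) +
    (\<integral>\<omega>. B r \<omega> * ((\<Sum>i=1..n. min s (real i / real n) * D i (\<lambda>r. B r \<omega>)) * \<phi> (B \<theta> \<omega>)
       + min s \<theta> * (f (\<lambda>r. B r \<omega>) * \<phi>' (B \<theta> \<omega>))) \<partial>M)"
  proof -
    have "W r = B r" by (rule ext) (rule W_eq[OF r])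
    then have B: "Lp (B r)" using Lp_W[of r] by (simp only:)
    have p: "Lp (\<lambda>\<omega>. \<phi> (B \<theta> \<omega>))" "Lp (\<lambda>\<omega>. \<phi>' (B \<theta> \<omega>))"
    proof -
      have "continuous_on UNIV \<phi>" by (rule DERIV_continuous_on) (use \<phi>(4) in simp)
      then have "\<phi> \<in> borel_measurable borel" by (rule borel_measurable_continuous_onI)
      then show "Lp (\<lambda>\<omega>. \<phi> (B \<theta> \<omega>))"
        by (rule Lp_bounded[OF measurable_compose[OF B_measurable[OF \<theta>]] \<phi>(3)])
      show "Lp (\<lambda>\<omega>. \<phi>' (B \<theta> \<omega>))"
        by (rule Lp_bounded[OF measurable_compose[OF B_measurable[OF \<theta>] \<phi>(6)] \<phi>(5)])
    qed
    have i1: "integrable M (\<lambda>\<omega>. min s r * (f (\<lambda>r. B r \<omega>) * \<phi> (B \<theta> \<omega>)))"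
      by (intro Lp_integrable Lp_mult Lp_const Lp_smooth[OF f] p)
    have i2: "integrable M (\<lambda>\<omega>. B r \<omega> * ((\<Sum>i=1..n. min s (real i / real n) * D i (\<lambda>r. B r \<omega>)) * \<phi> (B \<theta> \<omega>)
       + min s \<theta> * (f (\<lambda>r. B r \<omega>) * \<phi>' (B \<theta> \<omega>))))"
      by (intro Lp_integrable Lp_mult Lp_add Lp_sum Lp_const Lp_smooth[OF f] Lp_smooth_D[OF f] p B)
    show ?thesis
      unfolding Bochner_Integration.integral_add[OF i1 i2] by (simp only: integral_mult_right_zero)
  qed
  finally have main: "(\<integral>\<omega>. B s \<omega> * ?\<psi> (\<lambda>r. B r \<omega>) \<partial>M) = \<dots>" .
  have "(\<integral>\<omega>. W r \<omega> * (W s \<omega> * f (\<lambda>r. B r \<omega>) * \<phi> (W \<theta> \<omega>)) \<partial>M) = (\<integral>\<omega>. B s \<omega> * ?\<psi> (\<lambda>r. B r \<omega>) \<partial>M)"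
    unfolding W_eq[OF s] W_eq[OF r] W_eq[OF \<theta>]
    by (intro Bochner_Integration.integral_cong refl) (simp only: mult_ac)
  then show ?thesis unfolding main W_eq[OF r] W_eq[OF \<theta>] .
qed

text \<open>\<open>ibp_triple\<close> integrated against \<open>k1 s\<close> and
  \<open>k2 r\<close>. The covariance term becomes E[N1 N2] E[f \<phi>], exactly the subtracted
  expectation; the term with \<phi>' acquires the covariance of \<open>N1\<close> with
  \<open>W \<theta>\<close>, which is \<open>v \<theta>\<close>, and drops out. The gradient of
  \<open>f\<close> ends up along \<open>v\<close>.\<close>

lemma ibp_weighted:
  fixes k1 k2 :: "real \<Rightarrow> real"
  assumes f: "smooth_cyl n A c f D"
    and \<phi>: "L \<ge> 0" "\<And>x y. \<bar>\<phi> x - \<phi> y\<bar> \<le> L * \<bar>x - y\<bar>" "\<And>x. \<bar>\<phi> x\<bar> \<le> L"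
    "\<And>x. (\<phi> has_real_derivative \<phi>' x) (at x)" "\<And>x. \<bar>\<phi>' x\<bar> \<le> L" "\<phi>' \<in> borel_measurable borel"
    and \<theta>: "\<theta> \<in> {0..1}"
    and k1: "continuous_on UNIV k1" "\<And>s. \<bar>k1 s\<bar> \<le> c1" and k2: "continuous_on UNIV k2" "\<And>s. \<bar>k2 s\<bar> \<le> c2"
  defines "N1 \<equiv> \<lambda>\<omega>. LINT s:{0..1}|lborel. k1 s * W s \<omega>" and "N2 \<equiv> \<lambda>\<omega>. LINT s:{0..1}|lborel. k2 s * W s \<omega>"
    and "v \<equiv> \<lambda>t. LINT s:{0..1}|lborel. k1 s * min s t"
  assumes v\<theta>: "v \<theta> = 0"
  shows "(\<integral>\<omega>. f (\<lambda>r. B r \<omega>) * (N1 \<omega> * N2 \<omega> - (\<integral>\<omega>. N1 \<omega> * N2 \<omega> \<partial>M)) * \<phi> (W \<theta> \<omega>) \<partial>M)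
    = (\<Sum>i=1..n. v (real i / real n) * (\<integral>\<omega>. D i (\<lambda>r. B r \<omega>) * N2 \<omega> * \<phi> (W \<theta> \<omega>) \<partial>M))"
proof -
  let ?f = "\<lambda>\<omega>. f (\<lambda>r. B r \<omega>)" and ?D = "\<lambda>i \<omega>. D i (\<lambda>r. B r \<omega>)"
  let ?p = "\<lambda>\<omega>. \<phi> (W \<theta> \<omega>)" and ?p' = "\<lambda>\<omega>. \<phi>' (W \<theta> \<omega>)"
  let ?t = "\<lambda>i. real i / real n"
  have pm: "\<phi> \<in> borel_measurable borel"
    by (rule borel_measurable_continuous_onI, rule DERIV_continuous_on) (use \<phi>(4) in simp)
  have Lp: "Lp ?f" "\<And>i. i \<in> {1..n} \<Longrightarrow> Lp (?D i)" "Lp N1" "Lp N2" "Lp ?p" "Lp ?p'"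
    unfolding N1_def N2_def
    by (rule Lp_smooth[OF f], rule Lp_smooth_D[OF f], assumption, rule Lp_time_integral(1)[OF k1], rule Lp_time_integral(1)[OF k2],
      rule Lp_bounded[OF measurable_compose[OF W_measurable pm] \<phi>(3)],
      rule Lp_bounded[OF measurable_compose[OF W_measurable \<phi>(6)] \<phi>(5)])
  have k1m: "k1 \<in> borel_measurable borel" and k2m: "k2 \<in> borel_measurable borel"
    using k1(1) k2(1) by (auto intro: borel_measurable_continuous_onI)
  \<comment> \<open>The covariance of \<open>W s\<close> with \<open>N2\<close>, as
    \<open>a0\<close> shows below; integrated against \<open>k1\<close> it becomes E[N1 N2].\<close>
  define a where "a = (\<lambda>s. LINT r:{0..1}|lborel. k2 r * min s r)"
  define F0 where "F0 = (\<integral>\<omega>. ?f \<omega> * ?p \<omega> \<partial>M)"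
  define E where "E = (\<lambda>i. \<integral>\<omega>. ?D i \<omega> * N2 \<omega> * ?p \<omega> \<partial>M)"
  define E' where "E' = (\<integral>\<omega>. N2 \<omega> * (?f \<omega> * ?p' \<omega>) \<partial>M)"
  have I: "(\<integral>\<omega>. W s \<omega> * (N2 \<omega> * ?f \<omega> * ?p \<omega>) \<partial>M)
      = a s * F0 + ((\<Sum>i=1..n. min s (?t i) * E i) + min s \<theta> * E')" if s: "s \<in> {0..1}" for s
  proof -
    let ?H = "\<lambda>\<omega>. (\<Sum>i=1..n. min s (?t i) * ?D i \<omega>) * ?p \<omega> + min s \<theta> * (?f \<omega> * ?p' \<omega>)"
    have H: "Lp ?H" by (intro Lp_mult Lp_add Lp_sum Lp_const Lp)
    have G: "Lp (\<lambda>\<omega>. W s \<omega> * ?f \<omega> * ?p \<omega>)" by (intro Lp_mult Lp_W Lp)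
    have "(\<integral>\<omega>. W s \<omega> * (N2 \<omega> * ?f \<omega> * ?p \<omega>) \<partial>M) = (\<integral>\<omega>. N2 \<omega> * (W s \<omega> * ?f \<omega> * ?p \<omega>) \<partial>M)"
      by (simp add: mult_ac)
    also have "\<dots> = (LINT r:{0..1}|lborel. k2 r * (\<integral>\<omega>. W r \<omega> * (W s \<omega> * ?f \<omega> * ?p \<omega>) \<partial>M))"
      unfolding N2_def by (rule integral_W_mult(1)[OF k2m k2(2) G])
    also have "\<dots> = (LINT r:{0..1}|lborel. (k2 r * min s r) * F0 + k2 r * (\<integral>\<omega>. W r \<omega> * ?H \<omega> \<partial>M))"
    proof (rule set_lebesgue_integral_cong, simp, intro allI impI)
      fix r :: real assume r: "r \<in> {0..1}"
      show "k2 r * (\<integral>\<omega>. W r \<omega> * (W s \<omega> * ?f \<omega> * ?p \<omega>) \<partial>M) = (k2 r * min s r) * F0 + k2 r * (\<integral>\<omega>. W r \<omega> * ?H \<omega> \<partial>M)"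
        unfolding ibp_triple[OF f \<phi> s r \<theta>] F0_def by (simp only: distrib_left mult.assoc)
    qed
    also have "\<dots> = (LINT r:{0..1}|lborel. (k2 r * min s r) * F0) + (LINT r:{0..1}|lborel. k2 r * (\<integral>\<omega>. W r \<omega> * ?H \<omega> \<partial>M))"
      by (intro set_integral_add(2) integral_W_mult(2)[OF k2m k2(2) H] set_integrable_cont continuous_intros k2(1))
    also have "(LINT r:{0..1}|lborel. (k2 r * min s r) * F0) = a s * F0"
      unfolding a_def by (rule set_integral_mult_left)
    also have "(LINT r:{0..1}|lborel. k2 r * (\<integral>\<omega>. W r \<omega> * ?H \<omega> \<partial>M)) = (\<integral>\<omega>. N2 \<omega> * ?H \<omega> \<partial>M)"
      unfolding N2_def by (rule integral_W_mult(1)[OF k2m k2(2) H, symmetric])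
    also have "(\<integral>\<omega>. N2 \<omega> * ?H \<omega> \<partial>M) = (\<integral>\<omega>. (\<Sum>i=1..n. min s (?t i) * (?D i \<omega> * N2 \<omega> * ?p \<omega>)) + min s \<theta> * (N2 \<omega> * (?f \<omega> * ?p' \<omega>)) \<partial>M)"
      by (intro Bochner_Integration.integral_cong) (simp_all add: sum_distrib_left sum_distrib_right distrib_left mult_ac)
    also have "\<dots> = (\<integral>\<omega>. (\<Sum>i=1..n. min s (?t i) * (?D i \<omega> * N2 \<omega> * ?p \<omega>)) \<partial>M) + (\<integral>\<omega>. min s \<theta> * (N2 \<omega> * (?f \<omega> * ?p' \<omega>)) \<partial>M)"
      by (intro Bochner_Integration.integral_add Lp_integrable Lp_sum Lp_mult Lp_const Lp)
    also have "(\<integral>\<omega>. min s \<theta> * (N2 \<omega> * (?f \<omega> * ?p' \<omega>)) \<partial>M) = min s \<theta> * E'" unfolding E'_def by simp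
    also have "(\<integral>\<omega>. (\<Sum>i=1..n. min s (?t i) * (?D i \<omega> * N2 \<omega> * ?p \<omega>)) \<partial>M) = (\<Sum>i=1..n. \<integral>\<omega>. min s (?t i) * (?D i \<omega> * N2 \<omega> * ?p \<omega>) \<partial>M)"
      by (intro Bochner_Integration.integral_sum Lp_integrable Lp_mult Lp_const Lp)
    also have "\<dots> = (\<Sum>i=1..n. min s (?t i) * E i)" unfolding E_def by simp
    finally show ?thesis .
  qed
  have a0: "(\<integral>\<omega>. W s \<omega> * N2 \<omega> \<partial>M) = a s" if s: "s \<in> {0..1}" for s
  proof -
    have "(\<integral>\<omega>. W s \<omega> * N2 \<omega> \<partial>M) = (\<integral>\<omega>. N2 \<omega> * W s \<omega> \<partial>M)" by (simp add: mult.commute)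
    also have "\<dots> = (LINT r:{0..1}|lborel. k2 r * (\<integral>\<omega>. W r \<omega> * W s \<omega> \<partial>M))"
      unfolding N2_def by (rule integral_W_mult(1)[OF k2m k2(2) Lp_W])
    also have "\<dots> = a s"
      unfolding a_def
    proof (rule set_lebesgue_integral_cong, simp, intro allI impI)
      fix r :: real assume r: "r \<in> {0..1}"
      show "k2 r * (\<integral>\<omega>. W r \<omega> * W s \<omega> \<partial>M) = k2 r * min s r"
        by (simp only: covariance_B[OF r s] min.commute)
    qed
    finally show ?thesis .
  qed
  have ai: "set_integrable lborel {0..1} (\<lambda>s. k1 s * a s)"
  proof -
    have "set_integrable lborel {0..1} (\<lambda>s. k1 s * (\<integral>\<omega>. W s \<omega> * N2 \<omega> \<partial>M))"
      by (rule integral_W_mult(2)[OF k1m k1(2) Lp(4)])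
    moreover have "set_integrable lborel {0..1} (\<lambda>s. k1 s * (\<integral>\<omega>. W s \<omega> * N2 \<omega> \<partial>M)) = set_integrable lborel {0..1} (\<lambda>s. k1 s * a s)"
      by (rule set_integrable_cong) (auto simp: a0)
    ultimately show ?thesis by simp
  qed
  have c: "(\<integral>\<omega>. N1 \<omega> * N2 \<omega> \<partial>M) = (LINT s:{0..1}|lborel. k1 s * a s)"
  proof -
    have "(\<integral>\<omega>. N1 \<omega> * N2 \<omega> \<partial>M) = (LINT s:{0..1}|lborel. k1 s * (\<integral>\<omega>. W s \<omega> * N2 \<omega> \<partial>M))"
      unfolding N1_def by (rule integral_W_mult(1)[OF k1m k1(2) Lp(4)])
    also have "\<dots> = (LINT s:{0..1}|lborel. k1 s * a s)"
      by (rule set_lebesgue_integral_cong) (auto simp: a0)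
    finally show ?thesis .
  qed
  have ci: "set_integrable lborel {0..1} (\<lambda>s. k1 s * min s t * x)" for t x
    by (intro set_integrable_cont continuous_intros k1(1))
  have "(\<integral>\<omega>. N1 \<omega> * (N2 \<omega> * ?f \<omega> * ?p \<omega>) \<partial>M) = (LINT s:{0..1}|lborel. k1 s * (\<integral>\<omega>. W s \<omega> * (N2 \<omega> * ?f \<omega> * ?p \<omega>) \<partial>M))"
    unfolding N1_def by (intro integral_W_mult(1)[OF k1m k1(2)] Lp_mult Lp)
  also have "\<dots> = (LINT s:{0..1}|lborel. k1 s * a s * F0 + ((\<Sum>i=1..n. k1 s * min s (?t i) * E i) + k1 s * min s \<theta> * E'))"
  proof (rule set_lebesgue_integral_cong, simp, intro allI impI)
    fix s :: real assume s: "s \<in> {0..1}"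
    show "k1 s * (\<integral>\<omega>. W s \<omega> * (N2 \<omega> * ?f \<omega> * ?p \<omega>) \<partial>M)
      = k1 s * a s * F0 + ((\<Sum>i=1..n. k1 s * min s (?t i) * E i) + k1 s * min s \<theta> * E')"
      unfolding I[OF s] by (simp only: sum_distrib_left distrib_left mult.assoc)
  qed
  also have "\<dots> = (LINT s:{0..1}|lborel. k1 s * a s * F0) + ((\<Sum>i=1..n. LINT s:{0..1}|lborel. k1 s * min s (?t i) * E i) + (LINT s:{0..1}|lborel. k1 s * min s \<theta> * E'))"
  proof -
    have 1: "set_integrable lborel {0..1} (\<lambda>s. k1 s * a s * F0)" using ai by (rule set_integrable_mult_left)
    have 2: "set_integrable lborel {0..1} (\<lambda>s. \<Sum>i=1..n. k1 s * min s (?t i) * E i)"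
      by (rule set_integral_sum'(1)) (rule ci)
    show ?thesis
      unfolding set_integral_add(2)[OF 1 set_integral_add(1)[OF 2 ci[of \<theta> E']]] set_integral_add(2)[OF 2 ci[of \<theta> E']]
      by (subst set_integral_sum'(2)) (auto intro: ci)
  qed
  also have "\<dots> = (\<integral>\<omega>. N1 \<omega> * N2 \<omega> \<partial>M) * F0 + ((\<Sum>i=1..n. v (?t i) * E i) + v \<theta> * E')"
    unfolding c v_def by (simp only: set_integral_mult_left)
  finally have main: "(\<integral>\<omega>. N1 \<omega> * (N2 \<omega> * ?f \<omega> * ?p \<omega>) \<partial>M) = (\<integral>\<omega>. N1 \<omega> * N2 \<omega> \<partial>M) * F0 + (\<Sum>i=1..n. v (?t i) * E i)"
    using v\<theta> by simp
  let ?c = "\<integral>\<omega>. N1 \<omega> * N2 \<omega> \<partial>M"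
  have "(\<integral>\<omega>. ?f \<omega> * (N1 \<omega> * N2 \<omega> - ?c) * ?p \<omega> \<partial>M) = (\<integral>\<omega>. N1 \<omega> * (N2 \<omega> * ?f \<omega> * ?p \<omega>) - ?c * (?f \<omega> * ?p \<omega>) \<partial>M)"
    by (intro Bochner_Integration.integral_cong) (simp_all add: algebra_simps)
  also have "\<dots> = (\<integral>\<omega>. N1 \<omega> * (N2 \<omega> * ?f \<omega> * ?p \<omega>) \<partial>M) - (\<integral>\<omega>. ?c * (?f \<omega> * ?p \<omega>) \<partial>M)"
    by (intro Bochner_Integration.integral_diff Lp_integrable Lp_mult Lp_const Lp)
  also have "\<dots> = (\<Sum>i=1..n. v (?t i) * E i)" unfolding main F0_def by simp
  finally show ?thesis unfolding E_def .
qed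

end

section \<open>The derivative of the mollified path\<close>

text \<open>In the application \<open>p\<close> is minus the derivative of the mollifier; the sign
  comes from differentiating (s - \<theta>) / e with respect to \<theta>. The mean-zero condition
  says that the derivative of a mollified constant is 0.\<close>

locale kernel =
  fixes p :: "real \<Rightarrow> real" and G :: real
  assumes p_cont: "continuous_on UNIV p"
    and p_supp: "\<And>x. 1 \<le> \<bar>x\<bar> \<Longrightarrow> p x = 0"
    and p_bound: "\<And>x. \<bar>p x\<bar> \<le> G"
    and p_mean: "(LINT x|lborel. p x) = 0"
begin

lemma G_nonneg: "0 \<le> G"
  using p_bound[of 0] by linarith

lemma p_outside: "x \<notin> {-1..1} \<Longrightarrow> p x = 0"
  by (rule p_supp) auto

lemma integrable_p_mult:
  assumes "continuous_on UNIV q"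
  shows "integrable lborel (\<lambda>x. p x * q x)"
proof -
  have "integrable lborel (\<lambda>x. indicator {-1..1} x *\<^sub>R (p x * q x))"
    by (intro borel_integrable_compact compact_Icc continuous_on_mult
        continuous_on_subset[OF p_cont subset_UNIV] continuous_on_subset[OF assms subset_UNIV])
  moreover have "indicator {-1..1} x *\<^sub>R (p x * q x) = p x * q x" for x
    by (cases "x \<in> {-1..1}") (auto simp: p_outside)
  ultimately show ?thesis by (simp only:)
qed

lemma integral_p_mult_bound:
  assumes q: "continuous_on UNIV q" and b: "\<And>x. \<bar>x\<bar> \<le> 1 \<Longrightarrow> \<bar>q x\<bar> \<le> C" and C: "0 \<le> C"
  shows "\<bar>LINT x|lborel. p x * q x\<bar> \<le> 2 * G * C"
proof -
  have "\<bar>LINT x|lborel. p x * q x\<bar> \<le> (LINT x|lborel. \<bar>p x * q x\<bar>)"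
    using integral_norm_bound[of lborel "\<lambda>x. p x * q x"] by simp
  also have "\<dots> \<le> (LINT x|lborel. indicator {-1..1::real} x * (G * C))"
  proof (rule integral_mono)
    show "integrable lborel (\<lambda>x. \<bar>p x * q x\<bar>)" by (intro integrable_abs integrable_p_mult q)
    show "integrable lborel (\<lambda>x::real. indicator {-1..1} x * (G * C))"
      by (intro integrable_mult_left) simp
    fix x :: real
    show "\<bar>p x * q x\<bar> \<le> indicator {-1..1} x * (G * C)"
    proof (cases "x \<in> {-1..1}")
      case True
      then have "\<bar>q x\<bar> \<le> C" by (intro b) auto
      then show ?thesis using True p_bound[of x] G_nonneg by (simp add: abs_mult mult_mono)
    qed (simp add: p_outside)
  qed
  also have "\<dots> = 2 * G * C" by simp
  finally show ?thesis .
qed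

text \<open>The covariance profile: by \<open>K_min\<close> the kernel at scale e around \<theta>,
  paired with the covariance function of the path at time t, gives \<open>kap\<close> at (t -
  \<theta>) / e. For p = - deriv \<rho> it is the distribution function of \<rho>, by an integration
  by parts. At t = \<theta> it equals \<open>kap 0\<close> at every scale.\<close>

definition kap :: "real \<Rightarrow> real" where
  "kap y = (LINT x|lborel. p x * min x y)"

lemma kap_le: "y \<le> -1 \<Longrightarrow> kap y = 0"
proof -
  assume y: "y \<le> -1"
  have eq: "p x * min x y = p x * y" for x
    using y p_outside[of x] by (cases "x \<in> {-1..1}") auto
  have "kap y = (LINT x|lborel. p x * y)" unfolding kap_def eq ..
  then show ?thesis by (simp add: p_mean)
qed

lemma kap_ge: "1 \<le> y \<Longrightarrow> kap y = kap 1"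
proof -
  assume y: "1 \<le> y"
  have eq: "p x * min x y = p x * min x 1" for x
    using y p_outside[of x] by (cases "x \<in> {-1..1}") auto
  show ?thesis unfolding kap_def eq ..
qed

lemma kap_bound: "\<bar>kap y\<bar> \<le> 2 * G"
proof -
  have 1: "\<bar>kap y\<bar> \<le> 2 * G" if "\<bar>y\<bar> \<le> 1" for y
  proof -
    have "continuous_on UNIV (\<lambda>x. min x y)" by (intro continuous_intros)
    from integral_p_mult_bound[OF this, of 1] that show ?thesis
      unfolding kap_def by (simp add: abs_le_iff min_le_iff_disj)
  qed
  consider "y \<le> -1" | "\<bar>y\<bar> \<le> 1" | "1 \<le> y" by linarith
  then show ?thesis
  proof cases
    case 1 then show ?thesis using kap_le G_nonneg by simp
  next
    case 2 then show ?thesis by (rule 1)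
  next
    case 3 then show ?thesis using kap_ge[of y] 1[of 1] by simp
  qed
qed

lemma kap_cont: "continuous_on UNIV kap"
proof -
  have lip: "\<bar>kap y - kap z\<bar> \<le> 2 * G * \<bar>y - z\<bar>" for y z
  proof -
    have i: "integrable lborel (\<lambda>x. p x * min x y)" for y
      by (intro integrable_p_mult continuous_intros)
    have "kap y - kap z = (LINT x|lborel. p x * (min x y - min x z))"
      unfolding kap_def Bochner_Integration.integral_diff[OF i i, symmetric]
      by (intro Bochner_Integration.integral_cong) (simp_all add: algebra_simps)
    also have "\<bar>\<dots>\<bar> \<le> 2 * G * \<bar>y - z\<bar>"
    proof (rule integral_p_mult_bound)
      show "continuous_on UNIV (\<lambda>x. min x y - min x z)" by (intro continuous_intros)
    qed (auto simp: min_def)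
    finally show ?thesis .
  qed
  show ?thesis
    unfolding continuous_on_def
  proof
    fix z
    have "((\<lambda>y. kap y - kap z) \<longlongrightarrow> 0) (at z)"
    proof (rule Lim_null_comparison)
      show "\<forall>\<^sub>F y in at z. norm (kap y - kap z) \<le> 2 * G * \<bar>y - z\<bar>"
        using lip by (intro always_eventually allI) simp
      have "((\<lambda>y. 2 * G * \<bar>y - z\<bar>) \<longlongrightarrow> 2 * G * \<bar>z - z\<bar>) (at z)" by (intro tendsto_intros)
      then show "((\<lambda>y. 2 * G * \<bar>y - z\<bar>) \<longlongrightarrow> 0) (at z)" by simp
    qed
    then show "(kap \<longlongrightarrow> kap z) (at z within UNIV)" by (simp add: LIM_zero_iff)
  qed
qed

text \<open>For p = - deriv \<rho> this is the derivative in \<theta> of \<rho>((s - \<theta>) / e)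
  / e.\<close>

definition K :: "real \<Rightarrow> real \<Rightarrow> real \<Rightarrow> real" where
  "K e \<theta> s = p ((s - \<theta>) / e) / e\<^sup>2"

lemma K_joint_cont: "e \<noteq> 0 \<Longrightarrow> continuous_on UNIV (\<lambda>z. K e (fst z) (snd z))"
  unfolding K_def by (intro continuous_on_compose2[OF p_cont] continuous_intros) auto

lemma K_cont: "e \<noteq> 0 \<Longrightarrow> continuous_on UNIV (K e \<theta>)"
  unfolding K_def[abs_def] by (intro continuous_on_compose2[OF p_cont] continuous_intros) auto

lemma K_bound: "\<bar>K e \<theta> s\<bar> \<le> G / e\<^sup>2"
  unfolding K_def using p_bound by (simp add: abs_divide divide_right_mono)

lemma K_supp: "0 < e \<Longrightarrow> e \<le> \<bar>s - \<theta>\<bar> \<Longrightarrow> K e \<theta> s = 0"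
  unfolding K_def by (subst p_supp) (auto simp: abs_divide le_divide_eq)

text \<open>The window of radius e around \<theta> lies inside the unit interval, so the truncation
  of the integral is invisible and a substitution reduces everything to the profile
  \<open>p\<close>.\<close>

lemma K_integral:
  assumes e: "0 < e" "0 \<le> \<theta> - e" "\<theta> + e \<le> 1"
  shows "(LINT s:{0..1}|lborel. K e \<theta> s * q s) = (1 / e) * (LINT x|lborel. p x * q (\<theta> + e * x))"
proof -
  have "(LINT s:{0..1}|lborel. K e \<theta> s * q s) = (LINT s|lborel. K e \<theta> s * q s)"
    unfolding set_lebesgue_integral_def
  proof (intro Bochner_Integration.integral_cong refl)
    fix s :: real
    show "indicat_real {0..1} s *\<^sub>R (K e \<theta> s * q s) = K e \<theta> s * q s"
      using e K_supp[of e s \<theta>] by (cases "s \<in> {0..1}") (auto simp: indicator_def)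
  qed
  also have "\<dots> = \<bar>e\<bar> *\<^sub>R (LINT x|lborel. K e \<theta> (\<theta> + e * x) * q (\<theta> + e * x))"
    by (rule lborel_integral_real_affine) (use e in simp)
  also have "(LINT x|lborel. K e \<theta> (\<theta> + e * x) * q (\<theta> + e * x)) = (LINT x|lborel. (1 / e\<^sup>2) * (p x * q (\<theta> + e * x)))"
    using e by (intro Bochner_Integration.integral_cong refl) (simp add: K_def)
  finally show ?thesis using e by (simp add: power2_eq_square)
qed

lemma K_mean:
  assumes e: "0 < e" "0 \<le> \<theta> - e" "\<theta> + e \<le> 1"
  shows "(LINT s:{0..1}|lborel. K e \<theta> s) = 0"
  using K_integral[OF e, of "\<lambda>_. 1"] by (simp add: p_mean)

text \<open>min (\<theta> + e x, t) is \<theta> + e min (x, (t - \<theta>) / e). The constant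
  \<theta> is annihilated by the mean-zero profile, and the factor e cancels the 1/e left by the
  substitution.\<close>

lemma K_min:
  assumes e: "0 < e" "0 \<le> \<theta> - e" "\<theta> + e \<le> 1"
  shows "(LINT s:{0..1}|lborel. K e \<theta> s * min s t) = kap ((t - \<theta>) / e)"
proof -
  have m: "min (\<theta> + e * x) t = \<theta> + e * min x ((t - \<theta>) / e)" for x
    using e by (auto simp: min_def field_simps)
  have i: "integrable lborel (\<lambda>x. p x * \<theta>)" "integrable lborel (\<lambda>x. e * (p x * min x ((t - \<theta>) / e)))"
    by (intro integrable_mult_right integrable_p_mult continuous_intros)+
  have "(LINT s:{0..1}|lborel. K e \<theta> s * min s t) = (1 / e) * (LINT x|lborel. p x * \<theta> + e * (p x * min x ((t - \<theta>) / e)))"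
    unfolding K_integral[OF e] m by (simp add: algebra_simps)
  also have "(LINT x|lborel. p x * \<theta> + e * (p x * min x ((t - \<theta>) / e))) = e * kap ((t - \<theta>) / e)"
    unfolding Bochner_Integration.integral_add[OF i] kap_def by (simp add: p_mean)
  finally show ?thesis using e by simp
qed

end

section \<open>Fourth moments of the oscillation and of the occupation of a window\<close>

lemma mean_power4_le:
  fixes g :: "real \<Rightarrow> real"
  assumes g: "continuous_on UNIV g" and ab: "a < b"
  shows "(LINT s:{a..b}|lborel. g s) ^ 4 \<le> (b - a) ^ 3 * (LINT s:{a..b}|lborel. (g s) ^ 4)"
proof -
  let ?l = "b - a"
  let ?I = "LINT s:{a..b}|lborel. g s"
  let ?m = "?I / ?l"
  have cst: "(LINT s:{a..b}|lborel. x) = x * ?l" for x :: real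
    using ab by (simp add: set_lebesgue_integral_def)
  have "(LINT s:{a..b}|lborel. (?m ^ 4 - 4 * ?m ^ 4) + 4 * ?m ^ 3 * g s) \<le> (LINT s:{a..b}|lborel. (g s) ^ 4)"
  proof (rule set_integral_mono)
    fix s
    \<comment> \<open>Jensen's inequality for the fourth power: the remainder beyond the tangent at
      the mean is a square times a sum of squares.\<close>
    have "(g s) ^ 4 - ((?m ^ 4 - 4 * ?m ^ 4) + 4 * ?m ^ 3 * g s) = (g s - ?m)\<^sup>2 * ((g s + ?m)\<^sup>2 + 2 * ?m\<^sup>2)"
      by (simp add: power2_eq_square power4_eq_xxxx power3_eq_cube algebra_simps)
    also have "\<dots> \<ge> 0" by simp
    finally show "(?m ^ 4 - 4 * ?m ^ 4) + 4 * ?m ^ 3 * g s \<le> (g s) ^ 4" by simp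
  qed (intro set_integrable_cont continuous_intros g)+
  also have "(LINT s:{a..b}|lborel. (?m ^ 4 - 4 * ?m ^ 4) + 4 * ?m ^ 3 * g s) = (?m ^ 4 - 4 * ?m ^ 4) * ?l + 4 * ?m ^ 3 * ?I"
    by (subst set_integral_add(2)) (auto intro!: set_integrable_cont continuous_intros g simp: cst)
  also have "\<dots> = ?I ^ 4 / ?l ^ 3"
  proof -
    have "(m ^ 4 - 4 * m ^ 4) * l + 4 * m ^ 3 * (m * l) = (m * l) ^ 4 / l ^ 3" if "l \<noteq> 0" for m l :: real
      using that by (simp add: power_mult_distrib power4_eq_xxxx power3_eq_cube)
    from this[of ?l ?m] show ?thesis using ab by simp
  qed
  finally show ?thesis using ab by (simp add: divide_le_eq mult.commute)
qed

context brownian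
begin

text \<open>A majorant of the paths with all moments, uniform in time, takes the place of the
  integrability conditions of \<open>fubini_time\<close>.\<close>

lemma fubini_dominated:
  fixes X :: "real \<Rightarrow> 'w \<Rightarrow> real"
  assumes X: "(\<lambda>(r, \<omega>). X r \<omega>) \<in> borel_measurable (borel \<Otimes>\<^sub>M M)" and w: "Lp w"
    and b: "\<And>r \<omega>. r \<in> {0..1} \<Longrightarrow> \<omega> \<in> space M \<Longrightarrow> \<bar>X r \<omega>\<bar> \<le> w \<omega>"
  shows "(\<integral>\<omega>. (LINT r:{0..1}|lborel. X r \<omega>) \<partial>M) = (LINT r:{0..1}|lborel. (\<integral>\<omega>. X r \<omega> \<partial>M))"
    and "Lp (\<lambda>\<omega>. LINT r:{0..1}|lborel. X r \<omega>)"
    and "set_integrable lborel {0..1} (\<lambda>r. \<integral>\<omega>. X r \<omega> \<partial>M)"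
    and "\<And>\<omega>. \<omega> \<in> space M \<Longrightarrow> \<bar>LINT r:{0..1}|lborel. X r \<omega>\<bar> \<le> w \<omega>"
proof -
  have Xm: "X r \<in> borel_measurable M" for r
    using measurable_compose[OF measurable_Pair1' X, of r] by simp
  have Xt: "(\<lambda>r. X r \<omega>) \<in> borel_measurable borel" if "\<omega> \<in> space M" for \<omega>
    using measurable_compose[OF measurable_Pair2'[OF that] X] by simp
  have i: "integrable M (X r)" if "r \<in> {0..1}" for r
    by (rule Lp_integrable[OF LpI_dominated[OF w Xm b[OF that]]])
  have wi: "integrable M w" by (rule Lp_integrable[OF w])
  have le: "(\<integral>\<omega>. \<bar>X r \<omega>\<bar> \<partial>M) \<le> (\<integral>\<omega>. w \<omega> \<partial>M)" if "r \<in> {0..1}" for r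
    by (intro integral_mono integrable_abs i[OF that] wi b[OF that])
  have 0: "0 \<le> (\<integral>\<omega>. w \<omega> \<partial>M)"
    by (rule order_trans[OF _ le[of 0]]) (auto intro: Bochner_Integration.integral_nonneg)
  note F = fubini_time[OF X _ _ 0 i le, of "{0..1}"]
  show "(\<integral>\<omega>. (LINT r:{0..1}|lborel. X r \<omega>) \<partial>M) = (LINT r:{0..1}|lborel. (\<integral>\<omega>. X r \<omega> \<partial>M))"
    by (rule F(2)) auto
  show "set_integrable lborel {0..1} (\<lambda>r. \<integral>\<omega>. X r \<omega> \<partial>M)"
    by (rule F(3)) auto
  show bd: "\<bar>LINT r:{0..1}|lborel. X r \<omega>\<bar> \<le> w \<omega>" if \<omega>: "\<omega> \<in> space M" for \<omega>
  proof -
    have si: "set_integrable lborel {0..1} (\<lambda>r::real. w \<omega>)" by (intro set_integrable_cont continuous_intros)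
    have sX: "set_integrable lborel {0..1} (\<lambda>r. X r \<omega>)"
      by (rule set_integrable_bound[OF si]) (use Xt[OF \<omega>] b[OF _ \<omega>] in \<open>auto simp: set_borel_measurable_def intro: order_trans[OF _ abs_ge_self]\<close>)
    have "\<bar>LINT r:{0..1}|lborel. X r \<omega>\<bar> \<le> (LINT r:{0..1}|lborel. \<bar>X r \<omega>\<bar>)"
      using set_integral_norm_bound[OF sX] by simp
    also have "\<dots> \<le> (LINT r:{0..1::real}|lborel. w \<omega>)"
      by (rule set_integral_mono[OF set_integrable_abs[OF sX] si]) (rule b[OF _ \<omega>])
    finally show ?thesis by (simp add: set_integral_const_01)
  qed
  show "Lp (\<lambda>\<omega>. LINT r:{0..1}|lborel. X r \<omega>)"
    by (rule LpI_dominated[OF w time_integral_measurable[OF X] bd]) auto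
qed

lemma increment_moment4:
  assumes "s \<in> {0..1}" "t \<in> {0..1}"
  shows "(\<integral>\<omega>. (W s \<omega> - W t \<omega>) ^ 4 \<partial>M) = 3 * (s - t)\<^sup>2"
proof -
  have *: "(\<integral>\<omega>. (B t \<omega> - B s \<omega>) ^ 4 \<partial>M) = 3 * (t - s)\<^sup>2" if st: "0 \<le> s" "s < t" "t \<le> 1" for s t
  proof -
    have "(\<integral>\<omega>. (B t \<omega> - B s \<omega>) ^ 4 \<partial>M) = (\<integral>x. normal_density 0 (sqrt (t - s)) x * x ^ 4 \<partial>lborel)"
      by (rule distributed_integral[OF B_incr[OF st], symmetric]) auto
    also have "\<dots> = fact (2 * 2) / ((2 / (sqrt (t - s))\<^sup>2) ^ 2 * fact 2)"
      using integral_normal_moment_even[of "sqrt (t - s)" 0 2] st by simp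
    also have "\<dots> = 3 * (t - s)\<^sup>2" using st by (simp add: fact_numeral power_divide)
    finally show ?thesis .
  qed
  consider "s < t" | "s = t" | "t < s" by linarith
  then show ?thesis
  proof cases
    case 1
    then show ?thesis using *[of s t] assms by (simp add: W_eq power2_commute power4_eq_xxxx power2_eq_square algebra_simps)
  next
    case 3
    then show ?thesis using *[of t s] assms by (simp add: W_eq)
  qed simp
qed

definition osc :: "real \<Rightarrow> real \<Rightarrow> 'w \<Rightarrow> real" where
  "osc t d \<omega> = (LINT s:{t - d..t + d}|lborel. \<bar>W s \<omega> - W t \<omega>\<bar>)"

text \<open>The oscillation is of order d^(3/2), the length of the window times the square root of
  its radius. The constant 48 collects (2 d)^3 from Jensen, the window length 2 d, and the fourth
  moment 3 d^2 of an increment.\<close>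

lemma osc_moment:
  assumes d: "0 < d" "0 \<le> t - d" "t + d \<le> 1"
  shows "Lp (osc t d)" and "(\<integral>\<omega>. osc t d \<omega> ^ 4 \<partial>M) \<le> 48 * d ^ 6"
proof -
  let ?A = "{t - d..t + d}"
  have t: "t \<in> {0..1}" using d by auto
  have A: "?A \<in> sets borel" "?A \<subseteq> {0..1}" using d by auto
  have [measurable]: "(\<lambda>z. W (fst z) (snd z)) \<in> borel_measurable (borel \<Otimes>\<^sub>M M)"
    using W_joint by (simp add: case_prod_beta')
  note [measurable] = W_measurable
  have j: "(\<lambda>(s, \<omega>). \<bar>W s \<omega> - W t \<omega>\<bar>) \<in> borel_measurable (borel \<Otimes>\<^sub>M M)"
    "(\<lambda>(s, \<omega>). (W s \<omega> - W t \<omega>) ^ 4) \<in> borel_measurable (borel \<Otimes>\<^sub>M M)"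
    unfolding case_prod_beta' by measurable
  have om: "osc t d \<in> borel_measurable M"
    unfolding osc_def[abs_def] by (rule time_integral_measurable[OF j(1) A(1)])
  show "Lp (osc t d)"
  proof (rule LpI_dominated[OF _ om])
    show "Lp (\<lambda>\<omega>. (1 + Q \<omega>) + \<bar>W t \<omega>\<bar>)"
    proof (intro Lp_add Lp_const Lp_Q)
      show "Lp (\<lambda>\<omega>. \<bar>W t \<omega>\<bar>)" using Lp_W[of t] by (simp add: Lp_def)
    qed
    fix \<omega> assume \<omega>: "\<omega> \<in> space M"
    have c: "continuous_on UNIV (\<lambda>s. \<bar>W s \<omega>\<bar> + \<bar>W t \<omega>\<bar>)" "continuous_on UNIV (\<lambda>s. \<bar>W s \<omega> - W t \<omega>\<bar>)"
      by (intro continuous_intros W_cont \<omega>)+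
    have "osc t d \<omega> \<le> (LINT s:?A|lborel. \<bar>W s \<omega>\<bar> + \<bar>W t \<omega>\<bar>)"
      unfolding osc_def by (intro set_integral_mono set_integrable_cont c) auto
    also have "\<dots> \<le> (LINT s:{0..1}|lborel. \<bar>W s \<omega>\<bar> + \<bar>W t \<omega>\<bar>)"
    proof -
      have "integrable lborel (\<lambda>s. indicator {0..1} s *\<^sub>R (\<bar>W s \<omega>\<bar> + \<bar>W t \<omega>\<bar>))" "integrable lborel (\<lambda>s. indicator ?A s *\<^sub>R (\<bar>W s \<omega>\<bar> + \<bar>W t \<omega>\<bar>))"
        using set_integrable_cont[OF c(1)] unfolding set_integrable_def by blast+
      then show ?thesis unfolding set_lebesgue_integral_def
        using A(2) by (intro integral_mono) (auto simp: indicator_def)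
    qed
    also have "\<dots> = (LINT s:{0..1}|lborel. \<bar>W s \<omega>\<bar>) + \<bar>W t \<omega>\<bar>"
      by (subst set_integral_add(2)) (auto intro!: set_integrable_cont continuous_intros W_cont \<omega> simp: set_integral_const_01)
    also have "\<dots> \<le> (1 + Q \<omega>) + \<bar>W t \<omega>\<bar>" using integral_abs_W_le[OF \<omega>] by simp
    finally show "\<bar>osc t d \<omega>\<bar> \<le> (1 + Q \<omega>) + \<bar>W t \<omega>\<bar>"
      using Bochner_Integration.integral_nonneg[of lborel "\<lambda>s. indicat_real ?A s *\<^sub>R \<bar>W s \<omega> - W t \<omega>\<bar>"]
      by (simp add: osc_def set_lebesgue_integral_def)
  qed
  then have oL: "Lp (\<lambda>\<omega>. osc t d \<omega> ^ 4)" by (rule Lp_power)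
  have Wi: "integrable M (\<lambda>\<omega>. (W s \<omega> - W t \<omega>) ^ 4)" for s
    by (intro Lp_integrable Lp_power Lp_minus Lp_W)
  have b: "(\<integral>\<omega>. \<bar>(W s \<omega> - W t \<omega>) ^ 4\<bar> \<partial>M) \<le> 3 * d\<^sup>2" if s: "s \<in> ?A" for s
  proof -
    have s01: "s \<in> {0..1}" using s A by blast
    have "\<bar>s - t\<bar> \<le> d" using s by (auto simp: abs_le_iff)
    then have "\<bar>s - t\<bar>\<^sup>2 \<le> d\<^sup>2" by (intro power_mono) auto
    then show ?thesis using increment_moment4[OF s01 t] by (simp add: power_even_abs)
  qed
  note F = fubini_time[OF j(2) A _ Wi b]
  have "(\<integral>\<omega>. osc t d \<omega> ^ 4 \<partial>M) \<le> (\<integral>\<omega>. (2 * d) ^ 3 * (LINT s:?A|lborel. (W s \<omega> - W t \<omega>) ^ 4) \<partial>M)"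
  proof (rule integral_mono)
    show "integrable M (\<lambda>\<omega>. osc t d \<omega> ^ 4)" by (rule Lp_integrable[OF oL])
    show "integrable M (\<lambda>\<omega>. (2 * d) ^ 3 * (LINT s:?A|lborel. (W s \<omega> - W t \<omega>) ^ 4))"
      by (intro integrable_mult_right F(1)) auto
    fix \<omega> assume \<omega>: "\<omega> \<in> space M"
    show "osc t d \<omega> ^ 4 \<le> (2 * d) ^ 3 * (LINT s:?A|lborel. (W s \<omega> - W t \<omega>) ^ 4)"
      using mean_power4_le[of "\<lambda>s. \<bar>W s \<omega> - W t \<omega>\<bar>" "t - d" "t + d"] d W_cont[OF \<omega>]
      unfolding osc_def by (simp add: continuous_intros power_even_abs)
  qed
  also have "\<dots> = (2 * d) ^ 3 * (LINT s:?A|lborel. (\<integral>\<omega>. (W s \<omega> - W t \<omega>) ^ 4 \<partial>M))"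
    using F(2) by simp
  also have "\<dots> \<le> (2 * d) ^ 3 * (LINT s:?A|lborel. 3 * d\<^sup>2)"
  proof (intro mult_left_mono)
    have "set_integrable lborel ?A (\<lambda>s. \<integral>\<omega>. (W s \<omega> - W t \<omega>) ^ 4 \<partial>M)" by (rule F(3)) simp
    moreover have "set_integrable lborel ?A (\<lambda>s. 3 * d\<^sup>2)" by (intro set_integrable_cont continuous_intros)
    moreover have "(\<integral>\<omega>. (W s \<omega> - W t \<omega>) ^ 4 \<partial>M) \<le> 3 * d\<^sup>2" if "s \<in> ?A" for s
      using b[OF that] by (simp add: power_even_abs)
    ultimately show "(LINT s:?A|lborel. (\<integral>\<omega>. (W s \<omega> - W t \<omega>) ^ 4 \<partial>M)) \<le> (LINT s:?A|lborel. 3 * d\<^sup>2)"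
      by (rule set_integral_mono)
  qed (use d in auto)
  also have "\<dots> = 48 * d ^ 6"
    using d by (simp add: set_lebesgue_integral_def power2_eq_square eval_nat_numeral)
  finally show "(\<integral>\<omega>. osc t d \<omega> ^ 4 \<partial>M) \<le> 48 * d ^ 6" .
qed

text \<open>The gain over \<open>occ_moment\<close> with k = 4 lies in the earliest time. Since
  \<alpha> > 0, its density counted from time 0 is bounded by 1 / sqrt (2 pi \<alpha>), so it
  contributes \<beta> - \<alpha> instead of a square root, and the exponent is 5/2 instead of 2. The
  extra half power is the small probability that the path visits the level during the window. The
  constant 24 is 4 times 3!.\<close>

lemma occ_moment4:
  assumes \<phi>: "continuous_on UNIV \<phi>" "\<And>x. 0 \<le> \<phi> x" "(\<integral>\<^sup>+x. ennreal (\<phi> x) \<partial>lborel) \<le> 1"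
    and ab: "0 < \<alpha>" "\<alpha> \<le> \<beta>" "\<beta> \<le> 1"
  shows "(\<integral>\<^sup>+\<omega>. ennreal (occ \<phi> \<alpha> \<beta> \<omega> ^ 4) \<partial>M) \<le> ennreal (24 * sqrt (\<beta> - \<alpha>) ^ 3 * (1 / sqrt (2 * pi * \<alpha>)) * (\<beta> - \<alpha>))"
proof -
  have \<phi>m: "(\<lambda>x. ennreal (\<phi> x)) \<in> borel_measurable borel"
    using borel_measurable_continuous_onI[OF \<phi>(1)] by measurable
  let ?C = "6 * sqrt (\<beta> - \<alpha>) ^ 3 * (1 / sqrt (2 * pi * \<alpha>))"
  have C: "0 \<le> ?C" using ab by auto
  have "(\<integral>\<^sup>+\<omega>. ennreal (occ \<phi> \<alpha> \<beta> \<omega> ^ 4) \<partial>M) = (\<integral>\<^sup>+\<omega>. 1 * ennreal (occ \<phi> \<alpha> \<beta> \<omega> ^ Suc 3) \<partial>M)" by simp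
  also have "\<dots> = (\<integral>\<^sup>+r. (\<integral>\<^sup>+\<omega>. 1 * ennreal (\<phi> (W r \<omega>)) * ennreal (occ \<phi> r \<beta> \<omega> ^ 3) \<partial>M) * (ennreal (real (Suc 3)) * indicator {\<alpha>..\<beta>} r) \<partial>lborel)"
    by (rule nn_fubini_occ_power[OF \<phi>(1,2) ab(2)]) simp
  also have "\<dots> \<le> (\<integral>\<^sup>+r. ennreal ?C * (ennreal (real (Suc 3)) * indicator {\<alpha>..\<beta>} r) \<partial>lborel)"
  proof (rule nn_integral_mono)
    fix r :: real
    show "(\<integral>\<^sup>+\<omega>. 1 * ennreal (\<phi> (W r \<omega>)) * ennreal (occ \<phi> r \<beta> \<omega> ^ 3) \<partial>M) * (ennreal (real (Suc 3)) * indicator {\<alpha>..\<beta>} r)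
      \<le> ennreal ?C * (ennreal (real (Suc 3)) * indicator {\<alpha>..\<beta>} r)"
    proof (cases "r \<in> {\<alpha>..\<beta>}")
      case True
      then have r: "0 < r" "r \<le> 1" "\<alpha> \<le> r" "r \<le> \<beta>" using ab by auto
      then have r01: "r \<in> {0..1}" by simp
      have "(\<integral>\<^sup>+\<omega>. 1 * ennreal (\<phi> (W r \<omega>)) * ennreal (occ \<phi> r \<beta> \<omega> ^ 3) \<partial>M)
        = (\<integral>\<^sup>+\<omega>. (\<lambda>k. ennreal (\<phi> (k r))) (\<lambda>s. B s \<omega>) * ennreal (occ \<phi> r \<beta> \<omega> ^ 3) \<partial>M)"
        unfolding W_eq[OF r01] by simp
      also have "\<dots> \<le> ennreal (fact 3 * sqrt (\<beta> - r) ^ 3) * (\<integral>\<^sup>+\<omega>. (\<lambda>k. ennreal (\<phi> (k r))) (\<lambda>s. B s \<omega>) \<partial>M)"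
        using r ab by (intro occ_moment[OF \<phi>, where T = "{r}"] cyl_compose[OF \<phi>m] cyl_coord) auto
      also have "\<dots> \<le> ennreal (fact 3 * sqrt (\<beta> - \<alpha>) ^ 3) * ennreal (1 / sqrt (2 * pi * \<alpha>))"
      proof (intro mult_mono)
        show "ennreal (fact 3 * sqrt (\<beta> - r) ^ 3) \<le> ennreal (fact 3 * sqrt (\<beta> - \<alpha>) ^ 3)"
          using r by (intro ennreal_leI mult_left_mono power_mono) auto
        have "(\<integral>\<^sup>+\<omega>. 1 * ennreal (\<phi> (B r \<omega>)) \<partial>M) \<le> ennreal (1 / sqrt (2 * pi * (r - 0))) * (\<integral>\<^sup>+\<omega>. 1 \<partial>M)"
          by (rule one_step[where T = "{}" and G = "\<lambda>_. 1" and s = 0]) (use r \<phi>m \<phi>(3) in auto)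
        also have "\<dots> \<le> ennreal (1 / sqrt (2 * pi * \<alpha>))"
          using r ab by (simp add: emeasure_space_1) (intro ennreal_leI divide_left_mono, auto)
        finally show "(\<integral>\<^sup>+\<omega>. (\<lambda>k. ennreal (\<phi> (k r))) (\<lambda>s. B s \<omega>) \<partial>M) \<le> ennreal (1 / sqrt (2 * pi * \<alpha>))" by simp
      qed auto
      also have "\<dots> = ennreal ?C"
        using ab by (subst ennreal_mult[symmetric]) (auto simp: fact_numeral)
      finally show ?thesis by (rule mult_right_mono) simp
    qed simp
  qed
  also have "\<dots> = ennreal ?C * (ennreal (real (Suc 3)) * ennreal (\<beta> - \<alpha>))"
    using ab by (simp add: nn_integral_cmult)
  also have "\<dots> = ennreal (?C * (real (Suc 3) * (\<beta> - \<alpha>)))"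
    using ab C by (simp only: ennreal_mult[symmetric] of_nat_0_le_iff diff_ge_0_iff_ge mult_nonneg_nonneg)
  also have "?C * (real (Suc 3) * (\<beta> - \<alpha>)) = 24 * sqrt (\<beta> - \<alpha>) ^ 3 * (1 / sqrt (2 * pi * \<alpha>)) * (\<beta> - \<alpha>)" by simp
  finally show ?thesis .
qed

end

section \<open>The derivative of the mollified path as a process: bounds, covariances, integration
  by parts\<close>

locale brownian_kernel = brownian M B + kernel p G
  for M :: "'w measure" and B :: "real \<Rightarrow> 'w \<Rightarrow> real" and p :: "real \<Rightarrow> real" and G :: real
begin

text \<open>With \<open>p = - deriv \<rho>\<close> this is \<open>mollify_deriv\<close> along the path.\<close>

definition N :: "real \<Rightarrow> real \<Rightarrow> 'w \<Rightarrow> real" where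
  "N e \<theta> \<omega> = (LINT s:{0..1}|lborel. K e \<theta> s * W s \<omega>)"

lemma Lp_N: "e \<noteq> 0 \<Longrightarrow> Lp (N e \<theta>)"
  unfolding N_def[abs_def] by (rule Lp_time_integral(1)[OF K_cont K_bound])

lemma N_bound: "e \<noteq> 0 \<Longrightarrow> \<omega> \<in> space M \<Longrightarrow> \<bar>N e \<theta> \<omega>\<bar> \<le> G / e\<^sup>2 * (1 + Q \<omega>)"
  unfolding N_def by (rule Lp_time_integral(2)[OF K_cont K_bound])

lemma N_cont:
  assumes "e \<noteq> 0" "\<omega> \<in> space M"
  shows "continuous_on UNIV (\<lambda>\<theta>. N e \<theta> \<omega>)"
proof -
  have eq: "N e \<theta> \<omega> = integral (cbox 0 1) (\<lambda>s. K e \<theta> s * W s \<omega>)" for \<theta>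
    unfolding N_def cbox_interval
    by (intro set_borel_integral_eq_integral set_integrable_cont continuous_on_mult K_cont W_cont assms)
  have "continuous_on (UNIV \<times> cbox 0 1) (\<lambda>z. K e (fst z) (snd z) * W (snd z) \<omega>)"
    by (intro continuous_on_mult continuous_on_subset[OF K_joint_cont[OF assms(1)]]
        continuous_on_compose2[OF W_cont[OF assms(2)]] continuous_intros) auto
  then show ?thesis
    unfolding eq by (intro integral_continuous_on_param) (simp add: case_prod_beta')
qed

lemma N_joint: "e \<noteq> 0 \<Longrightarrow> (\<lambda>(\<theta>, \<omega>). N e \<theta> \<omega>) \<in> borel_measurable (borel \<Otimes>\<^sub>M M)"
  by (intro caratheodory_measurable Lp_measurable Lp_N N_cont)

definition wick_increment :: "real \<Rightarrow> real \<Rightarrow> real \<Rightarrow> 'w \<Rightarrow> real" where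
  "wick_increment e e' \<theta> \<omega> = ((N e \<theta> \<omega>)\<^sup>2 - (N e' \<theta> \<omega>)\<^sup>2) - (\<integral>\<omega>. (N e \<theta> \<omega>)\<^sup>2 - (N e' \<theta> \<omega>)\<^sup>2 \<partial>M)"

text \<open>A crude majorant, uniform in \<theta> but deteriorating as the scales shrink. It
  supplies domination and moments while the scales are held fixed.\<close>

definition wick_weight :: "real \<Rightarrow> real \<Rightarrow> 'w \<Rightarrow> real" where
  "wick_weight e e' \<omega> = (G / e\<^sup>2 * (1 + Q \<omega>))\<^sup>2 + (G / e'\<^sup>2 * (1 + Q \<omega>))\<^sup>2"

lemma Lp_wick_weight: "Lp (wick_weight e e')"
  unfolding wick_weight_def[abs_def] by (intro Lp_add Lp_power Lp_mult Lp_const Lp_Q)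

lemma N_sq_bound:
  assumes "e \<noteq> 0" "e' \<noteq> 0" "\<omega> \<in> space M"
  shows "\<bar>(N e \<theta> \<omega>)\<^sup>2 - (N e' \<theta> \<omega>)\<^sup>2\<bar> \<le> wick_weight e e' \<omega>"
proof -
  have "\<bar>N e \<theta> \<omega>\<bar>\<^sup>2 \<le> (G / e\<^sup>2 * (1 + Q \<omega>))\<^sup>2" "\<bar>N e' \<theta> \<omega>\<bar>\<^sup>2 \<le> (G / e'\<^sup>2 * (1 + Q \<omega>))\<^sup>2"
    by (intro power_mono N_bound assms abs_ge_zero)+
  then show ?thesis
    using zero_le_power2[of "N e \<theta> \<omega>"] zero_le_power2[of "N e' \<theta> \<omega>"]
    unfolding wick_weight_def power2_abs by linarith
qed

lemma wick_increment_bound: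
  assumes "e \<noteq> 0" "e' \<noteq> 0" "\<omega> \<in> space M"
  shows "\<bar>wick_increment e e' \<theta> \<omega>\<bar> \<le> wick_weight e e' \<omega> + (\<integral>\<omega>. wick_weight e e' \<omega> \<partial>M)"
proof -
  have i: "integrable M (\<lambda>\<omega>. (N e \<theta> \<omega>)\<^sup>2 - (N e' \<theta> \<omega>)\<^sup>2)"
    by (intro Lp_integrable Lp_minus Lp_power Lp_N assms)
  have "\<bar>\<integral>\<omega>. (N e \<theta> \<omega>)\<^sup>2 - (N e' \<theta> \<omega>)\<^sup>2 \<partial>M\<bar> \<le> (\<integral>\<omega>. \<bar>(N e \<theta> \<omega>)\<^sup>2 - (N e' \<theta> \<omega>)\<^sup>2\<bar> \<partial>M)"
    using integral_norm_bound[of M "\<lambda>\<omega>. (N e \<theta> \<omega>)\<^sup>2 - (N e' \<theta> \<omega>)\<^sup>2"] by simp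
  also have "\<dots> \<le> (\<integral>\<omega>. wick_weight e e' \<omega> \<partial>M)"
    by (intro integral_mono integrable_abs i Lp_integrable Lp_wick_weight N_sq_bound assms)
  finally show ?thesis using N_sq_bound[OF assms, of \<theta>] unfolding wick_increment_def by linarith
qed

lemma wick_increment_joint:
  assumes "e \<noteq> 0" "e' \<noteq> 0"
  shows "(\<lambda>(\<theta>, \<omega>). wick_increment e e' \<theta> \<omega>) \<in> borel_measurable (borel \<Otimes>\<^sub>M M)"
proof -
  have [measurable]: "(\<lambda>z. N e (fst z) (snd z)) \<in> borel_measurable (borel \<Otimes>\<^sub>M M)"
    "(\<lambda>z. N e' (fst z) (snd z)) \<in> borel_measurable (borel \<Otimes>\<^sub>M M)"
    using N_joint[OF assms(1)] N_joint[OF assms(2)] by (simp_all add: case_prod_beta')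
  have "(\<lambda>\<theta>. \<integral>\<omega>. (N e \<theta> \<omega>)\<^sup>2 - (N e' \<theta> \<omega>)\<^sup>2 \<partial>M) \<in> borel_measurable borel"
    by (rule borel_measurable_lebesgue_integral) (simp add: case_prod_beta')
  then have [measurable]: "(\<lambda>z. \<integral>\<omega>. (N e (fst z) \<omega>)\<^sup>2 - (N e' (fst z) \<omega>)\<^sup>2 \<partial>M) \<in> borel_measurable (borel \<Otimes>\<^sub>M M)"
    using measurable_compose[OF measurable_fst] by blast
  show ?thesis unfolding wick_increment_def case_prod_beta' by measurable
qed

text \<open>The covariance of \<open>N e \<theta> - N e' \<theta>\<close> with \<open>B t\<close> when \<open>\<theta>\<close> has distance at least \<open>e\<close> from the
  endpoints. It vanishes at \<open>t = \<theta>\<close>.\<close>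

definition v :: "real \<Rightarrow> real \<Rightarrow> real \<Rightarrow> real \<Rightarrow> real" where
  "v e e' \<theta> t = kap ((t - \<theta>) / e) - kap ((t - \<theta>) / e')"

lemma v_bound: "\<bar>v e e' \<theta> t\<bar> \<le> 4 * G"
  using kap_bound[of "(t - \<theta>) / e"] kap_bound[of "(t - \<theta>) / e'"] unfolding v_def by linarith

text \<open>On either side of \<theta> the profile has left its transition zone at both scales and
  takes the same value, 0 on the left and \<open>kap 1\<close> on the right. This is how the
  direction of differentiation becomes localised.\<close>

lemma v_supp:
  assumes "0 < e'" "e' \<le> e" "e \<le> \<bar>t - \<theta>\<bar>"
  shows "v e e' \<theta> t = 0"
proof (cases "0 \<le> t - \<theta>")
  case True
  then have 1: "1 \<le> (t - \<theta>) / e" "1 \<le> (t - \<theta>) / e'" using assms by (auto simp: le_divide_eq)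
  show ?thesis unfolding v_def using kap_ge[OF 1(1)] kap_ge[OF 1(2)] by linarith
next
  case False
  then have "(t - \<theta>) / e \<le> -1" "(t - \<theta>) / e' \<le> -1" using assms by (auto simp: divide_le_eq)
  then show ?thesis unfolding v_def using kap_le by simp
qed

lemma v_measurable: "(\<lambda>\<theta>. v e e' \<theta> t) \<in> borel_measurable borel"
proof -
  have [measurable]: "kap \<in> borel_measurable borel" by (rule borel_measurable_continuous_onI[OF kap_cont])
  show ?thesis unfolding v_def by measurable
qed

text \<open>\<open>ibp_weighted\<close> with the difference and the sum of the two kernels, so that
  the product of the averages is the difference of the squares. The condition at \<theta> holds
  because both terms of \<open>v\<close> equal \<open>kap 0\<close> there.\<close>

lemma ibp_N:
  assumes f: "smooth_cyl n A c f D"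
    and \<phi>: "L \<ge> 0" "\<And>x y. \<bar>\<phi> x - \<phi> y\<bar> \<le> L * \<bar>x - y\<bar>" "\<And>x. \<bar>\<phi> x\<bar> \<le> L"
    "\<And>x. (\<phi> has_real_derivative \<phi>' x) (at x)" "\<And>x. \<bar>\<phi>' x\<bar> \<le> L" "\<phi>' \<in> borel_measurable borel"
    and \<theta>: "0 \<le> \<theta> - e" "\<theta> + e \<le> 1" and e: "0 < e'" "e' \<le> e"
  shows "(\<integral>\<omega>. f (\<lambda>r. B r \<omega>) * wick_increment e e' \<theta> \<omega> * \<phi> (W \<theta> \<omega>) \<partial>M)
    = (\<Sum>i=1..n. v e e' \<theta> (real i / real n) * (\<integral>\<omega>. D i (\<lambda>r. B r \<omega>) * (N e \<theta> \<omega> + N e' \<theta> \<omega>) * \<phi> (W \<theta> \<omega>) \<partial>M))"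
proof -
  let ?k1 = "\<lambda>s. K e \<theta> s - K e' \<theta> s" and ?k2 = "\<lambda>s. K e \<theta> s + K e' \<theta> s"
  let ?c = "G / e\<^sup>2 + G / e'\<^sup>2"
  have e0: "e \<noteq> 0" "e' \<noteq> 0" using e by auto
  have k1: "continuous_on UNIV ?k1" "\<bar>?k1 s\<bar> \<le> ?c" and k2: "continuous_on UNIV ?k2" "\<bar>?k2 s\<bar> \<le> ?c" for s
    using K_bound[of e \<theta> s] K_bound[of e' \<theta> s] by (auto intro!: continuous_on_diff continuous_on_add K_cont e0)
  have si: "set_integrable lborel {0..1} (\<lambda>s. K d \<theta> s * q s)" if "d \<noteq> 0" "continuous_on UNIV q" for d q
    by (intro set_integrable_cont continuous_on_mult K_cont that)
  have N1: "(LINT s:{0..1}|lborel. ?k1 s * W s \<omega>) = N e \<theta> \<omega> - N e' \<theta> \<omega>"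
    and N2: "(LINT s:{0..1}|lborel. ?k2 s * W s \<omega>) = N e \<theta> \<omega> + N e' \<theta> \<omega>" if \<omega>: "\<omega> \<in> space M" for \<omega>
    unfolding N_def left_diff_distrib distrib_right
    using set_integral_diff(2)[OF si[OF e0(1) W_cont[OF \<omega>]] si[OF e0(2) W_cont[OF \<omega>]]]
      set_integral_add(2)[OF si[OF e0(1) W_cont[OF \<omega>]] si[OF e0(2) W_cont[OF \<omega>]]] by auto
  have vt: "(LINT s:{0..1}|lborel. ?k1 s * min s t) = v e e' \<theta> t" for t
  proof -
    have m: "continuous_on UNIV (\<lambda>s. min s t)" by (intro continuous_intros)
    have "(LINT s:{0..1}|lborel. ?k1 s * min s t) = (LINT s:{0..1}|lborel. K e \<theta> s * min s t) - (LINT s:{0..1}|lborel. K e' \<theta> s * min s t)"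
      unfolding left_diff_distrib by (rule set_integral_diff(2)[OF si[OF e0(1) m] si[OF e0(2) m]])
    also have "\<dots> = v e e' \<theta> t"
      unfolding v_def using e \<theta> by (subst K_min, simp, simp, simp)+ simp
    finally show ?thesis .
  qed
  have "\<theta> \<in> {0..1}" using \<theta> e by auto
  note I = ibp_weighted[OF f \<phi> this k1 k2, unfolded vt]
  have sq: "(N e \<theta> \<omega> - N e' \<theta> \<omega>) * (N e \<theta> \<omega> + N e' \<theta> \<omega>) = (N e \<theta> \<omega>)\<^sup>2 - (N e' \<theta> \<omega>)\<^sup>2" for \<omega>
    by (simp add: power2_eq_square algebra_simps)
  have "(\<integral>\<omega>. f (\<lambda>r. B r \<omega>) * ((LINT s:{0..1}|lborel. ?k1 s * W s \<omega>) * (LINT s:{0..1}|lborel. ?k2 s * W s \<omega>) -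
       (\<integral>\<omega>. (LINT s:{0..1}|lborel. ?k1 s * W s \<omega>) * (LINT s:{0..1}|lborel. ?k2 s * W s \<omega>) \<partial>M)) * \<phi> (W \<theta> \<omega>) \<partial>M)
     = (\<integral>\<omega>. f (\<lambda>r. B r \<omega>) * wick_increment e e' \<theta> \<omega> * \<phi> (W \<theta> \<omega>) \<partial>M)"
  proof -
    have c: "(\<integral>\<omega>. (LINT s:{0..1}|lborel. ?k1 s * W s \<omega>) * (LINT s:{0..1}|lborel. ?k2 s * W s \<omega>) \<partial>M)
      = (\<integral>\<omega>. (N e \<theta> \<omega>)\<^sup>2 - (N e' \<theta> \<omega>)\<^sup>2 \<partial>M)"
      by (intro Bochner_Integration.integral_cong refl) (simp only: N1 N2 sq)
    show ?thesis
      unfolding c wick_increment_def by (intro Bochner_Integration.integral_cong refl) (simp only: N1 N2 sq)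
  qed
  moreover have "(\<integral>\<omega>. D i (\<lambda>r. B r \<omega>) * (LINT s:{0..1}|lborel. ?k2 s * W s \<omega>) * \<phi> (W \<theta> \<omega>) \<partial>M)
    = (\<integral>\<omega>. D i (\<lambda>r. B r \<omega>) * (N e \<theta> \<omega> + N e' \<theta> \<omega>) * \<phi> (W \<theta> \<omega>) \<partial>M)" for i
    by (intro Bochner_Integration.integral_cong refl) (simp only: N2)
  moreover have "v e e' \<theta> \<theta> = 0" by (simp add: v_def)
  ultimately show ?thesis using I by (simp only:)
qed

text \<open>A mean-zero kernel allows the value of the path at any time t to be subtracted. With e
  \<le> 2 e' the two kernels together are bounded by G/e^2 plus 4 G/e^2, hence the 5, and |t -
  \<theta>| \<le> e places their supports into the window of radius 2 e around t.\<close>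

lemma N_osc_bound:
  assumes e: "0 < e'" "e' \<le> e" "e \<le> 2 * e'" and \<theta>: "0 \<le> \<theta> - e" "\<theta> + e \<le> 1" and t: "\<bar>t - \<theta>\<bar> \<le> e" and \<omega>: "\<omega> \<in> space M"
  shows "\<bar>N e \<theta> \<omega> + N e' \<theta> \<omega>\<bar> \<le> 5 * G / e\<^sup>2 * osc t (2 * e) \<omega>"
proof -
  have e0: "e \<noteq> 0" "e' \<noteq> 0" "0 < e" using e by auto
  let ?k = "\<lambda>s. K e \<theta> s + K e' \<theta> s"
  let ?V = "\<lambda>s. W s \<omega> - W t \<omega>"
  have Vc: "continuous_on UNIV ?V" by (intro continuous_intros W_cont \<omega>)
  have si: "set_integrable lborel {0..1} (\<lambda>s. K d \<theta> s * q s)" if "d \<noteq> 0" "continuous_on UNIV q" for d q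
    by (intro set_integrable_cont continuous_on_mult K_cont that)
  have N: "N d \<theta> \<omega> = (LINT s:{0..1}|lborel. K d \<theta> s * ?V s)" if d: "0 < d" "d \<le> e" for d
  proof -
    have d0: "d \<noteq> 0" using d by auto
    have "(LINT s:{0..1}|lborel. K d \<theta> s * ?V s) = N d \<theta> \<omega> - (LINT s:{0..1}|lborel. K d \<theta> s * W t \<omega>)"
      unfolding N_def right_diff_distrib by (intro set_integral_diff(2) si d0 W_cont \<omega> continuous_intros)
    also have "(LINT s:{0..1}|lborel. K d \<theta> s * W t \<omega>) = 0"
      using K_mean[of d \<theta>] d \<theta> by simp
    finally show ?thesis by simp
  qed
  have c: "continuous_on UNIV (\<lambda>s. ?k s * ?V s)"
    by (intro continuous_on_mult continuous_on_add K_cont e0 Vc)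
  have kb: "\<bar>?k s\<bar> \<le> 5 * G / e\<^sup>2" for s
  proof -
    have "e\<^sup>2 \<le> (2 * e')\<^sup>2" using e by (intro power_mono) auto
    then have "G / e'\<^sup>2 \<le> 4 * G / e\<^sup>2" using e e0 G_nonneg by (simp add: field_simps mult_left_mono)
    then show ?thesis using K_bound[of e \<theta> s] K_bound[of e' \<theta> s] by (simp add: add_divide_distrib)
  qed
  have k0: "?k s = 0" if "s \<notin> {t - 2 * e..t + 2 * e}" for s
  proof -
    have "e \<le> \<bar>s - \<theta>\<bar>" using that t by auto
    then show ?thesis using K_supp[of e s \<theta>] K_supp[of e' s \<theta>] e e0 by simp
  qed
  have eq: "N e \<theta> \<omega> + N e' \<theta> \<omega> = (LINT s:{0..1}|lborel. ?k s * ?V s)"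
    using e e0 unfolding distrib_right by (simp add: N set_integral_add(2)[OF si[OF e0(1) Vc] si[OF e0(2) Vc]])
  have "\<bar>N e \<theta> \<omega> + N e' \<theta> \<omega>\<bar> \<le> (LINT s:{0..1}|lborel. \<bar>?k s * ?V s\<bar>)"
    using set_integral_norm_bound[OF set_integrable_cont[OF c]] unfolding eq by simp
  also have "\<dots> \<le> (LINT s:{t - 2 * e..t + 2 * e}|lborel. 5 * G / e\<^sup>2 * \<bar>?V s\<bar>)"
  proof -
    have "continuous_on UNIV (\<lambda>s. \<bar>?k s * ?V s\<bar>)" "continuous_on UNIV (\<lambda>s. 5 * G / e\<^sup>2 * \<bar>?V s\<bar>)"
      by (intro continuous_on_rabs c continuous_on_mult continuous_on_const Vc)+
    note i = this[THEN set_integrable_cont, unfolded set_integrable_def]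
    show ?thesis
      unfolding set_lebesgue_integral_def
    proof (rule integral_mono[OF i(1) i(2)])
      fix s
      show "indicat_real {0..1} s *\<^sub>R \<bar>?k s * ?V s\<bar> \<le> indicat_real {t - 2 * e..t + 2 * e} s *\<^sub>R (5 * G / e\<^sup>2 * \<bar>?V s\<bar>)"
      proof (cases "s \<in> {t - 2 * e..t + 2 * e}")
        case True
        have "\<bar>?k s * ?V s\<bar> \<le> 5 * G / e\<^sup>2 * \<bar>?V s\<bar>"
          unfolding abs_mult by (intro mult_right_mono kb) simp
        then show ?thesis using True by (auto simp: indicator_def intro: order_trans[OF abs_ge_zero])
      next
        case False
        show ?thesis using k0[OF False] False by simp
      qed
    qed
  qed
  also have "\<dots> = 5 * G / e\<^sup>2 * osc t (2 * e) \<omega>" unfolding osc_def by (rule set_integral_mult_right)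
  finally show ?thesis .
qed

end

section \<open>The difference of two regularisations\<close>

text \<open>\<open>d\<close> is the margin to the endpoints: for e \<le> d every window of radius e
  around a time that contributes lies in the unit interval, as \<open>K_mean\<close> and
  \<open>K_min\<close> require.\<close>

definition cutoff :: "(real \<Rightarrow> real) \<Rightarrow> real \<Rightarrow> real \<Rightarrow> bool" where
  "cutoff h H d \<longleftrightarrow> continuous_on UNIV h \<and> (\<forall>x. \<bar>h x\<bar> \<le> H) \<and> 0 < d \<and> (\<forall>x. x \<notin> {d..1 - d} \<longrightarrow> h x = 0)"

text \<open>\<open>L\<close> makes the integration by parts legitimate and may grow as \<phi>
  concentrates. The estimates are uniform over bumps because they depend on \<phi> through the last
  clause, total mass at most 1.\<close>

definition bump :: "(real \<Rightarrow> real) \<Rightarrow> (real \<Rightarrow> real) \<Rightarrow> real \<Rightarrow> bool" where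
  "bump \<phi> \<phi>' L \<longleftrightarrow> 0 \<le> L \<and> (\<forall>x. 0 \<le> \<phi> x) \<and> (\<forall>x. \<bar>\<phi> x\<bar> \<le> L) \<and> (\<forall>x y. \<bar>\<phi> x - \<phi> y\<bar> \<le> L * \<bar>x - y\<bar>) \<and>
     (\<forall>x. (\<phi> has_real_derivative \<phi>' x) (at x)) \<and> (\<forall>x. \<bar>\<phi>' x\<bar> \<le> L) \<and> \<phi>' \<in> borel_measurable borel \<and>
     (\<integral>\<^sup>+x. ennreal (\<phi> x) \<partial>lborel) \<le> 1"

lemma weighted_am_gm: "2 * r * (a * b) \<le> a\<^sup>2 + r\<^sup>2 * b\<^sup>2" for a b r :: real
  using zero_le_power2[of "a - r * b"] by (simp add: power2_eq_square algebra_simps)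

lemma bump_cont: "bump \<phi> \<phi>' L \<Longrightarrow> continuous_on UNIV \<phi>"
  unfolding bump_def by (intro DERIV_continuous_on[where D = \<phi>']) simp

context brownian
begin

lemma Lp_abs: "Lp X \<Longrightarrow> Lp (\<lambda>\<omega>. \<bar>X \<omega>\<bar>)"
  by (auto simp: Lp_def)

lemma occ_bounds:
  assumes \<phi>: "continuous_on UNIV \<phi>" "\<And>x. 0 \<le> \<phi> x" "\<And>x. \<bar>\<phi> x\<bar> \<le> L" and ab: "\<alpha> \<le> \<beta>"
  shows "\<And>\<omega>. \<omega> \<in> space M \<Longrightarrow> \<bar>occ \<phi> \<alpha> \<beta> \<omega>\<bar> \<le> L * (\<beta> - \<alpha>)" and "Lp (occ \<phi> \<alpha> \<beta>)"
proof -
  show b: "\<bar>occ \<phi> \<alpha> \<beta> \<omega>\<bar> \<le> L * (\<beta> - \<alpha>)" if \<omega>: "\<omega> \<in> space M" for \<omega>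
  proof -
    have "occ \<phi> \<alpha> \<beta> \<omega> \<le> (LINT r:{\<alpha>..\<beta>}|lborel. L)"
      unfolding occ_def
    proof (rule set_integral_mono)
      show "set_integrable lborel {\<alpha>..\<beta>} (\<lambda>r. \<phi> (W r \<omega>))"
        by (intro set_integrable_cont continuous_on_compose2[OF \<phi>(1) W_cont[OF \<omega>]]) auto
      show "set_integrable lborel {\<alpha>..\<beta>} (\<lambda>r. L)" by (intro set_integrable_cont continuous_on_const)
      show "\<phi> (W r \<omega>) \<le> L" for r using \<phi>(3)[of "W r \<omega>"] by linarith
    qed
    also have "\<dots> = L * (\<beta> - \<alpha>)" using ab by (simp add: set_lebesgue_integral_def)
    finally show ?thesis using occ_nonneg[of \<phi> \<alpha> \<beta> \<omega>, OF \<phi>(2)] by linarith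
  qed
  show "Lp (occ \<phi> \<alpha> \<beta>)"
    by (rule LpI_dominated[OF Lp_const occ_measurable[OF \<phi>(1)] b])
qed

end

context brownian_kernel
begin

lemma v_cont: "e \<noteq> 0 \<Longrightarrow> e' \<noteq> 0 \<Longrightarrow> continuous_on UNIV (\<lambda>\<theta>. v e e' \<theta> t)"
  unfolding v_def by (intro continuous_on_diff continuous_on_compose2[OF kap_cont] continuous_intros) auto

text \<open>Integration by parts leaves \<open>Z\<close> at \<open>t = i/n\<close> as the weight of the \<open>i\<close>-th partial derivative.\<close>

definition Z :: "(real \<Rightarrow> real) \<Rightarrow> (real \<Rightarrow> real) \<Rightarrow> real \<Rightarrow> real \<Rightarrow> real \<Rightarrow> 'w \<Rightarrow> real" where
  "Z h \<phi> e e' t \<omega> = (LINT \<theta>:{0..1}|lborel. h \<theta> * v e e' \<theta> t * (N e \<theta> \<omega> + N e' \<theta> \<omega>) * \<phi> (W \<theta> \<omega>))"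

text \<open>A contributing \<theta> lies in the support of \<open>h\<close> and within e of t. Hence
  only times t bounded away from 0 matter, which is what \<open>occ_moment4\<close> asks
  for.\<close>

lemma Z_zero:
  assumes h: "cutoff h H d" and e: "0 < e'" "e' \<le> e" and t: "t \<notin> {d - e..1 - d + e}"
  shows "Z h \<phi> e e' t \<omega> = 0"
proof -
  have "h \<theta> * v e e' \<theta> t = 0" for \<theta>
  proof (cases "\<theta> \<in> {d..1 - d}")
    case True
    then have "e \<le> \<bar>t - \<theta>\<bar>" using t by auto
    then show ?thesis using v_supp[OF e] by simp
  next
    case False
    then show ?thesis using h by (simp add: cutoff_def)
  qed
  then show ?thesis unfolding Z_def by (simp only: mult_zero_left) (simp add: set_lebesgue_integral_def)
qed

text \<open>All contributing \<theta> are within e of t, so the oscillation can be taken around t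
  and pulled out of the time integral; what remains is the occupation integral of the window. The 20
  is the product of 4 from \<open>v_bound\<close> and 5 from \<open>N_osc_bound\<close>.\<close>

lemma Z_bound:
  assumes h: "cutoff h H d" and \<phi>: "continuous_on UNIV \<phi>" "\<And>x. 0 \<le> \<phi> x"
    and e: "0 < e'" "e' \<le> e" "e \<le> 2 * e'" "e \<le> d" and \<omega>: "\<omega> \<in> space M"
  shows "\<bar>Z h \<phi> e e' t \<omega>\<bar> \<le> 20 * H * G\<^sup>2 / e\<^sup>2 * osc t (2 * e) \<omega> * occ \<phi> (t - e) (t + e) \<omega>"
proof -
  let ?X = "\<lambda>\<theta>. h \<theta> * v e e' \<theta> t * (N e \<theta> \<omega> + N e' \<theta> \<omega>) * \<phi> (W \<theta> \<omega>)"
  let ?C = "20 * H * G\<^sup>2 / e\<^sup>2 * osc t (2 * e) \<omega>"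
  have e0: "e \<noteq> 0" "e' \<noteq> 0" using e by auto
  have hc: "continuous_on UNIV h" and hb: "\<And>x. \<bar>h x\<bar> \<le> H" using h by (auto simp: cutoff_def)
  have H: "0 \<le> H" using hb[of 0] by linarith
  have pc: "continuous_on UNIV (\<lambda>\<theta>. \<phi> (W \<theta> \<omega>))" by (rule continuous_on_compose2[OF \<phi>(1) W_cont[OF \<omega>]]) auto
  have Xc: "continuous_on UNIV ?X"
    by (intro continuous_on_mult continuous_on_add hc v_cont N_cont e0 \<omega> pc)
  have osc0: "0 \<le> osc t (2 * e) \<omega>"
    unfolding osc_def set_lebesgue_integral_def by (intro Bochner_Integration.integral_nonneg) auto
  have C0: "0 \<le> ?C" using H osc0 by (intro mult_nonneg_nonneg divide_nonneg_nonneg) auto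
  have pw: "\<bar>?X \<theta>\<bar> \<le> indicator {t - e..t + e} \<theta> * (?C * \<phi> (W \<theta> \<omega>))" for \<theta>
  proof (cases "h \<theta> = 0 \<or> e \<le> \<bar>t - \<theta>\<bar>")
    case True
    then have X0: "?X \<theta> = 0" using v_supp[OF e(1,2)] by auto
    have "0 \<le> indicator {t - e..t + e} \<theta> * (?C * \<phi> (W \<theta> \<omega>))" by (intro mult_nonneg_nonneg C0 \<phi>(2)) simp
    then show ?thesis by (simp only: X0 abs_zero)
  next
    case False
    then have "\<theta> \<in> {d..1 - d}" using h unfolding cutoff_def by blast
    then have \<theta>: "0 \<le> \<theta> - e" "\<theta> + e \<le> 1" using e by auto
    have t: "\<bar>t - \<theta>\<bar> \<le> e" "\<theta> \<in> {t - e..t + e}" using False by auto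
    have "\<bar>?X \<theta>\<bar> = \<bar>h \<theta>\<bar> * \<bar>v e e' \<theta> t\<bar> * \<bar>N e \<theta> \<omega> + N e' \<theta> \<omega>\<bar> * \<phi> (W \<theta> \<omega>)"
      using \<phi>(2)[of "W \<theta> \<omega>"] by (simp add: abs_mult)
    also have "\<dots> \<le> H * (4 * G) * (5 * G / e\<^sup>2 * osc t (2 * e) \<omega>) * \<phi> (W \<theta> \<omega>)"
      by (intro mult_right_mono mult_mono hb v_bound N_osc_bound[OF e(1-3) \<theta> t(1) \<omega>] \<phi>(2)) (use H G_nonneg in auto)
    also have "\<dots> = ?C * \<phi> (W \<theta> \<omega>)" by (simp add: power2_eq_square)
    finally show ?thesis using t(2) by simp
  qed
  have "\<bar>Z h \<phi> e e' t \<omega>\<bar> \<le> (LINT \<theta>:{0..1}|lborel. \<bar>?X \<theta>\<bar>)"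
    unfolding Z_def using set_integral_norm_bound[OF set_integrable_cont[OF Xc]] by simp
  also have "\<dots> \<le> (LINT \<theta>:{t - e..t + e}|lborel. ?C * \<phi> (W \<theta> \<omega>))"
  proof -
    have "continuous_on UNIV (\<lambda>\<theta>. \<bar>?X \<theta>\<bar>)" "continuous_on UNIV (\<lambda>\<theta>. ?C * \<phi> (W \<theta> \<omega>))"
      by (intro continuous_on_rabs Xc continuous_on_mult continuous_on_const pc)+
    note i = this[THEN set_integrable_cont, unfolded set_integrable_def]
    show ?thesis
      unfolding set_lebesgue_integral_def
    proof (rule integral_mono[OF i(1) i(2)])
      fix \<theta>
      have "indicat_real {0..1} \<theta> *\<^sub>R \<bar>?X \<theta>\<bar> \<le> \<bar>?X \<theta>\<bar>" by (simp add: indicator_def)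
      with pw[of \<theta>] show "indicat_real {0..1} \<theta> *\<^sub>R \<bar>?X \<theta>\<bar> \<le> indicat_real {t - e..t + e} \<theta> *\<^sub>R (?C * \<phi> (W \<theta> \<omega>))"
        unfolding real_scaleR_def by linarith
    qed
  qed
  also have "\<dots> = ?C * occ \<phi> (t - e) (t + e) \<omega>" unfolding occ_def by (rule set_integral_mult_right)
  finally show ?thesis .
qed

lemma Z_joint:
  assumes h: "cutoff h H d" and \<phi>: "continuous_on UNIV \<phi>" and e: "e \<noteq> 0" "e' \<noteq> 0" and R: "R \<in> borel_measurable M"
  shows "(\<lambda>(\<theta>, \<omega>). h \<theta> * v e e' \<theta> t * (N e \<theta> \<omega> + N e' \<theta> \<omega>) * \<phi> (W \<theta> \<omega>) * R \<omega>) \<in> borel_measurable (borel \<Otimes>\<^sub>M M)"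
proof -
  have [measurable]: "h \<in> borel_measurable borel" "\<phi> \<in> borel_measurable borel"
    using h \<phi> by (auto simp: cutoff_def intro: borel_measurable_continuous_onI)
  have [measurable]: "(\<lambda>z. W (fst z) (snd z)) \<in> borel_measurable (borel \<Otimes>\<^sub>M M)"
    "(\<lambda>z. N e (fst z) (snd z)) \<in> borel_measurable (borel \<Otimes>\<^sub>M M)"
    "(\<lambda>z. N e' (fst z) (snd z)) \<in> borel_measurable (borel \<Otimes>\<^sub>M M)"
    using W_joint N_joint[OF e(1)] N_joint[OF e(2)] by (simp_all add: case_prod_beta')
  note [measurable] = R v_measurable
  show ?thesis unfolding case_prod_beta' by measurable
qed

lemma Z_integrand_bound:
  assumes h: "cutoff h H d" and \<phi>: "\<And>x. \<bar>\<phi> x\<bar> \<le> L" and e: "e \<noteq> 0" "e' \<noteq> 0" and \<omega>: "\<omega> \<in> space M"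
  shows "\<bar>h \<theta> * v e e' \<theta> t * (N e \<theta> \<omega> + N e' \<theta> \<omega>) * \<phi> (W \<theta> \<omega>)\<bar> \<le> H * (4 * G) * ((G / e\<^sup>2 + G / e'\<^sup>2) * (1 + Q \<omega>)) * L"
proof -
  have hb: "\<bar>h x\<bar> \<le> H" for x using h by (auto simp: cutoff_def)
  have H: "0 \<le> H" using hb[of 0] by linarith
  have "\<bar>N e \<theta> \<omega> + N e' \<theta> \<omega>\<bar> \<le> (G / e\<^sup>2 + G / e'\<^sup>2) * (1 + Q \<omega>)"
    using N_bound[OF e(1) \<omega>, of \<theta>] N_bound[OF e(2) \<omega>, of \<theta>] unfolding distrib_right by linarith
  then show ?thesis
    unfolding abs_mult using hb v_bound \<phi> H G_nonneg by (intro mult_mono) (auto simp: Q_nonneg intro!: mult_nonneg_nonneg add_nonneg_nonneg)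
qed

lemma Lp_Z:
  assumes h: "cutoff h H d" and \<phi>: "continuous_on UNIV \<phi>" "\<And>x. \<bar>\<phi> x\<bar> \<le> L" and e: "e \<noteq> 0" "e' \<noteq> 0"
  shows "Lp (Z h \<phi> e e' t)"
  unfolding Z_def[abs_def]
proof (rule fubini_dominated(2))
  show "(\<lambda>(\<theta>, \<omega>). h \<theta> * v e e' \<theta> t * (N e \<theta> \<omega> + N e' \<theta> \<omega>) * \<phi> (W \<theta> \<omega>)) \<in> borel_measurable (borel \<Otimes>\<^sub>M M)"
    using Z_joint[OF h \<phi>(1) e, of "\<lambda>_. 1"] by simp
  show "Lp (\<lambda>\<omega>. H * (4 * G) * ((G / e\<^sup>2 + G / e'\<^sup>2) * (1 + Q \<omega>)) * L)"
    by (intro Lp_mult Lp_add Lp_const Lp_Q)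
qed (rule Z_integrand_bound[OF h \<phi>(2) e])

text \<open>Up to constants \<open>Z\<close> is bounded by \<open>e\<^sup>-\<^sup>2 osc occ\<close>, and the fourth moments of \<open>osc\<close> and \<open>occ\<close> are of order
  \<open>e\<^sup>6\<close> and \<open>e\<^sup>5\<^sup>/\<^sup>2\<close>; the substitution \<open>e = q\<^sup>8\<close> makes all exponents integral.\<close>

lemma Z_second_moment:
  assumes h: "cutoff h H d" and \<phi>: "bump \<phi> \<phi>' L"
    and q: "0 < q" and e: "e = q ^ 8" "0 < e'" "e' \<le> e" "e \<le> 2 * e'" "4 * e \<le> d"
  shows "(\<integral>\<omega>. (Z h \<phi> e e' t \<omega>)\<^sup>2 \<partial>M) \<le> (20 * H * G\<^sup>2)\<^sup>2 * (1536 + 72 / sqrt d) * q\<^sup>2"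
proof (cases "t \<in> {d - e..1 - d + e}")
  case False
  have "0 < d" using h by (simp add: cutoff_def)
  then show ?thesis using Z_zero[OF h e(2,3) False] by simp
next
  case True
  have pc: "continuous_on UNIV \<phi>" by (rule bump_cont[OF \<phi>])
  have p0: "\<And>x. 0 \<le> \<phi> x" and pL: "\<And>x. \<bar>\<phi> x\<bar> \<le> L" and p1: "(\<integral>\<^sup>+x. ennreal (\<phi> x) \<partial>lborel) \<le> 1"
    using \<phi> by (auto simp: bump_def)
  have d: "0 < d" using h by (simp add: cutoff_def)
  have e0: "0 < e" "e \<noteq> 0" "e' \<noteq> 0" using e by auto
  \<comment> \<open>From t \<ge> d - e and 4 e \<le> d: t - e \<ge> d - 2 e \<ge> d / 2 and t - 2 e
    \<ge> d - 3 e > 0; the upper end is symmetric.\<close>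
  have t: "d / 2 \<le> t - e" "0 \<le> t - 2 * e" "t + 2 * e \<le> 1" "t + e \<le> 1" "0 < t - e" using True e d e0 by auto
  let ?Y = "osc t (2 * e)" and ?O = "occ \<phi> (t - e) (t + e)"
  let ?C = "20 * H * G\<^sup>2"
  have LY: "Lp ?Y" by (rule osc_moment(1)) (use t e0 in auto)
  have EY: "(\<integral>\<omega>. ?Y \<omega> ^ 4 \<partial>M) \<le> 3072 * q ^ 48"
  proof -
    have "(\<integral>\<omega>. ?Y \<omega> ^ 4 \<partial>M) \<le> 48 * (2 * e) ^ 6" by (rule osc_moment(2)) (use t e0 in auto)
    also have "\<dots> = 3072 * q ^ 48" unfolding e(1) by (simp add: power_mult_distrib power_mult[symmetric])
    finally show ?thesis .
  qed
  have LO: "Lp ?O" by (rule occ_bounds(2)[OF pc p0 pL]) (use e0 in auto)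
  have EO: "(\<integral>\<omega>. ?O \<omega> ^ 4 \<partial>M) \<le> (144 / sqrt d) * q ^ 20"
  proof -
    have i: "integrable M (\<lambda>\<omega>. ?O \<omega> ^ 4)" by (intro Lp_integrable Lp_power LO)
    have s: "sqrt (2 * e) ^ 3 = 2 * sqrt 2 * q ^ 12"
    proof -
      have e2: "e = (q ^ 4)\<^sup>2" unfolding e(1) by (simp add: power_mult[symmetric])
      have q4: "0 \<le> q ^ 4" using q by simp
      have "sqrt (2 * e) = sqrt 2 * q ^ 4"
        unfolding e2 real_sqrt_mult by (simp only: real_sqrt_abs abs_of_nonneg[OF q4])
      moreover have "sqrt 2 ^ 3 = 2 * sqrt 2" by (simp add: power3_eq_cube)
      moreover have "(q ^ 4) ^ 3 = q ^ 12" by (simp add: power_mult[symmetric])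
      ultimately show ?thesis by (simp only: power_mult_distrib)
    qed
    have "ennreal (\<integral>\<omega>. ?O \<omega> ^ 4 \<partial>M) = (\<integral>\<^sup>+\<omega>. ennreal (?O \<omega> ^ 4) \<partial>M)"
      by (rule nn_integral_eq_integral[symmetric, OF i]) simp
    also have "\<dots> \<le> ennreal (24 * sqrt ((t + e) - (t - e)) ^ 3 * (1 / sqrt (2 * pi * (t - e))) * ((t + e) - (t - e)))"
      by (rule occ_moment4[OF pc p0 p1]) (use t e0 in auto)
    finally have "(\<integral>\<omega>. ?O \<omega> ^ 4 \<partial>M) \<le> 24 * sqrt ((t + e) - (t - e)) ^ 3 * (1 / sqrt (2 * pi * (t - e))) * ((t + e) - (t - e))"
      using t e0 by (subst (asm) ennreal_le_iff) auto
    also have "(t + e) - (t - e) = 2 * e" by simp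
    \<comment> \<open>The cube of the root contributes q^12 and the window length q^8. The constant
      96 sqrt 2 is then rounded up to 144 by sqrt 2 \<le> 3/2.\<close>
    also have "24 * sqrt (2 * e) ^ 3 * (1 / sqrt (2 * pi * (t - e))) * (2 * e) = (96 * sqrt 2 * q ^ 20) * (1 / sqrt (2 * pi * (t - e)))"
      unfolding s unfolding e(1) by (simp add: power_add[symmetric])
    also have "\<dots> \<le> (144 * q ^ 20) * (1 / sqrt d)"
    proof (rule mult_mono)
      have "sqrt 2 \<le> sqrt ((3 / 2)\<^sup>2)" by (rule real_sqrt_le_mono) (simp add: power2_eq_square)
      then have "sqrt 2 \<le> 3 / 2" by simp
      then have "96 * sqrt 2 * q ^ 20 \<le> 96 * (3 / 2) * q ^ 20" using q by (intro mult_right_mono mult_left_mono) auto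
      then show "96 * sqrt 2 * q ^ 20 \<le> 144 * q ^ 20" by simp
      have "d \<le> 2 * pi * (t - e)"
      proof -
        have "d \<le> 2 * (t - e)" using t by simp
        also have "\<dots> \<le> (2 * pi) * (t - e)" using pi_gt3 t by (intro mult_right_mono) auto
        finally show ?thesis .
      qed
      then show "1 / sqrt (2 * pi * (t - e)) \<le> 1 / sqrt d" using d by (intro divide_left_mono) auto
    qed (use q t in auto)
    finally show ?thesis by simp
  qed
  have pw: "(Z h \<phi> e e' t \<omega>)\<^sup>2 \<le> ?C\<^sup>2 / (2 * q ^ 46) * ?Y \<omega> ^ 4 + ?C\<^sup>2 / (2 * q ^ 18) * ?O \<omega> ^ 4" if \<omega>: "\<omega> \<in> space M" for \<omega>
  proof -
    have "\<bar>Z h \<phi> e e' t \<omega>\<bar>\<^sup>2 \<le> (?C / e\<^sup>2 * ?Y \<omega> * ?O \<omega>)\<^sup>2"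
      by (intro power_mono Z_bound[OF h pc p0] \<omega>) (use e e0 in auto)
    also have "\<dots> = ?C\<^sup>2 / q ^ 32 * ((?Y \<omega>)\<^sup>2 * (?O \<omega>)\<^sup>2)"
      unfolding e(1) by (simp add: power_mult_distrib power_divide power_mult[symmetric])
    \<comment> \<open>The weight q^14 balances the two fourth moments, of order q^48 and q^20: both
      terms become of order q^34, and the prefactor q^(-32) leaves q^2.\<close>
    also have "\<dots> \<le> ?C\<^sup>2 / q ^ 32 * (?Y \<omega> ^ 4 / (2 * q ^ 14) + q ^ 14 * ?O \<omega> ^ 4 / 2)"
    proof (rule mult_left_mono)
      have "2 * q ^ 14 * ((?Y \<omega>)\<^sup>2 * (?O \<omega>)\<^sup>2) \<le> ((?Y \<omega>)\<^sup>2)\<^sup>2 + (q ^ 14)\<^sup>2 * ((?O \<omega>)\<^sup>2)\<^sup>2"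
        by (rule weighted_am_gm)
      also have "\<dots> = ?Y \<omega> ^ 4 + q ^ 28 * ?O \<omega> ^ 4" by (simp add: power_mult[symmetric])
      also have "\<dots> = 2 * q ^ 14 * (?Y \<omega> ^ 4 / (2 * q ^ 14) + q ^ 14 * ?O \<omega> ^ 4 / 2)"
        using q by (simp add: distrib_left power_add[symmetric])
      finally show "(?Y \<omega>)\<^sup>2 * (?O \<omega>)\<^sup>2 \<le> ?Y \<omega> ^ 4 / (2 * q ^ 14) + q ^ 14 * ?O \<omega> ^ 4 / 2"
        using q by (subst (asm) mult_le_cancel_left_pos) auto
    qed (use q in simp)
    also have "\<dots> = ?C\<^sup>2 / (2 * q ^ 46) * ?Y \<omega> ^ 4 + ?C\<^sup>2 / (2 * q ^ 18) * ?O \<omega> ^ 4"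
    proof -
      have "C / (b * a) * (Y / (2 * a) + a * Oc / 2) = C / (2 * (b * a * a)) * Y + C / (2 * b) * Oc"
        if "a \<noteq> 0" "b \<noteq> 0" for a b C Y Oc :: real
        using that by (simp add: field_simps)
      from this[of "q ^ 14" "q ^ 18" "?C\<^sup>2" "?Y \<omega> ^ 4" "?O \<omega> ^ 4"] q
      show ?thesis by (simp only: power_add[symmetric]) simp
    qed
    finally show ?thesis by simp
  qed
  have "(\<integral>\<omega>. (Z h \<phi> e e' t \<omega>)\<^sup>2 \<partial>M) \<le> (\<integral>\<omega>. ?C\<^sup>2 / (2 * q ^ 46) * ?Y \<omega> ^ 4 + ?C\<^sup>2 / (2 * q ^ 18) * ?O \<omega> ^ 4 \<partial>M)"
    by (intro integral_mono pw Lp_integrable Lp_add Lp_mult Lp_const Lp_power LY LO Lp_Z[OF h pc pL e0(2,3)])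
  also have "\<dots> = ?C\<^sup>2 / (2 * q ^ 46) * (\<integral>\<omega>. ?Y \<omega> ^ 4 \<partial>M) + ?C\<^sup>2 / (2 * q ^ 18) * (\<integral>\<omega>. ?O \<omega> ^ 4 \<partial>M)"
    using Lp_integrable[OF Lp_power[OF LY]] Lp_integrable[OF Lp_power[OF LO]] by simp
  also have "\<dots> \<le> ?C\<^sup>2 / (2 * q ^ 46) * (3072 * q ^ 48) + ?C\<^sup>2 / (2 * q ^ 18) * ((144 / sqrt d) * q ^ 20)"
    using q by (intro add_mono mult_left_mono EY EO) auto
  also have "\<dots> = ?C\<^sup>2 * (1536 + 72 / sqrt d) * q\<^sup>2"
  proof -
    have "C / (2 * x) * (3072 * (x * r)) + C / (2 * y) * ((144 / s) * (y * r)) = C * (1536 + 72 / s) * r"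
      if "x \<noteq> 0" "y \<noteq> 0" "s \<noteq> 0" for x y r s C :: real
      using that by (simp add: field_simps)
    from this[of "q ^ 46" "q ^ 18" "sqrt d" "?C\<^sup>2" "q\<^sup>2"] q d
    show ?thesis by (simp only: power_add[symmetric]) simp
  qed
  finally show ?thesis .
qed

text \<open>Stands for the difference of the functionals at two scales, with the local time measure
  replaced by \<phi>(W \<theta>) d\<theta>; \<open>weak_limit\<close> later undoes the
  replacement.\<close>

definition smeared_increment :: "(real \<Rightarrow> real) \<Rightarrow> (real \<Rightarrow> real) \<Rightarrow> real \<Rightarrow> real \<Rightarrow> 'w \<Rightarrow> real" where
  "smeared_increment h \<phi> e e' \<omega> = (LINT \<theta>:{0..1}|lborel. h \<theta> * wick_increment e e' \<theta> \<omega> * \<phi> (W \<theta> \<omega>))"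

lemma smeared_increment_fubini:
  assumes h: "cutoff h H d" and \<phi>: "continuous_on UNIV \<phi>" "\<And>x. \<bar>\<phi> x\<bar> \<le> L" and e: "e \<noteq> 0" "e' \<noteq> 0" and R: "Lp R"
  shows "(\<integral>\<omega>. R \<omega> * smeared_increment h \<phi> e e' \<omega> \<partial>M) = (LINT \<theta>:{0..1}|lborel. h \<theta> * (\<integral>\<omega>. R \<omega> * wick_increment e e' \<theta> \<omega> * \<phi> (W \<theta> \<omega>) \<partial>M))"
    and "Lp (smeared_increment h \<phi> e e')"
proof -
  have hb: "\<bar>h x\<bar> \<le> H" for x using h by (auto simp: cutoff_def)
  have H: "0 \<le> H" using hb[of 0] by linarith
  let ?w = "\<lambda>\<omega>. H * (wick_weight e e' \<omega> + (\<integral>\<omega>. wick_weight e e' \<omega> \<partial>M)) * L"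
  have w: "Lp ?w" by (intro Lp_mult Lp_add Lp_const Lp_wick_weight)
  have b: "\<bar>h \<theta> * wick_increment e e' \<theta> \<omega> * \<phi> (W \<theta> \<omega>)\<bar> \<le> ?w \<omega>" if "\<omega> \<in> space M" for \<theta> \<omega>
    unfolding abs_mult using hb \<phi>(2) wick_increment_bound[OF e that, of \<theta>] H
    by (intro mult_mono) (auto intro!: mult_nonneg_nonneg order_trans[OF abs_ge_zero])
  have j: "(\<lambda>(\<theta>, \<omega>). h \<theta> * wick_increment e e' \<theta> \<omega> * \<phi> (W \<theta> \<omega>) * R \<omega>) \<in> borel_measurable (borel \<Otimes>\<^sub>M M)" if "R \<in> borel_measurable M" for R
  proof -
    have [measurable]: "h \<in> borel_measurable borel" "\<phi> \<in> borel_measurable borel"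
      using h \<phi> by (auto simp: cutoff_def intro: borel_measurable_continuous_onI)
    have [measurable]: "(\<lambda>z. W (fst z) (snd z)) \<in> borel_measurable (borel \<Otimes>\<^sub>M M)"
      "(\<lambda>z. wick_increment e e' (fst z) (snd z)) \<in> borel_measurable (borel \<Otimes>\<^sub>M M)"
      using W_joint wick_increment_joint[OF e] by (simp_all add: case_prod_beta')
    note [measurable] = that
    show ?thesis unfolding case_prod_beta' by measurable
  qed
  show "Lp (smeared_increment h \<phi> e e')"
    unfolding smeared_increment_def[abs_def] using fubini_dominated(2)[OF _ w b] j[of "\<lambda>_. 1"] by simp
  have "(\<integral>\<omega>. R \<omega> * smeared_increment h \<phi> e e' \<omega> \<partial>M) = (\<integral>\<omega>. (LINT \<theta>:{0..1}|lborel. h \<theta> * wick_increment e e' \<theta> \<omega> * \<phi> (W \<theta> \<omega>) * R \<omega>) \<partial>M)"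
    unfolding smeared_increment_def set_integral_mult_left by (simp add: mult.commute)
  also have "\<dots> = (LINT \<theta>:{0..1}|lborel. (\<integral>\<omega>. h \<theta> * wick_increment e e' \<theta> \<omega> * \<phi> (W \<theta> \<omega>) * R \<omega> \<partial>M))"
  proof (rule fubini_dominated(1)[OF j[OF Lp_measurable[OF R]]])
    show "Lp (\<lambda>\<omega>. ?w \<omega> * \<bar>R \<omega>\<bar>)" by (rule Lp_mult[OF w Lp_abs[OF R]])
    fix \<theta> \<omega> assume "\<omega> \<in> space M"
    from mult_right_mono[OF b[OF this, of \<theta>], of "\<bar>R \<omega>\<bar>"]
    show "\<bar>h \<theta> * wick_increment e e' \<theta> \<omega> * \<phi> (W \<theta> \<omega>) * R \<omega>\<bar> \<le> ?w \<omega> * \<bar>R \<omega>\<bar>" by (simp add: abs_mult)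
  qed
  also have "\<dots> = (LINT \<theta>:{0..1}|lborel. h \<theta> * (\<integral>\<omega>. R \<omega> * wick_increment e e' \<theta> \<omega> * \<phi> (W \<theta> \<omega>) \<partial>M))"
  proof (rule set_lebesgue_integral_cong, simp, intro allI impI)
    fix \<theta> :: real
    have "(\<integral>\<omega>. h \<theta> * wick_increment e e' \<theta> \<omega> * \<phi> (W \<theta> \<omega>) * R \<omega> \<partial>M) = (\<integral>\<omega>. h \<theta> * (R \<omega> * wick_increment e e' \<theta> \<omega> * \<phi> (W \<theta> \<omega>)) \<partial>M)"
      by (intro Bochner_Integration.integral_cong refl) (simp only: mult_ac)
    then show "(\<integral>\<omega>. h \<theta> * wick_increment e e' \<theta> \<omega> * \<phi> (W \<theta> \<omega>) * R \<omega> \<partial>M) = h \<theta> * (\<integral>\<omega>. R \<omega> * wick_increment e e' \<theta> \<omega> * \<phi> (W \<theta> \<omega>) \<partial>M)"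
      by simp
  qed
  finally show "(\<integral>\<omega>. R \<omega> * smeared_increment h \<phi> e e' \<omega> \<partial>M) = (LINT \<theta>:{0..1}|lborel. h \<theta> * (\<integral>\<omega>. R \<omega> * wick_increment e e' \<theta> \<omega> * \<phi> (W \<theta> \<omega>) \<partial>M))" .
qed

text \<open>Integrating \<open>ibp_N\<close> over \<theta> gives the expected derivative of
  \<open>f\<close> along the random direction t -> \<open>Z\<close> at t. The gradient bound needs
  only the discrete L2 norm of that direction, and its second moment is an average of the second
  moments in \<open>Z_second_moment\<close>; this is why neither \<open>n\<close> nor \<phi> appears
  in the result.\<close>

lemma smooth_estimate:
  assumes f: "smooth_cyl n A c f D" and A: "0 \<le> A" and h: "cutoff h H d" and \<phi>: "bump \<phi> \<phi>' L"
    and q: "0 < q" and e: "e = q ^ 8" "0 < e'" "e' \<le> e" "e \<le> 2 * e'" "4 * e \<le> d"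
  shows "\<bar>\<integral>\<omega>. f (\<lambda>r. B r \<omega>) * smeared_increment h \<phi> e e' \<omega> \<partial>M\<bar>
    \<le> A * (exp ((2 * c)\<^sup>2) + (20 * H * G\<^sup>2)\<^sup>2 * (1536 + 72 / sqrt d)) * q"
proof -
  let ?f = "\<lambda>\<omega>. f (\<lambda>r. B r \<omega>)" and ?D = "\<lambda>i \<omega>. D i (\<lambda>r. B r \<omega>)" and ?t = "\<lambda>i. real i / real n"
  let ?Z = "Z h \<phi> e e'"
  have n: "n \<ge> 1" using f by (simp add: smooth_cyl_def)
  have pc: "continuous_on UNIV \<phi>" by (rule bump_cont[OF \<phi>])
  have p: "L \<ge> 0" "\<And>x y. \<bar>\<phi> x - \<phi> y\<bar> \<le> L * \<bar>x - y\<bar>" "\<And>x. \<bar>\<phi> x\<bar> \<le> L"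
    "\<And>x. (\<phi> has_real_derivative \<phi>' x) (at x)" "\<And>x. \<bar>\<phi>' x\<bar> \<le> L" "\<phi>' \<in> borel_measurable borel"
    using \<phi> by (auto simp: bump_def)
  have e0: "e \<noteq> 0" "e' \<noteq> 0" "0 < e" using e by auto
  have d: "0 < d" using h by (simp add: cutoff_def)
  let ?X = "\<lambda>i \<theta> \<omega>. h \<theta> * v e e' \<theta> (?t i) * (N e \<theta> \<omega> + N e' \<theta> \<omega>) * \<phi> (W \<theta> \<omega>) * ?D i \<omega>"
  let ?w = "\<lambda>i \<omega>. H * (4 * G) * ((G / e\<^sup>2 + G / e'\<^sup>2) * (1 + Q \<omega>)) * L * \<bar>?D i \<omega>\<bar>"
  have Xw: "Lp (?w i)" if "i \<in> {1..n}" for i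
    by (intro Lp_mult Lp_add Lp_const Lp_Q Lp_abs Lp_smooth_D[OF f that])
  have Xb: "\<bar>?X i \<theta> \<omega>\<bar> \<le> ?w i \<omega>" if "\<omega> \<in> space M" for i \<theta> \<omega>
    unfolding abs_mult[of _ "?D i \<omega>"] by (intro mult_right_mono Z_integrand_bound[OF h p(3) e0(1,2) that]) simp
  note F = fubini_dominated[OF Z_joint[OF h pc e0(1,2) Lp_measurable[OF Lp_smooth_D[OF f]]] Xw Xb]
  have "(\<integral>\<omega>. ?f \<omega> * smeared_increment h \<phi> e e' \<omega> \<partial>M) = (LINT \<theta>:{0..1}|lborel. h \<theta> * (\<integral>\<omega>. ?f \<omega> * wick_increment e e' \<theta> \<omega> * \<phi> (W \<theta> \<omega>) \<partial>M))"
    by (rule smeared_increment_fubini(1)[OF h pc p(3) e0(1,2) Lp_smooth[OF f]])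
  also have "\<dots> = (LINT \<theta>:{0..1}|lborel. (\<Sum>i=1..n. \<integral>\<omega>. ?X i \<theta> \<omega> \<partial>M))"
  proof (rule set_lebesgue_integral_cong, simp, intro allI impI)
    fix \<theta> :: real
    have X: "(\<integral>\<omega>. ?X i \<theta> \<omega> \<partial>M) = h \<theta> * (v e e' \<theta> (?t i) * (\<integral>\<omega>. ?D i \<omega> * (N e \<theta> \<omega> + N e' \<theta> \<omega>) * \<phi> (W \<theta> \<omega>) \<partial>M))" for i
    proof -
      have "(\<integral>\<omega>. ?X i \<theta> \<omega> \<partial>M) = (\<integral>\<omega>. (h \<theta> * v e e' \<theta> (?t i)) * (?D i \<omega> * (N e \<theta> \<omega> + N e' \<theta> \<omega>) * \<phi> (W \<theta> \<omega>)) \<partial>M)"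
        by (intro Bochner_Integration.integral_cong refl) (simp only: mult_ac)
      then show ?thesis by (simp add: mult.assoc)
    qed
    show "h \<theta> * (\<integral>\<omega>. ?f \<omega> * wick_increment e e' \<theta> \<omega> * \<phi> (W \<theta> \<omega>) \<partial>M) = (\<Sum>i=1..n. \<integral>\<omega>. ?X i \<theta> \<omega> \<partial>M)"
    \<comment> \<open>Inside the margin the window around \<theta> fits into the unit interval and
      \<open>ibp_N\<close> applies; outside it both sides vanish with \<open>h\<close>.\<close>
    proof (cases "\<theta> \<in> {d..1 - d}")
      case True
      then have \<theta>: "0 \<le> \<theta> - e" "\<theta> + e \<le> 1" using e e0 by auto
      show ?thesis unfolding X sum_distrib_left[symmetric] ibp_N[OF f p \<theta> e(2,3)] ..
    next
      case False
      then have "h \<theta> = 0" using h by (simp add: cutoff_def)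
      then show ?thesis unfolding X by simp
    qed
  qed
  also have "\<dots> = (\<Sum>i=1..n. LINT \<theta>:{0..1}|lborel. (\<integral>\<omega>. ?X i \<theta> \<omega> \<partial>M))"
    by (rule set_integral_sum'(2)) (rule F(3))
  also have "\<dots> = (\<Sum>i=1..n. \<integral>\<omega>. ?Z (?t i) \<omega> * ?D i \<omega> \<partial>M)"
  proof (rule sum.cong[OF refl])
    fix i assume i: "i \<in> {1..n}"
    have "(\<integral>\<omega>. (LINT \<theta>:{0..1}|lborel. ?X i \<theta> \<omega>) \<partial>M) = (LINT \<theta>:{0..1}|lborel. (\<integral>\<omega>. ?X i \<theta> \<omega> \<partial>M))"
      by (rule F(1)[OF i i])
    then show "(LINT \<theta>:{0..1}|lborel. (\<integral>\<omega>. ?X i \<theta> \<omega> \<partial>M)) = (\<integral>\<omega>. ?Z (?t i) \<omega> * ?D i \<omega> \<partial>M)"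
      unfolding Z_def set_integral_mult_left by (rule sym)
  qed
  also have "\<dots> = (\<integral>\<omega>. (\<Sum>i=1..n. ?Z (?t i) \<omega> * ?D i \<omega>) \<partial>M)"
    by (intro Bochner_Integration.integral_sum[symmetric] Lp_integrable Lp_mult Lp_Z[OF h pc p(3) e0(1,2)] Lp_smooth_D[OF f])
  finally have eq: "(\<integral>\<omega>. ?f \<omega> * smeared_increment h \<phi> e e' \<omega> \<partial>M) = (\<integral>\<omega>. (\<Sum>i=1..n. ?Z (?t i) \<omega> * ?D i \<omega>) \<partial>M)" .
  let ?C = "(20 * H * G\<^sup>2)\<^sup>2 * (1536 + 72 / sqrt d)"
  let ?V = "\<lambda>\<omega>. A * (q / 2 * exp (2 * c * grid_norm n (\<lambda>r. B r \<omega>)) + 1 / (2 * q) * ((\<Sum>i=1..n. (?Z (?t i) \<omega>)\<^sup>2) / real n))"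
  have LZ2: "Lp (\<lambda>\<omega>. (?Z t \<omega>)\<^sup>2)" for t by (intro Lp_power Lp_Z[OF h pc p(3) e0(1,2)])
  have LS: "Lp (\<lambda>\<omega>. (\<Sum>i=1..n. (?Z (?t i) \<omega>)\<^sup>2) / real n)"
    using Lp_mult[OF Lp_const[of "1 / real n"] Lp_sum[of "{1..n}" "\<lambda>i \<omega>. (?Z (?t i) \<omega>)\<^sup>2"]] LZ2 by simp
  have pw: "\<bar>\<Sum>i=1..n. ?Z (?t i) \<omega> * ?D i \<omega>\<bar> \<le> ?V \<omega>" for \<omega>
  proof -
    \<comment> \<open>The gradient bound is applied path by path, with the random function r ->
      \<open>Z\<close> at r as direction.\<close>
    let ?a = "exp (c * grid_norm n (\<lambda>r. B r \<omega>))" and ?b = "grid_norm n (\<lambda>r. ?Z r \<omega>)"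
    have "\<forall>k u. \<bar>\<Sum>i=1..n. u (real i / real n) * D i k\<bar> \<le> A * exp (c * grid_norm n k) * grid_norm n u"
      using f unfolding smooth_cyl_def by simp
    then have "\<bar>\<Sum>i=1..n. ?Z (?t i) \<omega> * ?D i \<omega>\<bar> \<le> A * ?a * ?b" by (rule allE, elim allE)
    \<comment> \<open>The weights are chosen so that the exponential moment, of order 1, and the
      second moment of \<open>Z\<close>, of order q^2, both contribute order q.\<close>
    also have "\<dots> \<le> A * (q / 2 * ?a\<^sup>2 + 1 / (2 * q) * ?b\<^sup>2)"
    proof -
      have "2 * q * (?a * ?b) \<le> q * q * ?a\<^sup>2 + ?b\<^sup>2"
        using weighted_am_gm[of q ?b ?a] by (simp add: power2_eq_square mult_ac)
      also have "\<dots> = 2 * q * (q / 2 * ?a\<^sup>2 + 1 / (2 * q) * ?b\<^sup>2)" using q by (simp add: distrib_left)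
      finally have "?a * ?b \<le> q / 2 * ?a\<^sup>2 + 1 / (2 * q) * ?b\<^sup>2"
        using q by (subst (asm) mult_le_cancel_left_pos) auto
      then show ?thesis using A unfolding mult.assoc by (intro mult_left_mono) auto
    qed
    also have "?a\<^sup>2 = exp (2 * c * grid_norm n (\<lambda>r. B r \<omega>))" by (simp add: exp_double[symmetric] mult.assoc)
    also have "?b\<^sup>2 = (\<Sum>i=1..n. (?Z (?t i) \<omega>)\<^sup>2) / real n" by (rule grid_norm_square)
    finally show ?thesis .
  qed
  have LV: "Lp ?V" by (intro Lp_mult Lp_add Lp_const Lp_grid_norm_exp n LS)
  have "\<bar>\<integral>\<omega>. (\<Sum>i=1..n. ?Z (?t i) \<omega> * ?D i \<omega>) \<partial>M\<bar> \<le> (\<integral>\<omega>. \<bar>\<Sum>i=1..n. ?Z (?t i) \<omega> * ?D i \<omega>\<bar> \<partial>M)"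
    using integral_norm_bound[of M "\<lambda>\<omega>. \<Sum>i=1..n. ?Z (?t i) \<omega> * ?D i \<omega>"] by simp
  also have "\<dots> \<le> (\<integral>\<omega>. ?V \<omega> \<partial>M)"
    by (intro integral_mono pw Lp_integrable Lp_abs Lp_sum Lp_mult Lp_Z[OF h pc p(3) e0(1,2)] Lp_smooth_D[OF f] LV)
  also have "\<dots> = A * (q / 2 * (\<integral>\<omega>. exp (2 * c * grid_norm n (\<lambda>r. B r \<omega>)) \<partial>M) + 1 / (2 * q) * (\<integral>\<omega>. (\<Sum>i=1..n. (?Z (?t i) \<omega>)\<^sup>2) / real n \<partial>M))"
  proof -
    have "integrable M (\<lambda>\<omega>. q / 2 * exp (2 * c * grid_norm n (\<lambda>r. B r \<omega>)))" "integrable M (\<lambda>\<omega>. 1 / (2 * q) * ((\<Sum>i=1..n. (?Z (?t i) \<omega>)\<^sup>2) / real n))"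
      by (intro Lp_integrable Lp_mult Lp_const Lp_grid_norm_exp n LS)+
    from Bochner_Integration.integral_add[OF this] show ?thesis by simp
  qed
  also have "(\<integral>\<omega>. (\<Sum>i=1..n. (?Z (?t i) \<omega>)\<^sup>2) / real n \<partial>M) = (\<Sum>i=1..n. \<integral>\<omega>. (?Z (?t i) \<omega>)\<^sup>2 \<partial>M) / real n"
    using Lp_integrable[OF LZ2] by (simp add: Bochner_Integration.integral_sum)
  also have "A * (q / 2 * (\<integral>\<omega>. exp (2 * c * grid_norm n (\<lambda>r. B r \<omega>)) \<partial>M) + 1 / (2 * q) * ((\<Sum>i=1..n. \<integral>\<omega>. (?Z (?t i) \<omega>)\<^sup>2 \<partial>M) / real n))
    \<le> A * (q / 2 * (2 * exp ((2 * c)\<^sup>2)) + 1 / (2 * q) * ((\<Sum>i=1..n. ?C * q\<^sup>2) / real n))"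
    using q A by (intro mult_left_mono add_mono divide_right_mono sum_mono exp_grid_norm_B(2) n Z_second_moment[OF h \<phi> q e]) auto
  also have "\<dots> = A * (exp ((2 * c)\<^sup>2) * q + ?C / 2 * q)"
    using n q by (simp add: power2_eq_square)
  also have "\<dots> \<le> A * (exp ((2 * c)\<^sup>2) * q + ?C * q)"
    using A q d by (intro mult_left_mono add_left_mono mult_right_mono) auto
  also have "\<dots> = A * (exp ((2 * c)\<^sup>2) + ?C) * q" by (simp only: distrib_right mult.assoc)
  finally show ?thesis unfolding eq .
qed

end

section \<open>Lipschitz functionals on the path space\<close>

lemma integral_lebesgue_on_01:
  fixes f :: "real \<Rightarrow> real"
  assumes f: "f \<in> borel_measurable borel"
  shows "(\<integral>x. f x \<partial>lebesgue_on {0<..<1}) = (LINT x:{0..1}|lborel. f x)"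
proof -
  have "(\<integral>x. f x \<partial>lebesgue_on {0<..<1}) = (\<integral>x. indicator {0<..<1} x *\<^sub>R f x \<partial>lebesgue)"
    by (rule integral_restrict_space) simp
  also have "\<dots> = (\<integral>x. indicator {0<..<1} x *\<^sub>R f x \<partial>lborel)"
    by (rule integral_completion) (use f in measurable)
  also have "\<dots> = (\<integral>x. indicator {0..1} x *\<^sub>R f x \<partial>lborel)"
  proof (rule integral_cong_AE)
    have "AE x in lborel. x \<noteq> 0 \<and> x \<noteq> (1::real)" using AE_lborel_singleton[of 0] AE_lborel_singleton[of 1] by auto
    then show "AE x in lborel. indicator {0<..<1} x *\<^sub>R f x = indicator {0..1} x *\<^sub>R f x"
      by eventually_elim (auto simp: indicator_def)
  qed (use f in measurable)
  finally show ?thesis by (simp add: set_lebesgue_integral_def)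
qed

lemma L2_01_norm_borel:
  "f \<in> borel_measurable borel \<Longrightarrow> L2_01_norm f = sqrt (LINT x:{0..1}|lborel. (f x)\<^sup>2)"
  unfolding L2_01_norm_def by (subst integral_lebesgue_on_01) auto

lemma L2_01I:
  assumes f: "f \<in> borel_measurable borel" and b: "\<And>x. x \<in> {0<..<1} \<Longrightarrow> \<bar>f x\<bar> \<le> C"
  shows "f \<in> L2_01"
  unfolding L2_01_def
proof (intro CollectI conjI)
  have fm: "f \<in> borel_measurable lebesgue" using f by (simp add: measurable_completion)
  show m: "f \<in> borel_measurable (lebesgue_on {0<..<1})" by (rule measurable_restrict_space1[OF fm])
  interpret finite_measure "lebesgue_on {0<..<1::real}"
    by (rule finite_measure_lebesgue_on) simp
  show "integrable (lebesgue_on {0<..<1}) (\<lambda>x. (f x)\<^sup>2)"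
  proof (rule integrable_const_bound[where B = "C\<^sup>2"])
    show "AE x in lebesgue_on {0<..<1}. norm ((f x)\<^sup>2) \<le> C\<^sup>2"
    proof (rule AE_I2)
      fix x assume "x \<in> space (lebesgue_on {0<..<1::real})"
      then have "\<bar>f x\<bar> \<le> C" by (intro b) (simp add: space_restrict_space)
      then have "\<bar>f x\<bar>\<^sup>2 \<le> C\<^sup>2" by (intro power_mono) auto
      then show "norm ((f x)\<^sup>2) \<le> C\<^sup>2" by simp
    qed
  qed (use m in measurable)
qed

section \<open>Step functions on an equidistant grid\<close>

definition cell :: "nat \<Rightarrow> real \<Rightarrow> nat" where
  "cell n s = nat \<lceil>s * real n\<rceil>"

lemma cell:
  assumes n: "n \<ge> 1" and s: "0 < s" "s \<le> 1"
  shows "cell n s \<in> {1..n}" and "s \<le> real (cell n s) / real n" and "real (cell n s) / real n < s + 1 / real n"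
    and "i \<in> {1..n} \<Longrightarrow> (s \<in> {(real i - 1) / real n<..real i / real n} \<longleftrightarrow> i = cell n s)"
proof -
  have n0: "0 < real n" using n by simp
  have pos: "0 < s * real n" using n s by simp
  then have c: "real (cell n s) = of_int \<lceil>s * real n\<rceil>" unfolding cell_def by simp
  have 1: "s * real n \<le> real (cell n s)" "real (cell n s) < s * real n + 1" unfolding c by linarith+
  have "s * real n \<le> real n" using s n0 by simp
  then have "real (cell n s) < real n + 1" "0 < real (cell n s)" using 1 pos by linarith+
  then show "cell n s \<in> {1..n}" by auto
  show "s \<le> real (cell n s) / real n" using 1 n0 by (simp add: pos_le_divide_eq)
  have "real (cell n s) / real n < (s * real n + 1) / real n" using 1 n0 by (intro divide_strict_right_mono)
  then show "real (cell n s) / real n < s + 1 / real n" using n0 by (simp add: add_divide_distrib)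
  show "s \<in> {(real i - 1) / real n<..real i / real n} \<longleftrightarrow> i = cell n s" if "i \<in> {1..n}"
  proof -
    have "s \<in> {(real i - 1) / real n<..real i / real n} \<longleftrightarrow> real i - 1 < s * real n \<and> s * real n \<le> real i"
      using n0 by (simp add: pos_divide_less_eq pos_le_divide_eq)
    also have "\<dots> \<longleftrightarrow> i = cell n s" using 1 by linarith
    finally show ?thesis .
  qed
qed

text \<open>Cells are open on the left and carry the value at their right end, in agreement with
  \<open>grid_norm\<close>; time 0 belongs to no cell, which changes nothing almost
  everywhere.\<close>

definition step :: "nat \<Rightarrow> (real \<Rightarrow> real) \<Rightarrow> real \<Rightarrow> real" where
  "step n k s = (\<Sum>i=1..n. k (real i / real n) * indicator {(real i - 1) / real n<..real i / real n} s)"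

lemma step_cell:
  assumes n: "n \<ge> 1" and s: "0 < s" "s \<le> 1"
  shows "(\<Sum>i=1..n. g i * indicator {(real i - 1) / real n<..real i / real n} s) = (g (cell n s) :: real)"
proof -
  have "(\<Sum>i=1..n. g i * indicator {(real i - 1) / real n<..real i / real n} s) = (\<Sum>i=1..n. if cell n s = i then g i else 0)"
  proof (rule sum.cong[OF refl])
    fix i assume "i \<in> {1..n}"
    from cell(4)[OF n s this] show "g i * indicator {(real i - 1) / real n<..real i / real n} s = (if cell n s = i then g i else 0)"
      by (simp add: indicator_def)
  qed
  also have "\<dots> = g (cell n s)" using cell(1)[OF n s] by (simp only: sum.delta' sum.delta finite_atLeastAtMost if_True)
  finally show ?thesis .
qed

lemma step_measurable: "step n k \<in> borel_measurable borel"
  unfolding step_def[abs_def] by measurable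

lemma step_diff: "step n k s - step n l s = step n (\<lambda>r. k r - l r) s"
  unfolding step_def sum_subtractf[symmetric] by (simp add: left_diff_distrib)

lemma step_L2:
  assumes n: "n \<ge> 1"
  shows "step n k \<in> L2_01" and "L2_01_norm (step n k) = grid_norm n k"
proof -
  show "step n k \<in> L2_01"
  proof (rule L2_01I[OF step_measurable])
    fix x :: real assume x: "x \<in> {0<..<1}"
    have "step n k x = k (real (cell n x) / real n)" unfolding step_def using x by (intro step_cell n) auto
    also have "\<bar>\<dots>\<bar> \<le> (\<Sum>i=1..n. \<bar>k (real i / real n)\<bar>)"
      using cell(1)[OF n, of x] x by (intro member_le_sum[of _ _ "\<lambda>i. \<bar>k (real i / real n)\<bar>"]) auto
    finally show "\<bar>step n k x\<bar> \<le> (\<Sum>i=1..n. \<bar>k (real i / real n)\<bar>)" .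
  qed
  let ?I = "\<lambda>i. {(real i - 1) / real n<..real i / real n}"
  have "(LINT x:{0..1}|lborel. (step n k x)\<^sup>2) = (\<integral>x. (\<Sum>i=1..n. (k (real i / real n))\<^sup>2 * indicator (?I i) x) \<partial>lborel)"
    unfolding set_lebesgue_integral_def
  proof (rule integral_cong_AE)
    have "AE x in lborel. x \<noteq> (0::real)" by (rule AE_lborel_singleton)
    then show "AE x in lborel. indicator {0..1} x *\<^sub>R (step n k x)\<^sup>2 = (\<Sum>i=1..n. (k (real i / real n))\<^sup>2 * indicator (?I i) x)"
    proof eventually_elim
      case (elim x)
      show ?case
      proof (cases "0 < x \<and> x \<le> 1")
        case True
        then have x: "0 < x" "x \<le> 1" by auto
        show ?thesis
          unfolding step_def step_cell[OF n x] using x by simp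
      next
        case False
        have "x \<notin> ?I i" if i: "i \<in> {1..n}" for i
        proof -
          have "0 \<le> (real i - 1) / real n" "real i / real n \<le> 1" using i by (auto simp: divide_le_eq)
          then show ?thesis using False by auto
        qed
        then have "(\<Sum>i=1..n. (k (real i / real n))\<^sup>2 * indicator (?I i) x) = 0" by (intro sum.neutral) auto
        moreover have "x \<notin> {0..1}" using False elim by auto
        ultimately show ?thesis by simp
      qed
    qed
  qed (use step_measurable in measurable)
  also have "\<dots> = (\<Sum>i=1..n. (k (real i / real n))\<^sup>2 * measure lborel (?I i))"
  proof (subst Bochner_Integration.integral_sum)
    fix i assume "i \<in> {1..n}"
    have "emeasure lborel (?I i) < \<infinity>" by (simp add: emeasure_lborel_Ioc divide_right_mono)
    then show "integrable lborel (\<lambda>x. (k (real i / real n))\<^sup>2 * indicator (?I i) x)"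
      by (intro integrable_mult_right integrable_real_indicator) auto
  qed simp
  also have "\<dots> = (\<Sum>i=1..n. (k (real i / real n))\<^sup>2 * (1 / real n))"
    by (intro sum.cong refl) (simp add: divide_right_mono diff_divide_distrib[symmetric])
  also have "\<dots> = (grid_norm n k)\<^sup>2" unfolding grid_norm_square by (simp add: sum_divide_distrib)
  finally show "L2_01_norm (step n k) = grid_norm n k"
    by (simp add: L2_01_norm_borel[OF step_measurable])
qed

lemma cross_term_le:
  assumes "0 < r" "0 \<le> s" "0 \<le> y"
  shows "s * y \<le> r * s\<^sup>2 + y\<^sup>2 / (r::real)"
proof -
  have "r * (2 * (s * y)) \<le> r * (r * s\<^sup>2 + y\<^sup>2 / r)"
    using weighted_am_gm[of r y s] assms(1) by (simp add: distrib_left power2_eq_square mult_ac)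
  then have "2 * (s * y) \<le> r * s\<^sup>2 + y\<^sup>2 / r"
    using assms(1) by (simp only: mult_le_cancel_left_pos)
  moreover have "0 \<le> s * y" using assms by simp
  ultimately show ?thesis by linarith
qed

context brownian
begin

lemma path_measurable: "\<omega> \<in> space M \<Longrightarrow> (\<lambda>s. W s \<omega>) \<in> borel_measurable borel"
  by (rule borel_measurable_continuous_onI[OF W_cont])

lemma path_L2:
  assumes \<omega>: "\<omega> \<in> space M"
  shows "(\<lambda>s. W s \<omega>) \<in> L2_01" "(\<lambda>s. B s \<omega>) \<in> L2_01" "L2_01_norm (\<lambda>s. W s \<omega>) = sqrt (Q \<omega>)"
proof -
  have "bounded ((\<lambda>s. W s \<omega>) ` {0..1})"
    by (intro compact_imp_bounded compact_continuous_image continuous_on_subset[OF W_cont[OF \<omega>]]) auto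
  then have "\<exists>C. \<forall>s\<in>{0..1}. \<bar>W s \<omega>\<bar> \<le> C" by (auto simp: bounded_iff)
  then obtain C where C: "\<forall>s\<in>{0..1}. \<bar>W s \<omega>\<bar> \<le> C" by blast
  show W2: "(\<lambda>s. W s \<omega>) \<in> L2_01"
    by (rule L2_01I[OF path_measurable[OF \<omega>], of C]) (use C in auto)
  have eq: "s \<in> space (lebesgue_on {0<..<1}) \<Longrightarrow> B s \<omega> = W s \<omega>" for s
    using W_eq[of s \<omega>] by (simp add: space_restrict_space)
  show "(\<lambda>s. B s \<omega>) \<in> L2_01"
  proof -
    have "(\<lambda>s. B s \<omega>) \<in> borel_measurable (lebesgue_on {0<..<1}) \<longleftrightarrow> (\<lambda>s. W s \<omega>) \<in> borel_measurable (lebesgue_on {0<..<1})"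
      by (rule measurable_cong) (rule eq)
    moreover have "integrable (lebesgue_on {0<..<1}) (\<lambda>s. (B s \<omega>)\<^sup>2) \<longleftrightarrow> integrable (lebesgue_on {0<..<1}) (\<lambda>s. (W s \<omega>)\<^sup>2)"
      by (rule Bochner_Integration.integrable_cong[OF refl]) (simp only: eq)
    ultimately show ?thesis using W2 unfolding L2_01_def by simp
  qed
  show "L2_01_norm (\<lambda>s. W s \<omega>) = sqrt (Q \<omega>)"
    unfolding Q_def by (rule L2_01_norm_borel[OF path_measurable[OF \<omega>]])
qed

text \<open>\<open>F\<close> receives a function on all reals, and \<open>B\<close> is unspecified
  outside the unit interval. The two representatives agree on (0,1), so the almost-everywhere
  invariance of \<open>Lip_e\<close> identifies the values.\<close>

lemma F_B_eq_F_W: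
  assumes F: "F \<in> Lip_e" and \<omega>: "\<omega> \<in> space M"
  shows "F (\<lambda>s. B s \<omega>) = F (\<lambda>s. W s \<omega>)"
proof (rule Lip_e_AE_cong[OF F path_L2(2)[OF \<omega>] path_L2(1)[OF \<omega>]])
  show "AE x in lebesgue_on {0<..<1}. B x \<omega> = W x \<omega>"
    by (rule AE_I2) (simp add: space_restrict_space W_eq)
qed

section \<open>The discretisation error of the path\<close>

definition rem :: "nat \<Rightarrow> 'w \<Rightarrow> real" where
  "rem n \<omega> = (LINT s:{0..1}|lborel. (step n (\<lambda>r. B r \<omega>) s - W s \<omega>)\<^sup>2)"

lemma rem_norm:
  assumes "\<omega> \<in> space M"
  shows "L2_01_norm (\<lambda>s. step n (\<lambda>r. B r \<omega>) s - W s \<omega>) = sqrt (rem n \<omega>)"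
  unfolding rem_def
  by (rule L2_01_norm_borel) (intro borel_measurable_diff step_measurable path_measurable assms)

lemma rem_nonneg: "0 \<le> rem n \<omega>"
  unfolding rem_def set_lebesgue_integral_def by (intro Bochner_Integration.integral_nonneg) auto

lemma increment_moment2:
  assumes "s \<in> {0..1}" "t \<in> {0..1}"
  shows "(\<integral>\<omega>. (W s \<omega> - W t \<omega>)\<^sup>2 \<partial>M) = \<bar>s - t\<bar>"
proof -
  have i: "integrable M (\<lambda>\<omega>. W s \<omega> * W t \<omega>)" for s t by (intro Lp_integrable Lp_mult Lp_W)
  have "(\<integral>\<omega>. (W s \<omega> - W t \<omega>)\<^sup>2 \<partial>M) = (\<integral>\<omega>. (W s \<omega> * W s \<omega> + W t \<omega> * W t \<omega>) - 2 * (W s \<omega> * W t \<omega>) \<partial>M)"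
    by (intro Bochner_Integration.integral_cong refl) (simp add: power2_eq_square algebra_simps)
  also have "\<dots> = (s + t) - 2 * min s t"
    by (subst Bochner_Integration.integral_diff)
      (auto simp only: i Bochner_Integration.integral_add[OF i i] integral_mult_right_zero
        covariance_B[OF assms(1) assms(1)] covariance_B[OF assms(2) assms(2)] covariance_B[OF assms] min.idem
        intro!: Bochner_Integration.integrable_add integrable_mult_right)
  also have "\<dots> = \<bar>s - t\<bar>" by (simp add: min_def)
  finally show ?thesis .
qed

text \<open>At each time the error is an increment of the path over a distance below 1/n, and the
  variance of an increment is its length.\<close>

lemma rem_integral:
  assumes n: "n \<ge> 1"
  shows "integrable M (rem n)" and "(\<integral>\<omega>. rem n \<omega> \<partial>M) \<le> 1 / real n"
proof -
  let ?X = "\<lambda>s \<omega>. (step n (\<lambda>r. B r \<omega>) s - W s \<omega>)\<^sup>2"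
  have g: "real i / real n \<in> {0..1}" if "i \<in> {1..n}" for i using that by (auto simp: divide_simps)
  have j: "(\<lambda>(s, \<omega>). ?X s \<omega>) \<in> borel_measurable (borel \<Otimes>\<^sub>M M)"
  proof -
    have [measurable]: "(\<lambda>z. W (fst z) (snd z)) \<in> borel_measurable (borel \<Otimes>\<^sub>M M)"
      using W_joint by (simp add: case_prod_beta')
    have "(\<lambda>z. step n (\<lambda>r. B r (snd z)) (fst z)) \<in> borel_measurable (borel \<Otimes>\<^sub>M M)"
      unfolding step_def
    proof (rule borel_measurable_sum)
      fix i assume "i \<in> {1..n}"
      note [measurable] = B_measurable[OF g[OF this]]
      show "(\<lambda>z. B (real i / real n) (snd z) * indicator {(real i - 1) / real n<..real i / real n} (fst z)) \<in> borel_measurable (borel \<Otimes>\<^sub>M M)"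
        by measurable
    qed
    then show ?thesis unfolding case_prod_beta' by measurable
  qed
  have st: "?X s \<omega> = (W (real (cell n s) / real n) \<omega> - W s \<omega>)\<^sup>2" if s: "s \<in> {0<..1}" for s \<omega>
  proof -
    have "step n (\<lambda>r. B r \<omega>) s = B (real (cell n s) / real n) \<omega>" unfolding step_def using s by (intro step_cell n) auto
    then show ?thesis using W_eq[OF g[OF cell(1)[OF n]]] s by simp
  qed
  have i: "integrable M (?X s)" if s: "s \<in> {0<..1}" for s
    unfolding st[OF s] by (intro Lp_integrable Lp_power Lp_minus Lp_W)
  have b: "(\<integral>\<omega>. \<bar>?X s \<omega>\<bar> \<partial>M) \<le> 1 / real n" if s: "s \<in> {0<..1}" for s
  proof -
    have "(\<integral>\<omega>. \<bar>?X s \<omega>\<bar> \<partial>M) = (\<integral>\<omega>. ?X s \<omega> \<partial>M)" by simp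
    also have "\<dots> = \<bar>real (cell n s) / real n - s\<bar>"
      unfolding st[OF s] using s by (intro increment_moment2 g cell(1) n) auto
    also have "\<dots> \<le> 1 / real n" using cell(2,3)[OF n, of s] s by auto
    finally show ?thesis .
  qed
  have A: "{0<..1::real} \<in> sets borel" "{0<..1::real} \<subseteq> {0..1}" by auto
  note F = fubini_time[OF j A _ i b]
  have eq: "rem n \<omega> = (LINT s:{0<..1}|lborel. ?X s \<omega>)" if \<omega>: "\<omega> \<in> space M" for \<omega>
    unfolding rem_def set_lebesgue_integral_def
  proof (rule integral_cong_AE)
    have "AE x in lborel. x \<noteq> (0::real)" by (rule AE_lborel_singleton)
    then show "AE x in lborel. indicator {0..1} x *\<^sub>R ?X x \<omega> = indicator {0<..1} x *\<^sub>R ?X x \<omega>"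
      by eventually_elim (auto simp: indicator_def)
    have "(\<lambda>s. ?X s \<omega>) \<in> borel_measurable borel"
      by (intro borel_measurable_power borel_measurable_diff step_measurable path_measurable \<omega>)
    then show "(\<lambda>s. indicator {0..1} s *\<^sub>R ?X s \<omega>) \<in> borel_measurable lborel" "(\<lambda>s. indicator {0<..1} s *\<^sub>R ?X s \<omega>) \<in> borel_measurable lborel"
      by auto
  qed
  show "integrable M (rem n)"
    by (rule Bochner_Integration.integrable_cong[THEN iffD1, OF refl _ F(1)]) (use eq in auto)
  have "(\<integral>\<omega>. rem n \<omega> \<partial>M) = (\<integral>\<omega>. (LINT s:{0<..1}|lborel. ?X s \<omega>) \<partial>M)"
    by (intro Bochner_Integration.integral_cong refl eq)
  also have "\<dots> = (LINT s:{0<..1}|lborel. (\<integral>\<omega>. ?X s \<omega> \<partial>M))" by (rule F(2)) simp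
  also have "\<dots> \<le> (LINT s:{0<..1::real}|lborel. 1 / real n)"
  proof (rule set_integral_mono)
    show "set_integrable lborel {0<..1} (\<lambda>s. \<integral>\<omega>. ?X s \<omega> \<partial>M)" by (rule F(3)) simp
    show "set_integrable lborel {0<..1::real} (\<lambda>s. 1 / real n)"
      by (rule set_integrable_subset[of _ "{0..1}"]) (auto intro!: set_integrable_cont)
    show "(\<integral>\<omega>. ?X s \<omega> \<partial>M) \<le> 1 / real n" if "s \<in> {0<..1}" for s using b[OF that] by simp
  qed
  also have "\<dots> = 1 / real n" by (simp add: set_lebesgue_integral_def)
  finally show "(\<integral>\<omega>. rem n \<omega> \<partial>M) \<le> 1 / real n" .
qed

text \<open>A statement for every single path, by uniform continuity. It serves the measurability of
  \<open>F\<close> along the path, whereas the rate in \<open>n\<close> comes from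
  \<open>rem_integral\<close>.\<close>

lemma rem_tendsto_0:
  assumes \<omega>: "\<omega> \<in> space M"
  shows "(\<lambda>n. sqrt (rem (Suc n) \<omega>)) \<longlonglongrightarrow> 0"
proof (rule LIMSEQ_I)
  fix r :: real assume r: "0 < r"
  have "uniformly_continuous_on {0..1} (\<lambda>s. W s \<omega>)"
    by (intro compact_uniformly_continuous continuous_on_subset[OF W_cont[OF \<omega>]]) auto
  from this[unfolded uniformly_continuous_on_def, rule_format, of "r / 2"]
  obtain \<delta> where \<delta>: "\<delta> > 0" "\<And>s t. s \<in> {0..1} \<Longrightarrow> t \<in> {0..1} \<Longrightarrow> dist t s < \<delta> \<Longrightarrow> dist (W t \<omega>) (W s \<omega>) < r / 2"
    using r by auto
  obtain N where N: "1 / \<delta> < real N" using reals_Archimedean2 by blast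
  show "\<exists>n0. \<forall>n\<ge>n0. norm (sqrt (rem (Suc n) \<omega>) - 0) < r"
  proof (intro exI[of _ N] allI impI)
    fix n assume n: "N \<le> n"
    have "1 / \<delta> < real (Suc n)" using N n by linarith
    then have sm: "1 / real (Suc n) < \<delta>" using \<delta>(1) by (simp add: field_simps)
    have m: "(\<lambda>s. (step (Suc n) (\<lambda>r. B r \<omega>) s - W s \<omega>)\<^sup>2) \<in> borel_measurable borel"
      by (intro borel_measurable_power borel_measurable_diff step_measurable path_measurable \<omega>)
    have pw: "(step (Suc n) (\<lambda>r. B r \<omega>) s - W s \<omega>)\<^sup>2 \<le> (r / 2)\<^sup>2" if s: "0 < s" "s \<le> 1" for s
    proof -
      note c = cell[of "Suc n" s, OF _ s]
      have t: "real (cell (Suc n) s) / real (Suc n) \<in> {0..1}" using c(1) by (auto simp: divide_simps)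
      have "step (Suc n) (\<lambda>r. B r \<omega>) s = B (real (cell (Suc n) s) / real (Suc n)) \<omega>" unfolding step_def using s by (intro step_cell) auto
      also have "\<dots> = W (real (cell (Suc n) s) / real (Suc n)) \<omega>" using W_eq[OF t] by simp
      finally have "\<bar>step (Suc n) (\<lambda>r. B r \<omega>) s - W s \<omega>\<bar> = dist (W (real (cell (Suc n) s) / real (Suc n)) \<omega>) (W s \<omega>)" by (simp add: dist_real_def)
      also have "\<dots> < r / 2" using c(2,3) sm s by (intro \<delta>(2) t) (auto simp: dist_real_def)
      finally have "\<bar>step (Suc n) (\<lambda>r. B r \<omega>) s - W s \<omega>\<bar>\<^sup>2 \<le> (r / 2)\<^sup>2" by (intro power_mono) auto
      then show ?thesis by simp
    qed
    have "rem (Suc n) \<omega> \<le> (\<integral>s. indicator {0..1::real} s *\<^sub>R (r / 2)\<^sup>2 \<partial>lborel)"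
      unfolding rem_def set_lebesgue_integral_def
    proof (rule integral_mono_AE')
      show "integrable lborel (\<lambda>s. indicator {0..1::real} s *\<^sub>R (r / 2)\<^sup>2)"
        using set_integrable_cont[OF continuous_on_const, of 0 1 "(r / 2)\<^sup>2"] by (simp only: set_integrable_def)
      have "AE x in lborel. x \<noteq> (0::real)" by (rule AE_lborel_singleton)
      then show "AE s in lborel. indicator {0..1} s *\<^sub>R (step (Suc n) (\<lambda>r. B r \<omega>) s - W s \<omega>)\<^sup>2 \<le> indicator {0..1::real} s *\<^sub>R (r / 2)\<^sup>2"
      proof eventually_elim
        case (elim s)
        show ?case
        proof (cases "s \<in> {0..1}")
          case True
          then show ?thesis using pw[of s] elim by simp
        qed simp
      qed
    qed auto
    also have "\<dots> = (r / 2)\<^sup>2" by simp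
    finally have "sqrt (rem (Suc n) \<omega>) \<le> sqrt ((r / 2)\<^sup>2)" by (rule real_sqrt_le_mono)
    then have "sqrt (rem (Suc n) \<omega>) \<le> r / 2" using r by simp
    then show "norm (sqrt (rem (Suc n) \<omega>) - 0) < r" using r rem_nonneg[of "Suc n" \<omega>] by simp
  qed
qed

section \<open>Measurability and smooth approximation of Lipschitz functionals of the path\<close>

lemma F_step_lipschitz:
  assumes F: "\<And>h k. h \<in> L2_01 \<Longrightarrow> k \<in> L2_01 \<Longrightarrow> \<bar>F h - F k\<bar> \<le> exp (c * L2_01_norm h) * L2_01_norm (\<lambda>x. h x - k x)"
    and n: "n \<ge> 1"
  shows "\<bar>F (step n k) - F (step n k')\<bar> \<le> exp (c * grid_norm n k) * grid_norm n (\<lambda>r. k r - k' r)"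
  using F[OF step_L2(1)[OF n, of k] step_L2(1)[OF n, of k']]
  unfolding step_diff step_L2(2)[OF n] .

text \<open>Measurability of \<open>F\<close> on L2 is not part of the assumptions. Along the path
  it is obtained from the cylinder functionals of the step approximations, which converge for every
  \<omega>.\<close>

lemma Lp_F:
  assumes F: "\<And>h k. h \<in> L2_01 \<Longrightarrow> k \<in> L2_01 \<Longrightarrow> \<bar>F h - F k\<bar> \<le> exp (c * L2_01_norm h) * L2_01_norm (\<lambda>x. h x - k x)"
    and c: "0 \<le> c"
  shows "Lp (\<lambda>\<omega>. F (\<lambda>s. W s \<omega>))"
proof (rule LpI_dominated)
  show "Lp (\<lambda>\<omega>. \<bar>F (\<lambda>_. 0)\<bar> + (1 + Q \<omega>))" by (intro Lp_add Lp_const Lp_Q)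
  have m: "(\<lambda>\<omega>. F (step (Suc n) (\<lambda>s. B s \<omega>))) \<in> borel_measurable M" for n
  proof -
    have "exp_lip (grid_set (Suc n)) (\<lambda>k. F (step (Suc n) k))"
    proof (rule exp_lipI[of "c + 1"])
      fix k k' :: "real \<Rightarrow> real"
      let ?S = "grid_set (Suc n)"
      have n: "Suc n \<ge> 1" by simp
      have le: "grid_norm (Suc n) k \<le> coord_norm ?S k + coord_norm ?S k'"
        using grid_norm_le_coord_norm[OF n, of k] coord_norm_nonneg[of ?S k'] by linarith
      have "\<bar>F (step (Suc n) k) - F (step (Suc n) k')\<bar> \<le> exp (c * grid_norm (Suc n) k) * grid_norm (Suc n) (\<lambda>r. k r - k' r)"
        by (rule F_step_lipschitz[OF F n])
      also have "\<dots> \<le> exp ((c + 1) * (coord_norm ?S k + coord_norm ?S k')) * coord_norm ?S (\<lambda>r. k r - k' r)"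
        using c le by (intro mult_mono grid_norm_le_coord_norm n iffD2[OF exp_le_cancel_iff]) auto
      also have "\<dots> \<le> (c + 1) * (exp ((c + 1) * (coord_norm ?S k + coord_norm ?S k')) * coord_norm ?S (\<lambda>r. k r - k' r))"
        using mult_right_mono[of 1 "c + 1" "exp ((c + 1) * (coord_norm ?S k + coord_norm ?S k')) * coord_norm ?S (\<lambda>r. k r - k' r)"] c by simp
      finally show "\<bar>F (step (Suc n) k) - F (step (Suc n) k')\<bar> \<le> (c + 1) * exp ((c + 1) * (coord_norm ?S k + coord_norm ?S k')) * coord_norm ?S (\<lambda>r. k r - k' r)"
        by (simp only: mult.assoc)
    qed (use c in simp)
    from cyl_B_measurable[OF exp_lip_cyl[OF grid_set(1) this] grid_set(2)] show ?thesis .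
  qed
  show "(\<lambda>\<omega>. F (\<lambda>s. W s \<omega>)) \<in> borel_measurable M"
  proof (rule borel_measurable_LIMSEQ_real[OF _ m])
    fix \<omega> assume \<omega>: "\<omega> \<in> space M"
    have "(\<lambda>n. F (step (Suc n) (\<lambda>s. B s \<omega>)) - F (\<lambda>s. W s \<omega>)) \<longlonglongrightarrow> 0"
    proof (rule Lim_null_comparison)
      show "\<forall>\<^sub>F n in sequentially. norm (F (step (Suc n) (\<lambda>s. B s \<omega>)) - F (\<lambda>s. W s \<omega>)) \<le> exp (c * sqrt (Q \<omega>)) * sqrt (rem (Suc n) \<omega>)"
      proof (intro always_eventually allI)
        fix n
        have "L2_01_norm (\<lambda>x. W x \<omega> - step (Suc n) (\<lambda>s. B s \<omega>) x) = sqrt (rem (Suc n) \<omega>)"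
          unfolding rem_norm[OF \<omega>, symmetric] L2_01_norm_def by (simp add: power2_commute)
        then show "norm (F (step (Suc n) (\<lambda>s. B s \<omega>)) - F (\<lambda>s. W s \<omega>)) \<le> exp (c * sqrt (Q \<omega>)) * sqrt (rem (Suc n) \<omega>)"
          using F[OF path_L2(1)[OF \<omega>] step_L2(1)[of "Suc n" "\<lambda>s. B s \<omega>"]]
          by (simp add: path_L2(3)[OF \<omega>] abs_minus_commute)
      qed
      show "(\<lambda>n. exp (c * sqrt (Q \<omega>)) * sqrt (rem (Suc n) \<omega>)) \<longlonglongrightarrow> 0"
        using tendsto_mult[OF tendsto_const rem_tendsto_0[OF \<omega>], of "exp (c * sqrt (Q \<omega>))"] by simp
    qed
    then show "(\<lambda>n. F (step (Suc n) (\<lambda>s. B s \<omega>))) \<longlonglongrightarrow> F (\<lambda>s. W s \<omega>)" by (simp add: LIM_zero_iff)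
  qed
  fix \<omega> assume \<omega>: "\<omega> \<in> space M"
  \<comment> \<open>The exponential weight contains the norm of the first argument only. Putting 0
    there shows that \<open>F\<close> grows at most linearly in the norm of the path, so no
    exponential moment of the norm enters.\<close>
  have z: "(\<lambda>_. 0) \<in> L2_01" by (rule L2_01I[of _ 0]) auto
  have "L2_01_norm (\<lambda>x. 0 - W x \<omega>) = sqrt (Q \<omega>)" "L2_01_norm (\<lambda>_. 0) = 0"
    using path_L2(3)[OF \<omega>] by (simp_all add: L2_01_norm_def)
  then have "\<bar>F (\<lambda>_. 0) - F (\<lambda>s. W s \<omega>)\<bar> \<le> sqrt (Q \<omega>)"
    using F[OF z path_L2(1)[OF \<omega>]] by simp
  moreover have "sqrt (Q \<omega>) \<le> 1 + Q \<omega>"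
  proof -
    have "Q \<omega> \<le> (1 + Q \<omega>)\<^sup>2" using Q_nonneg[of \<omega>] by (simp add: power2_eq_square algebra_simps)
    then have "sqrt (Q \<omega>) \<le> sqrt ((1 + Q \<omega>)\<^sup>2)" by (rule real_sqrt_le_mono)
    then show ?thesis using Q_nonneg[of \<omega>] by simp
  qed
  ultimately show "\<bar>F (\<lambda>s. W s \<omega>)\<bar> \<le> \<bar>F (\<lambda>_. 0)\<bar> + (1 + Q \<omega>)" by linarith
qed

text \<open>\<open>F\<close> on step functions, smoothed. The directional derivatives are bounded
  through the Lipschitz bound for \<open>g\<close> and not through the formula for them, which
  contains 1/\<kappa>; so the constants 2 exp (c^2) and c are free of \<open>n\<close>.\<close>

lemma smooth_approximation:
  assumes F: "\<And>h k. h \<in> L2_01 \<Longrightarrow> k \<in> L2_01 \<Longrightarrow> \<bar>F h - F k\<bar> \<le> exp (c * L2_01_norm h) * L2_01_norm (\<lambda>x. h x - k x)"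
    and c: "0 \<le> c" and n: "n \<ge> 1"
  shows "\<exists>g D. smooth_cyl n (2 * exp (c\<^sup>2)) c g D \<and>
    (\<forall>\<omega>\<in>space M. \<bar>F (\<lambda>s. W s \<omega>) - g (\<lambda>s. B s \<omega>)\<bar> \<le> exp (c * grid_norm n (\<lambda>r. B r \<omega>)) * (sqrt (rem n \<omega>) + 2 * exp 1 / real n))"
proof -
  let ?f = "\<lambda>k. F (step n k)"
  \<comment> \<open>The width has to vanish as n grows, and \<kappa> \<le> 1 keeps (c \<kappa>)^2
    below c^2 in the constant \<open>?A\<close>. The smoothing error 1/n is below the discretisation
    error, which is of order 1 / sqrt n.\<close>
  define \<kappa> where "\<kappa> = 1 / real n"
  have \<kappa>: "0 < \<kappa>" "\<kappa> \<le> 1" using n by (auto simp: \<kappa>_def)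
  define g where "g = (\<lambda>k. \<integral>\<omega>. ?f (\<lambda>r. k r + \<kappa> * B r \<omega>) \<partial>M)"
  have fl: "\<bar>?f k - ?f k'\<bar> \<le> exp (c * grid_norm n k) * grid_norm n (\<lambda>r. k r - k' r)" for k k'
    by (rule F_step_lipschitz[OF F n])
  have gk: "(\<integral>\<omega>. ?f (\<lambda>r. k r + \<kappa> * B r \<omega>) \<partial>M) = g k" for k
    by (simp only: g_def)
  note sm = smoothing[OF n c \<kappa>(1) fl, unfolded gk]
  obtain D where D: "\<And>k u. ((\<lambda>x. g (\<lambda>r. k r + x * u r)) has_real_derivative (\<Sum>i=1..n. u (real i / real n) * D i k)) (at 0)"
    using sm(3) by blast
  let ?A = "2 * exp (c\<^sup>2)"
  have A: "2 * exp ((c * \<kappa>)\<^sup>2) \<le> ?A"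
  proof -
    have "c * \<kappa> \<le> c" using \<kappa> c by (simp add: mult_left_le)
    then have "(c * \<kappa>)\<^sup>2 \<le> c\<^sup>2" using c \<kappa> by (intro power_mono) auto
    then show ?thesis by simp
  qed
  have lip: "\<bar>g k - g k'\<bar> \<le> ?A * exp (c * grid_norm n k) * grid_norm n (\<lambda>r. k r - k' r)" for k k'
  proof -
    note sm(2)[of k k']
    also have "2 * exp ((c * \<kappa>)\<^sup>2) * exp (c * grid_norm n k) * grid_norm n (\<lambda>r. k r - k' r) \<le> ?A * exp (c * grid_norm n k) * grid_norm n (\<lambda>r. k r - k' r)"
      by (intro mult_right_mono A) auto
    finally show ?thesis .
  qed
  have "smooth_cyl n ?A c g D"
    unfolding smooth_cyl_def
  proof (intro conjI allI n D)
    show "exp_lip (grid_set n) g"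
    proof (rule exp_lipI[of "c + ?A"])
      fix k k' :: "real \<Rightarrow> real"
      let ?S = "grid_set n"
      have le: "grid_norm n k \<le> coord_norm ?S k + coord_norm ?S k'"
        using grid_norm_le_coord_norm[OF n, of k] coord_norm_nonneg[of ?S k'] by linarith
      note lip[of k k']
      also have "?A * exp (c * grid_norm n k) * grid_norm n (\<lambda>r. k r - k' r) \<le> (c + ?A) * exp ((c + ?A) * (coord_norm ?S k + coord_norm ?S k')) * coord_norm ?S (\<lambda>r. k r - k' r)"
        using c le by (intro mult_mono grid_norm_le_coord_norm n iffD2[OF exp_le_cancel_iff]) auto
      finally show "\<bar>g k - g k'\<bar> \<le> (c + ?A) * exp ((c + ?A) * (coord_norm ?S k + coord_norm ?S k')) * coord_norm ?S (\<lambda>r. k r - k' r)" .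
    qed (use c in simp)
    fix k u :: "real \<Rightarrow> real"
    show "\<bar>\<Sum>i=1..n. u (real i / real n) * D i k\<bar> \<le> ?A * exp (c * grid_norm n k) * grid_norm n u"
    proof (rule deriv_bound_of_lipschitz[OF D])
      fix x :: real
      have "grid_norm n (\<lambda>r. k r - (k r + x * u r)) = \<bar>x\<bar> * grid_norm n u"
        using grid_norm_scale[of n "- x" u] by simp
      then show "\<bar>g (\<lambda>r. k r + x * u r) - g (\<lambda>r. k r + 0 * u r)\<bar> \<le> ?A * exp (c * grid_norm n k) * grid_norm n u * \<bar>x\<bar>"
        using lip[of k "\<lambda>r. k r + x * u r"] by (simp add: abs_minus_commute mult_ac)
    qed
  qed
  moreover have "\<bar>F (\<lambda>s. W s \<omega>) - g (\<lambda>s. B s \<omega>)\<bar> \<le> exp (c * grid_norm n (\<lambda>r. B r \<omega>)) * (sqrt (rem n \<omega>) + 2 * exp 1 / real n)"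
    if \<omega>: "\<omega> \<in> space M" for \<omega>
  proof -
    let ?k = "\<lambda>s. B s \<omega>"
    have "\<bar>F (step n ?k) - F (\<lambda>s. W s \<omega>)\<bar> \<le> exp (c * grid_norm n ?k) * sqrt (rem n \<omega>)"
      using F[OF step_L2(1)[OF n, of ?k] path_L2(1)[OF \<omega>]]
      unfolding step_L2(2)[OF n] rem_norm[OF \<omega>] .
    moreover have "\<bar>g ?k - F (step n ?k)\<bar> \<le> exp (c * grid_norm n ?k) * (2 * exp 1 / real n)"
      using sm(1)[of ?k] by (simp add: \<kappa>_def)
    ultimately show ?thesis unfolding distrib_left by linarith
  qed
  ultimately show ?thesis by blast
qed

text \<open>Used with \<open>D\<close> fixed and n growing. Since \<open>rem\<close> has mean at
  most 1/n, the product of its square root with the remaining factors is split with weight sqrt n,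
  which leaves order 1 / sqrt n on both sides.\<close>

lemma approximation_error:
  assumes n: "n \<ge> 1" and D: "Lp D"
    and X: "X \<in> borel_measurable M"
    and b: "\<And>\<omega>. \<omega> \<in> space M \<Longrightarrow> \<bar>X \<omega>\<bar> \<le> exp (c * grid_norm n (\<lambda>r. B r \<omega>)) * (sqrt (rem n \<omega>) + 2 * exp 1 / real n)"
  shows "\<bar>\<integral>\<omega>. X \<omega> * D \<omega> \<partial>M\<bar> \<le> (1 + 7 * (exp ((4 * c)\<^sup>2) + (\<integral>\<omega>. (D \<omega>) ^ 4 \<partial>M) + 1)) / sqrt (real n)"
proof -
  let ?a = "\<lambda>\<omega>. exp (c * grid_norm n (\<lambda>r. B r \<omega>))"
  let ?r = "sqrt (real n)"
  have r: "0 < ?r" "1 \<le> ?r" "?r * ?r = real n" using n by auto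
  let ?V = "\<lambda>\<omega>. ?r * rem n \<omega> + (7 / ?r) * (exp (4 * c * grid_norm n (\<lambda>r. B r \<omega>)) / 2 + (D \<omega>) ^ 4 + 1)"
  have e1: "exp (1::real) \<le> 3" by (rule exp_le)
  have pw: "\<bar>X \<omega> * D \<omega>\<bar> \<le> ?V \<omega>" if \<omega>: "\<omega> \<in> space M" for \<omega>
  proof -
    let ?y = "?a \<omega> * \<bar>D \<omega>\<bar>" and ?R = "rem n \<omega>"
    have y0: "0 \<le> ?y" by simp
    have "\<bar>X \<omega> * D \<omega>\<bar> \<le> (?a \<omega> * (sqrt ?R + 2 * exp 1 / real n)) * \<bar>D \<omega>\<bar>"
      unfolding abs_mult by (intro mult_right_mono b \<omega>) simp
    also have "\<dots> = sqrt ?R * ?y + (2 * exp 1 / real n) * ?y" by (simp add: algebra_simps)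
    finally have t0: "\<bar>X \<omega> * D \<omega>\<bar> \<le> sqrt ?R * ?y + (2 * exp 1 / real n) * ?y" .
    have t1: "sqrt ?R * ?y \<le> ?r * ?R + ?y\<^sup>2 / ?r"
      using cross_term_le[OF r(1), of "sqrt ?R" ?y] y0 rem_nonneg[of n \<omega>] by simp
    \<comment> \<open>The 6 comes from exp 1 \<le> 3; together with the 1 of the cross term it makes
      the 7 below.\<close>
    have t2: "(2 * exp 1 / real n) * ?y \<le> (6 / ?r) * (?y\<^sup>2 + 1)"
    proof (rule mult_mono)
      have "2 * exp 1 / real n \<le> 6 / real n" using e1 by (intro divide_right_mono) auto
      also have "\<dots> \<le> 6 / ?r"
      proof (rule divide_left_mono)
        have "?r * 1 \<le> ?r * ?r" using r by (intro mult_left_mono) auto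
        then show "?r \<le> real n" unfolding r(3) by simp
      qed (use r n in auto)
      finally show "2 * exp 1 / real n \<le> 6 / ?r" .
      have "2 * ?y \<le> ?y\<^sup>2 + 1" using zero_le_power2[of "?y - 1"] unfolding power2_diff by simp
      then show "?y \<le> ?y\<^sup>2 + 1" using y0 by linarith
    qed (use y0 r in auto)
    have "\<bar>X \<omega> * D \<omega>\<bar> \<le> ?r * ?R + (?y\<^sup>2 / ?r + (6 / ?r) * (?y\<^sup>2 + 1))"
      using t0 t1 t2 by linarith
    also have "\<dots> \<le> ?r * ?R + (7 / ?r) * (?y\<^sup>2 + 1)"
    proof (rule add_left_mono)
      have "b / a + (6 / a) * (b + 1) \<le> (7 / a) * (b + 1)" if "0 < a" for a b :: real
        using that by (simp add: field_simps)
      from this[OF r(1)] show "?y\<^sup>2 / ?r + (6 / ?r) * (?y\<^sup>2 + 1) \<le> (7 / ?r) * (?y\<^sup>2 + 1)" .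
    qed
    also have "\<dots> \<le> ?V \<omega>"
    proof -
      have "?y\<^sup>2 = (?a \<omega>)\<^sup>2 * (D \<omega>)\<^sup>2" by (simp add: power_mult_distrib)
      also have "\<dots> \<le> ((?a \<omega>)\<^sup>2)\<^sup>2 / 2 + ((D \<omega>)\<^sup>2)\<^sup>2"
        using weighted_am_gm[of 1 "(?a \<omega>)\<^sup>2" "(D \<omega>)\<^sup>2"] zero_le_power2[of "(D \<omega>)\<^sup>2"]
        unfolding one_power2 mult_1 mult_1_right by linarith
      also have "((?a \<omega>)\<^sup>2)\<^sup>2 = exp (4 * c * grid_norm n (\<lambda>r. B r \<omega>))"
        unfolding power_mult[symmetric] exp_of_nat_mult[symmetric] by (simp add: mult.assoc)
      finally have "?y\<^sup>2 + 1 \<le> exp (4 * c * grid_norm n (\<lambda>r. B r \<omega>)) / 2 + (D \<omega>) ^ 4 + 1" by (simp add: power_mult[symmetric])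
      then have "(7 / ?r) * (?y\<^sup>2 + 1) \<le> (7 / ?r) * (exp (4 * c * grid_norm n (\<lambda>r. B r \<omega>)) / 2 + (D \<omega>) ^ 4 + 1)"
        using r by (intro mult_left_mono) auto
      then show ?thesis by simp
    qed
    finally show ?thesis .
  qed
  have i1: "integrable M (\<lambda>\<omega>. ?r * rem n \<omega>)" by (intro integrable_mult_right rem_integral n)
  have L2: "Lp (\<lambda>\<omega>. exp (4 * c * grid_norm n (\<lambda>r. B r \<omega>)))" by (intro Lp_grid_norm_exp n)
  have L4: "Lp (\<lambda>\<omega>. (D \<omega>) ^ 4)" by (intro Lp_power D)
  have i2: "integrable M (\<lambda>\<omega>. exp (4 * c * grid_norm n (\<lambda>r. B r \<omega>)) / 2 + (D \<omega>) ^ 4 + 1)"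
    using Lp_integrable[OF L2] Lp_integrable[OF L4] by simp
  have i3: "integrable M ?V" by (intro Bochner_Integration.integrable_add i1 integrable_mult_right i2)
  have iX: "integrable M (\<lambda>\<omega>. X \<omega> * D \<omega>)"
  proof (rule Bochner_Integration.integrable_bound[OF i3])
    show "AE \<omega> in M. norm (X \<omega> * D \<omega>) \<le> norm (?V \<omega>)"
    proof (rule AE_I2)
      fix \<omega> assume "\<omega> \<in> space M"
      from pw[OF this] show "norm (X \<omega> * D \<omega>) \<le> norm (?V \<omega>)" unfolding real_norm_def by linarith
    qed
  qed (use X Lp_measurable[OF D] in measurable)
  have "\<bar>\<integral>\<omega>. X \<omega> * D \<omega> \<partial>M\<bar> \<le> (\<integral>\<omega>. \<bar>X \<omega> * D \<omega>\<bar> \<partial>M)"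
    using integral_norm_bound[of M "\<lambda>\<omega>. X \<omega> * D \<omega>"] by simp
  also have "\<dots> \<le> (\<integral>\<omega>. ?V \<omega> \<partial>M)" by (intro integral_mono integrable_abs iX i3 pw)
  also have "\<dots> = ?r * (\<integral>\<omega>. rem n \<omega> \<partial>M) + (7 / ?r) * ((\<integral>\<omega>. exp (4 * c * grid_norm n (\<lambda>r. B r \<omega>)) \<partial>M) / 2 + (\<integral>\<omega>. (D \<omega>) ^ 4 \<partial>M) + 1)"
    using i1 i2 Lp_integrable[OF L2] Lp_integrable[OF L4]
    by (subst Bochner_Integration.integral_add) (auto simp: prob_space)
  also have "\<dots> \<le> ?r * (1 / real n) + (7 / ?r) * ((2 * exp ((4 * c)\<^sup>2)) / 2 + (\<integral>\<omega>. (D \<omega>) ^ 4 \<partial>M) + 1)"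
    using r by (intro add_mono mult_left_mono rem_integral divide_right_mono exp_grid_norm_B n order_refl) auto
  also have "?r * (1 / real n) = 1 / ?r" using r by (simp add: field_simps)
  also have "1 / ?r + (7 / ?r) * ((2 * exp ((4 * c)\<^sup>2)) / 2 + (\<integral>\<omega>. (D \<omega>) ^ 4 \<partial>M) + 1)
     = (1 + 7 * (exp ((4 * c)\<^sup>2) + (\<integral>\<omega>. (D \<omega>) ^ 4 \<partial>M) + 1)) / ?r" by (simp add: add_divide_distrib)
  finally show ?thesis .
qed

end

context brownian_kernel
begin

text \<open>Here n tends to infinity with both scales and the bump fixed. The approximation error
  contains the fourth moment of the smeared increment, which is finite but not controlled uniformly;
  it is multiplied by 1 / sqrt n, while the main term does not contain n.\<close>

lemma F_estimate:
  assumes F: "\<And>h k. h \<in> L2_01 \<Longrightarrow> k \<in> L2_01 \<Longrightarrow> \<bar>F h - F k\<bar> \<le> exp (c * L2_01_norm h) * L2_01_norm (\<lambda>x. h x - k x)"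
    and c: "0 \<le> c" and h: "cutoff h H d" and \<phi>: "bump \<phi> \<phi>' L"
    and q: "0 < q" and e: "e = q ^ 8" "0 < e'" "e' \<le> e" "e \<le> 2 * e'" "4 * e \<le> d"
  shows "\<bar>\<integral>\<omega>. F (\<lambda>s. W s \<omega>) * smeared_increment h \<phi> e e' \<omega> \<partial>M\<bar>
    \<le> (2 * exp (c\<^sup>2)) * (exp ((2 * c)\<^sup>2) + (20 * H * G\<^sup>2)\<^sup>2 * (1536 + 72 / sqrt d)) * q"
proof -
  let ?D = "smeared_increment h \<phi> e e'" and ?F = "\<lambda>\<omega>. F (\<lambda>s. W s \<omega>)"
  let ?K = "(2 * exp (c\<^sup>2)) * (exp ((2 * c)\<^sup>2) + (20 * H * G\<^sup>2)\<^sup>2 * (1536 + 72 / sqrt d)) * q"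
  let ?R = "1 + 7 * (exp ((4 * c)\<^sup>2) + (\<integral>\<omega>. (?D \<omega>) ^ 4 \<partial>M) + 1)"
  have e0: "e \<noteq> 0" "e' \<noteq> 0" using e q by auto
  have LD: "Lp ?D"
    by (rule smeared_increment_fubini(2)[OF h bump_cont[OF \<phi>] _ e0 Lp_const[of 0]]) (use \<phi> in \<open>auto simp: bump_def\<close>)
  have LF: "Lp ?F" by (rule Lp_F[OF F c])
  have "\<bar>\<integral>\<omega>. ?F \<omega> * ?D \<omega> \<partial>M\<bar> \<le> ?K + ?R * (1 / sqrt (real (Suc n)))" for n
  proof -
    have n: "Suc n \<ge> 1" by simp
    obtain g D where g: "smooth_cyl (Suc n) (2 * exp (c\<^sup>2)) c g D"
      and b: "\<forall>\<omega>\<in>space M. \<bar>F (\<lambda>s. W s \<omega>) - g (\<lambda>s. B s \<omega>)\<bar> \<le> exp (c * grid_norm (Suc n) (\<lambda>r. B r \<omega>)) * (sqrt (rem (Suc n) \<omega>) + 2 * exp 1 / real (Suc n))"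
      using smooth_approximation[OF F c n] by blast
    let ?g = "\<lambda>\<omega>. g (\<lambda>s. B s \<omega>)"
    have Lg: "Lp ?g" by (rule Lp_smooth[OF g])
    have 1: "\<bar>\<integral>\<omega>. ?g \<omega> * ?D \<omega> \<partial>M\<bar> \<le> ?K"
      by (rule smooth_estimate[OF g _ h \<phi> q e]) simp
    have 2: "\<bar>\<integral>\<omega>. (?F \<omega> - ?g \<omega>) * ?D \<omega> \<partial>M\<bar> \<le> ?R / sqrt (real (Suc n))"
      by (rule approximation_error[OF n LD]) (use b Lp_measurable[OF LF] Lp_measurable[OF Lg] in auto)
    have "(\<integral>\<omega>. ?F \<omega> * ?D \<omega> \<partial>M) = (\<integral>\<omega>. ?g \<omega> * ?D \<omega> + (?F \<omega> - ?g \<omega>) * ?D \<omega> \<partial>M)"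
      by (intro Bochner_Integration.integral_cong refl) (simp add: algebra_simps)
    also have "\<dots> = (\<integral>\<omega>. ?g \<omega> * ?D \<omega> \<partial>M) + (\<integral>\<omega>. (?F \<omega> - ?g \<omega>) * ?D \<omega> \<partial>M)"
      by (intro Bochner_Integration.integral_add Lp_integrable Lp_mult Lp_minus LF Lg LD)
    finally show ?thesis using 1 2 by simp
  qed
  moreover have "(\<lambda>n. ?K + ?R * (1 / sqrt (real (Suc n)))) \<longlonglongrightarrow> ?K + ?R * 0"
  proof (intro tendsto_intros)
    have "(\<lambda>n. sqrt (1 / real (Suc n))) \<longlonglongrightarrow> sqrt 0" by (intro tendsto_real_sqrt LIMSEQ_Suc[OF lim_1_over_n])
    then show "(\<lambda>n. 1 / sqrt (real (Suc n))) \<longlonglongrightarrow> 0" by (simp add: real_sqrt_divide)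
  qed
  ultimately have "\<bar>\<integral>\<omega>. ?F \<omega> * ?D \<omega> \<partial>M\<bar> \<le> ?K + ?R * 0"
    by (intro LIMSEQ_le_const) auto
  then show ?thesis by simp
qed

end

section \<open>Convergence of measures on the unit interval\<close>

text \<open>From e one halves until e' is within a factor 2. The bounds along the chain form a
  geometric series with ratio 2^(-1/8), so the estimate for comparable scales extends to all pairs
  with the constant K / (1 - r).\<close>

lemma dyadic_limit:
  fixes T :: "real \<Rightarrow> real"
  assumes K: "0 \<le> K" and e0: "0 < e0"
    and T: "\<And>e e'. 0 < e' \<Longrightarrow> e' \<le> e \<Longrightarrow> e \<le> 2 * e' \<Longrightarrow> e \<le> e0 \<Longrightarrow> \<bar>T e - T e'\<bar> \<le> K * root 8 e"
  shows "\<exists>l. (T \<longlongrightarrow> l) (at_right 0)"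
proof -
  define r where "r = root 8 (1 / 2)"
  have r: "0 \<le> r" "r < 1" unfolding r_def by (simp_all add: real_root_lt_1_iff)
  have chain: "\<bar>T e - T e'\<bar> \<le> K * root 8 e * (\<Sum>i<k. r ^ i)" if "0 < e'" "e' \<le> e" "e / 2 ^ k \<le> e'" "e \<le> e0" for k e e'
    using that
  proof (induction k arbitrary: e)
    case 0
    then show ?case by simp
  next
    case (Suc k)
    have e: "0 < e" using Suc.prems by simp
    have S: "(\<Sum>i<Suc k. r ^ i) = 1 + r * (\<Sum>i<k. r ^ i)" by (subst sum.lessThan_Suc_shift) (simp add: sum_distrib_left)
    have re: "0 \<le> K * root 8 e" using K e by simp
    show ?case
    proof (cases "e \<le> 2 * e'")
      case True
      have "\<bar>T e - T e'\<bar> \<le> K * root 8 e * 1" using T[OF Suc.prems(1,2) True Suc.prems(4)] by simp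
      also have "\<dots> \<le> K * root 8 e * (\<Sum>i<Suc k. r ^ i)"
        using re mult_nonneg_nonneg[OF r(1) sum_nonneg[of "{..<k}" "\<lambda>i. r ^ i"]] r(1) unfolding S by (intro mult_left_mono) auto
      finally show ?thesis .
    next
      case False
      have 1: "\<bar>T e - T (e / 2)\<bar> \<le> K * root 8 e" using e Suc.prems by (intro T) auto
      have 2: "\<bar>T (e / 2) - T e'\<bar> \<le> K * root 8 (e / 2) * (\<Sum>i<k. r ^ i)"
        using Suc.prems False e by (intro Suc.IH) (auto simp: field_simps)
      have "root 8 (e / 2) = root 8 e * r" unfolding r_def by (simp add: real_root_mult[symmetric])
      then have "\<bar>T (e / 2) - T e'\<bar> \<le> K * root 8 e * (r * (\<Sum>i<k. r ^ i))" using 2 by (simp add: mult_ac)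
      then show ?thesis using 1 unfolding S distrib_left by linarith
    qed
  qed
  let ?C = "K / (1 - r)"
  have C: "\<bar>T e - T e'\<bar> \<le> ?C * root 8 e" if e: "0 < e'" "e' \<le> e" "e \<le> e0" for e e'
  proof -
    obtain k where "e / e' < 2 ^ k" using real_arch_pow[of 2 "e / e'"] by auto
    then have "e / 2 ^ k \<le> e'" using e by (simp add: field_simps)
    from chain[OF e(1,2) this e(3)] have "\<bar>T e - T e'\<bar> \<le> K * root 8 e * (\<Sum>i<k. r ^ i)" .
    also have "\<dots> \<le> K * root 8 e * (1 / (1 - r))"
    proof (rule mult_left_mono)
      have "(\<Sum>i<k. r ^ i) = (1 - r ^ k) / (1 - r)" using r by (simp add: sum_gp_strict)
      also have "\<dots> \<le> 1 / (1 - r)" using r by (intro divide_right_mono) auto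
      finally show "(\<Sum>i<k. r ^ i) \<le> 1 / (1 - r)" .
    qed (use K e in simp)
    finally show ?thesis by simp
  qed
  have root0: "(\<lambda>n. root 8 (e0 / real (Suc n))) \<longlonglongrightarrow> 0"
  proof -
    have "(\<lambda>n. e0 * (1 / real (Suc n))) \<longlonglongrightarrow> e0 * 0" by (intro tendsto_mult tendsto_const LIMSEQ_Suc[OF lim_1_over_n])
    then have "(\<lambda>n. root 8 (e0 / real (Suc n))) \<longlonglongrightarrow> root 8 0" by (intro tendsto_real_root) simp
    then show ?thesis by simp
  qed
  have "Cauchy (\<lambda>n. T (e0 / real (Suc n)))"
  proof (rule metric_CauchyI)
    fix s :: real assume s: "0 < s"
    have "(\<lambda>n. ?C * root 8 (e0 / real (Suc n))) \<longlonglongrightarrow> ?C * 0" by (intro tendsto_mult tendsto_const root0)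
    then have "\<forall>\<^sub>F n in sequentially. ?C * root 8 (e0 / real (Suc n)) < s"
      using s by (intro order_tendstoD(2)) auto
    then obtain n0 where n0: "\<And>n. n \<ge> n0 \<Longrightarrow> ?C * root 8 (e0 / real (Suc n)) < s" by (auto simp: eventually_sequentially)
    have *: "\<bar>T (e0 / real (Suc m)) - T (e0 / real (Suc n))\<bar> < s" if "n0 \<le> m" "m \<le> n" for m n
    proof -
      have "\<bar>T (e0 / real (Suc m)) - T (e0 / real (Suc n))\<bar> \<le> ?C * root 8 (e0 / real (Suc m))"
      proof (rule C)
        show "e0 / real (Suc n) \<le> e0 / real (Suc m)" using e0 that by (intro divide_left_mono) auto
        have "e0 * 1 \<le> e0 * real (Suc m)" using e0 by (intro mult_left_mono) auto
        then show "e0 / real (Suc m) \<le> e0" by (simp add: divide_le_eq)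
      qed (use e0 in simp)
      also have "\<dots> < s" by (rule n0[OF that(1)])
      finally show ?thesis .
    qed
    show "\<exists>N. \<forall>m\<ge>N. \<forall>n\<ge>N. dist (T (e0 / real (Suc m))) (T (e0 / real (Suc n))) < s"
    proof (intro exI[of _ n0] allI impI)
      fix m n assume "n0 \<le> m" "n0 \<le> n"
      then show "dist (T (e0 / real (Suc m))) (T (e0 / real (Suc n))) < s"
        using *[of m n] *[of n m] unfolding dist_real_def by (cases "m \<le> n") (auto simp: abs_minus_commute)
    qed
  qed
  then obtain l where l: "(\<lambda>n. T (e0 / real (Suc n))) \<longlonglongrightarrow> l" using Cauchy_convergent convergent_def by blast
  have b: "\<bar>T e - l\<bar> \<le> ?C * root 8 e" if e: "0 < e" "e \<le> e0" for e
  proof (rule LIMSEQ_le_const2)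
    show "(\<lambda>n. \<bar>T e - T (e0 / real (Suc n))\<bar>) \<longlonglongrightarrow> \<bar>T e - l\<bar>" by (intro tendsto_intros l)
    obtain N where N: "e0 / e < real N" using reals_Archimedean2 by blast
    show "\<exists>N. \<forall>n\<ge>N. \<bar>T e - T (e0 / real (Suc n))\<bar> \<le> ?C * root 8 e"
    proof (intro exI[of _ N] allI impI)
      fix n assume "N \<le> n"
      then have "e0 / e < real (Suc n)" using N by linarith
      then have "e0 / real (Suc n) \<le> e" using e by (simp add: field_simps)
      then show "\<bar>T e - T (e0 / real (Suc n))\<bar> \<le> ?C * root 8 e" using e e0 by (intro C) auto
    qed
  qed
  have "((\<lambda>e. T e - l) \<longlongrightarrow> 0) (at_right 0)"
  proof (rule Lim_null_comparison)
    show "\<forall>\<^sub>F e in at_right 0. norm (T e - l) \<le> ?C * root 8 e"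
      using eventually_at_right_less[of 0] eventually_at_right_real[OF e0]
      by eventually_elim (use b in auto)
    have "((\<lambda>e. ?C * root 8 e) \<longlongrightarrow> ?C * root 8 0) (at_right 0)" by (intro tendsto_intros)
    then show "((\<lambda>e. ?C * root 8 e) \<longlongrightarrow> 0) (at_right 0)" by simp
  qed
  then have "(T \<longlongrightarrow> l) (at_right 0)" by (simp add: LIM_zero_iff)
  then show ?thesis ..
qed

section \<open>Riemann sums and weak convergence on the unit interval\<close>

lemma set_integrable_finite_01:
  fixes f :: "real \<Rightarrow> real"
  assumes \<nu>: "sets \<nu> = sets borel" "emeasure \<nu> {0..1} < \<infinity>" and f: "continuous_on UNIV f"
  shows "set_integrable \<nu> {0..1} f"
proof -
  have [measurable_cong]: "sets \<nu> = sets borel" by (rule \<nu>(1))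
  have [measurable]: "f \<in> borel_measurable borel" by (rule borel_measurable_continuous_onI[OF f])
  have A: "{0..1} \<in> sets \<nu>" by (simp add: \<nu>(1))
  have i1: "integrable \<nu> (indicator {0..1} :: real \<Rightarrow> real)" using A \<nu>(2) by (intro integrable_real_indicator) auto
  have "bounded (f ` {0..1})"
    by (intro compact_imp_bounded compact_continuous_image continuous_on_subset[OF f]) auto
  then have "\<exists>C. \<forall>s\<in>{0..1}. \<bar>f s\<bar> \<le> C" by (auto simp: bounded_iff)
  then obtain C where C: "\<forall>s\<in>{0..1}. \<bar>f s\<bar> \<le> C" by blast
  show ?thesis unfolding set_integrable_def
  proof (rule Bochner_Integration.integrable_bound[OF integrable_mult_right[OF i1, of C]])
    show "AE s in \<nu>. norm (indicator {0..1} s *\<^sub>R f s) \<le> norm (C * indicator {0..1} s)"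
    proof (rule AE_I2)
      fix s show "norm (indicator {0..1} s *\<^sub>R f s) \<le> norm (C * indicator {0..1} s)"
        using C by (cases "s \<in> {0..1}") (auto intro: order_trans[OF _ abs_ge_self])
    qed
  qed measurable
qed

lemma set_integral_bound_01:
  fixes f :: "real \<Rightarrow> real"
  assumes \<nu>: "sets \<nu> = sets borel" "emeasure \<nu> {0..1} < \<infinity>" and f: "continuous_on UNIV f"
    and C: "\<And>s. s \<in> {0..1} \<Longrightarrow> \<bar>f s\<bar> \<le> C"
  shows "\<bar>LINT s:{0..1}|\<nu>. f s\<bar> \<le> C * measure \<nu> {0..1}"
proof -
  have A: "{0..1} \<in> sets \<nu>" by (simp add: \<nu>(1))
  have i: "integrable \<nu> (\<lambda>s. indicator {0..1} s *\<^sub>R f s)"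
    using set_integrable_finite_01[OF \<nu> f] by (simp add: set_integrable_def)
  have "\<bar>\<integral>s. indicator {0..1} s *\<^sub>R f s \<partial>\<nu>\<bar> \<le> (\<integral>s. \<bar>indicator {0..1} s *\<^sub>R f s\<bar> \<partial>\<nu>)"
    using integral_norm_bound[of \<nu> "\<lambda>s. indicator {0..1} s *\<^sub>R f s"] by simp
  moreover have "(\<integral>s. \<bar>indicator {0..1} s *\<^sub>R f s\<bar> \<partial>\<nu>) \<le> (\<integral>s. C * indicator {0..1} s \<partial>\<nu>)"
  proof (rule integral_mono)
    show "integrable \<nu> (\<lambda>s. \<bar>indicator {0..1} s *\<^sub>R f s\<bar>)" by (rule integrable_abs[OF i])
    show "integrable \<nu> (\<lambda>s. C * indicator {0..1} s)"
      using A \<nu>(2) by (intro integrable_mult_right integrable_real_indicator) auto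
    fix s show "\<bar>indicator {0..1} s *\<^sub>R f s\<bar> \<le> C * indicator {0..1} s" using C[of s] by (cases "s \<in> {0..1}") auto
  qed
  moreover have "(\<integral>s. C * indicator {0..1} s \<partial>\<nu>) = C * measure \<nu> {0..1}" using A by simp
  ultimately show ?thesis unfolding set_lebesgue_integral_def by linarith
qed

text \<open>On each cell \<open>f\<close> varies by at most \<open>w\<close>. The cells cover (0,1]
  only, so the point 0 must carry no mass.\<close>

lemma riemann_sum_error:
  fixes f :: "real \<Rightarrow> real"
  assumes \<nu>: "sets \<nu> = sets borel" "emeasure \<nu> {0..1} < \<infinity>" "emeasure \<nu> {0} = 0"
    and f: "continuous_on UNIV f" and n: "n \<ge> 1"
    and w: "\<And>s t. s \<in> {0..1} \<Longrightarrow> t \<in> {0..1} \<Longrightarrow> \<bar>s - t\<bar> \<le> 1 / real n \<Longrightarrow> \<bar>f s - f t\<bar> \<le> w"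
  shows "\<bar>(LINT s:{0..1}|\<nu>. f s) - (\<Sum>i=1..n. f (real i / real n) * measure \<nu> {(real i - 1) / real n<..real i / real n})\<bar> \<le> w * measure \<nu> {0..1}"
proof -
  let ?I = "\<lambda>i. {(real i - 1) / real n<..real i / real n}"
  have [measurable_cong]: "sets \<nu> = sets borel" by (rule \<nu>(1))
  have [measurable]: "f \<in> borel_measurable borel" by (rule borel_measurable_continuous_onI[OF f])
  have A: "{0..1} \<in> sets \<nu>" "\<And>i. ?I i \<in> sets \<nu>" "{0} \<in> sets \<nu>" by (simp_all add: \<nu>(1))
  have sub: "?I i \<subseteq> {0..1}" if "i \<in> {1..n}" for i
  proof -
    have "0 \<le> (real i - 1) / real n" "real i / real n \<le> 1" using that by (auto simp: divide_le_eq)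
    then show ?thesis by auto
  qed
  have fin: "emeasure \<nu> (?I i) < \<infinity>" if "i \<in> {1..n}" for i
    by (rule order.strict_trans1[OF emeasure_mono[OF sub[OF that] A(1)] \<nu>(2)])
  have i1: "integrable \<nu> (indicator {0..1} :: real \<Rightarrow> real)" using A \<nu>(2) by (intro integrable_real_indicator) auto
  have if': "integrable \<nu> (\<lambda>s. indicator {0..1} s *\<^sub>R f s)"
    using set_integrable_finite_01[OF \<nu>(1,2) f] by (simp add: set_integrable_def)
  have iS: "integrable \<nu> (\<lambda>s. \<Sum>i=1..n. f (real i / real n) * indicator (?I i) s)"
    using fin A by (intro Bochner_Integration.integrable_sum integrable_mult_right integrable_real_indicator) auto
  have "(\<Sum>i=1..n. f (real i / real n) * measure \<nu> (?I i)) = (\<integral>s. (\<Sum>i=1..n. f (real i / real n) * indicator (?I i) s) \<partial>\<nu>)"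
    using fin A by (subst Bochner_Integration.integral_sum) (auto intro!: integrable_mult_right integrable_real_indicator)
  then have 1: "(LINT s:{0..1}|\<nu>. f s) - (\<Sum>i=1..n. f (real i / real n) * measure \<nu> (?I i))
     = (\<integral>s. indicator {0..1} s *\<^sub>R f s - (\<Sum>i=1..n. f (real i / real n) * indicator (?I i) s) \<partial>\<nu>)"
    unfolding set_lebesgue_integral_def by (subst Bochner_Integration.integral_diff[OF if' iS]) simp
  have 2: "\<bar>\<integral>s. indicator {0..1} s *\<^sub>R f s - (\<Sum>i=1..n. f (real i / real n) * indicator (?I i) s) \<partial>\<nu>\<bar>
      \<le> (\<integral>s. \<bar>indicator {0..1} s *\<^sub>R f s - (\<Sum>i=1..n. f (real i / real n) * indicator (?I i) s)\<bar> \<partial>\<nu>)"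
    using integral_norm_bound[of \<nu> "\<lambda>s. indicator {0..1} s *\<^sub>R f s - (\<Sum>i=1..n. f (real i / real n) * indicator (?I i) s)"] by simp
  have 3: "(\<integral>s. \<bar>indicator {0..1} s *\<^sub>R f s - (\<Sum>i=1..n. f (real i / real n) * indicator (?I i) s)\<bar> \<partial>\<nu>)
      \<le> (\<integral>s. w * indicator {0..1} s \<partial>\<nu>)"
  proof (rule integral_mono_AE)
    show "integrable \<nu> (\<lambda>s. \<bar>indicator {0..1} s *\<^sub>R f s - (\<Sum>i=1..n. f (real i / real n) * indicator (?I i) s)\<bar>)"
      by (intro integrable_abs Bochner_Integration.integrable_diff if' iS)
    show "integrable \<nu> (\<lambda>s. w * indicator {0..1} s)" by (rule integrable_mult_right[OF i1])
    have "AE s in \<nu>. s \<noteq> 0" using \<nu>(3) A(3) by (intro AE_I[where N = "{0}"]) auto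
    then show "AE s in \<nu>. \<bar>indicator {0..1} s *\<^sub>R f s - (\<Sum>i=1..n. f (real i / real n) * indicator (?I i) s)\<bar> \<le> w * indicator {0..1} s"
    proof eventually_elim
      case (elim s)
      show ?case
      proof (cases "0 < s \<and> s \<le> 1")
        case True
        then have s: "0 < s" "s \<le> 1" by auto
        note c = cell[OF n s]
        have "\<bar>f s - f (real (cell n s) / real n)\<bar> \<le> w"
          using c(1-3) s by (intro w) (auto simp: divide_le_eq)
        then show ?thesis unfolding step_cell[OF n s] using s by simp
      next
        case False
        then have "s \<notin> {0..1}" using elim by auto
        moreover from this have "(\<Sum>i=1..n. f (real i / real n) * indicator (?I i) s) = 0"
        proof (intro sum.neutral ballI)
          fix i assume "i \<in> {1..n}"
          then have "s \<notin> ?I i" using sub[of i] \<open>s \<notin> {0..1}\<close> by blast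
          then show "f (real i / real n) * indicator (?I i) s = 0" by simp
        qed
        ultimately show ?thesis by simp
      qed
    qed
  qed
  have 4: "(\<integral>s. w * indicator {0..1} s \<partial>\<nu>) = w * measure \<nu> {0..1}" using A by simp
  show ?thesis using 2 3 unfolding 1 4 by linarith
qed

lemma uniform_modulus:
  fixes f :: "real \<Rightarrow> real"
  assumes f: "continuous_on UNIV f" and w: "0 < w"
  obtains n where "n \<ge> 1" "\<And>m s t. n \<le> m \<Longrightarrow> s \<in> {0..1} \<Longrightarrow> t \<in> {0..1} \<Longrightarrow> \<bar>s - t\<bar> \<le> 1 / real m \<Longrightarrow> \<bar>f s - f t\<bar> \<le> w"
proof -
  have "uniformly_continuous_on {0..1} f"
    by (intro compact_uniformly_continuous continuous_on_subset[OF f]) auto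
  from this[unfolded uniformly_continuous_on_def, rule_format, OF w]
  obtain \<delta> where \<delta>: "\<delta> > 0" "\<And>s t. s \<in> {0..1} \<Longrightarrow> t \<in> {0..1} \<Longrightarrow> dist t s < \<delta> \<Longrightarrow> dist (f t) (f s) < w"
    by auto
  obtain N where N: "1 / \<delta> < real N" using reals_Archimedean2 by blast
  show thesis
  proof (rule that[of "Suc N"])
    fix m s t assume m: "Suc N \<le> m" and st: "s \<in> {0..1}" "t \<in> {0..1}" "\<bar>s - t\<bar> \<le> 1 / real m"
    have "1 / \<delta> < real m" using N m by linarith
    then have "1 / real m < \<delta>" using \<delta>(1) m by (simp add: field_simps)
    then have "dist s t < \<delta>" using st(3) by (simp add: dist_real_def)
    from \<delta>(2)[OF st(2,1) this] show "\<bar>f s - f t\<bar> \<le> w" by (simp add: dist_real_def)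
  qed simp
qed

text \<open>Expresses an integral through the masses of grid cells. For a measure depending on
  \<omega> this gives measurability of the integral in \<omega>, see
  \<open>Lp_renorm\<close>.\<close>

lemma riemann_sums_tendsto:
  fixes f :: "real \<Rightarrow> real"
  assumes \<nu>: "sets \<nu> = sets borel" "emeasure \<nu> {0..1} < \<infinity>" "emeasure \<nu> {0} = 0"
    and f: "continuous_on UNIV f"
  shows "(\<lambda>n. \<Sum>i=1..Suc n. f (real i / real (Suc n)) * measure \<nu> {(real i - 1) / real (Suc n)<..real i / real (Suc n)})
    \<longlonglongrightarrow> (LINT s:{0..1}|\<nu>. f s)"
proof (rule LIMSEQ_I)
  fix r :: real assume r: "0 < r"
  let ?m = "measure \<nu> {0..1}"
  have m1: "0 < ?m + 1" by (rule add_nonneg_pos[OF measure_nonneg zero_less_one])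
  define w where "w = r / (?m + 1)"
  have w: "0 < w" unfolding w_def by (rule divide_pos_pos[OF r m1])
  obtain n0 where "1 \<le> n0" and n0: "\<And>m s t. n0 \<le> m \<Longrightarrow> s \<in> {0..1} \<Longrightarrow> t \<in> {0..1} \<Longrightarrow> \<bar>s - t\<bar> \<le> 1 / real m \<Longrightarrow> \<bar>f s - f t\<bar> \<le> w"
    using uniform_modulus[OF f w] by blast
  have "w * ?m < r"
  proof -
    have "r / x * x = r" if "0 < x" for x using that by simp
    from this[OF m1] have "w * (?m + 1) = r" unfolding w_def .
    then show ?thesis using w unfolding distrib_left by linarith
  qed
  show "\<exists>no. \<forall>n\<ge>no. norm ((\<Sum>i=1..Suc n. f (real i / real (Suc n)) * measure \<nu> {(real i - 1) / real (Suc n)<..real i / real (Suc n)})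
      - (LINT s:{0..1}|\<nu>. f s)) < r"
  proof (intro exI[of _ n0] allI impI)
    fix n assume n: "n0 \<le> n"
    have "\<bar>(LINT s:{0..1}|\<nu>. f s) - (\<Sum>i=1..Suc n. f (real i / real (Suc n)) * measure \<nu> {(real i - 1) / real (Suc n)<..real i / real (Suc n)})\<bar> \<le> w * ?m"
    proof (rule riemann_sum_error[OF \<nu> f])
      fix s t :: real assume "s \<in> {0..1}" "t \<in> {0..1}" "\<bar>s - t\<bar> \<le> 1 / real (Suc n)"
      then show "\<bar>f s - f t\<bar> \<le> w" using n by (intro n0[of "Suc n" s t]) auto
    qed simp
    then show "norm ((\<Sum>i=1..Suc n. f (real i / real (Suc n)) * measure \<nu> {(real i - 1) / real (Suc n)<..real i / real (Suc n)})
      - (LINT s:{0..1}|\<nu>. f s)) < r"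
      using \<open>w * ?m < r\<close> unfolding real_norm_def by linarith
  qed
qed

text \<open>Both integrals are close to Riemann sums over one common grid, and there only finitely
  many cell masses have to converge. Convergence of the total mass keeps the Riemann error uniform
  in j.\<close>

lemma weak_convergence_01:
  fixes f :: "real \<Rightarrow> real" and \<nu> :: "real measure" and \<nu>' :: "nat \<Rightarrow> real measure"
  assumes \<nu>: "sets \<nu> = sets borel" "emeasure \<nu> {0..1} < \<infinity>" "emeasure \<nu> {0} = 0"
    and \<nu>': "\<And>j. sets (\<nu>' j) = sets borel" "\<And>j. emeasure (\<nu>' j) {0..1} < \<infinity>" "\<And>j. emeasure (\<nu>' j) {0} = 0"
    and c: "\<And>n i. n \<ge> 1 \<Longrightarrow> i \<in> {1..n} \<Longrightarrow>
      (\<lambda>j. measure (\<nu>' j) {(real i - 1) / real n<..real i / real n}) \<longlonglongrightarrow> measure \<nu> {(real i - 1) / real n<..real i / real n}"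
    and t: "(\<lambda>j. measure (\<nu>' j) {0..1}) \<longlonglongrightarrow> measure \<nu> {0..1}"
    and f: "continuous_on UNIV f"
  shows "(\<lambda>j. LINT s:{0..1}|\<nu>' j. f s) \<longlonglongrightarrow> (LINT s:{0..1}|\<nu>. f s)"
proof (rule LIMSEQ_I)
  fix r :: real assume r: "0 < r"
  let ?m = "measure \<nu> {0..1}"
  \<comment> \<open>Each of the two Riemann errors is then at most r/4, and so eventually is the
    difference of the sums. The added 1 allows for zero mass and bounds the masses of \<nu>'
    eventually.\<close>
  define w where "w = r / (4 * (?m + 1))"
  have m0: "0 \<le> ?m" by simp
  have m1: "0 < ?m + 1" by (rule add_nonneg_pos[OF m0 zero_less_one])
  have w: "0 < w" unfolding w_def by (rule divide_pos_pos[OF r mult_pos_pos[OF _ m1]]) simp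
  obtain n where n: "n \<ge> 1" and "\<And>m s t. n \<le> m \<Longrightarrow> s \<in> {0..1} \<Longrightarrow> t \<in> {0..1} \<Longrightarrow> \<bar>s - t\<bar> \<le> 1 / real m \<Longrightarrow> \<bar>f s - f t\<bar> \<le> w"
    using uniform_modulus[OF f w] by blast
  then have md: "\<And>s t. s \<in> {0..1} \<Longrightarrow> t \<in> {0..1} \<Longrightarrow> \<bar>s - t\<bar> \<le> 1 / real n \<Longrightarrow> \<bar>f s - f t\<bar> \<le> w" by blast
  let ?R = "\<lambda>\<mu>. \<Sum>i=1..n. f (real i / real n) * measure \<mu> {(real i - 1) / real n<..real i / real n}"
  have "(\<lambda>j. ?R (\<nu>' j)) \<longlonglongrightarrow> ?R \<nu>" by (intro tendsto_sum tendsto_mult tendsto_const c n)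
  then have "\<forall>\<^sub>F j in sequentially. \<bar>?R (\<nu>' j) - ?R \<nu>\<bar> < r / 4"
    using r tendstoD[of "\<lambda>j. ?R (\<nu>' j)" "?R \<nu>" sequentially "r / 4"] by (simp add: dist_real_def)
  moreover have "\<forall>\<^sub>F j in sequentially. measure (\<nu>' j) {0..1} < ?m + 1"
    using order_tendstoD(2)[OF t, of "?m + 1"] by simp
  ultimately have "\<forall>\<^sub>F j in sequentially. norm ((LINT s:{0..1}|\<nu>' j. f s) - (LINT s:{0..1}|\<nu>. f s)) < r"
  proof eventually_elim
    case (elim j)
    have 1: "\<bar>(LINT s:{0..1}|\<nu>' j. f s) - ?R (\<nu>' j)\<bar> \<le> w * measure (\<nu>' j) {0..1}"
      by (rule riemann_sum_error[OF \<nu>' f n md])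
    have 2: "\<bar>(LINT s:{0..1}|\<nu>. f s) - ?R \<nu>\<bar> \<le> w * ?m"
      by (rule riemann_sum_error[OF \<nu> f n md])
    have "w * measure (\<nu>' j) {0..1} \<le> w * (?m + 1)" using elim w by (intro mult_left_mono) auto
    moreover have "w * ?m \<le> w * (?m + 1)" using w by (intro mult_left_mono) auto
    moreover have "w * (?m + 1) = r / 4" unfolding w_def
    proof -
      have "r / (4 * x) * x = r / 4" if "0 < x" for x using that by simp
      from this[OF m1] show "r / (4 * (?m + 1)) * (?m + 1) = r / 4" .
    qed
    ultimately show ?case using 1 2 elim(1) r unfolding real_norm_def by linarith
  qed
  then show "\<exists>no. \<forall>j\<ge>no. norm ((LINT s:{0..1}|\<nu>' j. f s) - (LINT s:{0..1}|\<nu>. f s)) < r"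
    by (simp add: eventually_sequentially)
qed

text \<open>Continuity of \<open>g\<close> excludes atoms, so half-open and closed intervals have
  the same mass.\<close>

lemma stieltjes_01:
  assumes g: "continuous_on {0..1} g" "mono_on {0..1} g"
  shows "sets (stieltjes_01 g) = sets borel"
    and "\<And>p q. 0 \<le> p \<Longrightarrow> p \<le> q \<Longrightarrow> q \<le> 1 \<Longrightarrow> emeasure (stieltjes_01 g) {p<..q} = ennreal (g q - g p)"
    and "\<And>p q. 0 \<le> p \<Longrightarrow> p \<le> q \<Longrightarrow> q \<le> 1 \<Longrightarrow> emeasure (stieltjes_01 g) {p..q} = ennreal (g q - g p)"
    and "\<And>p q. 0 \<le> p \<Longrightarrow> p \<le> q \<Longrightarrow> q \<le> 1 \<Longrightarrow> measure (stieltjes_01 g) {p<..q} = g q - g p"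
    and "\<And>p q. 0 \<le> p \<Longrightarrow> p \<le> q \<Longrightarrow> q \<le> 1 \<Longrightarrow> measure (stieltjes_01 g) {p..q} = g q - g p"
proof -
  let ?g = "\<lambda>s. g (max 0 (min 1 s))"
  have m: "?g x \<le> ?g y" if "x \<le> y" for x y
    using that by (intro mono_onD[OF g(2)]) auto
  have c: "continuous_on UNIV ?g"
    by (rule continuous_on_compose2[OF g(1)]) (auto intro!: continuous_intros)
  have rc: "continuous (at_right x) ?g" for x
    using c by (simp add: continuous_on_eq_continuous_at continuous_at_imp_continuous_at_within)
  show "sets (stieltjes_01 g) = sets borel" by (simp add: stieltjes_01_def)
  have pq: "g p \<le> g q" if "0 \<le> p" "p \<le> q" "q \<le> 1" for p q using that by (intro mono_onD[OF g(2)]) auto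
  show 1: "emeasure (stieltjes_01 g) {p<..q} = ennreal (g q - g p)" if "0 \<le> p" "p \<le> q" "q \<le> 1" for p q
    unfolding stieltjes_01_def using emeasure_interval_measure_Ioc[OF that(2) m rc] that by simp
  show 2: "emeasure (stieltjes_01 g) {p..q} = ennreal (g q - g p)" if "0 \<le> p" "p \<le> q" "q \<le> 1" for p q
    unfolding stieltjes_01_def using emeasure_interval_measure_Icc[OF that(2) m c] that by simp
  show "measure (stieltjes_01 g) {p<..q} = g q - g p" if "0 \<le> p" "p \<le> q" "q \<le> 1" for p q
    unfolding measure_def 1[OF that] using pq[OF that] by simp
  show "measure (stieltjes_01 g) {p..q} = g q - g p" if "0 \<le> p" "p \<le> q" "q \<le> 1" for p q
    unfolding measure_def 2[OF that] using pq[OF that] by simp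
qed

section \<open>Mollifiers, bumps and cutoffs\<close>

lemma mollifier_props:
  assumes \<rho>: "mollifier \<rho>"
  shows "\<And>x. (\<rho> has_real_derivative deriv \<rho> x) (at x)" and "continuous_on UNIV \<rho>" and "continuous_on UNIV (deriv \<rho>)"
    and "\<And>x. 1 \<le> \<bar>x\<bar> \<Longrightarrow> \<rho> x = 0" and "\<And>x. 1 \<le> \<bar>x\<bar> \<Longrightarrow> deriv \<rho> x = 0"
    and "\<exists>C\<ge>0. (\<forall>x. \<bar>\<rho> x\<bar> \<le> C) \<and> (\<forall>x. \<bar>deriv \<rho> x\<bar> \<le> C)"
    and "integrable lborel \<rho>" and "(LINT x|lborel. deriv \<rho> x) = 0"
proof -
  have dn: "\<And>n x. (deriv ^^ n) \<rho> differentiable (at x)" using \<rho> by (simp add: mollifier_def)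
  have d0: "\<rho> differentiable (at x)" and d1: "deriv \<rho> differentiable (at x)" for x using dn[of 0 x] dn[of 1 x] by simp_all
  show D: "(\<rho> has_real_derivative deriv \<rho> x) (at x)" for x
    using d0[of x] by (simp add: DERIV_deriv_iff_real_differentiable)
  show c0: "continuous_on UNIV \<rho>" using d0 by (simp add: continuous_on_eq_continuous_at differentiable_imp_continuous_within)
  show c1: "continuous_on UNIV (deriv \<rho>)" using d1 by (simp add: continuous_on_eq_continuous_at differentiable_imp_continuous_within)
  let ?S = "closure {x. \<rho> x \<noteq> 0}"
  have S: "?S \<subseteq> {-1<..<1}" using \<rho> by (simp add: mollifier_def)
  have out: "x \<notin> ?S" if "1 \<le> \<bar>x\<bar>" for x
  proof
    assume "x \<in> ?S"
    then have "x \<in> {-1<..<1}" using S by blast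
    then show False using that by auto
  qed
  show z0: "\<rho> x = 0" if "1 \<le> \<bar>x\<bar>" for x
  proof (rule ccontr)
    assume "\<rho> x \<noteq> 0"
    then have "x \<in> ?S" using closure_subset[of "{x. \<rho> x \<noteq> 0}"] by auto
    then show False using out[OF that] by blast
  qed
  show z1: "deriv \<rho> x = 0" if "1 \<le> \<bar>x\<bar>" for x
  proof -
    \<comment> \<open>The points -1 and 1 are included: the closed support lies in the open
      interval, so the mollifier vanishes on a neighbourhood of each point x with |x| \<ge> 1, and
      its derivative vanishes with it.\<close>
    have "open (- ?S)" "x \<in> - ?S" using out[OF that] by auto
    moreover have "0 = \<rho> y" if "y \<in> - ?S" for y using that closure_subset[of "{x. \<rho> x \<noteq> 0}"] by auto
    ultimately have "(\<rho> has_real_derivative 0) (at x)"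
      by (rule has_field_derivative_transform_within_open[OF DERIV_const])
    then show ?thesis by (rule DERIV_imp_deriv)
  qed
  have bd: "\<exists>C\<ge>0. \<forall>x. \<bar>f x\<bar> \<le> C" if f: "continuous_on UNIV f" "\<And>x. 1 \<le> \<bar>x\<bar> \<Longrightarrow> f x = 0" for f :: "real \<Rightarrow> real"
  proof -
    have "bounded (f ` {-1..1})"
      by (intro compact_imp_bounded compact_continuous_image continuous_on_subset[OF f(1)]) auto
    then obtain C where C: "\<forall>x\<in>{-1..1}. \<bar>f x\<bar> \<le> C" by (auto simp: bounded_iff)
    have "\<bar>f x\<bar> \<le> max 0 C" for x
      using C f(2)[of x] by (cases "x \<in> {-1..1}") (auto simp: le_max_iff_disj)
    then show ?thesis by (intro exI[of _ "max 0 C"]) auto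
  qed
  obtain C0 where C0: "C0 \<ge> 0" "\<forall>x. \<bar>\<rho> x\<bar> \<le> C0" using bd[OF c0 z0] by blast
  obtain C1 where C1: "C1 \<ge> 0" "\<forall>x. \<bar>deriv \<rho> x\<bar> \<le> C1" using bd[OF c1 z1] by blast
  show "\<exists>C\<ge>0. (\<forall>x. \<bar>\<rho> x\<bar> \<le> C) \<and> (\<forall>x. \<bar>deriv \<rho> x\<bar> \<le> C)"
    using C0 C1 by (intro exI[of _ "C0 + C1"]) (auto intro: add_increasing add_increasing2)
  have ind: "f x = indicator {-1..1} x *\<^sub>R f x" if "\<And>x. 1 \<le> \<bar>x\<bar> \<Longrightarrow> f x = 0" for f :: "real \<Rightarrow> real" and x
    using that[of x] by (cases "x \<in> {-1..1}") auto
  have "integrable lborel (\<lambda>x. indicator {-1..1} x *\<^sub>R \<rho> x)"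
    by (intro borel_integrable_compact continuous_on_subset[OF c0]) auto
  moreover have "(\<lambda>x. indicator {-1..1} x *\<^sub>R \<rho> x) = \<rho>" by (rule ext) (rule ind[OF z0, symmetric])
  ultimately show "integrable lborel \<rho>" by simp
  have "(LINT x|lborel. deriv \<rho> x) = (\<integral>x. indicator {-1..1} x *\<^sub>R deriv \<rho> x \<partial>lborel)"
    by (intro Bochner_Integration.integral_cong refl ind z1)
  also have "\<dots> = \<rho> 1 - \<rho> (-1)"
    by (rule integral_FTC_Icc[OF _ has_vector_derivative_at_within[OF D[unfolded has_real_derivative_iff_has_vector_derivative]] continuous_on_subset[OF c1]]) auto
  also have "\<dots> = 0" using z0[of 1] z0[of "-1"] by simp
  finally show "(LINT x|lborel. deriv \<rho> x) = 0" .
qed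

lemma mollifier_kernel:
  assumes \<rho>: "mollifier \<rho>"
  obtains G where "kernel (\<lambda>x. - deriv \<rho> x) G"
proof -
  note m = mollifier_props[OF \<rho>]
  obtain C where C: "\<forall>x. \<bar>deriv \<rho> x\<bar> \<le> C" using m(6) by blast
  have "kernel (\<lambda>x. - deriv \<rho> x) C"
    by unfold_locales (use m(5,8) C in \<open>auto intro!: continuous_on_minus m(3)\<close>)
  then show thesis by (rule that)
qed

text \<open>The mollifier doubles as the profile of an approximate Dirac mass at \<open>a\<close>.
  Its height and its Lipschitz constant grow as \<delta> shrinks, its mass does not.\<close>

lemma mollifier_bump:
  assumes \<rho>: "mollifier \<rho>" and \<delta>: "0 < \<delta>"
  obtains \<phi>' L where "bump (\<lambda>x. \<rho> ((x - a) / \<delta>) / \<delta>) \<phi>' L"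
proof -
  note m = mollifier_props[OF \<rho>]
  obtain C where C: "0 \<le> C" "\<forall>x. \<bar>\<rho> x\<bar> \<le> C" "\<forall>x. \<bar>deriv \<rho> x\<bar> \<le> C" using m(6) by blast
  let ?\<phi> = "\<lambda>x. \<rho> ((x - a) / \<delta>) / \<delta>" and ?\<phi>' = "\<lambda>x. deriv \<rho> ((x - a) / \<delta>) / \<delta>\<^sup>2"
  let ?L = "C / \<delta> + C / \<delta>\<^sup>2"
  have p: "0 \<le> \<rho> x" for x using \<rho> by (simp add: mollifier_def)
  have L: "0 \<le> ?L" "C / \<delta> \<le> ?L" "C / \<delta>\<^sup>2 \<le> ?L" using C \<delta> by auto
  have D: "(?\<phi> has_real_derivative ?\<phi>' x) (at x)" for x
  proof -
    have "((\<lambda>x. (x - a) / \<delta>) has_real_derivative 1 / \<delta>) (at x)" using \<delta> by (auto intro!: derivative_eq_intros)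
    from DERIV_cdivide[OF DERIV_chain2[OF m(1) this], of \<delta>]
    show ?thesis by (simp add: power2_eq_square)
  qed
  have b': "\<bar>?\<phi>' x\<bar> \<le> ?L" for x
  proof -
    have "\<bar>?\<phi>' x\<bar> \<le> C / \<delta>\<^sup>2" using C \<delta> by (simp add: abs_divide divide_right_mono)
    then show ?thesis using L by linarith
  qed
  have lip: "\<bar>?\<phi> x - ?\<phi> y\<bar> \<le> ?L * \<bar>x - y\<bar>" for x y
    using field_differentiable_bound[of UNIV ?\<phi> ?\<phi>' ?L x y] D b' by simp
  have "(\<integral>\<^sup>+x. ennreal (?\<phi> x) \<partial>lborel) = ennreal \<bar>\<delta>\<bar> * (\<integral>\<^sup>+x. ennreal (?\<phi> (a + \<delta> * x)) \<partial>lborel)"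
    using borel_measurable_continuous_onI[OF m(2)] \<delta> by (intro nn_integral_real_affine) auto
  also have "\<dots> = (\<integral>\<^sup>+x. ennreal \<delta> * ennreal (\<rho> x / \<delta>) \<partial>lborel)"
    using \<delta> borel_measurable_continuous_onI[OF m(2)] by (subst nn_integral_cmult) auto
  also have "\<dots> = (\<integral>\<^sup>+x. ennreal (\<rho> x) \<partial>lborel)"
    using \<delta> p by (intro nn_integral_cong) (simp add: ennreal_mult[symmetric])
  also have "\<dots> = ennreal 1" using p m(7) \<rho> by (subst nn_integral_eq_integral) (auto simp: mollifier_def)
  finally have "(\<integral>\<^sup>+x. ennreal (?\<phi> x) \<partial>lborel) \<le> 1" by simp
  moreover have "\<bar>?\<phi> x\<bar> \<le> ?L" for x
  proof -
    have "\<bar>?\<phi> x\<bar> \<le> C / \<delta>" using C \<delta> by (simp add: abs_divide divide_right_mono)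
    then show ?thesis using L by linarith
  qed
  moreover have "?\<phi>' \<in> borel_measurable borel" using borel_measurable_continuous_onI[OF m(3)] by measurable
  ultimately have "bump ?\<phi> ?\<phi>' ?L"
    unfolding bump_def using L(1) p \<delta> lip D b' by auto
  then show thesis by (rule that)
qed

text \<open>A compact support inside the open interval has a least and a greatest point, and these
  keep a positive distance from the endpoints.\<close>

lemma Cc_01_cutoff:
  assumes "h \<in> Cc_01"
  obtains H d where "cutoff h H d"
proof -
  let ?S = "closure {x. h x \<noteq> 0}"
  have h: "continuous_on UNIV h" "compact ?S" "?S \<subseteq> {0<..<1}" using assms by (auto simp: Cc_01_def)
  have z: "x \<in> ?S" if "h x \<noteq> 0" for x using that closure_subset[of "{x. h x \<noteq> 0}"] by auto
  have z': "x \<in> {0<..<1}" if "h x \<noteq> 0" for x using z[OF that] h(3) by blast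
  have "bounded (h ` {0..1})"
    by (intro compact_imp_bounded compact_continuous_image continuous_on_subset[OF h(1)]) auto
  then obtain C where C: "\<forall>x\<in>{0..1}. \<bar>h x\<bar> \<le> C" by (auto simp: bounded_iff)
  have H: "\<bar>h x\<bar> \<le> max 0 C" for x
  proof (cases "h x = 0")
    case False
    then show ?thesis using z'[OF False] C by (auto simp: le_max_iff_disj)
  qed simp
  show thesis
  proof (cases "?S = {}")
    \<comment> \<open>For h = 0 the support has no extreme points and any positive margin will
      do.\<close>
    case True
    then have "h x = 0" for x using z by blast
    then show thesis using that[of "max 0 C" "1 / 2"] h(1) H by (simp add: cutoff_def)
  next
    case False
    obtain l where l: "l \<in> ?S" "\<forall>x\<in>?S. l \<le> x" using compact_attains_inf[OF h(2) False] by blast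
    obtain u where u: "u \<in> ?S" "\<forall>x\<in>?S. x \<le> u" using compact_attains_sup[OF h(2) False] by blast
    let ?d = "min l (1 - u)"
    have "0 < l" "u < 1" using l(1) u(1) h(3) by auto
    then have "0 < ?d" by simp
    moreover have "h x = 0" if x: "x \<notin> {?d..1 - ?d}" for x
    proof (rule ccontr)
      assume "h x \<noteq> 0"
      then have "l \<le> x" "x \<le> u" using z l u by auto
      then show False using x by auto
    qed
    ultimately have "cutoff h (max 0 C) ?d" using h(1) H by (simp add: cutoff_def)
    then show thesis by (rule that)
  qed
qed

section \<open>Passing bounds on expectations to almost sure limits\<close>

lemma clip_error:
  fixes t :: real
  assumes "0 < m"
  shows "\<bar>t - max (- m) (min m t)\<bar> \<le> t\<^sup>2 / m"
proof (cases "\<bar>t\<bar> \<le> m")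
  case True
  then have "t - max (- m) (min m t) = 0" by auto
  then show ?thesis using assms by simp
next
  case False
  then have "\<bar>t - max (- m) (min m t)\<bar> \<le> \<bar>t\<bar>" using assms by auto
  also have "\<bar>t\<bar> * m \<le> \<bar>t\<bar> * \<bar>t\<bar>" using False by (intro mult_left_mono) auto
  then have "\<bar>t\<bar> \<le> t\<^sup>2 / m" using assms by (simp add: le_divide_eq power2_eq_square)
  finally show ?thesis .
qed

context brownian
begin

text \<open>A bound in L2 yields uniform integrability, realised by clipping at a level m: clipping
  changes an expectation by at most the second moment divided by m, and the clipped variables
  converge in mean by dominated convergence.\<close>

lemma L2_limit_bound:
  assumes X: "\<And>j. Lp (X j)" and C: "\<And>j. (\<integral>\<omega>. (X j \<omega>)\<^sup>2 \<partial>M) \<le> C" and Y: "Lp Y"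
    and lim: "AE \<omega> in M. (\<lambda>j. X j \<omega>) \<longlonglongrightarrow> Y \<omega>" and b: "\<And>j. \<bar>\<integral>\<omega>. X j \<omega> \<partial>M\<bar> \<le> R"
  shows "\<bar>\<integral>\<omega>. Y \<omega> \<partial>M\<bar> \<le> R"
proof (rule field_le_epsilon)
  fix r :: real assume r: "0 < r"
  define C' where "C' = C + (\<integral>\<omega>. (Y \<omega>)\<^sup>2 \<partial>M)"
  have "0 \<le> (\<integral>\<omega>. (X 0 \<omega>)\<^sup>2 \<partial>M)" "0 \<le> (\<integral>\<omega>. (Y \<omega>)\<^sup>2 \<partial>M)" by simp_all
  then have C0: "0 \<le> C'" unfolding C'_def using C[of 0] by linarith
  \<comment> \<open>Chosen so that C' / m \<le> r. \<open>C'\<close> adds the second moments of the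
    sequence and of the limit because both clipping errors are paid, and the 1 keeps m
    positive.\<close>
  define m where "m = C' / r + 1"
  have m: "0 < m" unfolding m_def using C0 r by (simp add: add_nonneg_pos)
  have Cm: "C' / m \<le> r" using m r by (simp add: divide_le_eq) (simp add: m_def field_simps)
  let ?c = "\<lambda>t::real. max (- m) (min m t)"
  have err: "\<bar>(\<integral>\<omega>. Z \<omega> \<partial>M) - (\<integral>\<omega>. ?c (Z \<omega>) \<partial>M)\<bar> \<le> (\<integral>\<omega>. (Z \<omega>)\<^sup>2 \<partial>M) / m" if Z: "Lp Z" for Z
  proof -
    note [measurable] = Lp_measurable[OF Z]
    have c: "Lp (\<lambda>\<omega>. ?c (Z \<omega>))" by (rule Lp_bounded[of _ m]) (use m in auto)
    have "\<bar>\<integral>\<omega>. Z \<omega> - ?c (Z \<omega>) \<partial>M\<bar> \<le> (\<integral>\<omega>. \<bar>Z \<omega> - ?c (Z \<omega>)\<bar> \<partial>M)"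
      using integral_norm_bound[of M "\<lambda>\<omega>. Z \<omega> - ?c (Z \<omega>)"] by simp
    moreover have "(\<integral>\<omega>. \<bar>Z \<omega> - ?c (Z \<omega>)\<bar> \<partial>M) \<le> (\<integral>\<omega>. (Z \<omega>)\<^sup>2 / m \<partial>M)"
      by (intro integral_mono Lp_integrable Lp_abs Lp_minus Z c clip_error m integrable_divide Lp_square_integrable)
    moreover have "(\<integral>\<omega>. Z \<omega> - ?c (Z \<omega>) \<partial>M) = (\<integral>\<omega>. Z \<omega> \<partial>M) - (\<integral>\<omega>. ?c (Z \<omega>) \<partial>M)"
      by (intro Bochner_Integration.integral_diff Lp_integrable Z c)
    ultimately show ?thesis by simp
  qed
  have "(\<lambda>j. \<integral>\<omega>. ?c (X j \<omega>) \<partial>M) \<longlonglongrightarrow> (\<integral>\<omega>. ?c (Y \<omega>) \<partial>M)"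
  proof (rule integral_dominated_convergence[where w = "\<lambda>_. m"])
    note [measurable] = Lp_measurable[OF Y] Lp_measurable[OF X]
    show "(\<lambda>\<omega>. ?c (Y \<omega>)) \<in> borel_measurable M" "\<And>j. (\<lambda>\<omega>. ?c (X j \<omega>)) \<in> borel_measurable M" by measurable
    show "AE \<omega> in M. (\<lambda>j. ?c (X j \<omega>)) \<longlonglongrightarrow> ?c (Y \<omega>)"
      using lim by eventually_elim (intro tendsto_max tendsto_min tendsto_const)
  qed (use m in auto)
  then have l: "(\<lambda>j. \<bar>\<integral>\<omega>. ?c (X j \<omega>) \<partial>M\<bar>) \<longlonglongrightarrow> \<bar>\<integral>\<omega>. ?c (Y \<omega>) \<partial>M\<bar>" by (rule tendsto_rabs)
  have "\<bar>\<integral>\<omega>. ?c (X j \<omega>) \<partial>M\<bar> \<le> R + C / m" for j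
  proof -
    have "(\<integral>\<omega>. (X j \<omega>)\<^sup>2 \<partial>M) / m \<le> C / m" using C m by (intro divide_right_mono) auto
    then show ?thesis using err[OF X, of j] b[of j] by linarith
  qed
  then have "\<bar>\<integral>\<omega>. ?c (Y \<omega>) \<partial>M\<bar> \<le> R + C / m" by (intro LIMSEQ_le_const2[OF l]) auto
  moreover have "C / m + (\<integral>\<omega>. (Y \<omega>)\<^sup>2 \<partial>M) / m = C' / m" by (simp add: C'_def add_divide_distrib)
  ultimately show "\<bar>\<integral>\<omega>. Y \<omega> \<partial>M\<bar> \<le> R + r" using err[OF Y] Cm by linarith
qed

end

section \<open>Local time\<close>

locale local_time_kernel = brownian_kernel M B "\<lambda>x. - deriv \<rho> x" G
  for M :: "'w measure" and B :: "real \<Rightarrow> 'w \<Rightarrow> real" and \<rho> :: "real \<Rightarrow> real" and G :: real +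
  fixes loct :: "real \<Rightarrow> real \<Rightarrow> 'w \<Rightarrow> real" and a :: real
  assumes rho: "mollifier \<rho>" and local_time: "is_local_time M B loct"
begin

lemma loct_measurable: "t \<in> {0..1} \<Longrightarrow> loct x t \<in> borel_measurable M"
  using local_time by (simp add: is_local_time_def)

lemma loct_cont:
  assumes \<omega>: "\<omega> \<in> space M"
  shows "continuous_on {0..1} (\<lambda>t. loct x t \<omega>)" and "t \<in> {0..1} \<Longrightarrow> continuous_on UNIV (\<lambda>x. loct x t \<omega>)"
proof -
  have c: "continuous_on (UNIV \<times> {0..1}) (\<lambda>(x, t). loct x t \<omega>)"
    using local_time \<omega> unfolding is_local_time_def by blast
  have "continuous_on {0..1} (\<lambda>t. (\<lambda>(x, t). loct x t \<omega>) (x, t))"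
    by (rule continuous_on_compose2[OF c]) (auto intro!: continuous_intros)
  then show "continuous_on {0..1} (\<lambda>t. loct x t \<omega>)" by simp
  show "continuous_on UNIV (\<lambda>x. loct x t \<omega>)" if "t \<in> {0..1}"
  proof -
    have "continuous_on UNIV (\<lambda>x. (\<lambda>(x, t). loct x t \<omega>) (x, t))"
      by (rule continuous_on_compose2[OF c]) (use that in \<open>auto intro!: continuous_intros\<close>)
    then show ?thesis by simp
  qed
qed

lemma loct_mono: "\<omega> \<in> space M \<Longrightarrow> mono_on {0..1} (\<lambda>t. loct x t \<omega>)"
  and loct_0: "\<omega> \<in> space M \<Longrightarrow> loct x 0 \<omega> = 0"
  using local_time unfolding is_local_time_def by blast+

lemma loct_nonneg: "\<omega> \<in> space M \<Longrightarrow> t \<in> {0..1} \<Longrightarrow> 0 \<le> loct x t \<omega>"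
  using mono_onD[OF loct_mono, of \<omega> 0 t x] loct_0[of \<omega> x] by auto

definition \<Lambda> :: "'w \<Rightarrow> real measure" where
  "\<Lambda> \<omega> = stieltjes_01 (\<lambda>s. loct a s \<omega>)"

lemma \<Lambda>_sets: "\<omega> \<in> space M \<Longrightarrow> sets (\<Lambda> \<omega>) = sets borel"
  unfolding \<Lambda>_def by (rule stieltjes_01(1)[OF loct_cont(1) loct_mono])

lemma \<Lambda>_Ioc: "\<omega> \<in> space M \<Longrightarrow> 0 \<le> s \<Longrightarrow> s \<le> t \<Longrightarrow> t \<le> 1 \<Longrightarrow> measure (\<Lambda> \<omega>) {s<..t} = loct a t \<omega> - loct a s \<omega>"
  unfolding \<Lambda>_def by (rule stieltjes_01(4)[OF loct_cont(1) loct_mono])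

lemma \<Lambda>_01: "\<omega> \<in> space M \<Longrightarrow> measure (\<Lambda> \<omega>) {0..1} = loct a 1 \<omega>"
  unfolding \<Lambda>_def by (subst stieltjes_01(5)[OF loct_cont(1) loct_mono]) (auto simp: loct_0)

lemma \<Lambda>_finite: "\<omega> \<in> space M \<Longrightarrow> emeasure (\<Lambda> \<omega>) {0..1} < \<infinity>"
  unfolding \<Lambda>_def by (subst stieltjes_01(3)[OF loct_cont(1) loct_mono]) auto

lemma \<Lambda>_0: "\<omega> \<in> space M \<Longrightarrow> emeasure (\<Lambda> \<omega>) {0} = 0"
  using stieltjes_01(3)[OF loct_cont(1) loct_mono, of \<omega> 0 0 a] unfolding \<Lambda>_def by simp

text \<open>Approximate Dirac masses at \<open>a\<close> of width 1/(j+1).\<close>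

definition \<phi> :: "nat \<Rightarrow> real \<Rightarrow> real" where
  "\<phi> j x = \<rho> ((x - a) / (1 / real (Suc j))) / (1 / real (Suc j))"

lemma \<phi>_bump: "\<exists>\<phi>' L. bump (\<phi> j) \<phi>' L"
proof -
  have "0 < 1 / real (Suc j)" by simp
  from mollifier_bump[OF rho this, of a] show ?thesis unfolding \<phi>_def[abs_def] by blast
qed

lemma \<phi>_cont: "continuous_on UNIV (\<phi> j)"
  using \<phi>_bump bump_cont by blast

lemma \<phi>_nonneg: "0 \<le> \<phi> j x"
  using \<phi>_bump[of j] by (auto simp: bump_def)

lemma \<phi>_mass: "(\<integral>\<^sup>+x. ennreal (\<phi> j x) \<partial>lborel) \<le> 1"
  using \<phi>_bump[of j] by (auto simp: bump_def)

lemma \<phi>_bounded: "\<exists>L. \<forall>x. \<bar>\<phi> j x\<bar> \<le> L"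
  using \<phi>_bump[of j] by (auto simp: bump_def)

text \<open>The test function depends on the level only, so the inner integral has a constant
  integrand and reduces to the increase of local time up to t. The exceptional set depends on j and
  t.\<close>

lemma occupation:
  assumes t: "t \<in> {0..1}"
  shows "AE \<omega> in M. occ (\<phi> j) 0 t \<omega> = (\<integral>x. \<phi> j x * loct x t \<omega> \<partial>lborel)"
proof -
  let ?\<psi> = "\<lambda>z :: real \<times> real. \<phi> j (snd z)"
  have [measurable]: "\<phi> j \<in> borel_measurable borel" by (rule borel_measurable_continuous_onI[OF \<phi>_cont])
  have m: "?\<psi> \<in> borel_measurable borel" unfolding borel_prod[symmetric] by measurable
  obtain L where L: "\<forall>x. \<bar>\<phi> j x\<bar> \<le> L" using \<phi>_bounded by blast
  then have "bounded (range ?\<psi>)" by (auto simp: bounded_iff)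
  with m t local_time have "AE \<omega> in M. (LINT s:{0..t}|lborel. ?\<psi> (s, B s \<omega>)) =
      (\<integral>x. (LINT s:{0..t}|stieltjes_01 (\<lambda>s. loct x s \<omega>). ?\<psi> (s, x)) \<partial>lborel)"
    unfolding is_local_time_def by blast
  moreover have "AE \<omega> in M. \<omega> \<in> space M" by (rule AE_space)
  ultimately show ?thesis
  proof eventually_elim
    case (elim \<omega>)
    have "occ (\<phi> j) 0 t \<omega> = (LINT s:{0..t}|lborel. ?\<psi> (s, B s \<omega>))"
      unfolding occ_def by (rule set_lebesgue_integral_cong) (use t in \<open>auto simp: W_eq\<close>)
    moreover have "(LINT s:{0..t}|stieltjes_01 (\<lambda>s. loct x s \<omega>). ?\<psi> (s, x)) = \<phi> j x * loct x t \<omega>" for x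
    proof -
      note st = stieltjes_01[OF loct_cont(1)[OF elim(2), of x] loct_mono[OF elim(2), of x]]
      have "{0..t} \<in> sets (stieltjes_01 (\<lambda>s. loct x s \<omega>))" by (simp add: st(1))
      then have "(LINT s:{0..t}|stieltjes_01 (\<lambda>s. loct x s \<omega>). \<phi> j x) = \<phi> j x * measure (stieltjes_01 (\<lambda>s. loct x s \<omega>)) {0..t}"
        unfolding set_lebesgue_integral_def by simp
      then show ?thesis using st(5)[of 0 t] t loct_0[OF elim(2)] by simp
    qed
    ultimately show ?case using elim(1) by simp
  qed
qed

text \<open>Rescaling turns the integral into an average of local times at levels within 1/(j+1) of
  \<open>a\<close>; continuity in the level does the rest.\<close>

lemma \<phi>_approximation:
  assumes \<omega>: "\<omega> \<in> space M" and t: "t \<in> {0..1}"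
  shows "(\<lambda>j. \<integral>x. \<phi> j x * loct x t \<omega> \<partial>lborel) \<longlonglongrightarrow> loct a t \<omega>"
proof -
  note mp = mollifier_props[OF rho]
  let ?g = "\<lambda>x. loct x t \<omega>"
  have g: "continuous_on UNIV ?g" by (rule loct_cont(2)[OF \<omega> t])
  have [measurable]: "?g \<in> borel_measurable borel" "\<rho> \<in> borel_measurable borel"
    by (auto intro: borel_measurable_continuous_onI g mp(2))
  have p0: "0 \<le> \<rho> y" for y using rho by (simp add: mollifier_def)
  have 1: "(\<integral>x. \<phi> j x * ?g x \<partial>lborel) = (\<integral>y. \<rho> y * ?g (a + 1 / real (Suc j) * y) \<partial>lborel)" for j
  proof -
    let ?d = "1 / real (Suc j)"
    have "(\<integral>x. \<phi> j x * ?g x \<partial>lborel) = \<bar>?d\<bar> *\<^sub>R (\<integral>y. \<phi> j (a + ?d * y) * ?g (a + ?d * y) \<partial>lborel)"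
      by (rule lborel_integral_real_affine) simp
    also have "\<dots> = (\<integral>y. ?d * (\<phi> j (a + ?d * y) * ?g (a + ?d * y)) \<partial>lborel)" by simp
    also have "\<dots> = (\<integral>y. \<rho> y * ?g (a + ?d * y) \<partial>lborel)"
    proof (rule Bochner_Integration.integral_cong[OF refl])
      fix y
      have "\<phi> j (a + ?d * y) = \<rho> y / ?d" unfolding \<phi>_def by (simp del: of_nat_Suc)
      then show "?d * (\<phi> j (a + ?d * y) * ?g (a + ?d * y)) = \<rho> y * ?g (a + ?d * y)" by (simp del: of_nat_Suc)
    qed
    finally show ?thesis .
  qed
  have 2: "(\<lambda>j. \<integral>y. \<rho> y * ?g (a + 1 / real (Suc j) * y) \<partial>lborel) \<longlonglongrightarrow> (\<integral>y. \<rho> y * ?g a \<partial>lborel)"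
  proof -
    have "bounded (?g ` {a - 1..a + 1})"
      by (intro compact_imp_bounded compact_continuous_image continuous_on_subset[OF g]) auto
    then have "\<exists>C. \<forall>x\<in>{a - 1..a + 1}. \<bar>?g x\<bar> \<le> C" by (auto simp: bounded_iff)
    then obtain C where C: "\<forall>x\<in>{a - 1..a + 1}. \<bar>?g x\<bar> \<le> C" by blast
    show ?thesis
    proof (rule integral_dominated_convergence[where w = "\<lambda>y. \<rho> y * C"])
      show "integrable lborel (\<lambda>y. \<rho> y * C)" by (rule integrable_mult_left[OF mp(7)])
      show "AE y in lborel. (\<lambda>j. \<rho> y * ?g (a + 1 / real (Suc j) * y)) \<longlonglongrightarrow> \<rho> y * ?g a"
      proof (rule AE_I2)
        fix y
        have "(\<lambda>j. a + 1 / real (Suc j) * y) \<longlonglongrightarrow> a + 0 * y"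
          by (intro tendsto_intros LIMSEQ_Suc[OF lim_1_over_n])
        then have "(\<lambda>j. ?g (a + 1 / real (Suc j) * y)) \<longlonglongrightarrow> ?g a"
          using isCont_tendsto_compose[of a ?g] g by (simp add: continuous_on_eq_continuous_at)
        then show "(\<lambda>j. \<rho> y * ?g (a + 1 / real (Suc j) * y)) \<longlonglongrightarrow> \<rho> y * ?g a" by (rule tendsto_mult_left)
      qed
      show "AE y in lborel. norm (\<rho> y * ?g (a + 1 / real (Suc j) * y)) \<le> \<rho> y * C" for j
      proof (rule AE_I2)
        fix y
        show "norm (\<rho> y * ?g (a + 1 / real (Suc j) * y)) \<le> \<rho> y * C"
        proof (cases "1 \<le> \<bar>y\<bar>")
          case True
          then show ?thesis using mp(4) by simp
        next
          case False
          have "\<bar>1 / real (Suc j) * y\<bar> \<le> 1 * 1"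
            unfolding abs_mult using False by (intro mult_mono) auto
          then have "a + 1 / real (Suc j) * y \<in> {a - 1..a + 1}" unfolding abs_le_iff by (simp del: of_nat_Suc)
          with C have "\<bar>?g (a + 1 / real (Suc j) * y)\<bar> \<le> C" by blast
          then have "\<rho> y * \<bar>?g (a + 1 / real (Suc j) * y)\<bar> \<le> \<rho> y * C" by (rule mult_left_mono[OF _ p0])
          then show ?thesis by (simp only: real_norm_def abs_mult abs_of_nonneg[OF p0])
        qed
      qed
    qed measurable
  qed
  have 3: "(\<integral>y. \<rho> y * ?g a \<partial>lborel) = ?g a"
  proof -
    have "(\<integral>y. \<rho> y \<partial>lborel) = 1" using rho by (simp add: mollifier_def)
    then show ?thesis by simp
  qed
  show ?thesis using 2 unfolding 1 3 .
qed

text \<open>Restricting to the times i/n and to the countably many bumps allows one exceptional null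
  set for all of them. Convergence at these times is enough for weak convergence of the
  measures.\<close>

lemma occ_tendsto_loct:
  "AE \<omega> in M. \<forall>n i. n \<ge> 1 \<longrightarrow> i \<le> n \<longrightarrow> (\<lambda>j. occ (\<phi> j) 0 (real i / real n) \<omega>) \<longlonglongrightarrow> loct a (real i / real n) \<omega>"
proof -
  have "AE \<omega> in M. n \<ge> 1 \<longrightarrow> i \<le> n \<longrightarrow> occ (\<phi> j) 0 (real i / real n) \<omega> = (\<integral>x. \<phi> j x * loct x (real i / real n) \<omega> \<partial>lborel)" for n i j
  proof (cases "n \<ge> 1 \<and> i \<le> n")
    case True
    then have "real i / real n \<in> {0..1}" by (auto simp: divide_le_eq)
    from occupation[OF this, of j] show ?thesis by eventually_elim simp
  qed auto
  then have "AE \<omega> in M. \<forall>n i j. n \<ge> 1 \<longrightarrow> i \<le> n \<longrightarrow> occ (\<phi> j) 0 (real i / real n) \<omega> = (\<integral>x. \<phi> j x * loct x (real i / real n) \<omega> \<partial>lborel)"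
    unfolding AE_all_countable by blast
  moreover have "AE \<omega> in M. \<omega> \<in> space M" by (rule AE_space)
  ultimately show ?thesis
  proof eventually_elim
    case (elim \<omega>)
    show ?case
    proof (intro allI impI)
      fix n i :: nat assume ni: "n \<ge> 1" "i \<le> n"
      then have "real i / real n \<in> {0..1}" by (auto simp: divide_le_eq)
      from \<phi>_approximation[OF elim(2) this] show "(\<lambda>j. occ (\<phi> j) 0 (real i / real n) \<omega>) \<longlonglongrightarrow> loct a (real i / real n) \<omega>"
        using elim(1) ni by simp
    qed
  qed
qed

text \<open>Fatou's lemma: the k-th moments of the approximating occupation integrals on the unit
  interval are at most k! for every j, by \<open>occ_moment\<close> with no past.\<close>

lemma Lp_loct: "Lp (loct a 1)"
  unfolding Lp_def
proof (intro conjI allI)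
  show m: "loct a 1 \<in> borel_measurable M" by (rule loct_measurable) simp
  fix k :: nat
  have lim: "AE \<omega> in M. (\<lambda>j. occ (\<phi> j) 0 1 \<omega>) \<longlonglongrightarrow> loct a 1 \<omega>"
    using occ_tendsto_loct
  proof eventually_elim
    case (elim \<omega>)
    from elim[rule_format, of 1 1] show ?case by simp
  qed
  have b: "(\<integral>\<^sup>+\<omega>. ennreal (occ (\<phi> j) 0 1 \<omega> ^ k) \<partial>M) \<le> ennreal (fact k)" for j
    using occ_moment[OF \<phi>_cont \<phi>_nonneg \<phi>_mass, of 0 1 "{}" "\<lambda>_. 1" j k]
    by (simp add: cyl_def emeasure_space_1)
  have "(\<integral>\<^sup>+\<omega>. ennreal (\<bar>loct a 1 \<omega>\<bar> ^ k) \<partial>M) = (\<integral>\<^sup>+\<omega>. liminf (\<lambda>j. ennreal (occ (\<phi> j) 0 1 \<omega> ^ k)) \<partial>M)"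
  proof (rule nn_integral_cong_AE)
    show "AE \<omega> in M. ennreal (\<bar>loct a 1 \<omega>\<bar> ^ k) = liminf (\<lambda>j. ennreal (occ (\<phi> j) 0 1 \<omega> ^ k))"
      using lim AE_space
    proof eventually_elim
      case (elim \<omega>)
      have "(\<lambda>j. ennreal (occ (\<phi> j) 0 1 \<omega> ^ k)) \<longlonglongrightarrow> ennreal (loct a 1 \<omega> ^ k)"
        by (intro tendsto_ennrealI tendsto_power elim)
      then show ?case using loct_nonneg[OF elim(2), of 1 a] by (simp add: lim_imp_Liminf)
    qed
  qed
  also have "\<dots> \<le> liminf (\<lambda>j. \<integral>\<^sup>+\<omega>. ennreal (occ (\<phi> j) 0 1 \<omega> ^ k) \<partial>M)"
    by (rule nn_integral_liminf) (use occ_measurable[OF \<phi>_cont] in measurable)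
  also have "\<dots> \<le> liminf (\<lambda>j::nat. ennreal (fact k))" by (intro Liminf_mono always_eventually allI b)
  also have "\<dots> < \<infinity>" by (simp add: Liminf_const)
  finally show "integrable M (\<lambda>\<omega>. \<bar>loct a 1 \<omega>\<bar> ^ k)"
    using m by (intro integrableI_bounded) (auto simp: power_abs)
qed

lemma occ_interval:
  assumes \<omega>: "\<omega> \<in> space M" and st: "0 \<le> s" "s \<le> t"
  shows "(LINT r:{s<..t}|lborel. \<phi> j (W r \<omega>)) = occ (\<phi> j) 0 t \<omega> - occ (\<phi> j) 0 s \<omega>"
proof -
  have c: "continuous_on UNIV (\<lambda>r. \<phi> j (W r \<omega>))" by (intro continuous_on_compose2[OF \<phi>_cont] W_cont \<omega>) auto
  have "{0..t} = {0..s} \<union> {s<..t}" using st by auto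
  moreover have "(LINT r:{0..s} \<union> {s<..t}|lborel. \<phi> j (W r \<omega>)) = (LINT r:{0..s}|lborel. \<phi> j (W r \<omega>)) + (LINT r:{s<..t}|lborel. \<phi> j (W r \<omega>))"
  proof (rule set_integral_Un)
    show "set_integrable lborel {s<..t} (\<lambda>r. \<phi> j (W r \<omega>))"
      by (rule set_integrable_subset[OF set_integrable_cont[OF c, of s t]]) auto
  qed (auto intro: set_integrable_cont c)
  ultimately show ?thesis by (simp add: occ_def)
qed

text \<open>The approximating measures have density \<phi>_j(W s). Their cell masses are differences
  of occupation integrals, which converge to increments of local time.\<close>

lemma weak_limit:
  assumes \<omega>: "\<omega> \<in> space M" and f: "continuous_on UNIV f"
    and lim: "\<forall>n i. n \<ge> 1 \<longrightarrow> i \<le> n \<longrightarrow> (\<lambda>j. occ (\<phi> j) 0 (real i / real n) \<omega>) \<longlonglongrightarrow> loct a (real i / real n) \<omega>"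
  shows "(\<lambda>j. LINT s:{0..1}|lborel. f s * \<phi> j (W s \<omega>)) \<longlonglongrightarrow> (LINT s:{0..1}|\<Lambda> \<omega>. f s)"
proof -
  let ?p = "\<lambda>j s. \<phi> j (W s \<omega>)"
  have c: "continuous_on UNIV (?p j)" for j by (intro continuous_on_compose2[OF \<phi>_cont] W_cont \<omega>) auto
  note [measurable] = borel_measurable_continuous_onI[OF c] borel_measurable_continuous_onI[OF f]
  let ?\<nu> = "\<lambda>j. density lborel (\<lambda>s. ennreal (?p j s))"
  have em: "emeasure (?\<nu> j) A = ennreal (LINT s:A|lborel. ?p j s)" if A: "A \<in> sets borel" "A \<subseteq> {0..1}" for A j
  proof -
    have i: "set_integrable lborel A (?p j)"
      by (rule set_integrable_subset[OF set_integrable_cont[OF c, of 0 1]]) (use A in auto)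
    have "emeasure (?\<nu> j) A = (\<integral>\<^sup>+s. ennreal (?p j s) * indicator A s \<partial>lborel)"
      using A(1) by (intro emeasure_density) auto
    also have "\<dots> = (\<integral>\<^sup>+s. ennreal (indicator A s *\<^sub>R ?p j s) \<partial>lborel)"
      by (intro nn_integral_cong) (simp add: indicator_def)
    also have "\<dots> = ennreal (LINT s:A|lborel. ?p j s)"
      using i unfolding set_integrable_def set_lebesgue_integral_def
      by (intro nn_integral_eq_integral) (auto simp: \<phi>_nonneg)
    finally show ?thesis .
  qed
  have pos: "0 \<le> (LINT s:A|lborel. ?p j s)" for A j
    unfolding set_lebesgue_integral_def by (intro Bochner_Integration.integral_nonneg) (simp add: \<phi>_nonneg)
  have me: "measure (?\<nu> j) A = (LINT s:A|lborel. ?p j s)" if "A \<in> sets borel" "A \<subseteq> {0..1}" for A j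
    unfolding measure_def em[OF that] using pos by simp
  have "(LINT s:{0..1}|?\<nu> j. f s) = (LINT s:{0..1}|lborel. f s * ?p j s)" for j
  proof -
    have "(\<integral>s. indicator {0..1} s *\<^sub>R f s \<partial>?\<nu> j) = (\<integral>s. ?p j s *\<^sub>R (indicator {0..1} s *\<^sub>R f s) \<partial>lborel)"
      by (rule integral_density) (auto simp: \<phi>_nonneg)
    then show ?thesis unfolding set_lebesgue_integral_def by (simp add: mult_ac)
  qed
  moreover have "(\<lambda>j. LINT s:{0..1}|?\<nu> j. f s) \<longlonglongrightarrow> (LINT s:{0..1}|\<Lambda> \<omega>. f s)"
  proof (rule weak_convergence_01[OF \<Lambda>_sets[OF \<omega>] \<Lambda>_finite[OF \<omega>] \<Lambda>_0[OF \<omega>]])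
    show "sets (?\<nu> j) = sets borel" for j by simp
    show "emeasure (?\<nu> j) {0..1} < \<infinity>" for j by (subst em) auto
    show "emeasure (?\<nu> j) {0} = 0" for j
    proof -
      have "(LINT s:{0}|lborel. ?p j s) = 0"
        unfolding set_lebesgue_integral_def
        by (intro integral_eq_zero_AE) (use AE_lborel_singleton[of 0] in \<open>auto elim!: eventually_mono\<close>)
      then show ?thesis by (subst em) auto
    qed
    show "(\<lambda>j. measure (?\<nu> j) {0..1}) \<longlonglongrightarrow> measure (\<Lambda> \<omega>) {0..1}"
    proof -
      have "measure (?\<nu> j) {0..1} = occ (\<phi> j) 0 1 \<omega>" for j by (subst me) (auto simp: occ_def)
      then show ?thesis using lim[rule_format, of 1 1] by (simp add: \<Lambda>_01[OF \<omega>])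
    qed
    fix n i :: nat assume n: "n \<ge> 1" and i: "i \<in> {1..n}"
    let ?s = "(real i - 1) / real n" and ?t = "real i / real n"
    have st: "0 \<le> ?s" "?s \<le> ?t" "?t \<le> 1" using n i by (auto simp: divide_le_eq divide_right_mono)
    \<comment> \<open>Since i \<ge> 1 the truncated subtraction is exact, and the left end of the
      cell is again a grid time at which convergence is known.\<close>
    have s: "?s = real (i - 1) / real n" using i by (simp add: of_nat_diff)
    have "measure (?\<nu> j) {?s<..?t} = occ (\<phi> j) 0 ?t \<omega> - occ (\<phi> j) 0 ?s \<omega>" for j
      using st occ_interval[OF \<omega> st(1,2)] by (subst me) auto
    moreover have "(\<lambda>j. occ (\<phi> j) 0 ?t \<omega> - occ (\<phi> j) 0 ?s \<omega>) \<longlonglongrightarrow> loct a ?t \<omega> - loct a ?s \<omega>"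
      unfolding s using n i by (intro tendsto_diff lim[rule_format]) auto
    ultimately show "(\<lambda>j. measure (?\<nu> j) {?s<..?t}) \<longlonglongrightarrow> measure (\<Lambda> \<omega>) {?s<..?t}"
      unfolding \<Lambda>_Ioc[OF \<omega> st] by simp
  qed (rule f)
  ultimately show ?thesis by simp
qed

section \<open>The renormalised functional\<close>

lemma mollify_deriv_eq:
  assumes \<omega>: "\<omega> \<in> space M" and e: "0 < e"
  shows "mollify_deriv \<rho> e (\<lambda>s. B s \<omega>) \<theta> = N e \<theta> \<omega>"
proof -
  note mp = mollifier_props[OF rho]
  let ?f = "\<lambda>\<theta> s. (1 / e) * \<rho> ((s - \<theta>) / e) * W s \<omega>"
  have fc: "continuous_on UNIV (?f \<theta>)" for \<theta>
    by (intro continuous_on_mult continuous_on_const continuous_on_compose2[OF mp(2)] continuous_intros W_cont \<omega>) (use e in auto)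
  have int: "integral (cbox 0 1) g = (LINT s:{0..1}|lborel. g s)" if "continuous_on UNIV g" for g :: "real \<Rightarrow> real"
    unfolding cbox_interval by (rule set_borel_integral_eq_integral(2)[OF set_integrable_cont[OF that], symmetric])
  have "mollify \<rho> e (\<lambda>s. B s \<omega>) = (\<lambda>\<theta>. integral (cbox 0 1) (?f \<theta>))"
  proof
    fix \<theta>
    have "mollify \<rho> e (\<lambda>s. B s \<omega>) \<theta> = (LINT s:{0..1}|lborel. ?f \<theta> s)"
      unfolding mollify_def by (rule set_lebesgue_integral_cong) (auto simp: W_eq)
    then show "mollify \<rho> e (\<lambda>s. B s \<omega>) \<theta> = integral (cbox 0 1) (?f \<theta>)" by (simp only: int[OF fc])
  qed
  moreover have "((\<lambda>\<theta>. integral (cbox 0 1) (?f \<theta>)) has_field_derivative integral (cbox 0 1) (\<lambda>s. K e \<theta> s * W s \<omega>)) (at \<theta> within UNIV)"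
  proof (rule leibniz_rule_field_derivative)
    fix x t
    have "((\<lambda>x. (t - x) / e) has_real_derivative - 1 / e) (at x)" using e by (auto intro!: derivative_eq_intros)
    from DERIV_cmult_right[OF DERIV_cmult[OF DERIV_chain2[OF mp(1) this], of "1 / e"], of "W t \<omega>"]
    show "((\<lambda>x. ?f x t) has_field_derivative K e x t * W t \<omega>) (at x within UNIV)"
      by (simp add: K_def power2_eq_square)
    show "?f x integrable_on cbox 0 1"
      unfolding cbox_interval by (rule set_borel_integral_eq_integral(1)[OF set_integrable_cont[OF fc]])
    have "continuous_on (UNIV \<times> cbox 0 1) (\<lambda>z. K e (fst z) (snd z) * W (snd z) \<omega>)"
      using e by (intro continuous_on_mult continuous_on_subset[OF K_joint_cont]
        continuous_on_compose2[OF W_cont[OF \<omega>]] continuous_intros) auto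
    then show "continuous_on (UNIV \<times> cbox 0 1) (\<lambda>(\<theta>, s). K e \<theta> s * W s \<omega>)" by (simp add: case_prod_beta')
  qed auto
  moreover have "integral (cbox 0 1) (\<lambda>s. K e \<theta> s * W s \<omega>) = N e \<theta> \<omega>"
    unfolding N_def using e by (intro int continuous_on_mult K_cont W_cont \<omega>) auto
  ultimately show ?thesis unfolding mollify_deriv_def by (simp add: DERIV_imp_deriv)
qed

definition wick :: "real \<Rightarrow> real \<Rightarrow> 'w \<Rightarrow> real" where
  "wick e \<theta> \<omega> = (N e \<theta> \<omega>)\<^sup>2 - (\<integral>\<omega>. (N e \<theta> \<omega>)\<^sup>2 \<partial>M)"

lemma wick_square_eq: "\<omega> \<in> space M \<Longrightarrow> 0 < e \<Longrightarrow> wick_square M B \<rho> e \<theta> \<omega> = wick e \<theta> \<omega>"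
  unfolding wick_square_def wick_def
  by (simp add: mollify_deriv_eq cong: Bochner_Integration.integral_cong)

lemma N_sq_le: "e \<noteq> 0 \<Longrightarrow> \<omega> \<in> space M \<Longrightarrow> (N e \<theta> \<omega>)\<^sup>2 \<le> (G / e\<^sup>2 * (1 + Q \<omega>))\<^sup>2"
  using power_mono[OF N_bound, of e \<omega> \<theta> 2] by simp

lemma Lp_GQ: "Lp (\<lambda>\<omega>. (G / e\<^sup>2 * (1 + Q \<omega>))\<^sup>2)"
  by (intro Lp_power Lp_mult Lp_add Lp_const Lp_Q)

text \<open>Riemann sums and weak limits call for continuous integrands. The subtracted expectation
  is continuous in \<theta> by dominated convergence, with the majorant uniform in \<theta> provided
  by \<open>N_bound\<close>.\<close>

lemma wick_cont:
  assumes e: "e \<noteq> 0" and \<omega>: "\<omega> \<in> space M"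
  shows "continuous_on UNIV (\<lambda>\<theta>. wick e \<theta> \<omega>)"
proof -
  have "continuous_on UNIV (\<lambda>\<theta>. \<integral>\<omega>. (N e \<theta> \<omega>)\<^sup>2 \<partial>M)"
    unfolding continuous_on_sequentially comp_def
  proof (intro allI ballI impI)
    fix x :: "nat \<Rightarrow> real" and l assume "(\<forall>n. x n \<in> UNIV) \<and> x \<longlonglongrightarrow> l"
    then have x: "x \<longlonglongrightarrow> l" by simp
    show "(\<lambda>n. \<integral>\<omega>. (N e (x n) \<omega>)\<^sup>2 \<partial>M) \<longlonglongrightarrow> (\<integral>\<omega>. (N e l \<omega>)\<^sup>2 \<partial>M)"
    proof (rule integral_dominated_convergence[OF _ _ Lp_integrable[OF Lp_GQ[of e]]])
      show "(\<lambda>\<omega>. (N e l \<omega>)\<^sup>2) \<in> borel_measurable M" "\<And>n. (\<lambda>\<omega>. (N e (x n) \<omega>)\<^sup>2) \<in> borel_measurable M"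
        by (intro Lp_measurable Lp_power Lp_N e)+
      show "AE \<omega> in M. (\<lambda>n. (N e (x n) \<omega>)\<^sup>2) \<longlonglongrightarrow> (N e l \<omega>)\<^sup>2"
      proof (rule AE_I2)
        fix \<omega> assume "\<omega> \<in> space M"
        from N_cont[OF e this] have "isCont (\<lambda>\<theta>. N e \<theta> \<omega>) l" by (simp add: continuous_on_eq_continuous_at)
        from isCont_tendsto_compose[OF this x] show "(\<lambda>n. (N e (x n) \<omega>)\<^sup>2) \<longlonglongrightarrow> (N e l \<omega>)\<^sup>2" by (rule tendsto_power)
      qed
      show "AE \<omega> in M. norm ((N e (x n) \<omega>)\<^sup>2) \<le> (G / e\<^sup>2 * (1 + Q \<omega>))\<^sup>2" for n
        using N_sq_le[OF e] by (intro AE_I2) simp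
    qed
  qed
  then show ?thesis unfolding wick_def by (intro continuous_on_diff continuous_on_power N_cont e \<omega>)
qed

lemma Lp_wick: "e \<noteq> 0 \<Longrightarrow> Lp (wick e \<theta>)"
  unfolding wick_def[abs_def] by (intro Lp_minus Lp_power Lp_N Lp_const)

lemma wick_bound:
  assumes e: "e \<noteq> 0" and \<omega>: "\<omega> \<in> space M"
  shows "\<bar>wick e \<theta> \<omega>\<bar> \<le> (G / e\<^sup>2 * (1 + Q \<omega>))\<^sup>2 + (\<integral>\<omega>. (G / e\<^sup>2 * (1 + Q \<omega>))\<^sup>2 \<partial>M)"
proof -
  have "(\<integral>\<omega>. (N e \<theta> \<omega>)\<^sup>2 \<partial>M) \<le> (\<integral>\<omega>. (G / e\<^sup>2 * (1 + Q \<omega>))\<^sup>2 \<partial>M)"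
    by (intro integral_mono Lp_integrable Lp_GQ Lp_power Lp_N e N_sq_le)
  moreover have "0 \<le> (\<integral>\<omega>. (N e \<theta> \<omega>)\<^sup>2 \<partial>M)" by simp
  ultimately show ?thesis unfolding wick_def
    using N_sq_le[OF e \<omega>, of \<theta>] zero_le_power2[of "N e \<theta> \<omega>"] by linarith
qed

lemma wick_diff:
  assumes "e \<noteq> 0" "e' \<noteq> 0"
  shows "wick e \<theta> \<omega> - wick e' \<theta> \<omega> = wick_increment e e' \<theta> \<omega>"
  unfolding wick_def wick_increment_def
  by (subst Bochner_Integration.integral_diff) (use assms in \<open>auto intro!: Lp_integrable Lp_power Lp_N\<close>)

definition renorm :: "(real \<Rightarrow> real) \<Rightarrow> real \<Rightarrow> 'w \<Rightarrow> real" where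
  "renorm h e \<omega> = (LINT \<theta>:{0..1}|\<Lambda> \<omega>. h \<theta> * wick e \<theta> \<omega>)"

lemma renormalized_eq: "\<omega> \<in> space M \<Longrightarrow> 0 < e \<Longrightarrow> renormalized_functional M B loct \<rho> h a e \<omega> = renorm h e \<omega>"
  unfolding renormalized_functional_def renorm_def \<Lambda>_def by (simp add: wick_square_eq)

text \<open>The integrating measure itself depends on \<omega>, so measurability is read off from
  Riemann sums, in which the measure enters only through \<open>loct\<close> at grid times.\<close>

lemma Lp_renorm:
  assumes h: "continuous_on UNIV h" "\<And>x. \<bar>h x\<bar> \<le> H" and e: "e \<noteq> 0"
  shows "Lp (renorm h e)"
proof (rule LpI_dominated)
  let ?U = "\<lambda>\<omega>. (G / e\<^sup>2 * (1 + Q \<omega>))\<^sup>2 + (\<integral>\<omega>. (G / e\<^sup>2 * (1 + Q \<omega>))\<^sup>2 \<partial>M)"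
  show "Lp (\<lambda>\<omega>. (H * ?U \<omega>) * loct a 1 \<omega>)"
    by (intro Lp_mult Lp_add Lp_GQ Lp_const Lp_loct)
  have c: "continuous_on UNIV (\<lambda>\<theta>. h \<theta> * wick e \<theta> \<omega>)" if "\<omega> \<in> space M" for \<omega>
    by (intro continuous_on_mult h(1) wick_cont e that)
  show "\<bar>renorm h e \<omega>\<bar> \<le> (H * ?U \<omega>) * loct a 1 \<omega>" if \<omega>: "\<omega> \<in> space M" for \<omega>
    unfolding renorm_def \<Lambda>_01[OF \<omega>, symmetric]
  proof (rule set_integral_bound_01[OF \<Lambda>_sets[OF \<omega>] \<Lambda>_finite[OF \<omega>] c[OF \<omega>]])
    fix \<theta>
    show "\<bar>h \<theta> * wick e \<theta> \<omega>\<bar> \<le> H * ?U \<omega>"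
      unfolding abs_mult using h(2)[of \<theta>] by (intro mult_mono h(2) wick_bound e \<omega>) auto
  qed
  let ?x = "\<lambda>n i. real i / real (Suc n)" and ?y = "\<lambda>n i. (real i - 1) / real (Suc n)"
  show "renorm h e \<in> borel_measurable M"
  proof (rule borel_measurable_LIMSEQ_real)
    fix \<omega> assume \<omega>: "\<omega> \<in> space M"
    show "(\<lambda>n. \<Sum>i=1..Suc n. h (?x n i) * wick e (?x n i) \<omega> * (loct a (?x n i) \<omega> - loct a (?y n i) \<omega>)) \<longlonglongrightarrow> renorm h e \<omega>"
    proof -
      have "measure (\<Lambda> \<omega>) {?y n i<..?x n i} = loct a (?x n i) \<omega> - loct a (?y n i) \<omega>" if "i \<in> {1..Suc n}" for n i
        using that by (intro \<Lambda>_Ioc \<omega>) (auto simp: divide_le_eq divide_right_mono)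
      then have "(\<Sum>i=1..Suc n. h (?x n i) * wick e (?x n i) \<omega> * measure (\<Lambda> \<omega>) {?y n i<..?x n i})
          = (\<Sum>i=1..Suc n. h (?x n i) * wick e (?x n i) \<omega> * (loct a (?x n i) \<omega> - loct a (?y n i) \<omega>))" for n
        by (intro sum.cong refl) (simp only:)
      with riemann_sums_tendsto[OF \<Lambda>_sets[OF \<omega>] \<Lambda>_finite[OF \<omega>] \<Lambda>_0[OF \<omega>] c[OF \<omega>]]
      show ?thesis unfolding renorm_def by (simp only:)
    qed
  next
    fix n
    have "?x n i \<in> {0..1}" "?y n i \<in> {0..1}" if "i \<in> {1..Suc n}" for i
      using that by (auto simp: divide_le_eq)
    then show "(\<lambda>\<omega>. \<Sum>i=1..Suc n. h (?x n i) * wick e (?x n i) \<omega> * (loct a (?x n i) \<omega> - loct a (?y n i) \<omega>)) \<in> borel_measurable M"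
      by (intro borel_measurable_sum borel_measurable_times borel_measurable_diff borel_measurable_const Lp_measurable[OF Lp_wick] loct_measurable e)
  qed
qed

text \<open>\<open>F_estimate\<close> holds for every bump with the same bound, and
  \<open>L2_limit_bound\<close> carries it to the local time measure. The bound in L2 uniform in j
  comes from estimating each product by \<open>V\<close> times the total occupation.\<close>

lemma difference_estimate:
  assumes F: "\<And>h k. h \<in> L2_01 \<Longrightarrow> k \<in> L2_01 \<Longrightarrow> \<bar>F h - F k\<bar> \<le> exp (c * L2_01_norm h) * L2_01_norm (\<lambda>x. h x - k x)"
    and c: "0 \<le> c" and h: "cutoff h H d"
    and q: "0 < q" and e: "e = q ^ 8" "0 < e'" "e' \<le> e" "e \<le> 2 * e'" "4 * e \<le> d"
  shows "\<bar>\<integral>\<omega>. F (\<lambda>s. W s \<omega>) * (renorm h e \<omega> - renorm h e' \<omega>) \<partial>M\<bar>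
    \<le> (2 * exp (c\<^sup>2)) * (exp ((2 * c)\<^sup>2) + (20 * H * G\<^sup>2)\<^sup>2 * (1536 + 72 / sqrt d)) * q"
proof -
  have e0: "e \<noteq> 0" "e' \<noteq> 0" using e q by auto
  have hc: "continuous_on UNIV h" and hb: "\<And>x. \<bar>h x\<bar> \<le> H" using h by (auto simp: cutoff_def)
  let ?F = "\<lambda>\<omega>. F (\<lambda>s. W s \<omega>)"
  note LF = Lp_F[OF F c]
  \<comment> \<open>Collects the factors independent of j. The scales are fixed at this stage, so
    the crude \<open>wick_weight\<close> is good enough.\<close>
  define V where "V = (\<lambda>\<omega>. \<bar>?F \<omega>\<bar> * (H * (wick_weight e e' \<omega> + (\<integral>\<omega>. wick_weight e e' \<omega> \<partial>M))))"
  have LV: "Lp V" unfolding V_def by (intro Lp_mult Lp_abs LF Lp_add Lp_const Lp_wick_weight)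
  let ?o = "\<lambda>j. occ (\<phi> j) 0 1"
  have Lo: "Lp (?o j)" for j
  proof -
    obtain L where "\<forall>x. \<bar>\<phi> j x\<bar> \<le> L" using \<phi>_bounded by blast
    then show ?thesis by (intro occ_bounds(2)[OF \<phi>_cont \<phi>_nonneg, of j L]) auto
  qed
  have LD: "Lp (smeared_increment h (\<phi> j) e e')" for j
  proof -
    obtain L where L: "\<forall>x. \<bar>\<phi> j x\<bar> \<le> L" using \<phi>_bounded by blast
    show ?thesis by (rule smeared_increment_fubini(2)[OF h \<phi>_cont L[rule_format] e0 Lp_const[of 0]])
  qed
  have Cc: "continuous_on UNIV (\<lambda>\<theta>. wick_increment e e' \<theta> \<omega>)" if "\<omega> \<in> space M" for \<omega>
    unfolding wick_diff[OF e0, symmetric] by (intro continuous_on_diff wick_cont e0 that)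
  \<comment> \<open>The 24 is 4!, from \<open>occ_moment\<close> on the whole unit interval.\<close>
  have o4: "(\<integral>\<omega>. (?o j \<omega>) ^ 4 \<partial>M) \<le> 24" for j
  proof -
    have "(\<integral>\<^sup>+\<omega>. ennreal (?o j \<omega> ^ 4) \<partial>M) \<le> ennreal 24"
      using occ_moment[OF \<phi>_cont \<phi>_nonneg \<phi>_mass, of 0 1 "{}" "\<lambda>_. 1" j 4]
      by (simp add: cyl_def emeasure_space_1 fact_numeral)
    then show ?thesis
      by (subst integral_eq_nn_integral) (auto simp: enn2real_leI Lp_measurable[OF Lp_power[OF Lo]])
  qed
  show ?thesis
  proof (rule L2_limit_bound)
    show "Lp (\<lambda>\<omega>. ?F \<omega> * smeared_increment h (\<phi> j) e e' \<omega>)" for j by (intro Lp_mult LF LD)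
    show "Lp (\<lambda>\<omega>. ?F \<omega> * (renorm h e \<omega> - renorm h e' \<omega>))" by (intro Lp_mult LF Lp_minus Lp_renorm[OF hc hb] e0)
    show "\<bar>\<integral>\<omega>. ?F \<omega> * smeared_increment h (\<phi> j) e e' \<omega> \<partial>M\<bar>
      \<le> (2 * exp (c\<^sup>2)) * (exp ((2 * c)\<^sup>2) + (20 * H * G\<^sup>2)\<^sup>2 * (1536 + 72 / sqrt d)) * q" for j
    proof -
      obtain \<phi>' L where "bump (\<phi> j) \<phi>' L" using \<phi>_bump by blast
      from F_estimate[OF F c h this q e] show ?thesis .
    qed
    show "(\<integral>\<omega>. (?F \<omega> * smeared_increment h (\<phi> j) e e' \<omega>)\<^sup>2 \<partial>M) \<le> (\<integral>\<omega>. (V \<omega>) ^ 4 \<partial>M) + 24" for j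
    proof -
      have "(?F \<omega> * smeared_increment h (\<phi> j) e e' \<omega>)\<^sup>2 \<le> (V \<omega>) ^ 4 + (?o j \<omega>) ^ 4" if \<omega>: "\<omega> \<in> space M" for \<omega>
      proof -
        let ?U = "H * (wick_weight e e' \<omega> + (\<integral>\<omega>. wick_weight e e' \<omega> \<partial>M))"
        have pc: "continuous_on UNIV (\<lambda>\<theta>. \<phi> j (W \<theta> \<omega>))" by (intro continuous_on_compose2[OF \<phi>_cont] W_cont \<omega>) auto
        have "\<bar>smeared_increment h (\<phi> j) e e' \<omega>\<bar> \<le> (LINT \<theta>:{0..1}|lborel. ?U * \<phi> j (W \<theta> \<omega>))"
        proof -
          have "\<bar>smeared_increment h (\<phi> j) e e' \<omega>\<bar> \<le> (LINT \<theta>:{0..1}|lborel. \<bar>h \<theta> * wick_increment e e' \<theta> \<omega> * \<phi> j (W \<theta> \<omega>)\<bar>)"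
            unfolding smeared_increment_def real_norm_def[symmetric]
            by (intro set_integral_norm_bound set_integrable_cont continuous_on_mult hc Cc pc \<omega>)
          also have "\<dots> \<le> (LINT \<theta>:{0..1}|lborel. ?U * \<phi> j (W \<theta> \<omega>))"
          proof (rule set_integral_mono)
            fix \<theta>
            have "\<bar>h \<theta> * wick_increment e e' \<theta> \<omega>\<bar> \<le> ?U"
              unfolding abs_mult using hb[of \<theta>] by (intro mult_mono hb wick_increment_bound e0 \<omega>) auto
            then show "\<bar>h \<theta> * wick_increment e e' \<theta> \<omega> * \<phi> j (W \<theta> \<omega>)\<bar> \<le> ?U * \<phi> j (W \<theta> \<omega>)"
              unfolding abs_mult[of "h \<theta> * wick_increment e e' \<theta> \<omega>"] abs_of_nonneg[OF \<phi>_nonneg] by (rule mult_right_mono) (rule \<phi>_nonneg)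
          qed (intro set_integrable_cont continuous_on_rabs continuous_on_mult continuous_on_const hc Cc pc \<omega>)+
          finally show ?thesis .
        qed
        also have "\<dots> = ?U * ?o j \<omega>" unfolding occ_def by (rule set_integral_mult_right)
        finally have "\<bar>?F \<omega>\<bar> * \<bar>smeared_increment h (\<phi> j) e e' \<omega>\<bar> \<le> \<bar>?F \<omega>\<bar> * (?U * ?o j \<omega>)" by (rule mult_left_mono) simp
        then have "\<bar>?F \<omega> * smeared_increment h (\<phi> j) e e' \<omega>\<bar> \<le> V \<omega> * ?o j \<omega>" unfolding V_def abs_mult by (simp only: mult.assoc)
        then have "\<bar>?F \<omega> * smeared_increment h (\<phi> j) e e' \<omega>\<bar>\<^sup>2 \<le> (V \<omega> * ?o j \<omega>)\<^sup>2" by (rule power_mono) simp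
        moreover have "(x * y)\<^sup>2 \<le> x ^ 4 + y ^ 4" for x y :: real
        proof -
          have "2 * (x\<^sup>2 * y\<^sup>2) \<le> (x\<^sup>2)\<^sup>2 + (y\<^sup>2)\<^sup>2" using zero_le_power2[of "x\<^sup>2 - y\<^sup>2"] by (simp add: power2_diff)
          moreover have "0 \<le> x\<^sup>2 * y\<^sup>2" by simp
          ultimately have "x\<^sup>2 * y\<^sup>2 \<le> (x\<^sup>2)\<^sup>2 + (y\<^sup>2)\<^sup>2" by linarith
          then show ?thesis by (simp add: power_mult_distrib power_mult[symmetric])
        qed
        ultimately show ?thesis unfolding power2_abs by (meson order_trans)
      qed
      then have "(\<integral>\<omega>. (?F \<omega> * smeared_increment h (\<phi> j) e e' \<omega>)\<^sup>2 \<partial>M) \<le> (\<integral>\<omega>. (V \<omega>) ^ 4 + (?o j \<omega>) ^ 4 \<partial>M)"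
        by (intro integral_mono Lp_integrable Lp_power Lp_add Lp_mult LF LD LV Lo)
      also have "\<dots> = (\<integral>\<omega>. (V \<omega>) ^ 4 \<partial>M) + (\<integral>\<omega>. (?o j \<omega>) ^ 4 \<partial>M)"
        by (intro Bochner_Integration.integral_add Lp_integrable Lp_power LV Lo)
      finally show ?thesis using o4[of j] by linarith
    qed
    show "AE \<omega> in M. (\<lambda>j. ?F \<omega> * smeared_increment h (\<phi> j) e e' \<omega>) \<longlonglongrightarrow> ?F \<omega> * (renorm h e \<omega> - renorm h e' \<omega>)"
      using occ_tendsto_loct AE_space
    proof eventually_elim
      case (elim \<omega>)
      note \<omega> = elim(2)
      have "renorm h e \<omega> - renorm h e' \<omega> = (LINT \<theta>:{0..1}|\<Lambda> \<omega>. h \<theta> * wick e \<theta> \<omega> - h \<theta> * wick e' \<theta> \<omega>)"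
        unfolding renorm_def
        by (intro set_integral_diff(2)[symmetric] set_integrable_finite_01 \<Lambda>_sets \<Lambda>_finite continuous_on_mult hc wick_cont e0 \<omega>)
      also have "\<dots> = (LINT \<theta>:{0..1}|\<Lambda> \<omega>. h \<theta> * wick_increment e e' \<theta> \<omega>)"
        by (simp only: right_diff_distrib[symmetric] wick_diff[OF e0])
      finally have "renorm h e \<omega> - renorm h e' \<omega> = (LINT \<theta>:{0..1}|\<Lambda> \<omega>. h \<theta> * wick_increment e e' \<theta> \<omega>)" .
      moreover have "(\<lambda>j. smeared_increment h (\<phi> j) e e' \<omega>) \<longlonglongrightarrow> (LINT \<theta>:{0..1}|\<Lambda> \<omega>. h \<theta> * wick_increment e e' \<theta> \<omega>)"
        unfolding smeared_increment_def by (intro weak_limit \<omega> continuous_on_mult hc Cc elim(1))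
      ultimately show ?case by (simp add: tendsto_mult_left)
    qed
  qed
qed

end

theorem theorem2p1:
  fixes M :: "'w measure"
    and B :: "real \<Rightarrow> 'w \<Rightarrow> real"
    and loct :: "real \<Rightarrow> real \<Rightarrow> 'w \<Rightarrow> real"
    and \<rho> h :: "real \<Rightarrow> real"
    and a :: real
    and F :: "(real \<Rightarrow> real) \<Rightarrow> real"
  assumes "standard_BM M B"
    and "is_local_time M B loct"
    and "mollifier \<rho>"
    and "h \<in> Cc_01"
    and "F \<in> Lip_e"
  shows "(\<forall>\<epsilon>>0. integrable M (\<lambda>\<omega>. F (\<lambda>s. B s \<omega>) * renormalized_functional M B loct \<rho> h a \<epsilon> \<omega>)) \<and>
    (\<exists>l. ((\<lambda>\<epsilon>. \<integral>\<omega>. F (\<lambda>s. B s \<omega>) * renormalized_functional M B loct \<rho> h a \<epsilon> \<omega> \<partial>M)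
            \<longlongrightarrow> l) (at_right 0))"
proof -
  obtain G where "kernel (\<lambda>x. - deriv \<rho> x) G" by (rule mollifier_kernel[OF assms(3)])
  then interpret local_time_kernel M B \<rho> G loct a
    using assms by (intro local_time_kernel.intro brownian_kernel.intro brownian.intro local_time_kernel_axioms.intro)
  obtain H d where h: "cutoff h H d" by (rule Cc_01_cutoff[OF assms(4)])
  then have hc: "continuous_on UNIV h" and hb: "\<And>x. \<bar>h x\<bar> \<le> H" and d: "0 < d" by (auto simp: cutoff_def)
  obtain c where c: "0 < c" and F: "\<forall>h\<in>L2_01. \<forall>k\<in>L2_01. \<bar>F h - F k\<bar> \<le> exp (c * L2_01_norm h) * L2_01_norm (\<lambda>x. h x - k x)"
    using assms(5) unfolding Lip_e_def by blast
  have c0: "0 \<le> c" using c by simp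
  note F' = F[rule_format]
  note LF = Lp_F[OF F' c0]
  let ?T = "\<lambda>e. \<integral>\<omega>. F (\<lambda>s. B s \<omega>) * renormalized_functional M B loct \<rho> h a e \<omega> \<partial>M"
  have eq: "F (\<lambda>s. B s \<omega>) * renormalized_functional M B loct \<rho> h a e \<omega> = F (\<lambda>s. W s \<omega>) * renorm h e \<omega>"
    if "0 < e" "\<omega> \<in> space M" for e \<omega>
    using that by (simp only: renormalized_eq F_B_eq_F_W[OF assms(5)])
  have LR: "Lp (\<lambda>\<omega>. F (\<lambda>s. W s \<omega>) * renorm h e \<omega>)" if "0 < e" for e
    using that by (intro Lp_mult LF Lp_renorm[OF hc hb]) auto
  have T: "?T e = (\<integral>\<omega>. F (\<lambda>s. W s \<omega>) * renorm h e \<omega> \<partial>M)" if "0 < e" for e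
    by (rule Bochner_Integration.integral_cong[OF refl eq[OF that]])
  let ?K = "(2 * exp (c\<^sup>2)) * (exp ((2 * c)\<^sup>2) + (20 * H * G\<^sup>2)\<^sup>2 * (1536 + 72 / sqrt d))"
  have "\<exists>l. (?T \<longlongrightarrow> l) (at_right 0)"
  proof (rule dyadic_limit)
    show "0 \<le> ?K" using d by simp
    show "0 < d / 4" using d by simp
    fix e e' :: real assume e: "0 < e'" "e' \<le> e" "e \<le> 2 * e'" "e \<le> d / 4"
    then have e0: "0 < e" by simp
    have "?T e - ?T e' = (\<integral>\<omega>. F (\<lambda>s. W s \<omega>) * renorm h e \<omega> - F (\<lambda>s. W s \<omega>) * renorm h e' \<omega> \<partial>M)"
      unfolding T[OF e0] T[OF e(1)]
      by (intro Bochner_Integration.integral_diff[symmetric] Lp_integrable LR e0 e(1))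
    also have "\<dots> = (\<integral>\<omega>. F (\<lambda>s. W s \<omega>) * (renorm h e \<omega> - renorm h e' \<omega>) \<partial>M)" by (simp only: right_diff_distrib)
    finally have "?T e - ?T e' = (\<integral>\<omega>. F (\<lambda>s. W s \<omega>) * (renorm h e \<omega> - renorm h e' \<omega>) \<partial>M)" .
    moreover have "\<bar>\<integral>\<omega>. F (\<lambda>s. W s \<omega>) * (renorm h e \<omega> - renorm h e' \<omega>) \<partial>M\<bar> \<le> ?K * root 8 e"
      \<comment> \<open>Here \<open>q\<close> is the eighth root of e, and the restriction e \<le> d
        / 4 gives the required 4 e \<le> d.\<close>
      by (rule difference_estimate[OF F' c0 h]) (use e0 e in auto)
    ultimately show "\<bar>?T e - ?T e'\<bar> \<le> ?K * root 8 e" by simp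
  qed
  moreover have "integrable M (\<lambda>\<omega>. F (\<lambda>s. B s \<omega>) * renormalized_functional M B loct \<rho> h a e \<omega>)" if "0 < e" for e
    using Lp_integrable[OF LR[OF that]] by (subst Bochner_Integration.integrable_cong[OF refl eq[OF that]])
  ultimately show ?thesis by blast
qed

end
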